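(* Let $A$ and $B$ be Artin algebras and let $F:\mathscr{D}^b(A)\xrightarrow{\ \sim\ }\mathscr{D}^b(B)$ be a derived equivalence. Then $$|\mathrm{ext.dim}(A)-\mathrm{ext.dim}(B)|\le \ell(F(A))-1.$$
   Context: Let $k$ be a fixed commutative Artin ring. All algebras are Artin $k$-algebras with unit, modules are finitely generated unitary left modules, and all functors are $k$-functors. $A\text{-mod}$ is the category of finitely generated left $A$-modules; $\mathscr{K}^b(A)$ and $\mathscr{D}^b(A)$ are its bounded homotopy category and bounded derived category; $A\text{-proj}$ is the full subcategory of projective modules. A derived equivalence is an equivalence $\mathscr{D}^b(A)\to\mathscr{D}^b(B)$ of triangulated categories. Extension dimension: for a class $\mathcal{T}$ of $A$-modules, $\mathrm{add}(\mathcal{T})$ is the smallest full subcategory of $A\text{-mod}$ containing $\mathcal{T}$ and closed under finite direct sums and direct summands. For subcategories $\mathcal{T}_1,\mathcal{T}_2$ of $A\text{-mod}$, $\mathcal{T}_1\bullet\mathcal{T}_2$ is $\mathrm{add}$ of the class of modules $X$ for which there is an exact sequence $0\to T_1\to X\to T_2\to 0$ with $T_1\in\mathcal{T}_1$, $T_2\in\mathcal{T}_2$. For $T\in A\text{-mod}$ put $[T]_0=\{0\}$, $[T]_1=\mathrm{add}(T)$, and $[T]_n=[T]_1\bullet[T]_{n-1}$ for $n\ge 2$. Then $\mathrm{ext.dim}(A):=\inf\{n\ge 0\mid A\text{-mod}=[T]_{n+1}\text{ for some }T\in A\text{-mod}\}$. Length: a homomorphism $f:X\to Y$ of modules is radical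 if for any module $Z$ and homomorphisms $h:Z\to X$, $g:Y\to Z$, the composite $Z\xrightarrow{h}X\xrightarrow{f}Y\xrightarrow{g}Z$ is not an isomorphism (for $Z\neq 0$). A complex is radical if all its differentials are radical. Every complex over $A\text{-mod}$ is isomorphic in the homotopy category to a radical complex, unique up to isomorphism of complexes. The length of a radical complex $X^\bullet\in\mathscr{K}^b(A)$ is $\ell(X^\bullet)=\sup\{s\mid X^s\ne 0\}-\inf\{t\mid X^t\ne 0\}+1$, and the length of an arbitrary complex in $\mathscr{K}^b(A)$ is the length of the radical complex isomorphic to it in $\mathscr{K}^b(A)$. Here $F(A)$, the image of the regular module ${}_AA$, is regarded as the (tilting) complex in $\mathscr{K}^b(B\text{-proj})$ to which it is isomorphic in $\mathscr{D}^b(B)$, and $\ell(F(A))$ is the length of that complex. *)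

theory Defs
  imports "HOL-Algebra.Module" "HOL-Algebra.Ideal" "HOL-Library.Extended_Real"
begin

section \<open>Artin algebras and finitely generated left modules\<close>

definition comm_artin_ring :: "'k ring \<Rightarrow> bool" where
  "comm_artin_ring k \<longleftrightarrow> cring k \<and>
     (\<forall>I :: nat \<Rightarrow> 'k set. (\<forall>n. ideal (I n) k \<and> I (Suc n) \<subseteq> I n) \<longrightarrow>
        (\<exists>N. \<forall>n\<ge>N. I n = I N))"

text \<open>The structure map \<open>\<phi>\<close> makes \<open>A\<close> a \<open>k\<close>-algebra; it has to be part of the data because
  functors between derived categories are required to be \<open>k\<close>-linear.\<close>

definition artin_algebra :: "'k ring \<Rightarrow> 'a ring \<Rightarrow> ('k \<Rightarrow> 'a) \<Rightarrow> bool" where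
  "artin_algebra k A \<phi> \<longleftrightarrow> ring A \<and> \<phi> \<in> ring_hom k A \<and>
     (\<forall>c\<in>carrier k. \<forall>a\<in>carrier A. \<phi> c \<otimes>\<^bsub>A\<^esub> a = a \<otimes>\<^bsub>A\<^esub> \<phi> c) \<and>
     (\<exists>S. finite S \<and> S \<subseteq> carrier A \<and>
        (\<forall>a\<in>carrier A. \<exists>c\<in>S \<rightarrow> carrier k. a = (\<Oplus>\<^bsub>A\<^esub>s\<in>S. \<phi> (c s) \<otimes>\<^bsub>A\<^esub> s)))"

text \<open>The locale \<^locale>\<open>module\<close> of HOL-Algebra requires a commutative ring of scalars.\<close>

locale left_module = R?: ring R + M?: abelian_group M
  for R :: "'a ring" (structure) and M :: "('a, 'm) module" (structure) +
  assumes smult_closed [simp, intro]: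
      "\<lbrakk>a \<in> carrier R; x \<in> carrier M\<rbrakk> \<Longrightarrow> a \<odot>\<^bsub>M\<^esub> x \<in> carrier M"
    and smult_l_distr:
      "\<lbrakk>a \<in> carrier R; b \<in> carrier R; x \<in> carrier M\<rbrakk> \<Longrightarrow>
       (a \<oplus> b) \<odot>\<^bsub>M\<^esub> x = a \<odot>\<^bsub>M\<^esub> x \<oplus>\<^bsub>M\<^esub> b \<odot>\<^bsub>M\<^esub> x"
    and smult_r_distr:
      "\<lbrakk>a \<in> carrier R; x \<in> carrier M; y \<in> carrier M\<rbrakk> \<Longrightarrow>
       a \<odot>\<^bsub>M\<^esub> (x \<oplus>\<^bsub>M\<^esub> y) = a \<odot>\<^bsub>M\<^esub> x \<oplus>\<^bsub>M\<^esub> a \<odot>\<^bsub>M\<^esub> y"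
    and smult_assoc:
      "\<lbrakk>a \<in> carrier R; b \<in> carrier R; x \<in> carrier M\<rbrakk> \<Longrightarrow>
       (a \<otimes> b) \<odot>\<^bsub>M\<^esub> x = a \<odot>\<^bsub>M\<^esub> (b \<odot>\<^bsub>M\<^esub> x)"
    and smult_one [simp]: "x \<in> carrier M \<Longrightarrow> \<one> \<odot>\<^bsub>M\<^esub> x = x"

definition fin_gen :: "'a ring \<Rightarrow> ('a, 'm) module \<Rightarrow> bool" where
  "fin_gen A M \<longleftrightarrow> (\<exists>S. finite S \<and> S \<subseteq> carrier M \<and>
     (\<forall>x\<in>carrier M. \<exists>c\<in>S \<rightarrow> carrier A. x = (\<Oplus>\<^bsub>M\<^esub>s\<in>S. c s \<odot>\<^bsub>M\<^esub> s)))"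

text \<open>Morphisms are functions on the whole carrier type, so only their values on the carrier of
  the source are meaningful. This is harmless below: homotopy of chain maps, which is what
  equality of morphisms of complexes is reduced to, only looks at those values.\<close>

definition lhom :: "'a ring \<Rightarrow> ('a, 'm) module \<Rightarrow> ('a, 'n) module \<Rightarrow> ('m \<Rightarrow> 'n) set" where
  "lhom A M N = {f. f \<in> carrier M \<rightarrow> carrier N \<and>
     (\<forall>x\<in>carrier M. \<forall>y\<in>carrier M. f (x \<oplus>\<^bsub>M\<^esub> y) = f x \<oplus>\<^bsub>N\<^esub> f y) \<and>
     (\<forall>a\<in>carrier A. \<forall>x\<in>carrier M. f (a \<odot>\<^bsub>M\<^esub> x) = a \<odot>\<^bsub>N\<^esub> f x)}"

definition liso :: "'a ring \<Rightarrow> ('a, 'm) module \<Rightarrow> ('a, 'n) module \<Rightarrow> ('m \<Rightarrow> 'n) set" where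
  "liso A M N = {f \<in> lhom A M N. bij_betw f (carrier M) (carrier N)}"

definition mod_iso :: "'a ring \<Rightarrow> ('a, 'm) module \<Rightarrow> ('a, 'n) module \<Rightarrow> bool" where
  "mod_iso A M N \<longleftrightarrow> liso A M N \<noteq> {}"

definition is_zero_mod :: "('a, 'm) module \<Rightarrow> bool" where
  "is_zero_mod M \<longleftrightarrow> carrier M = {\<zero>\<^bsub>M\<^esub>}"

definition dsum :: "('a, 'm) module \<Rightarrow> ('a, 'n) module \<Rightarrow> ('a, 'm \<times> 'n) module" where
  "dsum M N = \<lparr>carrier = carrier M \<times> carrier N,
     monoid.mult = undefined, one = undefined,
     ring.zero = (\<zero>\<^bsub>M\<^esub>, \<zero>\<^bsub>N\<^esub>),
     ring.add = (\<lambda>(x, y) (x', y'). (x \<oplus>\<^bsub>M\<^esub> x', y \<oplus>\<^bsub>N\<^esub> y')),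
     smult = (\<lambda>a (x, y). (a \<odot>\<^bsub>M\<^esub> x, a \<odot>\<^bsub>N\<^esub> y))\<rparr>"

text \<open>The category of finitely generated left \<open>A\<close>-modules. Every such module is a quotient of some
  \<open>A\<^sup>n\<close>, hence can be realised on a set of subsets of \<open>A\<^sup>n\<close>, and elements of \<open>A\<^sup>n\<close> are lists over
  \<open>A\<close>. So up to isomorphism nothing is lost by fixing the carrier type \<open>'a list set\<close>
  (see \<open>fg_module_representative\<close> below).\<close>

type_synonym 'a fgm = "('a, 'a list set) module"

definition Mods :: "'a ring \<Rightarrow> 'a fgm set" where
  "Mods A = {M. left_module A M \<and> fin_gen A M}"

definition projective :: "'a ring \<Rightarrow> 'a fgm \<Rightarrow> bool" where
  "projective A P \<longleftrightarrow> P \<in> Mods A \<and>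
     (\<forall>M\<in>Mods A. \<forall>N\<in>Mods A. \<forall>g\<in>lhom A M N. \<forall>h\<in>lhom A P N. g ` carrier M = carrier N \<longrightarrow>
        (\<exists>h'\<in>lhom A P M. \<forall>x\<in>carrier P. g (h' x) = h x))"

definition transport :: "('m \<Rightarrow> 'n) \<Rightarrow> ('a, 'm) module \<Rightarrow> ('a, 'n) module" where
  "transport e M = (let r = inv_into (carrier M) e in
     \<lparr>carrier = e ` carrier M, monoid.mult = undefined, one = undefined,
      ring.zero = e \<zero>\<^bsub>M\<^esub>, ring.add = (\<lambda>x y. e (r x \<oplus>\<^bsub>M\<^esub> r y)), smult = (\<lambda>a x. e (a \<odot>\<^bsub>M\<^esub> r x))\<rparr>)"

definition left_regular :: "'a ring \<Rightarrow> ('a, 'a) module" where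
  "left_regular A = \<lparr>carrier = carrier A, monoid.mult = monoid.mult A, one = one A,
     ring.zero = ring.zero A, ring.add = ring.add A, smult = monoid.mult A\<rparr>"

definition regular_module :: "'a ring \<Rightarrow> 'a fgm" where
  "regular_module A = transport (\<lambda>a. {[a]}) (left_regular A)"

definition zero_module :: "'a fgm" where
  "zero_module = \<lparr>carrier = {{}}, monoid.mult = (\<lambda>_ _. {}), one = {}, ring.zero = {},
     ring.add = (\<lambda>_ _. {}), smult = (\<lambda>_ _. {})\<rparr>"


section \<open>Extension dimension\<close>

inductive_set add_closure :: "'a ring \<Rightarrow> 'a fgm set \<Rightarrow> 'a fgm set"
  for A :: "'a ring" and \<T> :: "'a fgm set" where
  base: "M \<in> \<T> \<Longrightarrow> M \<in> Mods A \<Longrightarrow> M \<in> add_closure A \<T>"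
| empty_sum: "M \<in> Mods A \<Longrightarrow> is_zero_mod M \<Longrightarrow> M \<in> add_closure A \<T>"
| sum: "M \<in> add_closure A \<T> \<Longrightarrow> N \<in> add_closure A \<T> \<Longrightarrow> L \<in> Mods A \<Longrightarrow>
    mod_iso A L (dsum M N) \<Longrightarrow> L \<in> add_closure A \<T>"
| summand: "M \<in> add_closure A \<T> \<Longrightarrow> L \<in> Mods A \<Longrightarrow> N \<in> Mods A \<Longrightarrow>
    mod_iso A M (dsum L N) \<Longrightarrow> L \<in> add_closure A \<T>"

definition short_exact :: "'a ring \<Rightarrow> 'a fgm \<Rightarrow> 'a fgm \<Rightarrow> 'a fgm \<Rightarrow> bool" where
  "short_exact A L M N \<longleftrightarrow> (\<exists>f\<in>lhom A L M. \<exists>g\<in>lhom A M N.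
     inj_on f (carrier L) \<and> f ` carrier L = a_kernel M N g \<and> g ` carrier M = carrier N)"

definition ext_prod :: "'a ring \<Rightarrow> 'a fgm set \<Rightarrow> 'a fgm set \<Rightarrow> 'a fgm set" where
  "ext_prod A \<T>1 \<T>2 =
     add_closure A {X \<in> Mods A. \<exists>T1\<in>\<T>1. \<exists>T2\<in>\<T>2. short_exact A T1 X T2}"

fun ext_gen :: "'a ring \<Rightarrow> 'a fgm \<Rightarrow> nat \<Rightarrow> 'a fgm set" where
  "ext_gen A T 0 = {M \<in> Mods A. is_zero_mod M}"
| "ext_gen A T (Suc 0) = add_closure A {T}"
| "ext_gen A T (Suc (Suc n)) = ext_prod A (ext_gen A T (Suc 0)) (ext_gen A T (Suc n))"

definition ext_dim :: "'a ring \<Rightarrow> enat" where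
  "ext_dim A = (INF n \<in> {n. \<exists>T\<in>Mods A. Mods A = ext_gen A T (n + 1)}. enat n)"


section \<open>Bounded complexes\<close>

record ('a, 'm) cpx =
  ob :: "int \<Rightarrow> ('a, 'm) module"
  df :: "int \<Rightarrow> 'm \<Rightarrow> 'm"

type_synonym 'a fgcpx = "('a, 'a list set) cpx"
type_synonym 'a fgmap = "int \<Rightarrow> 'a list set \<Rightarrow> 'a list set"

definition Cb :: "'a ring \<Rightarrow> 'a fgcpx set" where
  "Cb A = {X. (\<forall>n. ob X n \<in> Mods A \<and> df X n \<in> lhom A (ob X n) (ob X (n + 1)) \<and>
                (\<forall>x\<in>carrier (ob X n). df X (n + 1) (df X n x) = \<zero>\<^bsub>ob X (n + 2)\<^esub>)) \<and>
              (\<exists>N. \<forall>n. \<bar>n\<bar> > N \<longrightarrow> is_zero_mod (ob X n))}"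

definition chain_maps :: "'a ring \<Rightarrow> 'a fgcpx \<Rightarrow> 'a fgcpx \<Rightarrow> 'a fgmap set" where
  "chain_maps A X Y = {f. \<forall>n. f n \<in> lhom A (ob X n) (ob Y n) \<and>
     (\<forall>x\<in>carrier (ob X n). f (n + 1) (df X n x) = df Y n (f n x))}"

definition ccomp :: "'a fgmap \<Rightarrow> 'a fgmap \<Rightarrow> 'a fgmap" where
  "ccomp g f = (\<lambda>n. g n \<circ> f n)"

definition cid :: "'a fgmap" where
  "cid = (\<lambda>n x. x)"

definition homotopic :: "'a ring \<Rightarrow> 'a fgcpx \<Rightarrow> 'a fgcpx \<Rightarrow> 'a fgmap \<Rightarrow> 'a fgmap \<Rightarrow> bool" where
  "homotopic A X Y f g \<longleftrightarrow> (\<exists>h. (\<forall>n. h n \<in> lhom A (ob X n) (ob Y (n - 1))) \<and>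
     (\<forall>n. \<forall>x\<in>carrier (ob X n).
        f n x \<ominus>\<^bsub>ob Y n\<^esub> g n x = df Y (n - 1) (h n x) \<oplus>\<^bsub>ob Y n\<^esub> h (n + 1) (df X n x)))"

text \<open>Isomorphism in the bounded homotopy category.\<close>

definition Kb_iso :: "'a ring \<Rightarrow> 'a fgcpx \<Rightarrow> 'a fgcpx \<Rightarrow> bool" where
  "Kb_iso A X Y \<longleftrightarrow> (\<exists>f\<in>chain_maps A X Y. \<exists>g\<in>chain_maps A Y X.
     homotopic A X X (ccomp g f) cid \<and> homotopic A Y Y (ccomp f g) cid)"

definition Kb_proj :: "'a ring \<Rightarrow> 'a fgcpx set" where
  "Kb_proj A = {X \<in> Cb A. \<forall>n. projective A (ob X n)}"

definition coboundaries :: "'a fgcpx \<Rightarrow> int \<Rightarrow> 'a list set set" where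
  "coboundaries X n = df X (n - 1) ` carrier (ob X (n - 1))"

definition cocycles :: "'a fgcpx \<Rightarrow> int \<Rightarrow> 'a list set set" where
  "cocycles X n = a_kernel (ob X n) (ob X (n + 1)) (df X n)"

definition cohomology :: "'a fgcpx \<Rightarrow> int \<Rightarrow> 'a list set set set" where
  "cohomology X n = a_rcosets\<^bsub>(ob X n)\<lparr>carrier := cocycles X n\<rparr>\<^esub> (coboundaries X n)"

text \<open>The coset of \<open>x\<close> is sent to the coset of \<open>f x\<close>.\<close>

definition cohomology_map :: "'a fgcpx \<Rightarrow> 'a fgmap \<Rightarrow> int \<Rightarrow> 'a list set set \<Rightarrow> 'a list set set" where
  "cohomology_map Y f n c = coboundaries Y n <+>\<^bsub>ob Y n\<^esub> f n ` c"

definition quasi_isos :: "'a ring \<Rightarrow> 'a fgcpx \<Rightarrow> 'a fgcpx \<Rightarrow> 'a fgmap set" where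
  "quasi_isos A X Y = {f \<in> chain_maps A X Y.
     \<forall>n. bij_betw (cohomology_map Y f n) (cohomology X n) (cohomology Y n)}"

definition shift_cpx :: "'a fgcpx \<Rightarrow> 'a fgcpx" where
  "shift_cpx X = \<lparr>ob = (\<lambda>n. ob X (n + 1)),
     df = (\<lambda>n x. \<ominus>\<^bsub>ob X (n + 2)\<^esub> df X (n + 1) x)\<rparr>"

definition shift_map :: "'a fgmap \<Rightarrow> 'a fgmap" where
  "shift_map f = (\<lambda>n. f (n + 1))"

definition stalk :: "'a fgm \<Rightarrow> 'a fgcpx" where
  "stalk M = \<lparr>ob = (\<lambda>n. if n = 0 then M else zero_module),
     df = (\<lambda>n x. \<zero>\<^bsub>if n + 1 = 0 then M else zero_module\<^esub>)\<rparr>"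

text \<open>\<open>C\<close>, with the chain maps \<open>\<iota>\<close> and \<open>\<pi>\<close>, is a mapping cone of \<open>f : X \<rightarrow> Y\<close>. The components
  \<open>X\<^sup>n\<^sup>+\<^sup>1 \<oplus> Y\<^sup>n\<close> live on a product type, so they are compared with \<open>C\<^sup>n\<close> by isomorphisms \<open>\<theta>\<close>.\<close>

definition is_cone :: "'a ring \<Rightarrow> 'a fgcpx \<Rightarrow> 'a fgcpx \<Rightarrow> 'a fgmap \<Rightarrow>
    'a fgcpx \<Rightarrow> 'a fgmap \<Rightarrow> 'a fgmap \<Rightarrow> bool" where
  "is_cone A X Y f C \<iota> \<pi> \<longleftrightarrow> C \<in> Cb A \<and> \<iota> \<in> chain_maps A Y C \<and> \<pi> \<in> chain_maps A C (shift_cpx X) \<and>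
     (\<exists>\<theta>. \<forall>n. \<theta> n \<in> liso A (dsum (ob X (n + 1)) (ob Y n)) (ob C n) \<and>
        (\<forall>x\<in>carrier (ob X (n + 1)). \<forall>y\<in>carrier (ob Y n).
           df C n (\<theta> n (x, y)) =
             \<theta> (n + 1) (\<ominus>\<^bsub>ob X (n + 2)\<^esub> df X (n + 1) x, f (n + 1) x \<oplus>\<^bsub>ob Y (n + 1)\<^esub> df Y n y) \<and>
           \<iota> n y = \<theta> n (\<zero>\<^bsub>ob X (n + 1)\<^esub>, y) \<and>
           \<pi> n (\<theta> n (x, y)) = x))"


section \<open>Linear categories, triangles and equivalences\<close>

text \<open>Arrows carry no source and target; all operations on arrows take the objects involved as
  arguments, \<open>comp_arr C X Y Z g f\<close> being the composite of \<open>f : X \<rightarrow> Y\<close> and \<open>g : Y \<rightarrow> Z\<close>.\<close>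

record ('k, 'o, 'm) lincat =
  objs :: "'o set"
  arr :: "'o \<Rightarrow> 'o \<Rightarrow> 'm set"
  ident :: "'o \<Rightarrow> 'm"
  comp_arr :: "'o \<Rightarrow> 'o \<Rightarrow> 'o \<Rightarrow> 'm \<Rightarrow> 'm \<Rightarrow> 'm"
  plus_arr :: "'o \<Rightarrow> 'o \<Rightarrow> 'm \<Rightarrow> 'm \<Rightarrow> 'm"
  scal_arr :: "'o \<Rightarrow> 'o \<Rightarrow> 'k \<Rightarrow> 'm \<Rightarrow> 'm"

record ('k, 'o, 'm) tricat = "('k, 'o, 'm) lincat" +
  shift_ob :: "'o \<Rightarrow> 'o"
  shift_arr :: "'o \<Rightarrow> 'o \<Rightarrow> 'm \<Rightarrow> 'm"
  triangles :: "('o \<times> 'o \<times> 'o \<times> 'm \<times> 'm \<times> 'm) set"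

definition iso_arr :: "('k, 'o, 'm, 'z) lincat_scheme \<Rightarrow> 'o \<Rightarrow> 'o \<Rightarrow> 'm set" where
  "iso_arr C X Y = {f \<in> arr C X Y. \<exists>g\<in>arr C Y X.
     comp_arr C X Y X g f = ident C X \<and> comp_arr C Y X Y f g = ident C Y}"

record ('o, 'm, 'p, 'n) cfunctor =
  fob :: "'o \<Rightarrow> 'p"
  far :: "'o \<Rightarrow> 'o \<Rightarrow> 'm \<Rightarrow> 'n"

definition lin_functor :: "'k ring \<Rightarrow> ('k, 'o, 'm, 'z) lincat_scheme \<Rightarrow>
    ('k, 'p, 'n, 'y) lincat_scheme \<Rightarrow> ('o, 'm, 'p, 'n) cfunctor \<Rightarrow> bool" where
  "lin_functor k C D F \<longleftrightarrow>
     (\<forall>X\<in>objs C. fob F X \<in> objs D \<and> far F X X (ident C X) = ident D (fob F X)) \<and>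
     (\<forall>X\<in>objs C. \<forall>Y\<in>objs C. \<forall>f\<in>arr C X Y.
        far F X Y f \<in> arr D (fob F X) (fob F Y) \<and>
        (\<forall>g\<in>arr C X Y. far F X Y (plus_arr C X Y f g) =
           plus_arr D (fob F X) (fob F Y) (far F X Y f) (far F X Y g)) \<and>
        (\<forall>c\<in>carrier k. far F X Y (scal_arr C X Y c f) =
           scal_arr D (fob F X) (fob F Y) c (far F X Y f))) \<and>
     (\<forall>X\<in>objs C. \<forall>Y\<in>objs C. \<forall>Z\<in>objs C. \<forall>f\<in>arr C X Y. \<forall>g\<in>arr C Y Z.
        far F X Z (comp_arr C X Y Z g f) =
          comp_arr D (fob F X) (fob F Y) (fob F Z) (far F Y Z g) (far F X Y f))"

definition nat_iso :: "('k, 'o, 'm, 'z) lincat_scheme \<Rightarrow> ('k, 'p, 'n, 'y) lincat_scheme \<Rightarrow>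
    ('o, 'm, 'p, 'n) cfunctor \<Rightarrow> ('o, 'm, 'p, 'n) cfunctor \<Rightarrow> ('o \<Rightarrow> 'n) \<Rightarrow> bool" where
  "nat_iso C D F G \<eta> \<longleftrightarrow>
     (\<forall>X\<in>objs C. \<eta> X \<in> iso_arr D (fob F X) (fob G X)) \<and>
     (\<forall>X\<in>objs C. \<forall>Y\<in>objs C. \<forall>f\<in>arr C X Y.
        comp_arr D (fob F X) (fob F Y) (fob G Y) (\<eta> Y) (far F X Y f) =
        comp_arr D (fob F X) (fob G X) (fob G Y) (far G X Y f) (\<eta> X))"

definition fcomp :: "('p, 'n, 'q, 'l) cfunctor \<Rightarrow> ('o, 'm, 'p, 'n) cfunctor \<Rightarrow>
    ('o, 'm, 'q, 'l) cfunctor" where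
  "fcomp G F = \<lparr>fob = (\<lambda>X. fob G (fob F X)),
     far = (\<lambda>X Y f. far G (fob F X) (fob F Y) (far F X Y f))\<rparr>"

definition fidentity :: "('o, 'm, 'o, 'm) cfunctor" where
  "fidentity = \<lparr>fob = (\<lambda>X. X), far = (\<lambda>X Y f. f)\<rparr>"

definition shift_functor :: "('k, 'o, 'm, 'z) tricat_scheme \<Rightarrow> ('o, 'm, 'o, 'm) cfunctor" where
  "shift_functor C = \<lparr>fob = shift_ob C, far = shift_arr C\<rparr>"

definition equivalence_functor :: "'k ring \<Rightarrow> ('k, 'o, 'm, 'z) lincat_scheme \<Rightarrow>
    ('k, 'p, 'n, 'y) lincat_scheme \<Rightarrow> ('o, 'm, 'p, 'n) cfunctor \<Rightarrow> bool" where
  "equivalence_functor k C D F \<longleftrightarrow> lin_functor k C D F \<and>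
     (\<exists>G \<alpha> \<beta>. lin_functor k D C G \<and>
        nat_iso C C (fcomp G F) fidentity \<alpha> \<and> nat_iso D D (fcomp F G) fidentity \<beta>)"

definition triangle_functor :: "'k ring \<Rightarrow> ('k, 'o, 'm) tricat \<Rightarrow> ('k, 'p, 'n) tricat \<Rightarrow>
    ('o, 'm, 'p, 'n) cfunctor \<Rightarrow> bool" where
  "triangle_functor k C D F \<longleftrightarrow> lin_functor k C D F \<and>
     (\<exists>\<eta>. nat_iso C D (fcomp F (shift_functor C)) (fcomp (shift_functor D) F) \<eta> \<and>
        (\<forall>X Y Z u v w. (X, Y, Z, u, v, w) \<in> triangles C \<longrightarrow>
           (fob F X, fob F Y, fob F Z, far F X Y u, far F Y Z v,
            comp_arr D (fob F Z) (fob F (shift_ob C X)) (shift_ob D (fob F X))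
              (\<eta> X) (far F Z (shift_ob C X) w)) \<in> triangles D))"

definition triangle_equivalence :: "'k ring \<Rightarrow> ('k, 'o, 'm) tricat \<Rightarrow> ('k, 'p, 'n) tricat \<Rightarrow>
    ('o, 'm, 'p, 'n) cfunctor \<Rightarrow> bool" where
  "triangle_equivalence k C D F \<longleftrightarrow> triangle_functor k C D F \<and> equivalence_functor k C D F"


section \<open>The bounded derived category\<close>

text \<open>\<open>D\<^sup>b(A)\<close> is the localisation of \<open>K\<^sup>b(A)\<close> at the quasi-isomorphisms, by calculus of fractions:
  the roof \<open>(W, s, f)\<close> stands for \<open>X \<leftarrow> W \<rightarrow> Y\<close> with quasi-isomorphism \<open>s\<close>, and represents
  \<open>f \<circ> s\<^sup>-\<^sup>1\<close>.\<close>

type_synonym 'a roof = "'a fgcpx \<times> 'a fgmap \<times> 'a fgmap"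

definition roofs :: "'a ring \<Rightarrow> 'a fgcpx \<Rightarrow> 'a fgcpx \<Rightarrow> 'a roof set" where
  "roofs A X Y = {(W, s, f). W \<in> Cb A \<and> s \<in> quasi_isos A W X \<and> f \<in> chain_maps A W Y}"

definition roof_eq :: "'a ring \<Rightarrow> 'a fgcpx \<Rightarrow> 'a fgcpx \<Rightarrow> 'a roof \<Rightarrow> 'a roof \<Rightarrow> bool" where
  "roof_eq A X Y = (\<lambda>(W, s, f) (W', s', f').
     \<exists>V\<in>Cb A. \<exists>u\<in>chain_maps A V W. \<exists>u'\<in>chain_maps A V W'.
       ccomp s u \<in> quasi_isos A V X \<and>
       homotopic A V X (ccomp s u) (ccomp s' u') \<and> homotopic A V Y (ccomp f u) (ccomp f' u'))"

definition roof_class :: "'a ring \<Rightarrow> 'a fgcpx \<Rightarrow> 'a fgcpx \<Rightarrow> 'a roof \<Rightarrow> 'a roof set" where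
  "roof_class A X Y r = {r' \<in> roofs A X Y. roof_eq A X Y r r'}"

text \<open>The image in \<open>D\<^sup>b(A)\<close> of a chain map from \<open>X\<close> to \<open>Y\<close>.\<close>

definition loc :: "'a ring \<Rightarrow> 'a fgcpx \<Rightarrow> 'a fgcpx \<Rightarrow> 'a fgmap \<Rightarrow> 'a roof set" where
  "loc A X Y f = roof_class A X Y (X, cid, f)"

text \<open>The operations on classes of roofs are computed on representatives: composites by completing
  \<open>W \<rightarrow> Y \<leftarrow> V\<close> to a square commuting up to homotopy, sums on representatives with a common
  denominator. An element \<open>c\<close> of \<open>k\<close> acts through \<open>\<phi> c\<close>.\<close>

definition Db_comp :: "'a ring \<Rightarrow> 'a fgcpx \<Rightarrow> 'a fgcpx \<Rightarrow> 'a fgcpx \<Rightarrow>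
    'a roof set \<Rightarrow> 'a roof set \<Rightarrow> 'a roof set" where
  "Db_comp A X Y Z \<beta> \<alpha> = {r. \<exists>W s f V t g U u v.
     (W, s, f) \<in> \<alpha> \<and> (V, t, g) \<in> \<beta> \<and>
     U \<in> Cb A \<and> u \<in> quasi_isos A U W \<and> v \<in> chain_maps A U V \<and>
     homotopic A U Y (ccomp f u) (ccomp t v) \<and>
     r \<in> roof_class A X Z (U, ccomp s u, ccomp g v)}"

definition Db_plus :: "'a ring \<Rightarrow> 'a fgcpx \<Rightarrow> 'a fgcpx \<Rightarrow> 'a roof set \<Rightarrow> 'a roof set \<Rightarrow> 'a roof set" where
  "Db_plus A X Y \<alpha> \<beta> = {r. \<exists>W s f g. (W, s, f) \<in> \<alpha> \<and> (W, s, g) \<in> \<beta> \<and>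
     r \<in> roof_class A X Y (W, s, \<lambda>n x. f n x \<oplus>\<^bsub>ob Y n\<^esub> g n x)}"

definition Db_scal :: "'a ring \<Rightarrow> ('k \<Rightarrow> 'a) \<Rightarrow> 'a fgcpx \<Rightarrow> 'a fgcpx \<Rightarrow> 'k \<Rightarrow>
    'a roof set \<Rightarrow> 'a roof set" where
  "Db_scal A \<phi> X Y c \<alpha> = {r. \<exists>W s f. (W, s, f) \<in> \<alpha> \<and>
     r \<in> roof_class A X Y (W, s, \<lambda>n x. \<phi> c \<odot>\<^bsub>ob Y n\<^esub> f n x)}"

definition Db_shift :: "'a ring \<Rightarrow> 'a fgcpx \<Rightarrow> 'a fgcpx \<Rightarrow> 'a roof set \<Rightarrow> 'a roof set" where
  "Db_shift A X Y \<alpha> = {r. \<exists>W s f. (W, s, f) \<in> \<alpha> \<and>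
     r \<in> roof_class A (shift_cpx X) (shift_cpx Y) (shift_cpx W, shift_map s, shift_map f)}"

definition Db_lin :: "'a ring \<Rightarrow> ('k \<Rightarrow> 'a) \<Rightarrow> ('k, 'a fgcpx, 'a roof set) lincat" where
  "Db_lin A \<phi> = \<lparr>objs = Cb A,
     arr = (\<lambda>X Y. roof_class A X Y ` roofs A X Y),
     ident = (\<lambda>X. loc A X X cid),
     comp_arr = Db_comp A,
     plus_arr = Db_plus A,
     scal_arr = Db_scal A \<phi>\<rparr>"

definition Db_triangles :: "'a ring \<Rightarrow> ('k \<Rightarrow> 'a) \<Rightarrow>
    ('a fgcpx \<times> 'a fgcpx \<times> 'a fgcpx \<times> 'a roof set \<times> 'a roof set \<times> 'a roof set) set" where
  "Db_triangles A \<phi> = {(X, Y, Z, u, v, w).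
     let D = Db_lin A \<phi> in
     X \<in> objs D \<and> Y \<in> objs D \<and> Z \<in> objs D \<and>
     u \<in> arr D X Y \<and> v \<in> arr D Y Z \<and> w \<in> arr D Z (shift_cpx X) \<and>
     (\<exists>X'\<in>objs D. \<exists>Y'\<in>objs D. \<exists>f\<in>chain_maps A X' Y'. \<exists>C \<iota> \<pi>. is_cone A X' Y' f C \<iota> \<pi> \<and>
        (\<exists>a\<in>iso_arr D X X'. \<exists>b\<in>iso_arr D Y Y'. \<exists>c\<in>iso_arr D Z C.
           comp_arr D X Y Y' b u = comp_arr D X X' Y' (loc A X' Y' f) a \<and>
           comp_arr D Y Z C c v = comp_arr D Y Y' C (loc A Y' C \<iota>) b \<and>
           comp_arr D Z (shift_cpx X) (shift_cpx X') (Db_shift A X X' a) w =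
             comp_arr D Z C (shift_cpx X') (loc A C (shift_cpx X') \<pi>) c))}"

definition Db :: "'a ring \<Rightarrow> ('k \<Rightarrow> 'a) \<Rightarrow> ('k, 'a fgcpx, 'a roof set) tricat" where
  "Db A \<phi> = lincat.extend (Db_lin A \<phi>)
     (tricat.fields shift_cpx (Db_shift A) (Db_triangles A \<phi>))"

definition derived_equivalence :: "'k ring \<Rightarrow> 'a ring \<Rightarrow> ('k \<Rightarrow> 'a) \<Rightarrow> 'b ring \<Rightarrow> ('k \<Rightarrow> 'b) \<Rightarrow>
    ('a fgcpx, 'a roof set, 'b fgcpx, 'b roof set) cfunctor \<Rightarrow> bool" where
  "derived_equivalence k A \<phi> B \<psi> F \<longleftrightarrow> triangle_equivalence k (Db A \<phi>) (Db B \<psi>) F"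


section \<open>Length\<close>

definition radical_hom :: "'a ring \<Rightarrow> 'a fgm \<Rightarrow> 'a fgm \<Rightarrow> ('a list set \<Rightarrow> 'a list set) \<Rightarrow> bool" where
  "radical_hom A X Y f \<longleftrightarrow> f \<in> lhom A X Y \<and>
     (\<forall>Z\<in>Mods A. \<not> is_zero_mod Z \<longrightarrow>
        (\<forall>h\<in>lhom A Z X. \<forall>g\<in>lhom A Y Z. g \<circ> f \<circ> h \<notin> liso A Z Z))"

definition radical_cpx :: "'a ring \<Rightarrow> 'a fgcpx \<Rightarrow> bool" where
  "radical_cpx A X \<longleftrightarrow> X \<in> Cb A \<and> (\<forall>n. radical_hom A (ob X n) (ob X (n + 1)) (df X n))"

definition radical_length :: "'a fgcpx \<Rightarrow> int" where
  "radical_length X =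
     Sup {s. \<not> is_zero_mod (ob X s)} - Inf {t. \<not> is_zero_mod (ob X t)} + 1"

definition cpx_length :: "'a ring \<Rightarrow> 'a fgcpx \<Rightarrow> int" where
  "cpx_length A X = (THE l. \<exists>R. radical_cpx A R \<and> Kb_iso A X R \<and> l = radical_length R)"

text \<open>The length of an object of \<open>D\<^sup>b(A)\<close> lying in the essential image of \<open>K\<^sup>b(A-proj)\<close>, as is the
  case for the image of the regular module under a derived equivalence. The object of
  \<open>K\<^sup>b(A-proj)\<close> is determined up to homotopy equivalence, so the value is well defined.\<close>

definition perfect_length :: "'a ring \<Rightarrow> ('k \<Rightarrow> 'a) \<Rightarrow> 'a fgcpx \<Rightarrow> int" where
  "perfect_length A \<phi> X =
     (THE l. \<exists>T\<in>Kb_proj A. iso_arr (Db A \<phi>) X T \<noteq> {} \<and> l = cpx_length A T)"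


section \<open>Adequacy of the carrier type\<close>

context
  fixes A :: "'a ring" and M :: "('a, 'm) module" and e :: "'m \<Rightarrow> 'n"
  assumes M: "left_module A M" and inj: "inj_on e (carrier M)"
begin

interpretation left_module A M by (rule M)

lemma transport_left_module: "left_module A (transport e M)"
proof -
  have r [simp]: "inv_into (carrier M) e (e x) = x" if "x \<in> carrier M" for x
    using that inj by simp
  have "abelian_group (transport e M)"
  proof (rule abelian_groupI)
    fix x assume "x \<in> carrier (transport e M)"
    then obtain y where y: "y \<in> carrier M" "x = e y" by (auto simp: transport_def Let_def)
    then show "\<exists>z\<in>carrier (transport e M). z \<oplus>\<^bsub>transport e M\<^esub> x = \<zero>\<^bsub>transport e M\<^esub>"
      by (intro bexI[of _ "e (\<ominus>\<^bsub>M\<^esub> y)"]) (auto simp: transport_def Let_def M.l_neg)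
  qed (auto simp: transport_def Let_def M.a_ac)
  then show ?thesis
    by (intro left_module.intro left_module_axioms.intro R.ring_axioms)
      (auto simp: transport_def Let_def smult_l_distr smult_r_distr smult_assoc)
qed

lemma transport_liso: "e \<in> liso A M (transport e M)"
  using inj by (auto simp: liso_def lhom_def transport_def Let_def bij_betw_def)

lemma transport_fin_gen:
  assumes "fin_gen A M"
  shows "fin_gen A (transport e M)"
proof -
  interpret N: left_module A "transport e M" by (rule transport_left_module)
  from assms obtain S where S: "finite S" "S \<subseteq> carrier M"
    and gen: "\<And>x. x \<in> carrier M \<Longrightarrow> \<exists>c\<in>S \<rightarrow> carrier A. x = (\<Oplus>\<^bsub>M\<^esub>s\<in>S. c s \<odot>\<^bsub>M\<^esub> s)"
    unfolding fin_gen_def by blast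
  let ?r = "inv_into (carrier M) e"
  have r: "?r (e x) = x" if "x \<in> carrier M" for x using that inj by simp
  have hom: "e (\<Oplus>\<^bsub>M\<^esub>s\<in>U. c s \<odot>\<^bsub>M\<^esub> s) = (\<Oplus>\<^bsub>transport e M\<^esub>s\<in>e ` U. c (?r s) \<odot>\<^bsub>transport e M\<^esub> s)"
    if "finite U" "U \<subseteq> carrier M" "c \<in> U \<rightarrow> carrier A" for U c
    using that
  proof (induction U rule: finite_induct)
    case empty
    show ?case by (simp add: M.finsum_empty N.finsum_empty) (simp add: transport_def Let_def)
  next
    case (insert u U)
    have ni: "e u \<notin> e ` U"
      using insert inj by (metis inj_on_image_mem_iff insert_subset)
    have cl: "c (?r s) \<odot>\<^bsub>transport e M\<^esub> s \<in> carrier (transport e M)" if "s \<in> e ` insert u U" for s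
    proof -
      obtain y where y: "y \<in> insert u U" "s = e y" using \<open>s \<in> e ` insert u U\<close> by blast
      with insert.prems have "y \<in> carrier M" "c y \<in> carrier A" by blast+
      with y(2) show ?thesis by (intro N.smult_closed) (auto simp: r transport_def Let_def)
    qed
    have "e (\<Oplus>\<^bsub>M\<^esub>s\<in>insert u U. c s \<odot>\<^bsub>M\<^esub> s) = e (c u \<odot>\<^bsub>M\<^esub> u \<oplus>\<^bsub>M\<^esub> (\<Oplus>\<^bsub>M\<^esub>s\<in>U. c s \<odot>\<^bsub>M\<^esub> s))"
      using insert by (subst M.finsum_insert) (auto simp: Pi_iff)
    also have "\<dots> = e (c u \<odot>\<^bsub>M\<^esub> u) \<oplus>\<^bsub>transport e M\<^esub> e (\<Oplus>\<^bsub>M\<^esub>s\<in>U. c s \<odot>\<^bsub>M\<^esub> s)"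
    proof -
      have "(\<Oplus>\<^bsub>M\<^esub>s\<in>U. c s \<odot>\<^bsub>M\<^esub> s) \<in> carrier M" "c u \<odot>\<^bsub>M\<^esub> u \<in> carrier M"
        using insert by (auto intro!: M.finsum_closed simp: Pi_iff)
      then show ?thesis by (simp add: transport_def Let_def r)
    qed
    also have "\<dots> = c (?r (e u)) \<odot>\<^bsub>transport e M\<^esub> e u \<oplus>\<^bsub>transport e M\<^esub>
        (\<Oplus>\<^bsub>transport e M\<^esub>s\<in>e ` U. c (?r s) \<odot>\<^bsub>transport e M\<^esub> s)"
      using insert by (auto simp: r) (simp add: transport_def Let_def r)
    also have "\<dots> = (\<Oplus>\<^bsub>transport e M\<^esub>s\<in>e ` insert u U. c (?r s) \<odot>\<^bsub>transport e M\<^esub> s)"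
      using insert ni cl by (simp add: N.finsum_insert Pi_iff)
    finally show ?case .
  qed
  show ?thesis unfolding fin_gen_def
  proof (intro exI[of _ "e ` S"] conjI ballI)
    fix x assume "x \<in> carrier (transport e M)"
    then obtain y where y: "y \<in> carrier M" "x = e y" by (auto simp: transport_def Let_def)
    obtain c where c: "c \<in> S \<rightarrow> carrier A" "y = (\<Oplus>\<^bsub>M\<^esub>s\<in>S. c s \<odot>\<^bsub>M\<^esub> s)" using gen[OF y(1)] by blast
    show "\<exists>c\<in>e ` S \<rightarrow> carrier A. x = (\<Oplus>\<^bsub>transport e M\<^esub>s\<in>e ` S. c s \<odot>\<^bsub>transport e M\<^esub> s)"
      using hom[OF S c(1)] c y(2) S(2) r
      by (intro bexI[of _ "\<lambda>s. c (?r s)"]) (auto simp: Pi_iff subset_iff)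
  qed (use S in \<open>auto simp: transport_def Let_def\<close>)
qed

end

lemma fg_module_representative:
  fixes A :: "'a ring" and M :: "('a, 'm) module"
  assumes "left_module A M" and "fin_gen A M"
  shows "\<exists>N\<in>Mods A. mod_iso A M N"
proof -
  interpret left_module A M by fact
  from assms(2) obtain S where S: "finite S" "S \<subseteq> carrier M"
    and gen: "\<And>x. x \<in> carrier M \<Longrightarrow> \<exists>c\<in>S \<rightarrow> carrier A. x = (\<Oplus>\<^bsub>M\<^esub>s\<in>S. c s \<odot>\<^bsub>M\<^esub> s)"
    unfolding fin_gen_def by blast
  obtain xs where xs: "set xs = S" using S(1) finite_list by blast
  define e where "e x = {map c xs | c. c \<in> S \<rightarrow> carrier A \<and> x = (\<Oplus>\<^bsub>M\<^esub>s\<in>S. c s \<odot>\<^bsub>M\<^esub> s)}" for x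
  have "inj_on e (carrier M)"
  proof (rule inj_onI)
    fix x y assume x: "x \<in> carrier M" and y: "y \<in> carrier M" and eq: "e x = e y"
    from gen[OF x] obtain c where c: "c \<in> S \<rightarrow> carrier A" "x = (\<Oplus>\<^bsub>M\<^esub>s\<in>S. c s \<odot>\<^bsub>M\<^esub> s)" by blast
    then have "map c xs \<in> e x" unfolding e_def by blast
    then have "map c xs \<in> e y" unfolding eq .
    then obtain d where d: "d \<in> S \<rightarrow> carrier A" "y = (\<Oplus>\<^bsub>M\<^esub>s\<in>S. d s \<odot>\<^bsub>M\<^esub> s)" "map c xs = map d xs"
      unfolding e_def by blast
    have "c s = d s" if "s \<in> S" for s using d(3) xs that by auto
    then show "x = y" unfolding c(2) d(2) using S(2) d(1)
      by (intro M.finsum_cong') (auto simp: Pi_iff)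
  qed
  then have "transport e M \<in> Mods A" "mod_iso A M (transport e M)"
    using assms transport_left_module transport_fin_gen transport_liso
    by (force simp: Mods_def mod_iso_def)+
  then show ?thesis by blast
qed

lemma regular_module_Mods:
  fixes A :: "'a ring"
  assumes "ring A"
  shows "regular_module A \<in> Mods A" and "mod_iso A (left_regular A) (regular_module A)"
proof -
  interpret ring A by fact
  have lm: "left_module A (left_regular A)"
    by (intro left_module.intro left_module_axioms.intro abelian_groupI)
      (auto simp: left_regular_def assms a_ac m_assoc l_distr r_distr
        intro: bexI[where x = "\<ominus>\<^bsub>A\<^esub> _"] l_neg)
  interpret L: left_module A "left_regular A" by (rule lm)
  have "fin_gen A (left_regular A)" unfolding fin_gen_def
  proof (intro exI[of _ "{\<one>\<^bsub>A\<^esub>}"] conjI ballI)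
    fix x assume "x \<in> carrier (left_regular A)"
    then have x: "x \<in> carrier A" by (simp add: left_regular_def)
    then have "(\<Oplus>\<^bsub>left_regular A\<^esub>s\<in>{\<one>\<^bsub>A\<^esub>}. x \<odot>\<^bsub>left_regular A\<^esub> s) = x"
      using L.finsum_insert[of "{}" "\<one>\<^bsub>A\<^esub>" "\<lambda>s. x \<odot>\<^bsub>left_regular A\<^esub> s", unfolded L.finsum_empty]
      by (simp add: left_regular_def)
    with x show "\<exists>c\<in>{\<one>\<^bsub>A\<^esub>} \<rightarrow> carrier A. x = (\<Oplus>\<^bsub>left_regular A\<^esub>s\<in>{\<one>\<^bsub>A\<^esub>}. c s \<odot>\<^bsub>left_regular A\<^esub> s)"
      by (intro bexI[of _ "\<lambda>_. x"]) auto
  qed (auto simp: left_regular_def)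
  moreover have "inj_on (\<lambda>a. {[a]}) (carrier (left_regular A))" by (auto simp: inj_on_def)
  ultimately show "regular_module A \<in> Mods A" "mod_iso A (left_regular A) (regular_module A)"
    using lm transport_left_module transport_fin_gen transport_liso
    by (force simp: regular_module_def Mods_def mod_iso_def)+
qed

lemma stalk_Cb:
  fixes A :: "'a ring"
  assumes "ring A" and "M \<in> Mods A"
  shows "stalk M \<in> Cb A"
proof -
  interpret ring A by fact
  interpret left_module A M using assms(2) by (simp add: Mods_def)
  have lm: "left_module A zero_module"
    by (intro left_module.intro left_module_axioms.intro abelian_groupI)
      (auto simp: zero_module_def assms)
  moreover have "fin_gen A zero_module" unfolding fin_gen_def
  proof (intro exI[of _ "{}"] conjI ballI)
    interpret Z: left_module A zero_module by (rule lm)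
    fix x :: "'a list set" assume "x \<in> carrier zero_module"
    then show "\<exists>c\<in>{} \<rightarrow> carrier A. x = (\<Oplus>\<^bsub>zero_module\<^esub>s\<in>{}. c s \<odot>\<^bsub>zero_module\<^esub> s)"
      by (simp add: Z.finsum_empty) (simp add: zero_module_def)
  qed auto
  ultimately have z: "zero_module \<in> Mods A" by (simp add: Mods_def)
  have "a \<odot>\<^bsub>M\<^esub> \<zero>\<^bsub>M\<^esub> = \<zero>\<^bsub>M\<^esub>" if "a \<in> carrier A" for a
    using that smult_r_distr[of a "\<zero>\<^bsub>M\<^esub>" "\<zero>\<^bsub>M\<^esub>"] M.add.r_cancel_one'[of "a \<odot>\<^bsub>M\<^esub> \<zero>\<^bsub>M\<^esub>" "a \<odot>\<^bsub>M\<^esub> \<zero>\<^bsub>M\<^esub>"]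
    by simp
  then have "df (stalk M) n \<in> lhom A (ob (stalk M) n) (ob (stalk M) (n + 1))" for n
    by (auto simp: stalk_def lhom_def) (auto simp: zero_module_def)
  moreover have "\<exists>N. \<forall>n. \<bar>n\<bar> > N \<longrightarrow> is_zero_mod (ob (stalk M) n)"
    by (intro exI[of _ 0]) (auto simp: stalk_def is_zero_mod_def zero_module_def)
  ultimately show ?thesis using z assms(2) by (auto simp: Cb_def stalk_def add.assoc)
qed

end

theory Submission
  imports Defs
begin

text \<open>Let the radical complex representing \<open>F(A)\<close> live in the degrees from \<open>a\<close> to \<open>b\<close>, let \<open>G\<close> be inverse
  to \<open>F\<close>, and put \<open>d = b - a\<close>. Since \<open>Hom(F(A), Z[i])\<close> is the \<open>i\<close>-th cohomology of \<open>G(Z)\<close>, vanishing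
  of morphisms between complexes shows that \<open>F\<close> and \<open>G\<close> move the range of the cohomology of a complex
  by amounts between \<open>a\<close> and \<open>b\<close> only.

  The cokernel of a differential of a projective resolution is a syzygy of the resolved complex. It is
  unique up to projective summands, and it turns triangles into short exact sequences. If every
  \<open>B\<close>-module is obtained from a module \<open>Y\<close> by \<open>n\<close> extensions, then, by taking syzygies of the complexes
  \<open>G(N)\<close> for modules \<open>N\<close>, the \<open>d\<close>-th syzygies of all \<open>A\<close>-modules are obtained from one module by
  \<open>n\<close> extensions. A module is recovered from its syzygy by embedding the syzygy into an injective module,
  at the price of one more extension, so all \<open>A\<close>-modules are obtained by \<open>n + d\<close> extensions. The other
  inequality follows by exchanging \<open>F\<close> and \<open>G\<close>.\<close>

text \<open>An equivalence is accessible only through vanishing of morphisms and through cones, so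
  every property carried along it is first brought into one of these forms: bounds on cohomology by
  orthogonality, and perfection of \<open>F(A)\<close> by \<open>perfect_criterion\<close>.
  Perfection is not part of the hypotheses; it requires one degree beyond which Hom(F(A), N[i])
  vanishes for all modules \<open>N\<close> at once. This uniformity comes from the finiteness of
  the extension dimension, as then one module controls all others. The same finiteness makes the
  asserted difference one of real numbers.

  Classes of roofs are computed as homotopy classes of maps between projective resolutions. The
  resolutions may be infinite to the left while the apex of a roof is bounded; truncating below the
  supports of the finitely many complexes in question bridges this gap.

  The shift by \<open>d\<close> arises as follows: truncated at \<open>a\<close>, the resolution of
  F(X) has at most its lowest term non-projective, and the part above that term contributes nothing
  to the syzygy in degree \<open>a - b\<close>. Injective modules are obtained without duality, from
  a bound on the length of essential extensions.\<close>

abbreviation plus_in ("(_ +[_] _)" [65, 0, 66] 65) where "x +[M] y \<equiv> x \<oplus>\<^bsub>M\<^esub> y"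
abbreviation minus_in ("(_ -[_] _)" [65, 0, 66] 65) where "x -[M] y \<equiv> x \<ominus>\<^bsub>M\<^esub> y"
abbreviation neg_in ("(-[_] _)" [0, 81] 80) where "-[M] x \<equiv> \<ominus>\<^bsub>M\<^esub> x"
abbreviation smult_in ("(_ *[_] _)" [70, 0, 71] 70) where "a *[M] x \<equiv> a \<odot>\<^bsub>M\<^esub> x"
abbreviation zero_in ("0[_]") where "0[M] \<equiv> \<zero>\<^bsub>M\<^esub>"
notation iff (infixr "<->" 25)
abbreviation mult_in ("(_ .[_] _)" [70, 0, 71] 70) where "x .[R] y \<equiv> x \<otimes>\<^bsub>R\<^esub> y"
abbreviation one_in ("1[_]") where "1[R] \<equiv> \<one>\<^bsub>R\<^esub>"
abbreviation "car \<equiv> carrier"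
abbreviation "cmap \<equiv> chain_maps"
abbreviation "rgm \<equiv> regular_module"
abbreviation "zmod \<equiv> is_zero_mod"
abbreviation "lreg \<equiv> left_regular"
abbreviation "lmod \<equiv> left_module"
abbreviation "htp \<equiv> homotopic"
abbreviation "shc \<equiv> shift_cpx"
abbreviation "addc \<equiv> add_closure"
abbreviation "cpa \<equiv> comp_arr"
lemmas (in left_module) lmA = left_module_axioms
abbreviation "el X n \<equiv> car (ob X n)"

text \<open>Makes the identities of an abelian group available to \<open>algebra\<close> in a
  module, where only addition, negation and subtraction occur; most rearrangements of chain
  conditions and homotopies are of this kind.\<close>

lemmas (in abelian_group) abelian_group_simprules
  [algebra abelian_group "zero G" "add G" "a_inv G" "a_minus G"] =
 a_closed zero_closed a_inv_closed minus_closed a_assoc l_zero l_neg a_comm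
 minus_eq r_zero r_neg r_neg2 r_neg1 minus_add minus_minus add.inv_one a_lcomm

lemma (in abelian_group) a_inv_zero [simp]: "\<ominus> \<zero> = \<zero>"
 by simp

lemma (in abelian_group) minus_zero_iff [simp]:
 assumes "x:car G" "y:car G" shows "x \<ominus> y = \<zero> <-> x = y"
proof
 assume *: "x \<ominus> y = \<zero>"
 have "x = (x \<ominus> y) \<oplus> y" using assms by algebra
 thus "x = y" using * assms by simp
qed(use assms in "simp add: minus_eq r_neg")

section \<open>Left modules, submodules, quotients and direct sums\<close>

context left_module
begin

lemma smult_r_null [simp]: "a:car R ==> a *[M] 0[M] = 0[M]"
 using smult_r_distr[of a "0[M]" "0[M]"] by simp

lemma smult_l_null [simp]: "x:car M ==> \<zero> *[M] x = 0[M]"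
 using smult_l_distr[of \<zero> \<zero> x] by simp

lemma smult_r_neg: "[|a:car R; x:car M|] ==> a *[M] (-[M] x) = -[M] (a *[M] x)"
 using smult_r_distr[of a "-[M] x" x] by(simp add: M.l_neg M.minus_equality)

lemma smult_l_neg: "[|a:car R; x:car M|] ==> (\<ominus> a) *[M] x = -[M] (a *[M] x)"
 using smult_l_distr[of "\<ominus> a" a x] by(simp add: R.l_neg M.minus_equality)

lemma smult_r_minus:
 "[|a:car R; x:car M; y:car M|] ==> a *[M] (x -[M] y) = a *[M] x -[M] a *[M] y" by(simp add: M.minus_eq smult_r_distr smult_r_neg)

end

locale lmap = M: left_module A M + N: left_module A N
 for A :: "'a ring" and M :: "('a, 'm) module" and N :: "('a, 'n) module" and f +
 assumes lhom: "f:lhom A M N"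
begin

lemma closed [simp]: "x:car M ==> f x:car N"
 and add [simp]: "[|x:car M; y:car M|] ==> f (x +[M] y) = f x +[N] f y" and smult [simp]: "[|a:car A; x:car M|] ==> f (a *[M] x) = a *[N] f x"
 using lhom by(auto simp: lhom_def)

lemma zero [simp]: "f 0[M] = 0[N]"
 using add[of "0[M]" "0[M]"] by simp

lemma neg [simp]: "x:car M ==> f (-[M] x) = -[N] f x"
 using add[of "-[M] x" x] by(simp add: M.M.l_neg N.M.minus_equality del: add)

lemma minus [simp]: "[|x:car M; y:car M|] ==> f (x -[M] y) = f x -[N] f y"
 by(simp add: M.M.minus_eq N.M.minus_eq)

end

lemma lhomI:
 assumes "!!x. x:car M ==> f x:car N" and "!!x y. [|x:car M; y:car M|] ==> f (x +[M] y) = f x +[N] f y"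
  and "!!a x. [|a:car A; x:car M|] ==> f (a *[M] x) = a *[N] f x"
 shows "f:lhom A M N" using assms by(auto simp: lhom_def)

lemma lmapI: "[|lmod A M; lmod A N; f:lhom A M N|] ==> lmap A M N f"
 by(simp add: lmap_def lmap_axioms_def)

lemma lcomp: "[|f:lhom A L M; g:lhom A M N|] ==> (%x. g (f x)):lhom A L N"
 by(auto simp: lhom_def Pi_iff)

lemma lhom_comp': "[|f:lhom A L M; g:lhom A M N|] ==> g o f:lhom A L N"
 by(auto simp: lhom_def Pi_iff)

lemma lhom_id: "(%x. x):lhom A M M"
 by(auto simp: lhom_def)

lemma lhom_zero: "lmod A N ==> (%x. 0[N]):lhom A M N"
proof -
 assume "lmod A N"
 then interpret N: left_module A N .
 show ?thesis by(auto simp: lhom_def)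
qed

lemma lhom_add:
 assumes "lmod A N" "f:lhom A M N" "g:lhom A M N"
 shows "(%x. f x +[N] g x):lhom A M N"
proof -
 interpret N: left_module A N by fact
 show ?thesis using assms(2,3) by(auto simp: lhom_def Pi_iff N.smult_r_distr N.a_ac)
qed

lemma lhom_neg:
 assumes "lmod A N" "f:lhom A M N"
 shows "(%x. -[N] f x):lhom A M N"
proof -
 interpret N: left_module A N by fact
 show ?thesis using assms(2) by(auto simp: lhom_def Pi_iff N.smult_r_neg N.minus_add)
qed

lemma lhom_minus:
 assumes "lmod A N" "f:lhom A M N" "g:lhom A M N"
 shows "(%x. f x -[N] g x):lhom A M N" unfolding a_minus_def by(intro lhom_add lhom_neg assms)

lemma liso_lhom: "f:liso A M N ==> f:lhom A M N"
 by(simp add: liso_def)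

lemma liso_inv:
 assumes "f:liso A M N" "lmod A M"
 obtains g where "g:liso A N M" "ALL x:car M. g (f x) = x" "ALL y:car N. f (g y) = y"
proof -
 interpret M: left_module A M by fact
 define g where "g = inv_into (car M) f"
 have bij: "bij_betw f (car M) (car N)" using assms by(simp add: liso_def)
 have gf: "g (f x) = x" if "x:car M" for x using bij that by(simp add: g_def bij_betw_def)
 have fg: "f (g y) = y" "g y:car M" if "y:car N" for y using bij that by(auto simp: g_def bij_betw_def f_inv_into_f inv_into_into)
 have f: "f (x +[M] y) = f x +[N] f y" "a:car A ==> f (a *[M] x) = a *[N] f x" if "x:car M" "y:car M" for x y a
  using assms that by(auto simp: liso_def lhom_def)
 have "g:lhom A N M"
 proof(rule lhomI)
  fix x y assume xy: "x:car N" "y:car N"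
  thus "g (x +[N] y) = g x +[M] g y" using fg f(1)[of "g x" "g y"] gf[of "g x +[M] g y"] by simp
  show "g x:car M" using xy fg by simp
 next
  fix a x assume xy: "a:car A" "x:car N"
  thus "g (a *[N] x) = a *[M] g x" using fg f(2)[of "g x" "g x" a] gf[of "a *[M] g x"] by simp
 qed
 moreover have "bij_betw g (car N) (car M)" unfolding g_def by(rule bij_betw_inv_into[OF bij])
 ultimately show ?thesis using that gf fg by(auto simp: liso_def)
qed

lemma lisoI:
 assumes "f:lhom A M N" "!!x. x:car M ==> g (f x) = x"
  "!!y. y:car N ==> g y:car M & f (g y) = y"
 shows "f:liso A M N" using assms by(auto simp: liso_def lhom_def intro!: bij_betwI[where g = g])

text \<open>The scalars \<open>S\<close> are a parameter because lengths are measured over the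
  ground ring: \<open>S\<close> is \<open>car A\<close> for submodules in the usual sense and the
  image of \<open>k\<close> for k-submodules. Closure under negation is derived from a scalar -1 in
  \<open>S\<close>.\<close>

definition submod :: "'a set => ('a, 'm) module => 'm set => bool" where
 "submod S M C <-> C <= car M & 0[M]:C & (ALL x:C. ALL y:C. x +[M] y:C) &
   (ALL a:S. ALL x:C. a *[M] x:C)"

abbreviation "smod A \<equiv> submod (car A)"

lemma submodI:
 assumes "C <= car M" "0[M]:C" "!!x y. x:C ==> y:C ==> x +[M] y:C"
  "!!a x. a:S ==> x:C ==> a *[M] x:C"
 shows "submod S M C" using assms by(auto simp: submod_def)

lemma submod_neg:
 assumes "lmod A M" "submod S M C" "-[A] 1[A]:S" "x:C"
 shows "-[M] x:C"
proof -
 interpret left_module A M by fact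
 have "-[M] x = (-[A] 1[A]) *[M] x" using assms by(auto simp: submod_def smult_l_neg)
 thus ?thesis using assms by(simp add: submod_def)
qed

lemma submod_minus:
 assumes "lmod A M" "submod S M C" "-[A] 1[A]:S" "x:C" "y:C"
 shows "x -[M] y:C" using assms submod_neg[OF assms(1-3,5)] by(simp add: a_minus_def submod_def)

definition restr :: "('a, 'm) module => 'm set => ('a, 'm) module" where
 "restr M C = M\<lparr>carrier := C\<rparr>"

lemma restr_simps [simp]: "car (restr M C) = C" "0[restr M C] = 0[M]"
 "add (restr M C) = add M" "smult (restr M C) = smult M" by(simp_all add: restr_def)

lemma restr_left_module:
 assumes "lmod A M" "smod A M C"
 shows "lmod A (restr M C)"
proof -
 interpret left_module A M by fact
 have C: "C <= car M" "0[M]:C" "!!x y. x:C ==> y:C ==> x +[M] y:C"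
  "!!x. x:C ==> -[M] x:C" "!!a x. a:car A ==> x:C ==> a *[M] x:C" using assms(2) submod_neg[OF assms] by(auto simp: submod_def)
 have "abelian_group (restr M C)"
 proof(rule abelian_groupI)
  fix x assume "x:car (restr M C)"
  thus "EX y:car (restr M C). y +[restr M C] x = 0[restr M C]" using C by(intro bexI[of _ "-[M] x"]) (auto simp: M.l_neg)
 qed(use C in "auto simp: subset_iff M.a_ac")
 thus ?thesis using C by(intro left_module.intro left_module_axioms.intro R.ring_axioms)
   (auto simp: subset_iff smult_l_distr smult_r_distr smult_assoc)
qed

lemma lhom_restr:
 assumes "f:lhom A L M" "f ` car L <= C" shows "f:lhom A L (restr M C)" using assms by(auto simp: lhom_def)

lemma lhom_from_restr:
 assumes "f:lhom A M N" "C <= car M" shows "f:lhom A (restr M C) N" using assms by(auto simp: lhom_def subset_iff)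

lemma a_kernelD: "x:a_kernel M N f <-> x:car M & f x = 0[N]"
 by(simp add: a_kernel_def kernel_def)

lemma submod_kernel:
 assumes "lmod A M" "lmod A N" "f:lhom A M N"
 shows "smod A M {x:car M. f x = 0[N]}"
proof -
 interpret lmap A M N f using assms by(rule lmapI)
 show ?thesis by(intro submodI) auto
qed

lemma submod_image:
 assumes "lmod A M" "lmod A N" "f:lhom A M N" "smod A M C"
 shows "smod A N (f ` C)"
proof -
 interpret lmap A M N f using assms(1-3) by(rule lmapI)
 have C: "C <= car M" "0[M]:C" "!!x y. x:C ==> y:C ==> x +[M] y:C"
  "!!a x. a:car A ==> x:C ==> a *[M] x:C" using assms(4) by(auto simp: submod_def)
 show ?thesis
 proof(intro submodI)
  fix x y assume "x:f ` C" "y:f ` C"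
  then obtain u v where "u:C" "v:C" "x = f u" "y = f v" by auto
  thus "x +[N] y:f ` C" using C by(intro image_eqI[of _ _ "u +[M] v"]) (auto simp: subset_iff)
 next
  fix a x assume "a:car A" "x:f ` C"
  then obtain u where "u:C" "x = f u" by auto
  thus "a *[N] x:f ` C" using C \<open>a : carrier A\<close>
   by(intro image_eqI[of _ _ "a *[M] u"]) auto
 next
  show "0[N]:f ` C" using C(2) zero by(metis image_eqI)
 qed(use C assms in "auto simp: subset_iff")
qed

lemma submod_top: "lmod A M ==> smod A M (car M)"
proof -
 assume "lmod A M" then interpret left_module A M .
 show ?thesis by(auto simp: submod_def)
qed

lemma submod_zero: "lmod A M ==> smod A M {0[M]}"
proof -
 assume "lmod A M" then interpret left_module A M .
 show ?thesis by(auto simp: submod_def)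
qed

lemma submod_vimage:
 assumes "lmod A M" "lmod A N" "f:lhom A M N" "smod A N C"
 shows "smod A M {x:car M. f x:C}"
proof -
 interpret lmap A M N f using assms(1-3) by(rule lmapI)
 show ?thesis using assms by(intro submodI) (auto simp: submod_def)
qed

lemma submod_Int: "submod S M C ==> submod S M D ==> submod S M (C Int D)"
 by(auto simp: submod_def)

lemma submod_sum:
 assumes "lmod A M" "smod A M C" "smod A M D"
 shows "smod A M {x +[M] y | x y. x:C & y:D}"
proof -
 interpret left_module A M by fact
 have C: "C <= car M" "0[M]:C" "!!x y. x:C ==> y:C ==> x +[M] y:C"
  "!!a x. a:car A ==> x:C ==> a *[M] x:C" using assms by(auto simp: submod_def)
 have D: "D <= car M" "0[M]:D" "!!x y. x:D ==> y:D ==> x +[M] y:D"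
  "!!a x. a:car A ==> x:D ==> a *[M] x:D" using assms by(auto simp: submod_def)
 let ?E = "{x +[M] y | x y. x:C & y:D}"
 show ?thesis
 proof(intro submodI)
  show "?E <= car M" using C(1) D(1) by auto
  have "0[M] = 0[M] +[M] 0[M]" by simp
  with C(2) D(2) show "0[M]:?E" by blast
 next
  fix x y assume "x:?E" "y:?E"
  then obtain c d c' d' where *: "x = c +[M] d" "y = c' +[M] d'" "c:C" "d:D" "c':C" "d':D" by auto
  have "x +[M] y = (c +[M] c') +[M] (d +[M] d')" using * C(1) D(1) by(simp add: subset_iff M.a_ac)
  thus "x +[M] y:?E" using * C(3) D(3) by blast
 next
  fix a x assume "x:?E" and a: "a:car A"
  then obtain c d where *: "x = c +[M] d" "c:C" "d:D" by auto
  have "a *[M] x = a *[M] c +[M] a *[M] d" using * C(1) D(1) a by(simp add: subset_iff smult_r_distr)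
  thus "a *[M] x:?E" using * C(4) D(4) a by blast
 qed
qed

lemma submod_cyclic:
 assumes "lmod A M" "x:car M"
 shows "smod A M ((%a. a *[M] x) ` car A)"
proof -
 interpret left_module A M by fact
 show ?thesis
 proof(intro submodI)
  show "0[M]:(%a. a *[M] x) ` car A" using assms by(intro image_eqI[of _ _ "0[A]"]) auto
 qed(use assms in "auto simp flip: smult_l_distr smult_assoc")
qed

text \<open>A quotient is realised on chosen representatives of the cosets, so that it stays on the
  same carrier type.\<close>

lemma quotient_exists:
 fixes M :: "('a, 'm) module"
 assumes "lmod A M" "smod A M C"
 obtains Q :: "('a, 'm) module" and pj where "lmod A Q" "pj:lhom A M Q"
  "pj ` car M = car Q" "ALL x:car M. pj x = 0[Q] <-> x:C"
proof -
 interpret left_module A M by fact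
 have C: "C <= car M" "0[M]:C" "!!x y. x:C ==> y:C ==> x +[M] y:C"
  "!!x. x:C ==> -[M] x:C" "!!a x. a:car A ==> x:C ==> a *[M] x:C" using assms(2) submod_neg[OF assms] by(auto simp: submod_def)
 define r where "r x = (SOME y. y:car M & y -[M] x:C)" for x
 have r: "r x:car M" "r x -[M] x:C" if "x:car M" for x using someI[of "%y. y:car M & y -[M] x:C" x] that C(2) M.r_neg by(auto simp: r_def M.minus_eq)
 have sym: "y -[M] x:C" if "x -[M] y:C" "x:car M" "y:car M" for x y using C(4)[OF that(1)] that by(simp add: M.minus_eq M.minus_add M.a_comm)
 have trans: "x -[M] z:C" if "x -[M] y:C" "y -[M] z:C" "x:car M" "y:car M" "z:car M" for x y z
 proof -
  have "(x -[M] y) +[M] (y -[M] z) = x -[M] z" using that(3-5) by algebra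
  thus ?thesis using C(3)[OF that(1,2)] by simp
 qed
 have req: "r x = r y <-> x -[M] y:C" if xy: "x:car M" "y:car M" for x y
 proof
  assume "r x = r y" thus "x -[M] y:C" using r[of x] r[of y] sym[of "r x" x] trans[of x "r y" y] xy by auto
 next
  assume *: "x -[M] y:C"
  \<comment> \<open>Congruent elements satisfy the same defining predicate, so the choice operator
    returns the same element for both: equality of cosets becomes equality of
    representatives.\<close>
  have "(z:car M & z -[M] x:C) <-> (z:car M & z -[M] y:C)" for z using trans[of z x y] trans[of z y x] sym[OF *] * xy by blast
  thus "r x = r y" by(simp add: r_def)
 qed
 have rr: "r (r x) = r x" if "x:car M" for x using req r that by simp
 have radd: "r (r x +[M] y) = r (x +[M] y)" if "x:car M" "y:car M" for x y
 proof -
  have "r x +[M] y -[M] (x +[M] y) = r x -[M] x" using that r(1)[OF that(1)] by algebra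
  thus ?thesis using r[of x] that by(simp add: req)
 qed
 have radd': "r (y +[M] r x) = r (y +[M] x)" if "x:car M" "y:car M" for x y using radd[OF that] that r(1) by(simp add: M.a_comm)
 have rsm: "r (a *[M] r x) = r (a *[M] x)" if "x:car M" "a:car A" for x a using that r C(5)[of a "r x -[M] x"] by(simp add: req smult_r_minus)
 define Q :: "('a, 'm) module" where "Q = \<lparr>carrier = r ` car M, monoid.mult = undefined, one = undefined,
   ring.zero = r 0[M], ring.add = (%x y. r (x +[M] y)), smult = (%a x. r (a *[M] x))\<rparr>"
 have Q: "car Q = r ` car M" "0[Q] = r 0[M]" "x +[Q] y = r (x +[M] y)" "a *[Q] x = r (a *[M] x)" for x y a by(simp_all add: Q_def)
 have "abelian_group Q"
 proof(rule abelian_groupI)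
  fix x assume "x:car Q"
  then obtain y where y: "y:car M" "x = r y" by(auto simp: Q)
  thus "EX z:car Q. z +[Q] x = 0[Q]" by(intro bexI[of _ "r (-[M] y)"]) (auto simp: Q radd radd' r(1) M.l_neg)
 qed(auto simp: Q radd radd' rr r(1) M.a_assoc, simp add: M.a_comm)
 hence "lmod A Q" by(intro left_module.intro left_module_axioms.intro R.ring_axioms)
   (auto simp: Q radd radd' rsm r(1) rr smult_r_distr simp flip: smult_l_distr smult_assoc)
 moreover have "r:lhom A M Q" by(rule lhomI) (auto simp: Q radd radd' rsm r(1))
 moreover have "r x = 0[Q] <-> x:C" if "x:car M" for x using that req[of x "0[M]"] by(simp add: Q M.minus_eq)
 ultimately show ?thesis using that[of Q r] by(simp add: Q)
qed

lemma finsum_in_submod: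
 assumes "lmod A M" "submod S M C" "finite I" "f:I \<rightarrow> C"
 shows "finsum M f I:C"
proof -
 interpret left_module A M by fact
 have C: "C <= car M" "0[M]:C" "!!x y. x:C ==> y:C ==> x +[M] y:C" using assms(2) by(auto simp: submod_def)
 show ?thesis using assms(3,4)
 proof(induction I rule: finite_induct)
  case (insert i I)
  thus ?case using C by(subst M.finsum_insert) auto
 qed(use C in "simp add: M.finsum_empty")
qed

text \<open>This form of generation mentions no finite sums. It passes through homomorphisms by
  taking inverse images of submodules, which is how it is used from here on.\<close>

lemma fin_gen_iff:
 assumes "lmod A M"
 shows "fin_gen A M <-> (EX S. finite S & S <= car M &
  (ALL C. smod A M C & S <= C --> car M <= C))"
proof -
 interpret left_module A M by fact
 define D where "D S = {(\<Oplus>\<^bsub>M\<^esub>s\<in>S. c s *[M] s) | c. c:S \<rightarrow> car A}" for S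
 have D: "smod A M (D S)" "S <= D S" if S: "finite S" "S <= car M" for S
 proof -
  have sm: "a *[M] (\<Oplus>\<^bsub>M\<^esub>s\<in>U. c s *[M] s) = (\<Oplus>\<^bsub>M\<^esub>s\<in>U. (a .[A] c s) *[M] s)"
   if "finite U" "U <= car M" "c:U \<rightarrow> car A" "a:car A" for U c a using that
  proof(induction U rule: finite_induct)
   case (insert u U)
   hence "(%s. c s *[M] s):U \<rightarrow> car M" "(%s. (a .[A] c s) *[M] s):U \<rightarrow> car M" by auto
   thus ?case using insert by(simp add: smult_r_distr smult_assoc)
  qed(simp add: M.finsum_empty)
  show "smod A M (D S)"
  proof(rule submodI)
   show "D S <= car M" unfolding D_def using S by(auto intro!: M.finsum_closed simp:)
   have "0[M] = (\<Oplus>\<^bsub>M\<^esub>s\<in>S. 0[A] *[M] s)" using S by(subst M.finsum_zero[of S, symmetric], intro M.finsum_cong') auto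
   thus "0[M]:D S" unfolding D_def by force
  next
   fix x y assume "x:D S" "y:D S"
   then obtain c d where cd: "c:S \<rightarrow> car A" "d:S \<rightarrow> car A" "x = (\<Oplus>\<^bsub>M\<^esub>s\<in>S. c s *[M] s)" "y = (\<Oplus>\<^bsub>M\<^esub>s\<in>S. d s *[M] s)"
    unfolding D_def by blast
   have "x +[M] y = (\<Oplus>\<^bsub>M\<^esub>s\<in>S. c s *[M] s +[M] d s *[M] s)"
    unfolding cd using cd(1,2) S by(intro M.finsum_addf[symmetric]) auto
   also have "... = (\<Oplus>\<^bsub>M\<^esub>s\<in>S. (c s +[A] d s) *[M] s)"
    using cd(1,2) S by(intro M.finsum_cong') (auto simp: Pi_iff smult_l_distr)
   finally show "x +[M] y:D S" unfolding D_def using cd(1,2) by(auto simp: Pi_iff)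
  next
   fix a x assume "a:car A" "x:D S"
   then obtain c where cd: "c:S \<rightarrow> car A" "x = (\<Oplus>\<^bsub>M\<^esub>s\<in>S. c s *[M] s)" unfolding D_def by blast
   thus "a *[M] x:D S" unfolding D_def using sm[OF S cd(1) \<open>a : carrier A\<close>] \<open>a : carrier A\<close>
    by(auto simp: intro!: exI[of _ "%s. a .[A] c s"])
  qed
  show "S <= D S"
  proof
   fix s assume s: "s:S"
   have "(\<Oplus>\<^bsub>M\<^esub>t\<in>S. (if s = t then 1[A] else 0[A]) *[M] t) = (\<Oplus>\<^bsub>M\<^esub>t\<in>S. if s = t then t else 0[M])"
    using S by(intro M.finsum_cong') auto
   also have "... = s" using M.finsum_singleton[of s S "%t. t"] s S by auto
   finally show "s:D S" unfolding D_def by(force intro!: exI[of _ "%t. if s = t then 1[A] else 0[A]"])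
  qed
 qed
 show ?thesis
 proof
  assume "fin_gen A M"
  then obtain S where S: "finite S" "S <= car M" "!!x. x:car M ==> EX c:S \<rightarrow> car A. x = (\<Oplus>\<^bsub>M\<^esub>s\<in>S. c s *[M] s)"
   unfolding fin_gen_def by blast
  show "EX S. finite S & S <= car M & (ALL C. smod A M C & S <= C --> car M <= C)"
  proof(intro exI[of _ S] conjI allI impI subsetI)
   fix C x assume C: "smod A M C & S <= C" and "x:car M"
   then obtain c where "c:S \<rightarrow> car A" "x = (\<Oplus>\<^bsub>M\<^esub>s\<in>S. c s *[M] s)" using S by blast
   moreover have "c s *[M] s:C" if "s:S" for s using C that \<open>c : S \<rightarrow> carrier A\<close> by(auto simp: submod_def Pi_iff)
   ultimately show "x:C" using finsum_in_submod[OF assms conjunct1[OF C] S(1), of "%s. c s *[M] s"] by simp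
  qed(use S(1,2) in auto)
 next
  assume "EX S. finite S & S <= car M & (ALL C. smod A M C & S <= C --> car M <= C)"
  then obtain S where S: "finite S" "S <= car M" "ALL C. smod A M C & S <= C --> car M <= C" by blast
  hence "car M <= D S" using D[OF S(1,2)] by blast
  thus "fin_gen A M" using S(1,2) unfolding fin_gen_def D_def by blast
 qed
qed

lemma fin_genE:
 assumes "fin_gen A M" "lmod A M"
 obtains S where "finite S" "S <= car M" "ALL C. smod A M C & S <= C --> car M <= C"
 using assms(1) unfolding fin_gen_iff[OF assms(2)] by(elim exE conjE)

lemma fin_gen_image:
 assumes "lmod A M" "lmod A N" "f:lhom A M N" "f ` car M = car N" "fin_gen A M"
 shows "fin_gen A N"
proof -
 obtain S where S: "finite S" "S <= car M" "ALL C. smod A M C & S <= C --> car M <= C" by(rule fin_genE[OF assms(5,1)])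
 have "car N <= C" if "smod A N C" "f ` S <= C" for C
 using S(3)[rule_format, OF conjI, OF submod_vimage[OF assms(1-3) that(1)]] S(2) that(2) assms(4)[symmetric] by auto
 moreover have "finite (f ` S)" "f ` S <= car N" using S(1,2) assms(4) by auto
 ultimately show ?thesis unfolding fin_gen_iff[OF assms(2)] by(intro exI[of _ "f ` S"]) simp
qed

lemma ModsD: "M:Mods A ==> lmod A M" "M:Mods A ==> fin_gen A M"
 by(simp_all add: Mods_def)

lemma quotient_Mods:
 fixes M :: "'a fgm"
 assumes "M:Mods A" "smod A M C"
 obtains Q pj where "Q:Mods A" "pj:lhom A M Q"
  "pj ` car M = car Q" "ALL x:car M. pj x = 0[Q] <-> x:C"
proof -
 obtain Q :: "'a fgm" and pj where "lmod A Q" "pj:lhom A M Q"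
  "pj ` car M = car Q" "ALL x:car M. pj x = 0[Q] <-> x:C" by(rule quotient_exists[OF ModsD(1)[OF assms(1)] assms(2)])
 moreover from this fin_gen_image[of A M Q pj] have "Q:Mods A" using assms by(simp add: Mods_def)
 ultimately show ?thesis using that by blast
qed

lemma lmap_factor:
 assumes "lmod A M" "lmod A Q" "lmod A N" "pj:lhom A M Q" "f:lhom A M N"
  "pj ` car M = car Q" "!!x. x:car M ==> pj x = 0[Q] ==> f x = 0[N]"
 obtains g where "g:lhom A Q N" "ALL x:car M. g (pj x) = f x"
proof -
 interpret p: lmap A M Q pj using assms by(intro lmapI)
 interpret f: lmap A M N f using assms by(intro lmapI)
 define g where "g = (%y. f (inv_into (car M) pj y))"
 have g: "g (pj x) = f x" if x: "x:car M" for x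
 proof -
  let ?y = "inv_into (car M) pj (pj x)"
  have y: "?y:car M" "pj ?y = pj x" using x by(auto simp: inv_into_into f_inv_into_f)
  hence "pj (?y -[M] x) = 0[Q]" using x by simp
  hence "f ?y -[N] f x = 0[N]" using assms(7)[of "?y -[M] x"] x y by simp
  thus ?thesis using x y by(simp add: g_def)
 qed
 have "g:lhom A Q N"
 proof(rule lhomI)
  fix x y assume "x:car Q" "y:car Q"
  then obtain u v where "u:car M" "v:car M" "x = pj u" "y = pj v" using assms(6) by blast
  thus "g (x +[Q] y) = g x +[N] g y" using g[of "u +[M] v"] g[of u] g[of v] by simp
 next
  fix a x assume a: "a:car A" and "x:car Q"
  then obtain u where "u:car M" "x = pj u" using assms(6) by blast
  thus "g (a *[Q] x) = a *[N] g x" using g[of "a *[M] u"] g[of u] a by simp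
 next
  fix x assume "x:car Q"
  then obtain u where "u:car M" "x = pj u" using assms(6) by blast
  thus "g x:car N" using g[of u] by simp
 qed
 with g show ?thesis by(intro that ballI)
qed

text \<open>Brings modules on other carrier types, above all direct sums on product types, back to
  the carrier type of \<open>Mods A\<close>.\<close>

lemma Mods_rep:
 fixes A :: "'a ring" and M :: "('a, 'm) module"
 assumes "lmod A M" "fin_gen A M"
 obtains N :: "'a fgm" and e where "N:Mods A" "e:liso A M N" using fg_module_representative[OF assms] unfolding mod_iso_def by blast

lemma dsum_simps [simp]: "car (dsum M N) = car M \<times> car N" "0[dsum M N] = (0[M], 0[N])"
 "(x, y) +[dsum M N] (x', y') = (x +[M] x', y +[N] y')"
 "a *[dsum M N] (x, y) = (a *[M] x, a *[N] y)" by(simp_all add: dsum_def)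

lemma dsum_lm:
 assumes "lmod A M" "lmod A N"
 shows "lmod A (dsum M N)"
proof -
 interpret M: left_module A M by fact
 interpret N: left_module A N by fact
 have "abelian_group (dsum M N)"
 proof(rule abelian_groupI)
  fix x assume "x:car (dsum M N)"
  thus "EX y:car (dsum M N). y +[dsum M N] x = 0[dsum M N]" by(intro bexI[of _ "(-[M] fst x, -[N] snd x)"]) (auto simp: M.M.l_neg N.M.l_neg)
 qed(auto simp: M.M.a_ac N.M.a_ac)
 thus ?thesis by(intro left_module.intro left_module_axioms.intro M.R.ring_axioms)
  (auto simp: M.smult_l_distr M.smult_r_distr M.smult_assoc N.smult_l_distr N.smult_r_distr N.smult_assoc)
qed

lemma lhom_dsum:
 "fst:lhom A (dsum M N) M" "snd:lhom A (dsum M N) N"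
 "[|f:lhom A L M; g:lhom A L N|] ==> (%x. (f x, g x)):lhom A L (dsum M N)" by(auto simp: lhom_def)

lemma lhom_inl: "lmod A N ==> (%x. (x, 0[N])):lhom A M (dsum M N)"
 and lhom_inr: "lmod A M ==> (%x. (0[M], x)):lhom A N (dsum M N)" by(intro lhom_dsum lhom_id lhom_zero; assumption)+

lemma dsum_fin_gen:
 assumes "lmod A M" "lmod A N" "fin_gen A M" "fin_gen A N"
 shows "fin_gen A (dsum M N)"
proof -
 interpret M: left_module A M by fact
 interpret N: left_module A N by fact
 obtain S where S: "finite S" "S <= car M" "ALL C. smod A M C & S <= C --> car M <= C" by(rule fin_genE[OF assms(3,1)])
 obtain T where T: "finite T" "T <= car N" "ALL C. smod A N C & T <= C --> car N <= C" by(rule fin_genE[OF assms(4,2)])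
 note lm = dsum_lm[OF assms(1,2)]
 let ?S = "(%x. (x, 0[N])) ` S \<union> (%x. (0[M], x)) ` T"
 show ?thesis unfolding fin_gen_iff[OF lm]
 proof(intro exI[of _ ?S] conjI allI impI subsetI)
  fix C z assume *: "smod A (dsum M N) C & ?S <= C" and "z:car (dsum M N)"
  then obtain x y where z: "z = (x, y)" "x:car M" "y:car N" by auto
  have C: "smod A (dsum M N) C" "(%x. (x, 0[N])) ` S <= C" "(%x. (0[M], x)) ` T <= C" using * by auto
  have "car M <= {x:car M. (x, 0[N]):C}"
   by(rule S(3)[rule_format, OF conjI, OF submod_vimage[OF assms(1) lm lhom_inl[OF assms(2)] C(1)]]) (use C(2) S(2) in auto)
  moreover have "car N <= {x:car N. (0[M], x):C}"
   by(rule T(3)[rule_format, OF conjI, OF submod_vimage[OF assms(2) lm lhom_inr[OF assms(1)] C(1)]]) (use C(3) T(2) in auto)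
  ultimately have "(x, 0[N]):C" "(0[M], y):C" using z by auto
  hence "(x, 0[N]) +[dsum M N] (0[M], y):C" using C(1) unfolding submod_def by blast
  thus "z:C" using z by simp
 qed(use S(1,2) T(1,2) in auto)
qed

lemma Mods_dsum:
 assumes "M:Mods A" "N:Mods A"
 obtains L e where "L:Mods A" "e:liso A (dsum M N) L" by(rule Mods_rep[of A "dsum M N"])
  (use dsum_lm dsum_fin_gen ModsD[OF assms(1)] ModsD[OF assms(2)] in blast)+

lemma mod_iso_sym:
 assumes "lmod A M" "mod_iso A M N" shows "mod_iso A N M" using assms liso_inv[of _ A M N] unfolding mod_iso_def by blast

text \<open>A retract is a direct summand: the complement is the kernel of the retraction.\<close>

lemma retract_dsum:
 assumes "lmod A L" "lmod A M" "i:lhom A L M" "p:lhom A M L"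
  "!!x. x:car L ==> p (i x) = x"
 shows "mod_iso A M (dsum L (restr M {x:car M. p x = 0[L]}))"
proof -
 interpret i: lmap A L M i using assms by(intro lmapI)
 interpret p: lmap A M L p using assms by(intro lmapI)
 let ?K = "{x:car M. p x = 0[L]}"
 have "(%x. (p x, x -[M] i (p x))):liso A M (dsum L (restr M ?K))"
 proof(rule lisoI[where g = "%(u, v). i u +[M] v"])
  show "(%x. (p x, x -[M] i (p x))):lhom A M (dsum L (restr M ?K))" by(intro lhom_dsum assms lhom_restr lhom_minus lhom_id lcomp[OF assms(4,3)])
    (auto simp: assms(5))
 next
  fix x assume "x:car M"
  thus "(case (p x, x -[M] i (p x)) of (u, v) => i u +[M] v) = x" by(simp add: i.N.M.minus_eq i.N.M.a_lcomm i.N.M.r_neg)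
 next
  fix y assume "y:car (dsum L (restr M ?K))"
  then obtain u v where y: "y = (u, v)" "u:car L" "v:car M" "p v = 0[L]" by auto
  have "i u +[M] v -[M] i u = v" using y i.closed[OF y(2)] by algebra
  thus "(case y of (u, v) => i u +[M] v):car M &
    (p (case y of (u, v) => i u +[M] v), (case y of (u, v) => i u +[M] v) -[M] i (p (case y of (u, v) => i u +[M] v))) = y"
   using y by(simp add: assms(5))
 qed
 thus ?thesis unfolding mod_iso_def by blast
qed

subsection \<open>Projective modules\<close>

lemma projective_Mods: "projective A P ==> P:Mods A"
 by(simp add: projective_def)

lemma projectiveD:
 "[|projective A P; g:lhom A M N; h:lhom A P N; g ` car M = car N; M:Mods A; N:Mods A|]
  ==> EX h':lhom A P M. ALL x:car P. g (h' x) = h x" unfolding projective_def by blast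

text \<open>The definition tests projectivity only against surjections between modules on the fixed
  carrier type. Here \<open>g\<close> is first corestricted to its image, which is finitely
  generated because \<open>M\<close> is, and then both modules are replaced by isomorphic ones of
  the right type.\<close>

lemma projective_lift:
 assumes P: "projective A P" and lm: "lmod A M" "lmod A N" "fin_gen A M"
  and g: "g:lhom A M N" and h: "h:lhom A P N" and im: "!!x. x:car P ==> h x:g ` car M"
 obtains h' where "h':lhom A P M" "ALL x:car P. g (h' x) = h x"
proof -
 obtain M' e where M': "M':Mods A" "e:liso A M M'" using Mods_rep[OF lm(1,3)] .
 obtain e' where e': "e':liso A M' M" "ALL x:car M. e' (e x) = x" "ALL x:car M'. e (e' x) = x" by(rule liso_inv[OF M'(2) lm(1)])
 let ?I = "restr N (g ` car M)"
 have I: "lmod A ?I" by(intro restr_left_module submod_image[OF lm(1,2) g] submod_top lm)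
 have gI: "g:lhom A M ?I" by(intro lhom_restr g) auto
 obtain N' d where N': "N':Mods A" "d:liso A ?I N'" using fin_gen_image[OF lm(1) I gI] Mods_rep[OF I] by(auto simp: lm)
 have dg: "(%x. d (g (e' x))):lhom A M' N'" by(intro lcomp[OF _ liso_lhom[OF N'(2)]] lcomp[OF liso_lhom[OF e'(1)]] gI)
 have dh: "(%x. d (h x)):lhom A P N'" by(rule lcomp[OF _ liso_lhom[OF N'(2)]]) (auto intro!: lhom_restr h im)
 have di: "(%x. d (g (e' x))) ` car M' = car N'"
 proof -
  have "e' ` car M' = car M" "d ` car ?I = car N'" using e'(1) N'(2) by(auto simp: liso_def bij_betw_def)
  thus ?thesis by(metis image_image restr_simps(1))
 qed
 obtain k where k: "k:lhom A P M'" "ALL x:car P. d (g (e' (k x))) = d (h x)" using projectiveD[OF P dg dh di M'(1) N'(1)] by blast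
 have e'k: "(%x. e' (k x)):lhom A P M" by(rule lcomp[OF k(1) liso_lhom[OF e'(1)]])
 have "g (e' (k x)) = h x" if "x:car P" for x
 proof -
  have inj: "inj_on d (g ` car M)" using N'(2) by(simp add: liso_def bij_betw_def)
  show ?thesis using e'k that inj_onD[OF inj bspec[OF k(2) that]] im[OF that] by(simp add: lhom_def Pi_iff)
 qed
 thus ?thesis by(intro that[OF e'k] ballI)
qed

lemma projective_retract:
 assumes "projective A P" "Q:Mods A" "i:lhom A Q P" "p:lhom A P Q"
  "!!x. x:car Q ==> p (i x) = x"
 shows "projective A Q" unfolding projective_def
proof(intro conjI ballI impI)
 fix M N g h assume *: "M:Mods A" "N:Mods A" "g:lhom A M N" "h:lhom A Q N" "g ` car M = car N"
 obtain h' where h': "h':lhom A P M" "ALL x:car P. g (h' x) = h (p x)" using projectiveD[OF assms(1) *(3) lcomp[OF assms(4) *(4)] *(5,1,2)] by blast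
 thus "EX h':lhom A Q M. ALL x:car Q. g (h' x) = h x" using assms by(intro bexI[of _ "%x. h' (i x)"]) (auto simp: lhom_def Pi_iff)
qed fact

lemma projective_dsum:
 assumes "projective A P" "projective A Q" "L:Mods A" "e:liso A (dsum P Q) L"
 shows "projective A L" unfolding projective_def
proof(intro conjI ballI impI)
 fix M N g h assume *: "M:Mods A" "N:Mods A" "g:lhom A M N" "h:lhom A L N" "g ` car M = car N"
 note lm = projective_Mods[OF assms(1), THEN ModsD(1)] projective_Mods[OF assms(2), THEN ModsD(1)]
  ModsD(1)[OF *(1)] ModsD(1)[OF *(2)]
 interpret P: left_module A P by fact
 interpret Q: left_module A Q by fact
 obtain e' where e': "e':liso A L (dsum P Q)" "ALL x:car (dsum P Q). e' (e x) = x"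
  "ALL x:car L. e (e' x) = x" by(rule liso_inv[OF assms(4) dsum_lm[OF lm(1,2)]])
 have he: "(%x. h (e x)):lhom A (dsum P Q) N" by(rule lcomp[OF liso_lhom[OF assms(4)] *(4)])
 interpret he: lmap A "dsum P Q" N "%x. h (e x)" by(intro lmapI dsum_lm lm he)
 obtain u where u: "u:lhom A P M" "ALL x:car P. g (u x) = h (e (x, 0[Q]))"
  using projectiveD[OF assms(1) *(3) lcomp[OF lhom_inl[OF lm(2)] he] *(5,1,2)] by blast
 obtain v where v: "v:lhom A Q M" "ALL x:car Q. g (v x) = h (e (0[P], x))"
  using projectiveD[OF assms(2) *(3) lcomp[OF lhom_inr[OF lm(1)] he] *(5,1,2)] by blast
 let ?w = "%x. u (fst (e' x)) +[M] v (snd (e' x))"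
 show "EX h':lhom A L M. ALL x:car L. g (h' x) = h x"
 proof(intro bexI[of _ ?w] ballI)
  show w: "?w:lhom A L M" by(intro lhom_add lm lcomp[OF _ u(1)] lcomp[OF _ v(1)] lcomp[OF liso_lhom[OF e'(1)]] lhom_dsum)
  fix x assume x: "x:car L"
  obtain y z where yz: "e' x = (y, z)" by fastforce
  hence yz': "y:car P" "z:car Q" using e'(1) x by(auto simp: liso_def lhom_def Pi_iff)
  have "g (?w x) = g (u y) +[N] g (v z)" using *(3) u(1) v(1) yz yz' by(auto simp: lhom_def Pi_iff)
  also have "... = h (e ((y, 0[Q]) +[dsum P Q] (0[P], z)))" using u(2) v(2) yz' he.add[of "(y, 0[Q])" "(0[P], z)"] by simp
  also have "... = h x" using yz' yz bspec[OF e'(3) x] by simp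
  finally show "g (?w x) = h x" .
 qed
qed fact

lemma lreg_lm:
 assumes "ring A" shows "lmod A (lreg A)"
proof -
 interpret ring A by fact
 show ?thesis by(intro left_module.intro left_module_axioms.intro abelian_groupI)
   (auto simp: left_regular_def assms a_ac m_assoc l_distr r_distr
    intro:)
qed

lemma regular_liso:
 assumes "ring A"
 obtains e where "e:liso A (rgm A) (lreg A)"
proof -
 obtain d where d: "d:liso A (lreg A) (rgm A)" using regular_module_Mods(2)[OF assms] by(auto simp: mod_iso_def)
 show ?thesis by(rule liso_inv[OF d lreg_lm[OF assms]]) (rule)
qed

lemma left_regular_simps [simp]: "car (lreg A) = car A"
 "smult (lreg A) = monoid.mult A" "add (lreg A) = add A" "0[lreg A] = 0[A]" by(simp_all add: left_regular_def)

lemma lhom_from_regular: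
 assumes "lmod A M" "x:car M"
 shows "(%a. a *[M] x):lhom A (lreg A) M"
proof -
 interpret left_module A M by fact
 show ?thesis using assms by(auto simp: lhom_def smult_l_distr smult_assoc)
qed

lemma projective_regular:
 assumes "ring A" shows "projective A (rgm A)" unfolding projective_def
proof(intro conjI ballI impI)
 interpret A: ring A by fact
 show "rgm A:Mods A" by(rule regular_module_Mods[OF assms])
 fix M N g h assume *: "M:Mods A" "N:Mods A" "g:lhom A M N" "h:lhom A (rgm A) N" "g ` car M = car N"
 interpret M: left_module A M by(rule ModsD[OF *(1)])
 obtain e where e: "e:liso A (rgm A) (lreg A)" using regular_liso[OF assms] .
 obtain e' where e': "e':liso A (lreg A) (rgm A)"
  "ALL x:car (rgm A). e' (e x) = x"
  "ALL x:car (lreg A). e (e' x) = x" by(rule liso_inv[OF e ModsD(1)[OF regular_module_Mods(1)[OF assms]]])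
 have he: "(%x. h (e' x)):lhom A (lreg A) N" by(rule lcomp[OF liso_lhom[OF e'(1)] *(4)])
 hence "h (e' 1[A]):car N" by(auto simp: lhom_def)
 then obtain m where m: "m:car M" "g m = h (e' 1[A])" using *(5) by(metis imageE)
 show "EX h':lhom A (rgm A) M. ALL x:car (rgm A). g (h' x) = h x"
 proof(intro bexI[of _ "%x. e x *[M] m"] ballI)
  show "(%x. e x *[M] m):lhom A (rgm A) M" by(rule lcomp[OF liso_lhom[OF e] lhom_from_regular]) (use m M.lmA in auto)
  fix x assume x: "x:car (rgm A)"
  hence ex: "e x:car A" using e by(auto simp: liso_def lhom_def)
  have "g (e x *[M] m) = e x *[N] h (e' 1[A])" using *(3) m ex by(simp add: lhom_def)
  also have "... = h (e' (e x .[A] 1[A]))" using he ex unfolding lhom_def by(simp del: A.r_one)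
  finally show "g (e x *[M] m) = h x" using ex bspec[OF e'(2) x] by simp
 qed
qed

lemma zero_module_Mods: assumes "ring A" shows "zero_module:Mods A"
proof -
 have "ob (stalk (rgm A)) 1:Mods A" using stalk_Cb[OF assms] regular_module_Mods[OF assms] unfolding Cb_def by blast
 thus ?thesis by(simp add: stalk_def)
qed

lemma zero_module_simps [simp]: "car zero_module = {{}}" "0[zero_module] = {}"
 by(simp_all add: zero_module_def)

lemma projective_zero:
 assumes "Z:Mods A" "zmod Z" shows "projective A Z" unfolding projective_def
proof(intro conjI ballI impI)
 fix M N g h assume *: "M:Mods A" "N:Mods A" "g:lhom A M N" "h:lhom A Z N" "g ` car M = car N"
 interpret g: lmap A M N g using * ModsD by(intro lmapI) auto
 interpret h: lmap A Z N h using * assms ModsD by(intro lmapI) auto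
 show "EX h':lhom A Z M. ALL x:car Z. g (h' x) = h x" using assms by(intro bexI[of _ "%_. 0[M]"] lhom_zero g.M.lmA) (simp add: is_zero_mod_def)
qed fact

text \<open>One copy of the regular module is added for each generator \<open>t\<close>, with 1 sent
  to \<open>t\<close>. Membership in \<open>addc A {rgm A}\<close> is recorded because it places all
  projective modules in every extension class that contains \<open>rgm A\<close>.\<close>

lemma enough_projectives:
 assumes "M:Mods A"
 obtains P g where "projective A P" "P:addc A {rgm A}" "g:lhom A P M" "g ` car P = car M"
proof -
 interpret M: left_module A M by(rule ModsD[OF assms])
 have rA: "ring A" by(rule M.R.ring_axioms)
 obtain S where S: "finite S" "S <= car M" "ALL C. smod A M C & S <= C --> car M <= C" by(rule fin_genE[OF ModsD(2)[OF assms] ModsD(1)[OF assms]])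
 have "EX P g. projective A P & P:addc A {rgm A} & g:lhom A P M & T <= g ` car P" if "finite T" "T <= car M" for T using that
 proof(induction T rule: finite_induct)
  case empty
  show ?case by(intro exI[of _ zero_module] exI[of _ "%_. 0[M]"] conjI lhom_zero M.lmA
     projective_zero add_closure.empty_sum zero_module_Mods rA) (auto simp: is_zero_mod_def)
 next
  case (insert t T)
  then obtain P g where P: "projective A P" "g:lhom A P M" "T <= g ` car P" and Pa: "P:addc A {rgm A}" by auto
  obtain e where e: "e:liso A (rgm A) (lreg A)" using regular_liso[OF rA] .
  have P': "P:Mods A" using P by(simp add: projective_def)
  note R = regular_module_Mods(1)[OF rA]
  note lm = ModsD(1)[OF P'] ModsD(1)[OF R]
  interpret g: lmap A P M g using P lm M.lmA by(intro lmapI)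
  obtain L d where L: "L:Mods A" "d:liso A (dsum P (rgm A)) L" using Mods_dsum[OF P' R] .
  obtain d' where d': "d':liso A L (dsum P (rgm A))" by(rule liso_inv[OF L(2) dsum_lm[OF lm]])
  have t: "t:car M" using insert by auto
  let ?f = "%x. g (fst x) +[M] e (snd x) *[M] t"
  have rt: "(%x. e x *[M] t):lhom A (rgm A) M" by(rule lcomp[OF liso_lhom[OF e] lhom_from_regular]) (use t M.lmA in auto)
  interpret e: lmap A "rgm A" "lreg A" e using lm liso_lhom[OF e] lreg_lm[OF rA] by(intro lmapI)
  have f: "?f:lhom A (dsum P (rgm A)) M" by(intro lhom_add M.lmA lcomp[OF _ P(2)] lcomp[OF _ rt] lhom_dsum)
  have im: "(%x. ?f (d' x)) ` car L = ?f ` car (dsum P (rgm A))"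
  proof -
   have d'': "d' ` car L = car (dsum P (rgm A))" using d' by(simp add: liso_def bij_betw_def)
   show ?thesis unfolding d''[symmetric] image_image ..
  qed
  have "insert t T <= ?f ` car (dsum P (rgm A))"
  proof -
   have "1[A]:e ` car (rgm A)" using e by(simp add: liso_def bij_betw_def)
   then obtain u where u: "u:car (rgm A)" "e u = 1[A]" by(metis imageE)
   have "t = ?f (0[P], u)" using u t by simp
   hence 1: "t:?f ` car (dsum P (rgm A))" by(rule) (simp add: u)
   have "g x = ?f (x, 0[rgm A])" if "x:car P" for x using that t by simp
   hence "g x:?f ` car (dsum P (rgm A))" if "x:car P" for x by(rule) (simp_all add: that)
   hence "g ` car P <= ?f ` car (dsum P (rgm A))" by blast
   with 1 P(3) show ?thesis by simp
  qed
  moreover have "L:addc A {rgm A}" by(rule add_closure.sum[OF Pa add_closure.base[OF _ R] L(1)]) (use d' in "auto simp: mod_iso_def")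
  ultimately show ?case unfolding im[symmetric] using projective_dsum[OF P(1) projective_regular[OF rA] L] lcomp[OF liso_lhom[OF d'] f]
   by(intro exI conjI)
 qed
 from this[OF S(1,2)] obtain P g where P: "projective A P" "g:lhom A P M" "S <= g ` car P" and Pa: "P:addc A {rgm A}" by blast
 have Pl: "lmod A P" using P by(simp add: projective_def Mods_def)
 have "car M <= g ` car P" by(rule S(3)[rule_format, OF conjI, OF submod_image[OF Pl M.lmA P(2) submod_top[OF Pl]] P(3)])
 moreover have "g ` car P <= car M" using P by(auto simp: lhom_def)
 ultimately show ?thesis by(intro that[OF P(1) Pa P(2)] subset_antisym)
qed

subsection \<open>Length\<close>

text \<open>Length is bounded by rank functions on the lattice of submodules; this makes subadditivity
 immediate.\<close>

definition is_rank :: "'a set => ('a, 'm) module => 'm set => ('m set => nat) => bool" where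
 "is_rank S M U rh <-> (ALL C D. submod S M C & submod S M D & C < D & D <= U --> rh C < rh D)"

text \<open>For a submodule \<open>U\<close> this bounds the number of strict inclusions in any
  chain of \<open>S\<close>-submodules of \<open>U\<close>, without a definition of length
  itself.\<close>

definition len_le :: "'a set => ('a, 'm) module => 'm set => nat => bool" where
 "len_le S M U c <-> (EX rh. is_rank S M U rh & rh U <= c)"

lemma is_rank_mono: "is_rank S M U rh ==> submod S M C ==> submod S M D ==> C <= D ==> D <= U ==> rh C <= rh D"
 unfolding is_rank_def by(metis le_less)

lemma len_le_mono: "len_le S M U c ==> c <= d ==> len_le S M U d"
 unfolding len_le_def by(meson le_trans)

lemma len_le_sub:
 assumes "len_le S M U c" "submod S M U" "submod S M V" "V < U"
 shows "EX d<c. len_le S M V d"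
proof -
 obtain rh where r: "is_rank S M U rh" "rh U <= c" using assms(1) by(auto simp: len_le_def)
 hence "is_rank S M V rh" "rh V < rh U" using assms unfolding is_rank_def by blast+
 thus ?thesis using r(2) unfolding len_le_def by(intro exI[of _ "rh V"]) auto
qed

lemma len_le_subset:
 assumes "len_le S M U c" "submod S M U" "submod S M V" "V <= U"
 shows "len_le S M V c" using len_le_sub[OF assms(1-3)] assms by(metis len_le_mono less_imp_le psubsetI)

lemma len_le_zero: "len_le S M {0[M]} 0"
 unfolding len_le_def is_rank_def by(intro exI[of _ "%_. 0"]) (auto simp: submod_def)

lemma submod_restr:
 "V <= car M ==> submod S (restr M V) C <-> submod S M C & C <= V" by(auto simp: submod_def)

text \<open>Additive maps given only on \<open>U\<close> and linear along a map \<open>si\<close> of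
  scalars. Both freedoms are used: \<open>c -> ph c *[M] x\<close> changes the scalars from
  \<open>k\<close> to its image in \<open>A\<close>, and the inverse of an embedding lives on the
  image only.\<close>

definition semilin :: "'s set => ('s => 'a) => ('s, 'm) module => 'm set => ('a, 'n) module => ('m => 'n) => bool" where
 "semilin S si M U N g <-> g ` U <= car N & g 0[M] = 0[N] &
   (ALL x:U. ALL y:U. g (x +[M] y) = g x +[N] g y) & (ALL s:S. ALL x:U. g (s *[M] x) = si s *[N] g x)"

lemma submod_semilin_image:
 assumes "semilin S si M U N g" "submod S M C" "C <= U"
 shows "submod (si ` S) N (g ` C)"
proof(rule submodI)
 note g = assms(1)[unfolded semilin_def]
 show "g ` C <= car N" using g assms(3) by auto
 show "0[N]:g ` C" using g assms(2) unfolding submod_def by(metis image_eqI)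
 fix x y assume "x:g ` C" "y:g ` C"
 then obtain u v where "u:C" "v:C" "x = g u" "y = g v" by auto
 thus "x +[N] y:g ` C" using g assms(2,3) by(intro image_eqI[of _ _ "u +[M] v"]) (auto simp: submod_def subset_iff)
next
 note g = assms(1)[unfolded semilin_def]
 fix a x assume "x:g ` C" "a:si ` S"
 then obtain u s where "u:C" "s:S" "x = g u" "a = si s" by auto
 thus "a *[N] x:g ` C" using g assms(2,3) by(intro image_eqI[of _ _ "s *[M] u"]) (auto simp: submod_def)
qed

lemma submod_semilin_vimage:
 assumes "semilin S si M U N g" "submod (si ` S) N C" "submod S M U"
 shows "submod S M {x:U. g x:C}" using assms by(intro submodI) (auto simp: submod_def semilin_def)

lemma semilin_kernel:
 assumes "semilin S si M U N g" "submod S M U" "lmod R' N" "si ` S <= car R'"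
 shows "submod S M {x:U. g x = 0[N]}"
proof -
 interpret N: left_module R' N by fact
 have "submod (si ` S) N {0[N]}" using assms(4) by(intro submodI) auto
 from submod_semilin_vimage[OF assms(1) this assms(2)] show ?thesis by simp
qed

lemma semilin_minus:
 assumes "semilin S si M U N g" "submod S M U" "lmod R M" "lmod R' N"
  "-[R] 1[R]:S" "x:U" "y:U"
 shows "g (x -[M] y) = g x -[N] g y"
proof -
 interpret M: left_module R M by fact
 interpret N: left_module R' N by fact
 have U: "x:car M" "y:car M" "x -[M] y:U" using assms submod_minus[OF assms(3,2,5,6,7)] by(auto simp: submod_def)
 have gU: "g x:car N" "g y:car N" "g (x -[M] y):car N" using assms U by(auto simp: semilin_def)
 have "(x -[M] y) +[M] y = x" using U by algebra
 hence "g (x -[M] y) +[N] g y = g x" using assms U unfolding semilin_def by metis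
 hence "g x -[N] g y = g (x -[M] y) +[N] g y -[N] g y" by simp
 also have "... = g (x -[M] y)" using gU by algebra
 finally show ?thesis ..
qed

text \<open>The rank of \<open>C\<close> is the rank of its intersection with the kernel plus the
  rank of its image. Both summands are monotone, and nested submodules that agree in both are equal,
  so the sum is strictly monotone.\<close>

lemma len_le_extension:
 assumes g: "semilin S si M U N g" and U: "submod S M U" and R: "lmod R M" "lmod R' N" and S: "-[R] 1[R]:S" "si ` S <= car R'"
  and K: "len_le S M {x:U. g x = 0[N]} c" and I: "len_le (si ` S) N (g ` U) d"
 shows "len_le S M U (c+d)"
proof -
 interpret M: left_module R M by fact
 interpret N: left_module R' N by fact
 let ?K = "{x:U. g x = 0[N]}"
 obtain rh_1 where r1: "is_rank S M ?K rh_1" "rh_1 ?K <= c" using K by(auto simp: len_le_def)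
 obtain rh_2 where r2: "is_rank (si ` S) N (g ` U) rh_2" "rh_2 (g ` U) <= d" using I by(auto simp: len_le_def)
 have Us: "U <= car M" using U by(simp add: submod_def)
 have gU: "g x:car N" if "x:U" for x using g that by(auto simp: semilin_def)
 note Ks = semilin_kernel[OF g U R(2) S(2)]
 have main: "rh_1 (C Int ?K)+rh_2 (g ` C) < rh_1 (D Int ?K)+rh_2 (g ` D)" if CD: "submod S M C" "submod S M D" "C < D" "D <= U" for C D
 proof -
  note CK = submod_Int[OF CD(1) Ks] submod_Int[OF CD(2) Ks]
  note gC = submod_semilin_image[OF g CD(1)] submod_semilin_image[OF g CD(2,4)]
  have gC1: "submod (si ` S) N (g ` C)" using CD by(intro gC) auto
  have le1: "rh_1 (C Int ?K) <= rh_1 (D Int ?K)" using CD by(intro is_rank_mono[OF r1(1) CK]) auto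
  have le2: "rh_2 (g ` C) <= rh_2 (g ` D)" using CD by(intro is_rank_mono[OF r2(1) gC1 gC(2)]) auto
  have "C Int ?K < D Int ?K | g ` C < g ` D"
  proof(rule ccontr)
   assume "~ ?thesis"
   hence *: "C Int ?K = D Int ?K" "g ` C = g ` D" using CD(3) by blast+
   obtain x where x: "x:D" "x ~: C" using CD(3) by blast
   have "g x:g ` C" using *(2) x by blast
   then obtain y where y: "y:C" "g y = g x" by auto
   have xy: "x:U" "y:U" "y:D" using x y CD by auto
   have "x -[M] y:D" using submod_minus[OF R(1) CD(2) S(1) x(1) xy(3)] .
   moreover have "g (x -[M] y) = 0[N]" using semilin_minus[OF g U R S(1) xy(1,2)] y gU[OF xy(1)] by simp
   ultimately have "x -[M] y:C" using * CD by blast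
   hence "(x -[M] y) +[M] y:C" using CD(1) y(1) by(simp add: submod_def)
   moreover have "(x -[M] y) +[M] y = x" using xy subsetD[OF Us] by algebra
   ultimately show False using x(2) by simp
  qed
  thus ?thesis
  proof
   assume "C Int ?K < D Int ?K"
   hence "rh_1 (C Int ?K) < rh_1 (D Int ?K)" using r1(1) CK unfolding is_rank_def by blast
   with le2 show ?thesis by simp
  next
   assume "g ` C < g ` D"
   hence "rh_2 (g ` C) < rh_2 (g ` D)"
    by(rule r2(1)[unfolded is_rank_def, rule_format, OF conjI, OF gC1 conjI, OF gC(2) conjI, OF _ image_mono[OF CD(4)]])
   with le1 show ?thesis by simp
  qed
 qed
 have UK: "U Int ?K = ?K" by blast
 have "is_rank S M U (%C. rh_1 (C Int ?K)+rh_2 (g ` C))" unfolding is_rank_def using main by simp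
 moreover have "rh_1 (U Int ?K)+rh_2 (g ` U) <= c+d" unfolding UK using r1(2) r2(2) by simp
 ultimately show ?thesis unfolding len_le_def by blast
qed

text \<open>A submodule of the image is ranked by its inverse image in \<open>U\<close>; distinct
  submodules of the image have distinct inverse images.\<close>

lemma len_le_image:
 assumes g: "semilin S si M U N g" and U: "submod S M U" "len_le S M U c"
 shows "len_le (si ` S) N (g ` U) c"
proof -
 obtain rh where r: "is_rank S M U rh" "rh U <= c" using U(2) by(auto simp: len_le_def)
 have "rh {x:U. g x:C} < rh {x:U. g x:D}" if "submod (si ` S) N C" "submod (si ` S) N D" "C < D" "D <= g ` U" for C D
 using that(3,4) r(1) submod_semilin_vimage[OF g that(1) U(1)] submod_semilin_vimage[OF g that(2) U(1)] is_rank_def by blast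
 moreover have "{x:U. g x:g ` U} = U" by auto
 ultimately show ?thesis unfolding len_le_def is_rank_def using r(2) by(intro exI[of _ "%C. rh {x:U. g x:C}"]) auto
qed

text \<open>The same kind of rank for the filtration of \<open>U + V\<close> by \<open>U\<close>.
  Here \<open>T C\<close> is the part of \<open>V\<close> that lies in \<open>C\<close> modulo
  \<open>U\<close>, which avoids forming the quotient by \<open>U\<close>.\<close>

lemma len_le_sum:
 assumes R: "lmod R M" and S: "-[R] 1[R]:S" "S <= car R" and U: "submod S M U" "len_le S M U c" and V: "submod S M V" "len_le S M V d"
 shows "submod S M {u +[M] v | u v. u:U & v:V} & len_le S M {u +[M] v | u v. u:U & v:V} (c+d)"
proof -
 interpret M: left_module R M by fact
 let ?W = "{u +[M] v | u v. u:U & v:V}"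
 have Uc: "u:car M" if "u:U" for u using that U by(auto simp: submod_def)
 have Vc: "u:car M" if "u:V" for u using that V by(auto simp: submod_def)
 have W: "submod S M ?W"
 proof(intro submodI)
  show "?W <= car M" using Uc Vc by auto
  have "0[M] = 0[M] +[M] 0[M]" "0[M]:U" "0[M]:V" using U V by(auto simp: submod_def)
  thus "0[M]:?W" by blast
 next
  fix x y assume "x:?W" "y:?W"
  then obtain c d c' d' where *: "x = c +[M] d" "y = c' +[M] d'" "c:U" "d:V" "c':U" "d':V" by auto
  hence "x +[M] y = (c +[M] c') +[M] (d +[M] d')" using Uc Vc by(simp add: M.M.a_ac)
  moreover have "c +[M] c':U" "d +[M] d':V" using * U V by(auto simp: submod_def)
  ultimately show "x +[M] y:?W" by blast
 next
  fix a x assume "x:?W" and a: "a:S"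
  then obtain c d where *: "x = c +[M] d" "c:U" "d:V" by auto
  hence "a *[M] x = a *[M] c +[M] a *[M] d" using Uc Vc a S(2) by(auto simp: M.smult_r_distr)
  moreover have "a *[M] c:U" "a *[M] d:V" using * U V a by(auto simp: submod_def)
  ultimately show "a *[M] x:?W" by blast
 qed
 obtain rh_1 where r1: "is_rank S M U rh_1" "rh_1 U <= c" using U by(auto simp: len_le_def)
 obtain rh_2 where r2: "is_rank S M V rh_2" "rh_2 V <= d" using V by(auto simp: len_le_def)
 define T where "T C = {v:V. EX u:U. u +[M] v:C}" for C
 have T: "submod S M (T C)" if C: "submod S M C" for C
 proof(intro submodI)
  show "T C <= car M" using Vc by(auto simp: T_def)
  show "0[M]:T C" using U V C unfolding T_def submod_def by(auto intro!: bexI[of _ "0[M]"])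
 next
  fix x y assume "x:T C" "y:T C"
  then obtain u v where *: "x:V" "y:V" "u:U" "v:U" "u +[M] x:C" "v +[M] y:C" by(auto simp: T_def)
  hence "(u +[M] v) +[M] (x +[M] y) = (u +[M] x) +[M] (v +[M] y)" using Uc Vc by(simp add: M.M.a_ac)
  moreover have "(u +[M] x) +[M] (v +[M] y):C" "u +[M] v:U" "x +[M] y:V" using * U V C by(auto simp: submod_def)
  ultimately show "x +[M] y:T C" unfolding T_def by(auto intro!: bexI[of _ "u +[M] v"])
 next
  fix a x assume a: "a:S" and "x:T C"
  then obtain u where *: "x:V" "u:U" "u +[M] x:C" by(auto simp: T_def)
  hence "a *[M] (u +[M] x) = a *[M] u +[M] a *[M] x" using Uc Vc a S(2) by(auto simp: M.smult_r_distr)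
  moreover have "a *[M] (u +[M] x):C" "a *[M] u:U" "a *[M] x:V" using * U V C a by(auto simp: submod_def)
  ultimately show "a *[M] x:T C" unfolding T_def by(auto intro!:)
 qed
 have main: "rh_1 (C Int U)+rh_2 (T C) < rh_1 (D Int U)+rh_2 (T D)" if CD: "submod S M C" "submod S M D" "C < D" "D <= ?W" for C D
 proof -
  note CU = submod_Int[OF CD(1) U(1)] submod_Int[OF CD(2) U(1)]
  have TT: "T C <= T D" using CD(3) by(auto simp: T_def)
  have le1: "rh_1 (C Int U) <= rh_1 (D Int U)" using CD by(intro is_rank_mono[OF r1(1) CU]) auto
  have le2: "rh_2 (T C) <= rh_2 (T D)" by(intro is_rank_mono[OF r2(1) T T] CD TT) (auto simp: T_def)
  have "C Int U < D Int U | T C < T D"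
  proof(rule ccontr)
   assume "~ ?thesis"
   hence *: "C Int U = D Int U" "T C = T D" using CD(3) TT by blast+
   obtain x where x: "x:D" "x ~: C" using CD(3) by blast
   then obtain u v where uv: "x = u +[M] v" "u:U" "v:V" using CD(4) by blast
   hence "v:T C" using x * by(auto simp: T_def)
   then obtain u' where u': "u':U" "u' +[M] v:C" by(auto simp: T_def)
   have cc: "u:car M" "v:car M" "u':car M" using uv u' Uc Vc by auto
   have "x -[M] (u' +[M] v):D" using u' CD by(intro submod_minus[OF R CD(2) S(1) x(1)]) auto
   moreover have "x -[M] (u' +[M] v) = u -[M] u'" unfolding uv using cc by algebra
   moreover have "u -[M] u':U" using submod_minus[OF R U(1) S(1) uv(2) u'(1)] .
   ultimately have "u -[M] u':C" using * by auto
   hence "(u -[M] u') +[M] (u' +[M] v):C" using u' CD(1) by(auto simp: submod_def)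
   moreover have "(u -[M] u') +[M] (u' +[M] v) = x" unfolding uv using cc by algebra
   ultimately show False using x by simp
  qed
  thus ?thesis
  proof
   assume "C Int U < D Int U"
   hence "rh_1 (C Int U) < rh_1 (D Int U)" using r1(1) CU unfolding is_rank_def by blast
   with le2 show ?thesis by simp
  next
   assume "T C < T D"
   moreover have "T D <= V" by(auto simp: T_def)
   ultimately have "rh_2 (T C) < rh_2 (T D)" using r2(1) T CD unfolding is_rank_def by blast
   with le1 show ?thesis by simp
  qed
 qed
 have WU: "?W Int U = U"
 proof -
  have "u:?W" if "u:U" for u
  proof -
   have "u = u +[M] 0[M]" "0[M]:V" using Uc[OF that] V(1) by(auto simp: submod_def)
   thus ?thesis using that by blast
  qed
  thus ?thesis by blast
 qed
 have TW: "T ?W = V" using U(1) T_def by(auto simp: submod_def)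
 have "is_rank S M ?W (%C. rh_1 (C Int U)+rh_2 (T C))" unfolding is_rank_def using main by simp
 moreover have "rh_1 (?W Int U)+rh_2 (T ?W) <= c+d" unfolding WU TW using r1(2) r2(2) by simp
 ultimately have "len_le S M ?W (c+d)" unfolding len_le_def by blast
 with W show ?thesis by blast
qed

subsection \<open>Modules over an Artin algebra have finite length\<close>

lemma submod_regular_ideal:
 assumes "cring k" "smod k (lreg k) I"
 shows "ideal I k"
proof -
 interpret cring k by fact
 have I: "I <= car k" "0[k]:I" "!!x y. x:I ==> y:I ==> x +[k] y:I"
  "!!a x. a:car k ==> x:I ==> a .[k] x:I" using assms(2) by(auto simp: submod_def)
 have Ic: "x:I ==> x:car k" for x using I(1) by auto
 have neg: "-[k] x:I" if "x:I" for x using I(4)[of "-[k] 1[k]" x] that Ic[OF that] by(simp add: l_minus)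
 have I5: "x .[k] a:I" if "x:I" "a:car k" for a x using I(4)[OF that(2,1)] m_comm[of x a] that Ic by simp
 have "subgroup I (add_monoid k)" using I neg[unfolded a_inv_def] by(intro subgroup.intro) auto
 thus ?thesis by(intro idealI ring_axioms) (use I(4) I5 in auto)
qed

text \<open>Akizuki's theorem, in the form that a commutative Artinian ring has finite length. In an ideal
  \<open>I\<close> minimal among those of infinite length, multiplication by any scalar is surjective or zero, so
  \<open>I\<close> is a vector space over a residue field; a hyperplane of it has finite length.\<close>

theorem comm_artin_finite_length:
 fixes k :: "'k ring"
 assumes "comm_artin_ring k"
 shows "EX c. len_le (car k) (lreg k) (car k) c"
proof(rule ccontr)
 interpret cring k using assms by(simp add: comm_artin_ring_def)
 let ?L = "lreg k"
 have lm: "lmod k ?L" by(rule lreg_lm[OF ring_axioms])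
 have S: "-[k] 1[k]:car k" by simp
 let ?s = "smod k ?L"
 define fl where "fl U = (EX c. len_le (car k) ?L U c)" for U
 have artin: "EX N. ALL n>=N. J n = J N" if "!!n. ideal (J n) k" "!!n. J (Suc n) <= J n" for J :: "nat => 'k set"
  using assms that unfolding comm_artin_ring_def by blast
 assume "\<nexists>c. len_le (car k) ?L (car k) c"
 hence nfl: "~ fl (car k)" unfolding fl_def .
 have "EX I. ?s I & ~ fl I & (ALL J. ?s J & J < I --> fl J)"
 proof(rule ccontr)
  assume no: "~ ?thesis"
  have step: "EX J. (?s J & ~ fl J) & J < I" if "?s I & ~ fl I" for I using no that by blast
  have "EX f. ALL n. (?s (f n) & ~ fl (f n)) & f (Suc n) < f n"
  proof(rule dependent_nat_choice)
   show "EX I. ?s I & ~ fl I" using submod_top[OF lm] nfl by auto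
  qed(rule step)
  then obtain f where f: "!!n. ?s (f n) & ~ fl (f n)" "!!n. f (Suc n) < f n" by blast
  have f1: "ideal (f n) k" for n using f(1)[of n] submod_regular_ideal[OF is_cring] by blast
  have f2: "f (Suc n) <= f n" for n by(rule psubset_imp_subset[OF f(2)])
  obtain N where "ALL n>=N. f n = f N" using artin[of f, OF f1 f2] by(elim exE)
  thus False using le_SucI[OF order_refl, of N] f(2)[of N] by blast
 qed
 then obtain I where I: "?s I" "~ fl I" and Imin: "!!J. ?s J ==> J < I ==> fl J" by blast
 have Ic: "x:car k" if "x:I" for x using I(1) that by(auto simp: submod_def)
 have slin: "semilin (car k) (%s. s) ?L I ?L (%y. x .[k] y)" if "x:car k" for x using that Ic by(auto simp: semilin_def r_distr m_lcomm)
 \<comment> \<open>If multiplication by \<open>x\<close> on \<open>I\<close> were neither zero nor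
   onto, its kernel and its image would both be proper submodules of \<open>I\<close>, hence of
   finite length by minimality, and \<open>I\<close> would have finite length as well.\<close>
 have dich: "(%y. x .[k] y) ` I = I" if x: "x:car k" "y0:I" "x .[k] y0 ~= 0[k]" for x y0
 proof(rule ccontr)
  assume ne: "~ ?thesis"
  have xI: "?s ((%y. x .[k] y) ` I)" using submod_semilin_image[OF slin[OF x(1)] I(1)] by simp
  have "fl ((%y. x .[k] y) ` I)" using I(1) x(1) ne Imin[OF xI] by(force simp: submod_def)
  then obtain d where d: "len_le ((%s. s) ` car k) ?L ((%y. x .[k] y) ` I) d" unfolding fl_def image_ident ..
  have K: "?s {y:I. x .[k] y = 0[?L]}" using semilin_kernel[OF slin[OF x(1)] I(1) lm] by simp
  obtain c where c: "len_le (car k) ?L {y:I. x .[k] y = 0[?L]} c" using x Imin[OF K] by(auto simp: fl_def)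
  have "fl I" using len_le_extension[OF slin[OF x(1)] I(1) lm lm S _ c d] by(auto simp: fl_def)
  with I(2) show False by simp
 qed
 \<comment> \<open>Such an \<open>x\<close> is even invertible on \<open>I\<close>. The principal
   ideals of the powers of \<open>x\<close> become stationary, so the power with exponent
   \<open>N\<close> is \<open>c\<close> times the next one, and since every power of
   \<open>x\<close> maps \<open>I\<close> onto \<open>I\<close>, this \<open>c\<close> inverts
   \<open>x\<close> on \<open>I\<close>.\<close>
 have inv: "EX c:car k. ALL y:I. c .[k] (x .[k] y) = y" if x: "x:car k" "y0:I" "x .[k] y0 ~= 0[k]" for x y0
 proof -
  have desc: "PIdl\<^bsub>k\<^esub> (x [^]\<^bsub>k\<^esub> Suc n) <= PIdl\<^bsub>k\<^esub> (x [^]\<^bsub>k\<^esub> n)" for n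
  proof
   fix z assume "z:PIdl\<^bsub>k\<^esub> (x [^]\<^bsub>k\<^esub> Suc n)"
   then obtain a where "a:car k" "z = a .[k] (x [^]\<^bsub>k\<^esub> Suc n)" by(auto simp: cgenideal_def)
   hence "z = (a .[k] x) .[k] x [^]\<^bsub>k\<^esub> n" "a .[k] x:car k" using x(1) by(simp_all add: m_ac)
   thus "z:PIdl\<^bsub>k\<^esub> (x [^]\<^bsub>k\<^esub> n)" unfolding cgenideal_def by blast
  qed
  have id: "ideal (PIdl\<^bsub>k\<^esub> (x [^]\<^bsub>k\<^esub> n)) k" for n :: nat using x(1) by(intro cgenideal_ideal) simp
  obtain N :: nat where N: "ALL n>=N. PIdl\<^bsub>k\<^esub> (x [^]\<^bsub>k\<^esub> n) = PIdl\<^bsub>k\<^esub> (x [^]\<^bsub>k\<^esub> N)"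
   using artin[of "%n::nat. PIdl\<^bsub>k\<^esub> (x [^]\<^bsub>k\<^esub> n)", OF id desc] by(elim exE)
  have "PIdl\<^bsub>k\<^esub> (x [^]\<^bsub>k\<^esub> Suc N) = PIdl\<^bsub>k\<^esub> (x [^]\<^bsub>k\<^esub> N)" by(rule N[rule_format]) simp
  moreover have "x [^]\<^bsub>k\<^esub> N:PIdl\<^bsub>k\<^esub> (x [^]\<^bsub>k\<^esub> N)" using x(1) by(intro cgenideal_self) simp
  ultimately obtain c where c: "c:car k" "x [^]\<^bsub>k\<^esub> N = c .[k] x [^]\<^bsub>k\<^esub> Suc N" unfolding cgenideal_def by blast
  have surj: "EX y':I. y = x [^]\<^bsub>k\<^esub> n .[k] y'" if "y:I" for y and n :: nat
  proof(induction n)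
   case 0 thus ?case using that Ic by force
  next
   case (Suc n)
   then obtain y' where y': "y':I" "y = x [^]\<^bsub>k\<^esub> n .[k] y'" by blast
   then obtain y'' where "y'':I" "y' = x .[k] y''" using dich[OF x] by blast
   thus ?case using y' x(1) Ic by(intro bexI[of _ y'']) (simp_all add: m_ac)
  qed
  have "c .[k] (x .[k] y) = y" if y: "y:I" for y
  proof -
   obtain y' where y': "y':I" "y = x [^]\<^bsub>k\<^esub> N .[k] y'" using surj[OF y] by blast
   hence "c .[k] (x .[k] y) = (c .[k] x [^]\<^bsub>k\<^esub> Suc N) .[k] y'" using x(1) c(1) Ic by(simp add: m_ac)
   also have "... = y" using c y' by simp
   finally show ?thesis .
  qed
  thus ?thesis using c by blast
 qed
 have "I ~= {0[k]}" using I(2) len_le_zero[of "car k" ?L] by(auto simp: fl_def)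
 moreover have "0[k]:I" using I(1) by(simp add: submod_def)
 ultimately obtain z where z: "z:I" "z ~= 0[k]" by blast
 define Z where "Z = (%a. a .[k] z) ` car k"
 have Z: "?s Z" using submod_cyclic[OF lm, of z] Ic[OF z(1)] by(simp add: Z_def)
 \<comment> \<open>\<open>Z\<close> is simple, because a scalar that does not kill \<open>z\<close>
   is invertible on \<open>I\<close>. Ranks 0 and 1 therefore suffice.\<close>
 have "fl Z"
 proof -
  have simple: "C = {0[k]} | C = Z" if C: "?s C" "C <= Z" for C
  proof(rule disjCI)
   assume "C ~= Z"
   have 0: "0[k]:C" using C(1) by(simp add: submod_def)
   show "C = {0[k]}"
   proof(rule ccontr)
    assume "C ~= {0[k]}"
    then obtain w where w: "w:C" "w ~= 0[k]" using 0 by blast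
    then obtain a where a: "a:car k" "w = a .[k] z" using C(2) by(auto simp: Z_def)
    then obtain c where c: "c:car k" "c .[k] (a .[k] z) = z" using inv[of a z] w z by blast
    have "z:C" using C(1) w(1) c(1) c(2) a(2) by(force simp: submod_def)
    hence "Z <= C" using C(1) by(auto simp: submod_def Z_def)
    with \<open>C ~= Z\<close> C(2) show False by blast
   qed
  qed
  have "is_rank (car k) ?L Z (%C. if C = {0[k]} then 0 else 1)" unfolding is_rank_def
  proof(intro allI impI, elim conjE)
   fix C D assume CD: "smod k ?L C" "C < D" "D <= Z"
   show "(if C = {0[k]} then 0 else 1) < (if D = {0[k]} then 0 else 1 :: nat)" using CD(2,3) simple[of C] CD(1) by auto
  qed
  thus ?thesis unfolding fl_def len_le_def by blast
 qed
 \<comment> \<open>A submodule of \<open>I\<close> maximal among those avoiding \<open>z\<close>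
   plays the role of the hyperplane: it is a proper submodule, hence of finite length, and together
   with \<open>Z\<close> it spans \<open>I\<close>.\<close>
 let ?F = "{U. ?s U & U <= I & z ~: U}"
 have "EX U:?F. ALL V:?F. U <= V --> V = U"
 proof(rule subset_Zorn_nonempty)
  show "?F ~= {}" using submod_zero[OF lm] z \<open>0[k] : I\<close> by auto
  fix Ch assume Ch: "Ch ~= {}" "subset.chain ?F Ch"
  have ChF: "X:?F" if "X:Ch" for X using Ch(2) that by(auto simp: subset.chain_def)
  hence c: "X <= car k" "0[k]:X" "x:X ==> y:X ==> x +[k] y:X" "a:car k ==> x:X ==> a .[k] x:X"
   if "X:Ch" for X x y a using that by(auto simp: submod_def)
  have "EX W:Ch. x:W & y:W" if "X:Ch" "Y:Ch" "x:X" "y:Y" for X Y x y using subset.chain_total[OF Ch(2) that(1,2)] that by blast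
  note un = this
  have "?s (\<Union>Ch)"
  proof(rule submodI)
   fix x y assume "x:\<Union>Ch" "y:\<Union>Ch"
   then obtain W where "W:Ch" "x:W" "y:W" using un by blast
   thus "x +[?L] y:\<Union>Ch" using c(3) by auto
  next
   fix a x assume "a:car k" "x:\<Union>Ch"
   thus "a *[?L] x:\<Union>Ch" using c(4) by auto
  next
   show "\<Union>Ch <= car ?L" using c(1) by auto
   show "0[?L]:\<Union>Ch" using Ch(1) c(2) by auto
  qed
  thus "\<Union>Ch:?F" using ChF by blast
 qed
 then obtain U where U0: "U:?F" and Um: "ALL V:?F. U <= V --> V = U" by blast
 have U: "?s U" "U <= I" "z ~: U" using U0 by simp_all
 have Umax: "V = U" if "?s V" "V <= I" "z ~: V" "U <= V" for V using Um that by simp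
 have Uc: "u:car k" if "u:U" for u using that U(2) Ic by blast
 obtain c d where cd: "len_le (car k) ?L U c" "len_le (car k) ?L Z d" using Imin[OF U(1)] U z \<open>fl Z\<close> fl_def by blast
 let ?W = "{u +[?L] v | u v. u:U & v:Z}"
 have "I <= ?W"
 proof
  fix v assume v: "v:I"
  show "v:?W"
  proof(cases "v:U")
   case True
   moreover have "v = v +[?L] 0[k]" "0[k]:Z" using v Ic Z by(auto simp: submod_def)
   ultimately show ?thesis by blast
  next
   case False
   define V where "V = (%a. a .[k] v) ` car k"
   have V: "?s V" using submod_cyclic[OF lm, of v] Ic[OF v] by(simp add: V_def)
   let ?T = "{u +[?L] w | u w. u:U & w:V}"
   have T: "?s ?T" using submod_sum[OF lm] U(1) V by blast
   have "x +[k] y:I" if "x:I" "y:I" for x y using that I(1) by(simp add: submod_def)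
   hence "?T <= I" using v I(1) subsetD[OF U(2)] by(auto simp: V_def submod_def)
   moreover have "U <= ?T" using Uc V by(force simp: submod_def)
   moreover have "v:?T"
   proof -
    have "v = 0[k] +[?L] (1[k] .[k] v)" using Ic[OF v] by simp
    moreover have "0[k]:U" "1[k] .[k] v:V" using U(1) by(auto simp: submod_def V_def)
    ultimately show ?thesis by blast
   qed
   ultimately have "z:?T" using Umax[OF T] False by blast
   then obtain u a where ua: "u:U" "a:car k" "z = u +[k] a .[k] v" by(auto simp: V_def)
   \<comment> \<open>The scalar \<open>a\<close> does not kill \<open>v\<close>, since otherwise
     \<open>z = u\<close> would lie in \<open>U\<close>. Hence \<open>a\<close> is invertible on
     \<open>I\<close>, and the relation can be solved for \<open>v\<close>.\<close>
   obtain y where y: "y:car k" "ALL w:I. y .[k] (a .[k] w) = w" using ua U(3) Uc inv[OF ua(2) v] by force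
   have "v = y .[k] (a .[k] v)" using y v by simp
   also have "... = (-[k] y) .[k] u +[k] y .[k] z" using ua Uc Ic v y(1) by algebra
   finally have "v = (-[k] y) .[k] u +[?L] y .[k] z" by simp
   moreover have "(-[k] y) .[k] u:U" using U(1) ua(1) y(1) by(auto simp: submod_def)
   moreover have "y .[k] z:Z" using y by(simp add: Z_def)
   ultimately show ?thesis by blast
  qed
 qed
 moreover have "?s ?W" using submod_sum[OF lm] U(1) Z by blast
 ultimately have "fl I" using len_le_sum[OF lm S order_refl U(1) cd(1) Z cd(2)] fl_def len_le_subset I(1) by blast
 with I(2) show False by simp
qed

lemma finsum_left_regular:
 assumes "ring A" "finite S" "f:S \<rightarrow> car A"
 shows "finsum (lreg A) f S = finsum A f S"
proof -
 interpret A: ring A by fact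
 interpret L: left_module A "lreg A" by(rule lreg_lm[OF assms(1)])
 show ?thesis using assms(2,3)
 proof(induction S rule: finite_induct)
  case (insert s S)
  thus ?case by simp
 qed(simp add: A.finsum_empty L.finsum_empty)
qed

locale artin_alg =
 fixes k :: "'k ring" and A :: "'a ring" and ph :: "'k => 'a"
 assumes k: "comm_artin_ring k" and A: "artin_algebra k A ph"
begin

abbreviation "scal \<equiv> ph ` car k"

lemma ring_A: "ring A" and hom: "ph:ring_hom k A" and ring_k: "cring k"
 using A k by(simp_all add: artin_algebra_def comm_artin_ring_def)

lemma scal_carrier: "scal <= car A"
 using hom by(auto simp: ring_hom_def)

lemma scal_neg_one: "-[A] 1[A]:scal"
proof -
 interpret k: cring k by(rule ring_k)
 interpret A: ring A by(rule ring_A)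
 have "ph (-[k] 1[k]) +[A] ph 1[k] = ph (-[k] 1[k] +[k] 1[k])" using hom by(simp add: ring_hom_def)
 also have "... = 0[A]" by(simp add: k.l_neg ring_hom_zero[OF hom k.ring_axioms ring_A])
 finally have "ph (-[k] 1[k]) = -[A] 1[A]" using hom by(simp add: ring_hom_def Pi_iff A.minus_equality)
 thus ?thesis by(metis image_eqI k.a_inv_closed k.one_closed)
qed

text \<open>The k-submodule generated by \<open>x\<close> is an image of the regular module of
  \<open>k\<close>, to which Akizuki's theorem applies. This is where the Artinian ground ring
  enters.\<close>

lemma len_cyclic:
 assumes "lmod A M" "x:car M"
 shows "EX c. submod scal M ((%c. ph c *[M] x) ` car k) & len_le scal M ((%c. ph c *[M] x) ` car k) c"
proof -
 interpret k: cring k by(rule ring_k)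
 interpret M: left_module A M by fact
 have lm: "lmod k (lreg k)" by(rule lreg_lm[OF k.ring_axioms])
 obtain c where c: "len_le (car k) (lreg k) (car k) c" using comm_artin_finite_length[OF k] by blast
 have ph: "ph a:car A" if "a:car k" for a using that hom by(auto simp: ring_hom_def)
 have g: "semilin (car k) ph (lreg k) (car k) M (%c. ph c *[M] x)" using ring_hom_zero[OF hom k.ring_axioms ring_A] assms(2) hom ph by(auto simp: semilin_def ring_hom_def M.smult_l_distr M.smult_assoc)
 have s: "smod k (lreg k) (car k)" using submod_top[OF lm] by simp
 show ?thesis using len_le_image[OF g s c] submod_semilin_image[OF g s order_refl] by blast
qed

lemma len_finite_set:
 assumes M: "lmod A M" and "finite T" "T <= car M"
 shows "EX U c. submod scal M U & T <= U & len_le scal M U c" using assms(2,3)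
proof(induction T rule: finite_induct)
 case empty
 interpret M: left_module A M by(rule M)
 have "submod scal M {0[M]}" using scal_carrier by(intro submodI) auto
 thus ?case using len_le_zero[of scal M] by blast
next
 case (insert t T)
 interpret M: left_module A M by(rule M)
 interpret k: cring k by(rule ring_k)
 from insert obtain U c where U: "submod scal M U" "T <= U" "len_le scal M U c" by auto
 let ?V = "(%c. ph c *[M] t) ` car k"
 have t: "t:car M" using insert by auto
 obtain d where V: "submod scal M ?V" "len_le scal M ?V d" using len_cyclic[OF M t] by blast
 let ?W = "{u +[M] v | u v. u:U & v:?V}"
 have W: "submod scal M ?W & len_le scal M ?W (c+d)" by(rule len_le_sum[OF M scal_neg_one scal_carrier U(1,3) V])
 have "t = ph 1[k] *[M] t" using hom t by(simp add: ring_hom_def)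
 hence tV: "t:?V" by simp
 have UM: "u:car M" if "u:U" for u using that U(1) by(auto simp: submod_def)
 have 0: "0[M]:U" "0[M]:?V" using U(1) V(1) by(simp_all add: submod_def)
 have "T <= ?W"
 proof
  fix u assume "u:T" hence "u:U" "u = u +[M] 0[M]" using U(2) UM by auto
  thus "u:?W" using 0 by blast
 qed
 moreover have "t = 0[M] +[M] t" using t by simp
 hence "t:?W" using 0 tV by blast
 ultimately have "insert t T <= ?W" by simp
 with W show ?case by blast
qed

text \<open>Products of k-module generators of \<open>A\<close> with generators of \<open>M\<close>
  over \<open>A\<close> generate \<open>M\<close> over \<open>k\<close>, so \<open>M\<close> is a
  finite sum of cyclic k-submodules.\<close>

theorem len_Mods:
 assumes "M:Mods A"
 shows "EX c. len_le scal M (car M) c"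
proof -
 interpret M: left_module A M by(rule ModsD[OF assms])
 obtain G where G: "finite G" "G <= car M" "ALL C. smod A M C & G <= C --> car M <= C" by(rule fin_genE[OF ModsD(2,1)[OF assms]])
 obtain S where S: "finite S" "S <= car A"
  "ALL a:car A. EX c:S \<rightarrow> car k. a = (\<Oplus>\<^bsub>A\<^esub>s\<in>S. ph (c s) .[A] s)" using A unfolding artin_algebra_def by blast
 let ?T = "(%(s, g). s *[M] g) ` (S \<times> G)"
 have T: "finite ?T" "?T <= car M" using S G by auto
 obtain U c where U: "submod scal M U" "?T <= U" "len_le scal M U c" using len_finite_set[OF M.lmA T] by blast
 have Uc: "u:car M" if "u:U" for u using that U(1) by(auto simp: submod_def)
 \<comment> \<open>\<open>?C\<close> is an \<open>A\<close>-submodule, and it lies in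
   \<open>U\<close> because \<open>a\<close> may be 1. It therefore suffices that \<open>?C\<close>
   contains the generators \<open>G\<close>.\<close>
 let ?C = "{x:car M. ALL a:car A. a *[M] x:U}"
 have C: "smod A M ?C" using U(1) by(intro submodI) (auto simp: submod_def M.smult_r_distr simp flip: M.smult_assoc)
 have "g:?C" if g: "g:G" for g
 proof -
  have gM: "g:car M" using g G by auto
  let ?L = "lreg A"
  have lm: "lmod A ?L" by(rule lreg_lm[OF ring_A])
  let ?D = "{a:car A. a *[M] g:U}"
  have sc: "s:car A" if "s:scal" for s using that scal_carrier by auto
  have Us: "a *[M] x:U" if "a:scal" "x:U" for a x using that U(1) unfolding submod_def by blast
  have D: "submod scal ?L ?D"
  proof(rule submodI)
   show "?D <= car ?L" by auto
   show "0[?L]:?D" using U(1) gM by(simp add: submod_def)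
  next
   fix x y assume "x:?D" "y:?D"
   thus "x +[?L] y:?D" using U(1) gM by(simp add: submod_def M.smult_l_distr)
  next
   fix a x assume a: "a:scal" and "x:?D"
   thus "a *[?L] x:?D" using Us gM sc[OF a] by(simp add: M.smult_assoc)
  qed
  have "a:?D" if aA: "a:car A" for a
  proof -
   obtain c where c: "c:S \<rightarrow> car k" "a = (\<Oplus>\<^bsub>A\<^esub>s\<in>S. ph (c s) .[A] s)" using bspec[OF S(3) aA] by(elim bexE)
   have "ph (c s) .[A] s:?D" if s: "s:S" for s
   proof -
    have "s:?D" using s g S(2) U(2) by auto
    moreover have "ph (c s):scal" using c(1) s by auto
    ultimately have "ph (c s) *[?L] s:?D" using D unfolding submod_def by blast
    thus ?thesis by simp
   qed
   hence "finsum ?L (%s. ph (c s) .[A] s) S:?D" by(intro finsum_in_submod[OF lm D S(1)]) auto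
   moreover have "finsum ?L (%s. ph (c s) .[A] s) S = a" unfolding c(2)
   using finsum_left_regular[OF ring_A S(1)] c(1) S(2) hom by(simp add: ring_hom_def Pi_iff subset_iff)
   ultimately show ?thesis by simp
  qed
  thus ?thesis using gM by simp
 qed
 hence CM: "car M <= ?C" using G(3)[rule_format, OF conjI, OF C] by blast
 have "x:U" if "x:car M" for x using CM that by force
 hence "U = car M" using Uc by auto
 with U(3) show ?thesis by blast
qed

lemma rank_exists:
 assumes "M:Mods A"
 obtains rh :: "'a list set set => nat" where
  "ALL C D. smod A M C & smod A M D & C < D --> rh C < rh D"
proof -
 obtain c rh where r: "is_rank scal M (car M) rh" using len_Mods[OF assms] unfolding len_le_def by blast
 have "submod scal M C" if "smod A M C" for C using that scal_carrier by(auto simp: submod_def)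
 thus ?thesis using r by(intro that[of rh]) (auto simp: is_rank_def submod_def)
qed

text \<open>Ranks of submodules are bounded by the rank of the whole module, and a submodule of
  greatest rank with property \<open>P\<close> is maximal with it. This is the noetherian property
  in the form used throughout, with an arbitrary predicate \<open>P\<close>.\<close>

lemma maximal_submod:
 assumes "M:Mods A" "smod A M C0" "P C0"
 obtains C where "smod A M C" "P C" "ALL D. smod A M D & P D & C <= D --> D = C"
proof -
 obtain rh where r: "ALL C D. smod A M C & smod A M D & C < D --> (rh C :: nat) < rh D" by(rule rank_exists[OF assms(1)])
 have b: "rh C < Suc (rh (car M))" if C: "smod A M C" for C
 proof(cases "C = car M")
  case False
  hence "rh C < rh (car M)" by(metis C submod_def psubsetI r submod_top[OF ModsD(1)[OF assms(1)]])
  thus ?thesis by simp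
 qed simp
 have "EX C. (smod A M C & P C) & (ALL D. smod A M D & P D --> rh D <= rh C)"
  by(rule ex_has_greatest_nat[of "%C. smod A M C & P C" C0 rh "Suc (rh (car M))"])
   (use assms(2,3) b in blast)+
 then obtain C where C: "smod A M C & P C" "ALL D. smod A M D & P D --> rh D <= rh C" by blast
 have "D = C" if D: "smod A M D" "P D" "C <= D" for D
 proof(rule ccontr)
  assume "D ~= C"
  hence "rh C < rh D" using r D C by blast
  moreover have "rh D <= rh C" using C(2) D by blast
  ultimately show False by simp
 qed
 thus ?thesis using C(1) by(intro that[of C]) blast+
qed

end

definition span :: "'a ring => ('a, 'm) module => 'm set => 'm set" where
 "span A M F = \<Inter>{C. smod A M C & F <= C}"

lemma span_submod:
 assumes "lmod A M" "F <= car M"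
 shows "smod A M (span A M F)" using submod_top[OF assms(1)] assms(2) unfolding span_def by(intro submodI) (auto simp: submod_def)

lemma span_superset: "F <= span A M F"
 by(auto simp: span_def)

lemma span_least: "smod A M C ==> F <= C ==> span A M F <= C"
 by(auto simp: span_def)

text \<open>Among the submodules generated by finite subsets of \<open>C\<close> there is a maximal
  one. Adjoining one more element of \<open>C\<close> to its generators cannot enlarge it, so it is
  \<open>C\<close>.\<close>

lemma (in artin_alg) restr_Mods:
 assumes "M:Mods A" "smod A M C"
 shows "restr M C:Mods A"
proof -
 note lm = ModsD(1)[OF assms(1)]
 have Cc: "C <= car M" using assms(2) by(simp add: submod_def)
 let ?P = "%D. EX F. finite F & F <= C & D = span A M F"
 have sp: "smod A M (span A M F)" if "F <= C" for F using that Cc by(intro span_submod lm) auto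
 obtain D where D: "smod A M D" "?P D" "ALL D'. smod A M D' & ?P D' & D <= D' --> D' = D"
  by(rule maximal_submod[OF assms(1), of "span A M {}" ?P]) (use sp in auto)
 from D(2) obtain F where F: "finite F" "F <= C" "D = span A M F" by blast
 have "x:D" if x: "x:C" for x
 proof -
  have "D <= span A M (insert x F)" unfolding F(3) by(auto simp: span_def)
  moreover have "?P (span A M (insert x F))" using F x by(intro exI[of _ "insert x F"]) auto
  ultimately have "span A M (insert x F) = D" using D(3) sp[of "insert x F"] F x by blast
  thus ?thesis using span_superset[of "insert x F" A M] by auto
 qed
 hence CD: "C <= span A M F" using F(3) by blast
 have lr: "lmod A (restr M C)" by(rule restr_left_module[OF lm assms(2)])
 have "car (restr M C) <= E" if "smod A (restr M C) E" "F <= E" for E using that CD span_least[of A M E F] by(auto simp: submod_restr[OF Cc])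
 hence "fin_gen A (restr M C)" unfolding fin_gen_iff[OF lr] using F by(intro exI[of _ F]) simp_all
 with lr show ?thesis by(simp add: Mods_def)
qed

subsection \<open>Additive closure and iterated extensions\<close>

lemma add_closure_Mods: "M:addc A \<T> ==> M:Mods A"
 by(induction rule: add_closure.induct) auto

lemma add_closure_trans:
 assumes "M:addc A \<T>" "!!M. M:\<T> ==> M:Mods A ==> M:addc A \<T>'"
 shows "M:addc A \<T>'" using assms(1)
proof(induction rule: add_closure.induct)
 case (base M) thus ?case by(rule assms(2))
next
 case (empty_sum M) thus ?case by(rule)
next
 case (sum M N L) thus ?case by(intro add_closure.sum[of M A \<T>' N L])
next
 case (summand M L N) thus ?case by(intro add_closure.summand[of M A \<T>' L N])
qed

lemma add_closure_dsum:
 assumes "M:addc A \<T>" "N:addc A \<T>" "L:Mods A" "e:liso A (dsum M N) L"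
 shows "L:addc A \<T>"
using dsum_lm[OF ModsD(1)[OF add_closure_Mods[OF assms(1)]] ModsD(1)[OF add_closure_Mods[OF assms(2)]]] mod_iso_def mod_iso_sym assms add_closure.sum[of M A \<T> N L] by blast

lemma lmap_inj_iff:
 assumes "lmap A M N f"
 shows "inj_on f (car M) <-> (ALL x:car M. f x = 0[N] --> x = 0[M])"
proof -
 interpret lmap A M N f by fact
 show ?thesis
 proof
  assume "inj_on f (car M)"
  thus "ALL x:car M. f x = 0[N] --> x = 0[M]" using inj_onD[of f "car M" _ "0[M]"] by simp
 next
  assume *: "ALL x:car M. f x = 0[N] --> x = 0[M]"
  show "inj_on f (car M)"
  proof(rule inj_onI)
   fix x y assume xy: "x:car M" "y:car M" "f x = f y"
   hence "x -[M] y = 0[M]" using * by simp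
   thus "x = y" using xy by simp
  qed
 qed
qed

lemma zmodI: "lmod A M ==> (!!x. x:car M ==> x = 0[M]) ==> zmod M"
proof -
 assume "lmod A M" and *: "!!x. x:car M ==> x = 0[M]"
 then interpret left_module A M by simp
 have "0[M]:car M" by simp
 thus ?thesis unfolding is_zero_mod_def using * by blast
qed

lemma zmodD: "zmod M ==> x:car M ==> x = 0[M]"
 by(simp add: is_zero_mod_def)

context artin_alg
begin

lemma kernel_Mods:
 assumes "M:Mods A" "lmod A N" "f:lhom A M N"
 shows "restr M {x:car M. f x = 0[N]}:Mods A" by(intro restr_Mods assms submod_kernel[OF ModsD(1)[OF assms(1)] assms(2,3)])

text \<open>Replaces an explicit decomposition by a retraction; the complement is the kernel of
  \<open>p\<close>, which is in \<open>Mods A\<close> because submodules are finitely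
  generated.\<close>

lemma add_closure_retract:
 assumes "M:addc A \<T>" "L:Mods A" "i:lhom A L M" "p:lhom A M L"
  "!!x. x:car L ==> p (i x) = x"
 shows "L:addc A \<T>"
proof -
 note M = add_closure_Mods[OF assms(1)]
 show ?thesis by(rule add_closure.summand[OF assms(1,2) kernel_Mods[OF M ModsD(1)[OF assms(2)] assms(4)]
    retract_dsum[OF ModsD(1)[OF assms(2)] ModsD(1)[OF M] assms(3-5)]])
qed

lemma add_closure_iso:
 assumes "M:addc A \<T>" "L:Mods A" "f:liso A L M"
 shows "L:addc A \<T>"
proof -
 obtain g where "g:liso A M L" "ALL x:car L. g (f x) = x" "ALL y:car M. f (g y) = y" by(rule liso_inv[OF assms(3) ModsD(1)[OF assms(2)]])
 thus ?thesis using assms liso_lhom by(intro add_closure_retract[OF assms(1,2), of f g]) simp_all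
qed

text \<open>Here the identity of \<open>L\<close> is a sum of two maps through \<open>M\<close> and
  \<open>N\<close>. Sums and summands are both of this form, and an additive functor preserves the
  equation, while no direct sum has to be mentioned.\<close>

lemma add_closure_retract2:
 assumes M: "M:addc A \<T>" and N: "N:addc A \<T>" and L: "L:Mods A" and i: "i:lhom A L M" "j:lhom A L N" and p: "p:lhom A M L" "q:lhom A N L"
  and id: "!!x. x:car L ==> p (i x) +[L] q (j x) = x"
 shows "L:addc A \<T>"
proof -
 note lm = ModsD(1)[OF add_closure_Mods[OF M]] ModsD(1)[OF add_closure_Mods[OF N]] ModsD(1)[OF L]
 obtain D e where D: "D:Mods A" "e:liso A (dsum M N) D" by(rule Mods_dsum[OF add_closure_Mods[OF M] add_closure_Mods[OF N]])
 obtain e' where e': "e':liso A D (dsum M N)" "ALL x:car (dsum M N). e' (e x) = x" "ALL y:car D. e (e' y) = y"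
  by(rule liso_inv[OF D(2) dsum_lm[OF lm(1,2)]])
 have pq: "(%x. p (fst x) +[L] q (snd x)):lhom A (dsum M N) L" by(intro lhom_add lm lcomp[OF _ p(1)] lcomp[OF _ p(2)] lhom_dsum)
 show ?thesis
 proof(rule add_closure_retract[OF add_closure_dsum[OF M N D] L])
  show "(%x. e (i x, j x)):lhom A L D" by(rule lcomp[OF lhom_dsum(3)[OF i] liso_lhom[OF D(2)]])
  show "(%x. p (fst (e' x)) +[L] q (snd (e' x))):lhom A D L" by(rule lcomp[OF liso_lhom[OF e'(1)] pq])
  fix x assume x: "x:car L"
  thus "p (fst (e' (e (i x, j x)))) +[L] q (snd (e' (e (i x, j x)))) = x" using i bspec[OF e'(2)] id[OF x] by(simp add: lhom_def Pi_iff)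
 qed
qed

lemma ext_gen_Mods: "M:ext_gen A T n ==> M:Mods A"
 by(cases "(A, T, n)" rule: ext_gen.cases) (auto simp: ext_prod_def dest: add_closure_Mods)

lemma ext_gen_add_closure: "X:addc A (ext_gen A T (Suc n)) ==> X:ext_gen A T (Suc n)"
 by(cases n) (auto simp: ext_prod_def elim: add_closure_trans)

lemma ext_gen_zero: "Z:Mods A ==> zmod Z ==> Z:ext_gen A T n"
 by(cases "(A, T, n)" rule: ext_gen.cases) (auto simp: ext_prod_def intro: add_closure.empty_sum)

lemma ext_gen_retract:
 assumes "M:ext_gen A T (Suc n)" "L:Mods A" "i:lhom A L M" "p:lhom A M L"
  "!!x. x:car L ==> p (i x) = x"
 shows "L:ext_gen A T (Suc n)"
 by(rule ext_gen_add_closure[OF add_closure_retract[OF add_closure.base[OF assms(1) ext_gen_Mods[OF assms(1)]] assms(2-5)]])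

lemma ext_gen_retract2:
 assumes M: "M:ext_gen A T (Suc n)" and N: "N:ext_gen A T (Suc n)" and L: "L:Mods A"
  and i: "i:lhom A L M" "j:lhom A L N" and p: "p:lhom A M L" "q:lhom A N L" and id: "!!x. x:car L ==> p (i x) +[L] q (j x) = x"
 shows "L:ext_gen A T (Suc n)" by(rule ext_gen_add_closure[OF add_closure_retract2[OF add_closure.base[OF M ext_gen_Mods[OF M]]
    add_closure.base[OF N ext_gen_Mods[OF N]] L i p id]])

lemma ext_gen_iso:
 assumes "M:ext_gen A T (Suc n)" "L:Mods A" "f:liso A L M"
 shows "L:ext_gen A T (Suc n)" by(rule ext_gen_add_closure[OF add_closure_iso[OF add_closure.base[OF assms(1) ext_gen_Mods[OF assms(1)]] assms(2,3)]])

lemma ext_gen_extension: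
 assumes "short_exact A U X V" "X:Mods A" "U:ext_gen A T 1" "V:ext_gen A T n"
 shows "X:ext_gen A T (Suc n)"
proof(cases n)
 \<comment> \<open>The recursion for \<open>ext_gen\<close> uses extensions from index 2 on only.
   For \<open>n = 0\<close> the quotient \<open>V\<close> is zero, and the sequence is an
   isomorphism of \<open>U\<close> with \<open>X\<close>.\<close>
 case 0
 note U = ext_gen_Mods[OF assms(3)] and V = ext_gen_Mods[OF assms(4)]
 obtain f g where fg: "f:lhom A U X" "g:lhom A X V" "inj_on f (car U)"
  "f ` car U = a_kernel X V g" "g ` car X = car V" using assms(1) unfolding short_exact_def by(elim bexE conjE)
 have "g x = 0[V]" if "x:car X" for x using assms(4) 0 fg(2) that by(simp add: is_zero_mod_def lhom_def Pi_iff)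
 hence "f ` car U = car X" unfolding fg(4) a_kernel_def kernel_def by auto
 hence f: "f:liso A U X" using fg by(simp add: liso_def bij_betw_def)
 obtain h where h: "h:liso A X U" "ALL x:car U. h (f x) = x" "ALL y:car X. f (h y) = y" by(rule liso_inv[OF f ModsD(1)[OF U]])
 show ?thesis using ext_gen_iso[OF assms(3)[unfolded One_nat_def] assms(2) h(1)] 0 by simp
next
 case (Suc m)
 show ?thesis unfolding Suc ext_gen.simps ext_prod_def by(rule) (use assms Suc in auto)
qed

lemma short_exact_quotient:
 assumes "M:Mods A" "N:Mods A" "g:lhom A M N" "g ` car M = car N"
 shows "short_exact A (restr M {x:car M. g x = 0[N]}) M N" unfolding short_exact_def
proof(intro bexI conjI)
 let ?K = "{x:car M. g x = 0[N]}"
 show "(%x. x):lhom A (restr M ?K) M" by(intro lhom_from_restr lhom_id) auto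
 show "(%x. x) ` car (restr M ?K) = a_kernel M N g" by(simp add: a_kernel_def kernel_def)
qed(use assms in simp_all)

text \<open>\<open>X\<close> is an extension of itself by its zero submodule, which lies in every
  class.\<close>

lemma ext_gen_mono_Suc: "X:ext_gen A T n ==> X:ext_gen A T (Suc n)"
proof(cases n)
 case 0 thus "X:ext_gen A T n ==> ?thesis" by(simp add: add_closure.empty_sum)
next
 case (Suc m)
 assume X: "X:ext_gen A T n"
 note XM = ext_gen_Mods[OF X]
 interpret X: left_module A X by(rule ModsD[OF XM])
 let ?Z = "restr X {0[X]}"
 have Z: "?Z:Mods A" by(intro restr_Mods XM submod_zero X.lmA)
 have "short_exact A ?Z X X" unfolding short_exact_def
 proof(intro bexI conjI)
  show "(%x. x):lhom A ?Z X" by(intro lhom_from_restr lhom_id) auto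
  show "(%x. x) ` car ?Z = a_kernel X X (%x. x)" by(auto simp: a_kernelD)
 qed(simp_all add: lhom_id)
 thus ?thesis by(rule ext_gen_extension[OF _ XM ext_gen_zero[OF Z] X]) (simp add: is_zero_mod_def)
qed

lemma ext_gen_mono: "X:ext_gen A T m ==> m <= n ==> X:ext_gen A T n"
 by(induction n) (auto simp: le_Suc_eq intro: ext_gen_mono_Suc)

subsection \<open>Finiteness of the extension dimension\<close>

end

text \<open>A composition series of \<open>C\<close> in which repetitions are allowed, so that a
  factor is simple or zero.\<close>

definition series :: "'a ring => 'a fgm => 'a list set set => nat => (nat => 'a list set set) => bool" where
 "series A M C N L <-> L 0 = {0[M]} & L N = C & (ALL i<=N. smod A M (L i)) & (ALL i<N. L i <= L (Suc i) &
  (ALL D. smod A M D & L i <= D & D <= L (Suc i) --> D = L i | D = L (Suc i)))"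

context artin_alg
begin

lemma composition_series:
 assumes M: "M:Mods A" and "smod A M C"
 shows "EX N L. series A M C N L"
proof -
 note lm = ModsD(1)[OF M]
 obtain rh where r: "ALL C D. smod A M C & smod A M D & C < D --> (rh C :: nat) < rh D" by(rule rank_exists[OF M])
 show ?thesis using assms(2)
 proof(induction "rh C" arbitrary: C rule: less_induct)
  case less
  have 0: "0[M]:C" using less.prems by(simp add: submod_def)
  show ?case
  proof(cases "C = {0[M]}")
   case True
   hence "series A M C 0 (%_. {0[M]})" using less.prems by(simp add: series_def)
   thus ?thesis by blast
  next
   case False
   have "{0[M]} < C" using False 0 by(intro psubsetI) simp_all
   obtain D where D: "smod A M D" "D < C" "ALL E. smod A M E & E < C & D <= E --> E = D"
    by(rule maximal_submod[OF M submod_zero[OF lm], of "%E. E < C", OF \<open>{0[M]} \<subset> C\<close>])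
   have "rh D < rh C" using r D(1,2) less.prems by blast
   from less.hyps[OF this D(1)] obtain N L where L: "series A M D N L" by blast
   let ?L = "%i. if i <= N then L i else C"
   have "?L i <= ?L (Suc i) & (ALL E. smod A M E & ?L i <= E & E <= ?L (Suc i) --> E = ?L i | E = ?L (Suc i))" if "i < Suc N" for i
   proof(cases "i = N")
    case True
    thus ?thesis using L D(2,3) by(auto simp: series_def)
   next
    case False
    thus ?thesis using L that by(simp add: series_def)
   qed
   hence "series A M C (Suc N) ?L" using L less.prems by(simp add: series_def)
   thus ?thesis by blast
  qed
 qed
qed

text \<open>Elements of \<open>regular_module A\<close> are only codes; \<open>ep\<close> turns them into ring elements.\<close>

lemma regular_series:
 obtains ep L N where "ep:liso A (rgm A) (lreg A)"
  "!!(M :: 'a fgm) x. M:Mods A ==> x:car M ==> (%a. ep a *[M] x):lhom A (rgm A) M"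
  "!!(M :: 'a fgm) x. M:Mods A ==> x:car M ==> ALL a:L N. ep a *[M] x = 0[M] ==> x = 0[M]"
  "series A (rgm A) (car (rgm A)) N L" "!!a. a:car (rgm A) ==> ep a:car A"
  "!!i. i <= N ==> L i <= car (rgm A)"
proof -
 let ?R = "rgm A"
 note R = regular_module_Mods(1)[OF ring_A]
 obtain ep where e: "ep:liso A ?R (lreg A)" by(rule regular_liso[OF ring_A])
 interpret A: ring A by(rule ring_A)
 have "1[A]:ep ` car ?R" using e by(simp add: liso_def bij_betw_def)
 then obtain u where u: "u:car ?R" "ep u = 1[A]" by(metis imageE)
 obtain L N where L: "series A ?R (car ?R) N L" using composition_series[OF R submod_top[OF ModsD(1)[OF R]]] by blast
 show ?thesis
 proof(rule that[OF e _ _ L])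
  fix M :: "'a fgm" and x assume M: "M:Mods A" "x:car M"
  show "(%a. ep a *[M] x):lhom A ?R M" by(rule lcomp[OF liso_lhom[OF e] lhom_from_regular[OF ModsD(1)[OF M(1)] M(2)]])
  interpret M: left_module A M by(rule ModsD(1)[OF M(1)])
  show "x = 0[M]" if "ALL a:L N. ep a *[M] x = 0[M]" using that L u M(2) by(auto simp: series_def)
 qed(use e L in "auto simp: series_def submod_def liso_def lhom_def")
qed

text \<open>\<open>S\<close> is simple or zero, and \<open>V\<close> is generated by the images of
  \<open>S\<close>. A maximal submodule \<open>W\<close> that belongs to the additive closure
  contains every such image, because an image not contained in \<open>W\<close> could be added to it
  as a direct summand.\<close>

lemma semisimple_add_closure:
 assumes S: "S:Mods A" "ALL D. smod A S D --> D = {0[S]} | D = car S"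
  and V: "V:Mods A" "ALL C. smod A V C & (ALL f:lhom A S V. f ` car S <= C) --> C = car V"
 shows "V:addc A {S}"
proof -
 note lm = ModsD(1)[OF S(1)] ModsD(1)[OF V(1)]
 interpret V: left_module A V by fact
 interpret S: left_module A S by fact
 have 0: "restr V {0[V]}:addc A {S}" by(rule add_closure.empty_sum[OF restr_Mods[OF V(1) submod_zero[OF lm(2)]]]) (simp add: is_zero_mod_def)
 obtain W where W: "smod A V W" "restr V W:addc A {S}"
  "ALL D. smod A V D & restr V D:addc A {S} & W <= D --> D = W"
  by(rule maximal_submod[OF V(1) submod_zero[OF lm(2)], of "%D. restr V D:addc A {S}", OF 0])
 have Wc: "w:car V" if "w:W" for w using that W(1) by(auto simp: submod_def)
 have W0: "0[V]:W" using W(1) by(simp add: submod_def)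
 have "f ` car S <= W" if f: "f:lhom A S V" for f
 proof(rule ccontr)
  assume n: "~ f ` car S <= W"
  interpret f: lmap A S V f by(intro lmapI lm f)
  have K: "smod A S {s:car S. f s:W}" by(rule submod_vimage[OF lm f W(1)])
  \<comment> \<open>The inverse image of \<open>W\<close> is a submodule of \<open>S\<close> and not
    all of it, hence zero. Thus \<open>f\<close> is injective and its image meets \<open>W\<close>
    only in zero, which makes the sum \<open>?W\<close> direct.\<close>
  have K0: "{s:car S. f s:W} = {0[S]}" using S(2)[rule_format, OF K] n by blast
  let ?W = "{x +[V] y | x y. x:W & y:f ` car S}"
  have W': "smod A V ?W" by(rule submod_sum[OF lm(2) W(1) submod_image[OF lm f submod_top[OF lm(1)]]])
  let ?D = "dsum (restr V W) S" and ?g = "%x. fst x +[V] f (snd x)"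
  have "?g:lhom A ?D V" by(intro lhom_add lm lcomp[OF lhom_dsum(2) f]) (auto simp: lhom_def Wc)
  hence gV: "?g:lhom A ?D (restr V ?W)" by(rule lhom_restr) fastforce
  have "lmap A ?D (restr V ?W) ?g" by(intro lmapI dsum_lm restr_left_module lm W W' gV)
  moreover have "x = 0[?D]" if x: "x:car ?D" "?g x = 0[restr V ?W]" for x
  proof -
   have x': "fst x:W" "snd x:car S" using x(1) by auto
   hence "-[V] fst x = f (snd x)" using x(2) Wc by(intro V.M.minus_equality) (simp_all add: V.M.a_comm)
   moreover have "-[V] fst x:W" using submod_minus[OF lm(2) W(1) _ W0 x'(1)] Wc x' by(simp add: V.M.minus_eq)
   ultimately have "snd x:{s:car S. f s:W}" using x' by simp
   hence "snd x = 0[S]" unfolding K0 by simp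
   thus ?thesis using x Wc x' by(cases x) simp
  qed
  ultimately have "inj_on ?g (car ?D)" by(simp add: lmap_inj_iff del: dsum_simps)
  moreover have "?g ` car ?D = car (restr V ?W)" by force
  ultimately have iso: "?g:liso A ?D (restr V ?W)" using gV by(simp add: liso_def bij_betw_def)
  have A1: "restr V ?W:addc A {S}" by(rule add_closure_dsum[OF W(2) add_closure.base[OF _ S(1)] restr_Mods[OF V(1) W'] iso]) simp
  have A2: "W <= ?W" using Wc by force
  have fW: "f s:?W" if s: "s:car S" for s using s W0 by force
  obtain s where "s:car S" "f s ~: W" using n by blast
  thus False using W(3)[rule_format, OF conjI, OF W' conjI, OF A1 A2] fW[of s] by simp
 qed
 thus ?thesis using V(2) W(1) W(2) by(force simp: restr_def)
qed

text \<open>The direct sum of the family, so that finitely many modules can be replaced by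
  one.\<close>

lemma dominating_module:
 fixes S :: "nat => 'a fgm"
 assumes "!!i. i < N ==> S i:Mods A"
 obtains T where "T:Mods A" "ALL i<N. S i:addc A {T}"
proof -
 have "EX T. T:Mods A & (ALL i<N. S i:addc A {T})" using assms
 proof(induction N)
  case 0
  show ?case using regular_module_Mods(1)[OF ring_A] by blast
 next
  case (Suc N)
  then obtain T where T: "T:Mods A" "ALL i<N. S i:addc A {T}" by(meson less_SucI)
  have SN: "S N:Mods A" using Suc.prems by simp
  note lm = ModsD(1)[OF T(1)] ModsD(1)[OF SN]
  obtain D e where D: "D:Mods A" "e:liso A (dsum T (S N)) D" by(rule Mods_dsum[OF T(1) SN])
  obtain e' where e': "e':liso A D (dsum T (S N))" "ALL x:car (dsum T (S N)). e' (e x) = x" "ALL y:car D. e (e' y) = y"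
   by(rule liso_inv[OF D(2) dsum_lm[OF lm]])
  interpret T: left_module A T by fact
  interpret S: left_module A "S N" by fact
  have Dc: "D:addc A {D}" using D(1) by(intro add_closure.base) simp_all
  have TD: "T:addc A {D}"
  using add_closure_retract[OF Dc T(1)] lcomp[OF lhom_inl[OF lm(2)] liso_lhom[OF D(2)]] lcomp[OF liso_lhom[OF e'(1)] lhom_dsum(1)] bspec[OF e'(2)] by simp
  have SD: "S N:addc A {D}"
  using add_closure_retract[OF Dc SN] lcomp[OF lhom_inr[OF lm(1)] liso_lhom[OF D(2)]] lcomp[OF liso_lhom[OF e'(1)] lhom_dsum(2)] bspec[OF e'(2)] by simp
  have "S i:addc A {D}" if i: "i < Suc N" for i
  proof(cases "i = N")
   case False
   hence "S i:addc A {T}" using T(2) i by simp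
   thus ?thesis by(rule add_closure_trans) (use TD in simp)
  qed(use SD in simp)
  thus ?case using D(1) by blast
 qed
 thus ?thesis using that by(elim exE conjE)
qed

text \<open>A composition series of the regular module bounds the extension dimension: filter a module \<open>Q\<close>
  by the submodules generated by \<open>L\<^sub>i Q\<close>.\<close>

theorem ext_dim_finite: "EX T N. T:Mods A & Mods A = ext_gen A T (Suc N)"
proof -
 let ?R = "rgm A"
 note R = regular_module_Mods(1)[OF ring_A]
 interpret R: left_module A ?R by(rule ModsD(1)[OF R])
 obtain ep L N where e: "ep:liso A ?R (lreg A)" and act: "!!(M :: 'a fgm) x. M:Mods A ==> x:car M ==> (%a. ep a *[M] x):lhom A ?R M"
  and top: "!!(M :: 'a fgm) x. M:Mods A ==> x:car M ==> ALL a:L N. ep a *[M] x = 0[M] ==> x = 0[M]"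
  and ser: "series A ?R (car ?R) N L" and eA: "!!a. a:car ?R ==> ep a:car A" and LR': "!!i. i <= N ==> L i <= car ?R" by(rule regular_series) blast
 note L = ser[unfolded series_def]
 have "EX S si. S:Mods A & si:lhom A (restr ?R (L (Suc i))) S & si ` L (Suc i) = car S &
  (ALL x:L (Suc i). si x = 0[S] <-> x:L i)" if i: "i < N" for i
 proof -
  have s: "smod A ?R (L i)" "smod A ?R (L (Suc i))" "L i <= L (Suc i)" using L i by simp_all
  have "smod A (restr ?R (L (Suc i))) (L i)" using s by(simp add: submod_def)
  from quotient_Mods[OF restr_Mods[OF R s(2)] this] show ?thesis by(metis (no_types, lifting) restr_simps(1))
 qed
 then obtain S si where S: "!!i. i < N ==> S i:Mods A"
  and si: "!!i. i < N ==> si i:lhom A (restr ?R (L (Suc i))) (S i)" "!!i. i < N ==> si i ` L (Suc i) = car (S i)"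
  "!!i x. i < N ==> x:L (Suc i) ==> si i x = 0[S i] <-> x:L i" by metis
 obtain T where T: "T:Mods A" "ALL i<N. S i:addc A {T}" by(rule dominating_module[OF S])
 \<comment> \<open>Each level removes one factor of the series. With \<open>i = N - Suc j\<close>
   and \<open>Q\<close> killed by \<open>L i\<close>, the submodule \<open>Q'\<close> generated by
   \<open>L (Suc i) Q\<close> is a sum of images of \<open>S i\<close>, and the quotient by it is
   killed by \<open>L (Suc i)\<close>, to which the induction applies.\<close>
 have killed: "Q:ext_gen A T j" if "j <= N" "Q:Mods A" "ALL a:L (N-j). ALL x:car Q. ep a *[Q] x = 0[Q]" for j Q using that
 proof(induction j arbitrary: Q)
  case 0
  interpret Q: left_module A Q by(rule ModsD[OF 0(2)])
  have "x = 0[Q]" if "x:car Q" for x using top[OF 0(2) that] 0(3) that by simp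
  thus ?case by(intro ext_gen_zero 0 zmodI[OF Q.lmA])
 next
  case (Suc j)
  define i where "i = N-Suc j"
  have i: "i < N" "N-j = Suc i" using Suc.prems by(simp_all add: i_def)
  have Lk: "smod A ?R (L i)" "smod A ?R (L (Suc i))" "L i <= L (Suc i)"
   "!!D. smod A ?R D ==> L i <= D ==> D <= L (Suc i) ==> D = L i | D = L (Suc i)" using L i by simp_all
  have LR: "a:car ?R" if "a:L (Suc i)" for a using that LR'[of "Suc i"] i by auto
  note Q = Suc.prems(2)
  interpret Q: left_module A Q by(rule ModsD[OF Q])
  have ann: "ep a *[Q] x = 0[Q]" if "a:L i" "x:car Q" for a x using Suc.prems(3) that by(simp add: i_def)
  let ?F = "{ep a *[Q] x | a x. a:L (Suc i) & x:car Q}"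
  have F: "?F <= car Q" using eA LR by blast
  define Q' where "Q' = span A Q ?F"
  have Q': "smod A Q Q'" unfolding Q'_def by(rule span_submod[OF Q.lmA F])
  have FQ': "ep a *[Q] x:Q'" if "a:L (Suc i)" "x:car Q" for a x using that span_superset[of ?F A Q] unfolding Q'_def by blast
  have Q'c: "Q' <= car Q" using Q' by(simp add: submod_def)
  let ?U = "restr Q Q'"
  have U: "?U:Mods A" by(rule restr_Mods[OF Q Q'])
  have lmR: "lmod A (restr ?R (L (Suc i)))" by(rule restr_left_module[OF R.lmA Lk(2)])
  note lmS = ModsD(1)[OF S[OF i(1)]]
  interpret s: lmap A "restr ?R (L (Suc i))" "S i" "si i" by(intro lmapI lmR lmS si i)
  have "?U:addc A {S i}"
  proof(rule semisimple_add_closure[OF S[OF i(1)] _ U]; intro allI impI)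
   fix D assume D: "smod A (S i) D"
   let ?E = "{a:L (Suc i). si i a:D}"
   have E: "smod A ?R ?E" using submod_vimage[OF lmR lmS si(1)[OF i(1)] D] Lk(2) by(auto simp: submod_def)
   have D0: "0[S i]:D" "D <= car (S i)" using D by(simp_all add: submod_def)
   have "L i <= ?E"
   proof
    fix a assume "a:L i" thus "a:?E" using Lk(3) si(3)[OF i(1), of a] D0 by auto
   qed
   hence "?E = L i | ?E = L (Suc i)" by(intro Lk(4) E) auto
   moreover have "si i a = 0[S i]" if "a:L i" for a using si(3)[OF i(1)] Lk(3) that by blast
   hence "si i ` L i = {0[S i]}" using Lk(1) by(force simp: submod_def)
   ultimately have "si i ` ?E = {0[S i]} | si i ` ?E = car (S i)" using si(2)[OF i(1)] by(elim disjE) simp_all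
   moreover have "si i ` ?E = D" using D0(2) unfolding si(2)[OF i(1), symmetric] by blast
   ultimately show "D = {0[S i]} | D = car (S i)" by simp
  next
   fix C assume C: "smod A ?U C & (ALL f:lhom A (S i) ?U. f ` car (S i) <= C)"
   have C': "smod A Q C" "C <= Q'" using C submod_restr[OF Q'c] by simp_all
   have "ep a *[Q] x:C" if a: "a:L (Suc i)" and x: "x:car Q" for a x
   proof -
    \<comment> \<open>For fixed \<open>x\<close> the map \<open>a -> a x\<close> on
      \<open>L (Suc i)\<close> vanishes on \<open>L i\<close>, hence comes from the simple or zero
      factor \<open>S i\<close>; its image therefore lies in \<open>C\<close>.\<close>
    have g: "(%a. ep a *[Q] x):lhom A (restr ?R (L (Suc i))) ?U" by(intro lhom_restr lhom_from_restr act Q) (use FQ' x LR in auto)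
    obtain f where f: "f:lhom A (S i) ?U" "ALL a:car (restr ?R (L (Suc i))). f (si i a) = ep a *[Q] x"
     by(rule lmap_factor[OF lmR lmS ModsD(1)[OF U] si(1)[OF i(1)] g]) (use si(2,3) i(1) ann x in simp_all)
    have "f ` car (S i) <= C" using C f(1) by blast
    moreover have "si i a:car (S i)" using a by simp
    ultimately have "f (si i a):C" by blast
    thus ?thesis using f(2) a by simp
   qed
   hence "?F <= C" by blast
   hence "Q' <= C" unfolding Q'_def by(rule span_least[OF C'(1)])
   thus "C = car ?U" using C'(2) by simp
  qed
  hence U1: "?U:ext_gen A T 1" using add_closure_trans T(2) i(1) by force
  obtain V pj where V: "V:Mods A" "pj:lhom A Q V" "pj ` car Q = car V" "ALL x:car Q. pj x = 0[V] <-> x:Q'" by(rule quotient_Mods[OF Q Q'])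
  interpret p: lmap A Q V pj by(intro lmapI Q.lmA ModsD(1)[OF V(1)] V(2))
  have "V:ext_gen A T j"
  proof(rule Suc.IH[OF _ V(1)])
   show "j <= N" using Suc.prems by simp
   show "ALL a:L (N-j). ALL x:car V. ep a *[V] x = 0[V]" unfolding i(2)
   proof(intro ballI)
    fix a x assume a: "a:L (Suc i)" and "x:car V"
    then obtain y where y: "y:car Q" "x = pj y" by(metis V(3) imageE)
    hence "ep a *[V] x = pj (ep a *[Q] y)" using eA[OF LR[OF a]] by simp
    also have "... = 0[V]" using V(4) FQ'[OF a y(1)] Q'c by blast
    finally show "ep a *[V] x = 0[V]" .
   qed
  qed
  moreover have "short_exact A ?U Q V"
  proof -
   have "{x:car Q. pj x = 0[V]} = Q'" using V(4) Q'c by blast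
   thus ?thesis using short_exact_quotient[OF Q V(1-3)] by simp
  qed
  ultimately show ?case by(intro ext_gen_extension[OF _ Q U1])
 qed
 \<comment> \<open>The submodule \<open>L 0\<close> is zero and kills every module, so
   \<open>killed\<close> applies with index \<open>N\<close>. The index is raised by one to have the
   shape that occurs in \<open>ext_dim\<close>.\<close>
 have "Q:ext_gen A T (Suc N)" if Q: "Q:Mods A" for Q
 proof -
  interpret Q: left_module A Q by(rule ModsD[OF Q])
  interpret e: lmap A ?R "lreg A" ep by(intro lmapI R.lmA lreg_lm ring_A liso_lhom e)
  show ?thesis using killed[OF _ Q] ext_gen_mono_Suc L by simp
 qed
 hence "Mods A = ext_gen A T (Suc N)" using ext_gen_Mods by blast
 with T(1) show ?thesis by blast
qed

end

subsection \<open>Injective modules\<close>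

definition injective :: "'a ring => 'a fgm => bool" where
 "injective A I <-> I:Mods A &
   (ALL M:Mods A. ALL N:Mods A. ALL g:lhom A M N. ALL h:lhom A M I. inj_on g (car M) -->
    (EX h':lhom A N I. ALL x:car M. h' (g x) = h x))"

lemma injective_Mods: "injective A I ==> I:Mods A"
 by(simp add: injective_def)

lemma injectiveD:
 assumes "injective A I" "g:lhom A M N" "h:lhom A M I" "inj_on g (car M)" "M:Mods A" "N:Mods A"
 obtains h' where "h':lhom A N I" "ALL x:car M. h' (g x) = h x"
using assms(1)[unfolded injective_def, THEN conjunct2, rule_format, OF assms(5,6,2,3,4)] by blast

definition ses :: "'a ring => 'a fgm => ('a list set => 'a list set) => 'a fgm => ('a list set => 'a list set) => 'a fgm => bool" where
 "ses A U f X g V <-> U:Mods A & X:Mods A & V:Mods A & f:lhom A U X & g:lhom A X V &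
   inj_on f (car U) & g ` car X = car V & (ALL x:car X. g x = 0[V] <-> x:f ` car U)"

lemma sesD:
 assumes "ses A U f X g V"
 shows "U:Mods A" "X:Mods A" "V:Mods A" "f:lhom A U X" "g:lhom A X V" "inj_on f (car U)"
  "g ` car X = car V" "!!x. x:car X ==> g x = 0[V] <-> x:f ` car U"
  "lmap A U X f" "lmap A X V g" "!!u. u:car U ==> g (f u) = 0[V]" using assms by(auto simp: ses_def lmapI ModsD lhom_def Pi_iff)

lemma short_exact_iff_ses:
 assumes "U:Mods A" "X:Mods A" "V:Mods A"
 shows "short_exact A U X V <-> (EX f g. ses A U f X g V)"
proof
 assume "short_exact A U X V"
 then obtain f g where fg: "f:lhom A U X" "g:lhom A X V" "inj_on f (car U)"
  "f ` car U = a_kernel X V g" "g ` car X = car V" unfolding short_exact_def by(elim bexE conjE)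
 hence "ses A U f X g V" using assms by(simp add: ses_def a_kernelD)
 thus "EX f g. ses A U f X g V" by blast
next
 assume "EX f g. ses A U f X g V"
 then obtain f g where fg: "ses A U f X g V" by blast
 note s = sesD[OF fg]
 have "f ` car U = a_kernel X V g"
 proof(intro subset_antisym subsetI)
  fix x assume "x:f ` car U"
  thus "x:a_kernel X V g" using s(4,8) by(auto simp: a_kernelD lhom_def)
 next
  fix x assume "x:a_kernel X V g"
  thus "x:f ` car U" by(metis s(8) a_kernelD)
 qed
 thus "short_exact A U X V" unfolding short_exact_def using s by blast
qed

lemma ses_cokernel:
 assumes "U:Mods A" "X:Mods A" "f:lhom A U X" "inj_on f (car U)"
 obtains V g where "ses A U f X g V"
proof -
 note lm = ModsD(1)[OF assms(1)] ModsD(1)[OF assms(2)]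
 obtain V g where "V:Mods A" "g:lhom A X V" "g ` car X = car V" "ALL x:car X. g x = 0[V] <-> x:f ` car U"
  by(rule quotient_Mods[OF assms(2) submod_image[OF lm assms(3) submod_top[OF lm(1)]]])
 thus ?thesis using assms by(intro that[of g V]) (simp add: ses_def)
qed

lemma ses_factor:
 assumes "ses A U f X g V" "lmod A Z" "h:lhom A X Z" "!!u. u:car U ==> h (f u) = 0[Z]"
 obtains k where "k:lhom A V Z" "ALL x:car X. k (g x) = h x"
using lmap_factor[OF ModsD(1)[OF sesD(2)[OF assms(1)]] ModsD(1)[OF sesD(3)[OF assms(1)]] assms(2) sesD(5)[OF assms(1)] assms(3) sesD(7)[OF assms(1)]] sesD(8)[OF assms(1)] assms(4) by blast

lemma sesI:
 assumes "U:Mods A" "X:Mods A" "V:Mods A" and fg: "f:lhom A U X" "g:lhom A X V"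
  and inj: "!!x. x:car U ==> f x = 0[X] ==> x = 0[U]" and surj: "!!z. z:car V ==> EX y:car X. g y = z"
  and comp: "!!x. x:car U ==> g (f x) = 0[V]" and ker: "!!y. y:car X ==> g y = 0[V] ==> EX x:car U. f x = y"
 shows "ses A U f X g V"
proof -
 have "inj_on f (car U)" using inj lmap_inj_iff[OF lmapI[OF ModsD(1)[OF assms(1)] ModsD(1)[OF assms(2)] fg(1)]] by blast
 moreover have "g ` car X = car V"
 proof(intro subset_antisym image_subsetI subsetI)
  show "g x:car V" if "x:car X" for x using fg(2) that by(simp add: lhom_def Pi_iff)
  show "z:g ` car X" if "z:car V" for z using surj[OF that] by(elim bexE) (rule image_eqI, rule sym)
 qed
 moreover have "ALL x:car X. g x = 0[V] <-> x:f ` car U" using comp ker by blast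
 ultimately show ?thesis unfolding ses_def using assms(1-5) by simp
qed

context
 fixes A :: "'a ring" and U f X g V
 assumes s: "ses A U f X g V"
begin

lemma ses_inj: "x:car U ==> f x = 0[X] ==> x = 0[U]"
 using sesD(6)[OF s] lmap_inj_iff[OF sesD(9)[OF s]] by blast

lemma ses_lift:
 assumes "z:car V" obtains y where "y:car X" "g y = z" using assms that unfolding sesD(7)[OF s, symmetric] by(elim imageE) simp

lemma ses_kernel:
 assumes "y:car X" "g y = 0[V]" obtains x where "x:car U" "f x = y" using assms that sesD(8)[OF s] by(metis imageE)

end

lemma biproduct_Mods:
 assumes "M:Mods A" "N:Mods A"
 obtains D e e' where "D:Mods A" "e:lhom A (dsum M N) D" "e':lhom A D (dsum M N)"
  "ALL x:car (dsum M N). e' (e x) = x" "ALL y:car D. e (e' y) = y"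
proof -
 obtain D e where D: "D:Mods A" "e:liso A (dsum M N) D" by(rule Mods_dsum[OF assms])
 obtain e' where "e':liso A D (dsum M N)" "ALL x:car (dsum M N). e' (e x) = x" "ALL y:car D. e (e' y) = y"
  by(rule liso_inv[OF D(2) dsum_lm[OF ModsD(1)[OF assms(1)] ModsD(1)[OF assms(2)]]])
 thus ?thesis using D by(intro that[of D e e']) (simp_all add: liso_lhom)
qed

lemma injective_dsum:
 assumes "injective A I" "injective A J" "D:Mods A" "e:lhom A (dsum I J) D" "e':lhom A D (dsum I J)"
  "ALL y:car D. e (e' y) = y"
 shows "injective A D" unfolding injective_def
proof(intro conjI ballI impI)
 fix M N g h assume *: "M:Mods A" "N:Mods A" "g:lhom A M N" "h:lhom A M D" "inj_on g (car M)"
 have h1: "(%x. fst (e' (h x))):lhom A M I" by(rule lcomp[OF lcomp[OF *(4) assms(5)] lhom_dsum(1)])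
 have h2: "(%x. snd (e' (h x))):lhom A M J" by(rule lcomp[OF lcomp[OF *(4) assms(5)] lhom_dsum(2)])
 obtain u where u: "u:lhom A N I" "ALL x:car M. u (g x) = fst (e' (h x))" by(rule injectiveD[OF assms(1) *(3) h1 *(5,1,2)])
 obtain v where v: "v:lhom A N J" "ALL x:car M. v (g x) = snd (e' (h x))" by(rule injectiveD[OF assms(2) *(3) h2 *(5,1,2)])
 show "EX h':lhom A N D. ALL x:car M. h' (g x) = h x"
 proof(intro bexI ballI)
  show "(%x. e (u x, v x)):lhom A N D" by(rule lcomp[OF lhom_dsum(3)[OF u(1) v(1)] assms(4)])
  fix x assume x: "x:car M"
  hence "h x:car D" using *(4) by(simp add: lhom_def Pi_iff)
  thus "e (u (g x), v (g x)) = h x" using u(2) v(2) x assms(6) by simp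
 qed
qed(rule assms(3))

context artin_alg
begin

text \<open>The length over the ground ring. It is not taken over \<open>A\<close>, since
  multiplication by an element of \<open>A\<close> is in general only k-linear, and such maps occur
  in \<open>essential_bound\<close>.\<close>

definition klen :: "'a fgm => nat" where
 "klen M = (LEAST c. len_le scal M (car M) c)"

lemma klen: "M:Mods A ==> len_le scal M (car M) (klen M)"
 unfolding klen_def using len_Mods by(rule LeastI_ex)

lemma klen_le: "len_le scal M (car M) c ==> klen M <= c"
 unfolding klen_def by(rule Least_le)

lemma submod_scal: "smod A M C ==> submod scal M C"
 using scal_carrier by(auto simp: submod_def)

lemma lhom_semilin: "f:lhom A M N ==> lmap A M N f ==> semilin scal (%s. s) M (car M) N f"
proof -
 assume "lmap A M N f"
 then interpret lmap A M N f .
 show ?thesis using scal_carrier by(auto simp: semilin_def)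
qed

lemma klen_strict:
 assumes "M:Mods A" "N:Mods A" "f:lhom A M N" "inj_on f (car M)" "f ` car M ~= car N"
 shows "klen M < klen N"
proof -
 note lm = ModsD(1)[OF assms(1)] ModsD(1)[OF assms(2)]
 interpret f: lmap A M N f by(intro lmapI lm assms)
 let ?U = "f ` car M"
 have U: "smod A N ?U" by(rule submod_image[OF lm assms(3) submod_top[OF lm(1)]])
 obtain d where d: "d < klen N" "len_le scal N ?U d" using assms(5) len_le_sub[OF klen[OF assms(2)] submod_scal[OF submod_top[OF lm(2)]] submod_scal[OF U]] by force
 define g where "g = inv_into (car M) f"
 have gf: "g (f x) = x" if "x:car M" for x using assms(4) that by(simp add: g_def)
 have "semilin scal (%s. s) N ?U M g" unfolding semilin_def
 proof(intro conjI ballI)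
  show "g ` ?U <= car M" using gf by auto
  show "g 0[N] = 0[M]" using gf[of "0[M]"] by simp
  fix x y assume "x:?U" "y:?U"
  then obtain u v where "u:car M" "v:car M" "x = f u" "y = f v" by blast
  thus "g (x +[N] y) = g x +[M] g y" using gf[of "u +[M] v"] gf by simp
 next
  fix s x assume s: "s:scal" and "x:?U"
  then obtain u where "u:car M" "x = f u" by blast
  moreover have "s:car A" using s scal_carrier by(rule)
  ultimately show "g (s *[N] x) = s *[M] g x" using gf[of "s *[M] u"] gf by simp
 qed
 from len_le_image[OF this submod_scal[OF U] d(2)] have "len_le scal M (g ` ?U) d" by simp
 moreover have "g ` ?U = car M" using gf by(simp add: image_image)
 ultimately show ?thesis using klen_le[of M d] d(1) by simp
qed

definition essential :: "'a fgm => ('a list set => 'a list set) => 'a fgm => bool" where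
 "essential N i M <-> N:Mods A & M:Mods A & i:lhom A N M & inj_on i (car N) &
  (ALL C. smod A M C & C ~= {0[M]} --> (EX x:C. x ~= 0[M] & x:i ` car N))"

text \<open>Here the ground ring enters: for \<open>g : L\<^sub>i\<^sub>+\<^sub>1\<close> outside \<open>L\<^sub>i\<close>, multiplication by \<open>g\<close> is
  \<open>k\<close>-linear on the elements killed by \<open>L\<^sub>i\<close>, its kernel consists of the elements killed by
  \<open>L\<^sub>i\<^sub>+\<^sub>1\<close>, and its values generate simple modules, which lie in \<open>N\<close>.\<close>

lemma essential_bound: "EX n. ALL N i M. essential N i M --> klen M <= n * klen N"
proof -
 let ?R = "rgm A"
 obtain ep L n where e: "ep:liso A ?R (lreg A)" and act: "!!(M :: 'a fgm) x. M:Mods A ==> x:car M ==> (%a. ep a *[M] x):lhom A ?R M"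
  and top: "!!(M :: 'a fgm) x. M:Mods A ==> x:car M ==> ALL a:L n. ep a *[M] x = 0[M] ==> x = 0[M]"
  and ser: "series A ?R (car ?R) n L" and eA: "!!a. a:car ?R ==> ep a:car A" and LR': "!!i. i <= n ==> L i <= car ?R" by(rule regular_series) blast
 note L = ser[unfolded series_def]
 have "klen M <= n * klen N" if ess: "essential N i M" for N i M
 proof -
  note N = ess[unfolded essential_def]
  have M: "M:Mods A" and NM: "N:Mods A" and il: "i:lhom A N M" using N by simp_all
  have R: "lmod A ?R" using regular_module_Mods(1)[OF ring_A] by(rule ModsD(1))
  interpret M: left_module A M by(rule ModsD(1)[OF M])
  interpret i: lmap A N M i by(intro lmapI ModsD(1)[OF NM] ModsD(1)[OF M] il)
  have actM: "(%a. ep a *[M] x):lhom A ?R M" if "x:car M" for x by(rule act[OF M that])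
  have LR: "a:car ?R" if "a:L j" "j <= n" for a j using that LR'[of j] by auto
  let ?I = "i ` car N"
  have I: "smod A M ?I" by(rule submod_image[OF i.M.lmA M.lmA il submod_top[OF i.M.lmA]])
  have lenI: "len_le scal M ?I (klen N)" using len_le_image[OF lhom_semilin[OF il i.lmap_axioms] submod_scal[OF submod_top[OF i.M.lmA]] klen[OF NM]]
   by(simp only: image_ident)
  \<comment> \<open>The elements killed by the left ideal coded by \<open>L j\<close>. They form
    only a k-submodule in general. \<open>D n\<close> is zero and \<open>D 0\<close> is
    \<open>M\<close>; each step from \<open>Suc j\<close> down to \<open>j\<close> will cost at most
    \<open>klen N\<close>.\<close>
  define D where "D j = {x:car M. ALL a:L j. ep a *[M] x = 0[M]}" for j
  have comm: "ep a *[M] (s *[M] x) = s *[M] (ep a *[M] x)" if that': "a:car ?R" "s:scal" "x:car M" for a s x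
  proof -
   obtain c where c: "s = ph c" "c:car k" using that'(2) by(rule)
   have "ph c .[A] ep a = ep a .[A] ph c" using A c(2) eA[OF that'(1)] unfolding artin_algebra_def by blast
   moreover have "ph c:car A" using scal_carrier c(2) by blast
   ultimately show ?thesis using eA[OF that'(1)] that'(3) c(1) by(simp flip: M.smult_assoc)
  qed
  have Ds: "submod scal M (D j)" if j: "j <= n" for j
  proof(rule submodI)
   show "D j <= car M" by(simp add: D_def)
   show "0[M]:D j" using eA LR j by(simp add: D_def)
   show "x +[M] y:D j" if "x:D j" "y:D j" for x y using that eA LR j by(simp add: D_def M.smult_r_distr)
   show "s *[M] x:D j" if "s:scal" "x:D j" for s x using that scal_carrier comm[OF LR[OF _ j] that(1)] by(auto simp: D_def)
  qed
  have "len_le scal M (D (n-m)) (m * klen N)" if "m <= n" for m using that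
  proof(induction m)
   case 0
   have "D n = {0[M]}" using top M Ds[of n] by(auto simp: D_def submod_def)
   thus ?case using len_le_zero by simp
  next
   case (Suc m)
   define j where "j = n-Suc m"
   have j: "j < n" "n-m = Suc j" using Suc.prems by(simp_all add: j_def)
   have IH: "len_le scal M (D (Suc j)) (m * klen N)" using Suc j by simp
   have Lj: "smod A ?R (L j)" "smod A ?R (L (Suc j))" "L j <= L (Suc j)" using L j by simp_all
   have full: "E = L (Suc j)" if "smod A ?R E" "L j <= E" "E <= L (Suc j)" "a:E" "a ~: L j" for E a using L j(1) that by blast
   show ?case
   proof(cases "L (Suc j) = L j")
    case True
    thus ?thesis using len_le_mono[OF IH] by(simp add: D_def j_def)
   next
    case False
    then obtain g where g: "g:L (Suc j)" "g ~: L j" using Lj(3) by blast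
    have gR: "g:car ?R" using LR g(1) j(1) by simp
    note gA = eA[OF gR]
    let ?h = "%x. ep g *[M] x"
    have h: "semilin scal (%s. s) M (D j) M ?h"
    proof -
     have "x:car M" if "x:D j" for x using that by(simp add: D_def)
     thus ?thesis unfolding semilin_def using gA comm[OF gR] by(simp add: M.smult_r_distr image_subset_iff)
    qed
    \<comment> \<open>The elements of \<open>L (Suc j)\<close> that kill \<open>x\<close> form a
      submodule containing \<open>L j\<close> and also \<open>g\<close>; as nothing lies strictly
      between, they are all of \<open>L (Suc j)\<close>.\<close>
    have ker: "{x:D j. ?h x = 0[M]} = D (Suc j)"
    proof(intro subset_antisym subsetI)
     fix x assume "x:{x:D j. ?h x = 0[M]}"
     hence x: "x:car M" "ALL a:L j. ep a *[M] x = 0[M]" "?h x = 0[M]" by(simp_all add: D_def)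
     let ?E = "L (Suc j) Int {a:car ?R. ep a *[M] x = 0[M]}"
     have "?E = L (Suc j)"
     proof(rule full)
      show "smod A ?R ?E" by(intro submod_Int Lj(2) submod_kernel[OF R M.lmA actM[OF x(1)]])
      have "a:car ?R" if "a:L j" for a using that LR[of a j] j(1) by simp
      thus "L j <= ?E" using Lj(3) x(2) by blast
      show "g:?E" using g gR x(3) by simp
      show "g ~: L j" by(rule g(2))
     qed blast
     thus "x:D (Suc j)" using x(1) D_def by blast
    next
     fix x assume "x:D (Suc j)"
     thus "x:{x:D j. ?h x = 0[M]}" using g(1) Lj(3) by(simp add: D_def subset_iff)
    qed
    \<comment> \<open>If \<open>g x\<close> is nonzero, the submodule \<open>L (Suc j) x\<close>
      contains a nonzero element \<open>a x\<close> of \<open>N\<close> by essentiality. The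
      elements \<open>b\<close> with \<open>b x\<close> in \<open>N\<close> contain
      \<open>L j\<close> and \<open>a\<close>, hence are all of \<open>L (Suc j)\<close>, and
      \<open>g\<close> is one of them.\<close>
    have im: "?h ` D j <= ?I"
    proof(rule image_subsetI)
     fix x assume "x:D j"
     hence x: "x:car M" "ALL a:L j. ep a *[M] x = 0[M]" by(simp_all add: D_def)
     have I0: "0[M]:?I" using I by(simp add: submod_def)
     show "?h x:?I"
     proof(cases "?h x = 0[M]")
      case True thus ?thesis using I0 by simp
     next
      case False
      let ?C = "(%a. ep a *[M] x) ` L (Suc j)"
      obtain z where z: "z:?C" "z ~= 0[M]" "z:?I" using g(1) False submod_image[OF R M.lmA actM[OF x(1)] Lj(2)] N by blast
      obtain a where a: "a:L (Suc j)" "z = ep a *[M] x" using z(1) by(rule)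
      let ?E = "L (Suc j) Int {a:car ?R. ep a *[M] x:?I}"
      have "?E = L (Suc j)"
      proof(rule full)
       show "smod A ?R ?E" by(intro submod_Int Lj(2) submod_vimage[OF R M.lmA actM[OF x(1)] I])
       have "b:car ?R" if "b:L j" for b using that LR[of b j] j(1) by simp
       thus "L j <= ?E" using Lj(3) x(2) I0 by auto
       show "a:?E" using a z(3) LR[of a "Suc j"] j(1) by simp
       show "a ~: L j" using x(2) a z(2) by blast
      qed blast
      thus ?thesis using g(1) by blast
     qed
    qed
    have *: "len_le ((%s. s) ` scal) M (?h ` D j) (klen N)" using len_le_subset[OF lenI submod_scal[OF I] _ im] submod_semilin_image[OF h Ds[of j] order_refl] j(1) by simp
    show ?thesis using len_le_extension[OF h _ M.lmA M.lmA scal_neg_one _ _ *] Ds scal_carrier ker IH by(force simp: j_def add.commute)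
   qed
  qed
  from this[of n] have "len_le scal M (D 0) (n * klen N)" by simp
  moreover have "D 0 = car M"
  proof -
   interpret e: lmap A ?R "lreg A" ep by(intro lmapI R lreg_lm ring_A liso_lhom e)
   show ?thesis by(auto simp: D_def L)
  qed
  ultimately show ?thesis using klen_le by simp
 qed
 thus ?thesis by blast
qed

text \<open>An essential extension of maximal length is injective: otherwise enlarge it inside a pushout.\<close>

theorem enough_injectives:
 assumes N: "N:Mods A"
 obtains I i where "injective A I" "i:lhom A N I" "inj_on i (car N)"
proof -
 obtain n where bound: "!!N i M. essential N i M ==> klen M <= n * klen N" using essential_bound by blast
 have "essential N (%x. x) N"
 proof -
  have "EX x:C. x ~= 0[N] & x:(%x. x) ` car N" if "smod A N C" "C ~= {0[N]}" for C using that unfolding submod_def by blast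
  thus ?thesis using N by(simp add: essential_def lhom_id)
 qed
 hence "EX M. (EX i. essential N i M) & (ALL M'. (EX i. essential N i M') --> klen M' <= klen M)"
  by(intro ex_has_greatest_nat[of "%M. EX i. essential N i M" N klen "Suc (n * klen N)"])
   (use bound in "auto simp: less_Suc_eq_le")
 then obtain M i where ess: "essential N i M" and Mmax: "!!M' i'. essential N i' M' ==> klen M' <= klen M" by blast
 note Nf = ess[unfolded essential_def]
 have M: "M:Mods A" and i: "i:lhom A N M" "inj_on i (car N)" using Nf by simp_all
 have iess: "EX x:C. x ~= 0[M] & x:i ` car N" if "smod A M C" "C ~= {0[M]}" for C using Nf that by blast
 have lmM: "lmod A M" by(rule ModsD(1)[OF M])
 have "injective A M" unfolding injective_def
 proof(intro conjI ballI impI)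
  fix X Y g h assume X: "X:Mods A" "Y:Mods A" and g: "g:lhom A X Y" and h: "h:lhom A X M" and gi: "inj_on g (car X)"
  note lm = ModsD(1)[OF X(1)] ModsD(1)[OF X(2)]
  interpret g: lmap A X Y g by(intro lmapI lm g)
  interpret h: lmap A X M h by(intro lmapI lm lmM h)
  obtain D e e' where D: "D:Mods A" and e: "e:lhom A (dsum M Y) D" "e':lhom A D (dsum M Y)"
   "ALL x:car (dsum M Y). e' (e x) = x" "ALL y:car D. e (e' y) = y" by(rule biproduct_Mods[OF M X(2)])
  note lmD = ModsD(1)[OF D]
  interpret e: lmap A "dsum M Y" D e by(intro lmapI dsum_lm lmM lm lmD e)
  \<comment> \<open>The quotient of \<open>M + Y\<close> by the image of \<open>?q\<close> is the
    pushout \<open>Z\<close> of \<open>h\<close> and \<open>g\<close>; since \<open>g\<close> is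
    injective, \<open>M\<close> embeds into it.\<close>
  let ?q = "%x. e (h x, -[Y] g x)"
  have q: "?q:lhom A X D" by(rule lcomp[OF lhom_dsum(3)[OF h lhom_neg[OF lm(2) g]] e(1)])
  obtain Z p where Z: "Z:Mods A" "p:lhom A D Z" "p ` car D = car Z" "ALL x:car D. p x = 0[Z] <-> x:?q ` car X"
   by(rule quotient_Mods[OF D submod_image[OF lm(1) lmD q submod_top[OF lm(1)]]])
  note lmZ = ModsD(1)[OF Z(1)]
  interpret p: lmap A D Z p by(intro lmapI lmD lmZ Z)
  let ?j = "%m. p (e (m, 0[Y]))"
  have j: "?j:lhom A M Z" by(rule lcomp[OF lcomp[OF lhom_inl[OF lm(2)] e(1)] Z(2)])
  interpret j: lmap A M Z ?j by(intro lmapI lmM lmZ j)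
  have einj: "x = y" if "e x = e y" "x:car (dsum M Y)" "y:car (dsum M Y)" for x y using bspec[OF e(3) that(2)] bspec[OF e(3) that(3)] that(1) by metis
  have j0: "m = 0[M]" if m: "m:car M" "?j m = 0[Z]" for m
  proof -
   obtain x where x: "e (m, 0[Y]) = ?q x" "x:car X" using Z(4) m by auto
   hence "(m, 0[Y]) = (h x, -[Y] g x)" using m by(intro einj) simp_all
   hence mh: "m = h x" "-[Y] g x = 0[Y]" by simp_all
   have "g x = -[Y] (-[Y] g x)" using x by simp
   thus ?thesis using gi x(2) lmap_inj_iff[OF g.lmap_axioms] mh by auto
  qed
  \<comment> \<open>The pushout need not be essential over \<open>M\<close>. Dividing by a submodule
    maximal among those that meet \<open>M\<close> trivially makes it so.\<close>
  obtain K where K: "smod A Z K" "ALL m:car M. ?j m:K --> m = 0[M]"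
   "ALL D'. smod A Z D' & (ALL m:car M. ?j m:D' --> m = 0[M]) & K <= D' --> D' = K"
   by(rule maximal_submod[OF Z(1) submod_zero[OF lmZ], of "%K. ALL m:car M. ?j m:K --> m = 0[M]"])
    (use j0 in simp_all)
  obtain Z' p' where Z': "Z':Mods A" "p':lhom A Z Z'" "p' ` car Z = car Z'" "ALL x:car Z. p' x = 0[Z'] <-> x:K" by(rule quotient_Mods[OF Z(1) K(1)])
  note lmZ' = ModsD(1)[OF Z'(1)]
  let ?j' = "%m. p' (?j m)"
  have j': "?j':lhom A M Z'" by(rule lcomp[OF j Z'(2)])
  interpret j': lmap A M Z' ?j' by(intro lmapI lmM lmZ' j')
  have j'inj: "inj_on ?j' (car M)" unfolding lmap_inj_iff[OF j'.lmap_axioms] using Z'(4) K(2) j.closed by blast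
  have "essential N (%x. ?j' (i x)) Z'" unfolding essential_def
  proof(intro conjI allI impI N Z'(1))
   show "(%x. ?j' (i x)):lhom A N Z'" by(rule lcomp[OF i(1) j'])
   show "inj_on (%x. ?j' (i x)) (car N)" using i(1) comp_inj_on[OF i(2) inj_on_subset[OF j'inj]] by(auto simp: lhom_def comp_def)
   fix C assume C: "smod A Z' C & C ~= {0[Z']}"
   let ?P = "{z:car Z. p' z:C}"
   have C0: "0[Z']:C" "C <= car Z'" using C by(simp_all add: submod_def)
   have KP: "K <= ?P"
   proof
    fix z assume z: "z:K"
    hence zc: "z:car Z" using K(1) unfolding submod_def by blast
    thus "z:?P" using bspec[OF Z'(4) zc] z C0(1) by simp
   qed
   have "?P ~= K"
   proof
    assume PK: "?P = K"
    have "c = 0[Z']" if c: "c:C" for c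
    proof -
     have "c:p' ` car Z" using c C0 Z'(3) by blast
     then obtain z where z: "c = p' z" "z:car Z" by blast
     thus ?thesis using PK c Z'(4) by blast
    qed
    thus False using C C0 by blast
   qed
   hence "~ (ALL m:car M. ?j m:?P --> m = 0[M])" using submod_vimage[OF lmZ lmZ' Z'(2)] C K(3) KP by blast
   then obtain m where m: "m:car M" "?j' m:C" "m ~= 0[M]" by blast
   let ?Q = "{m:car M. ?j' m:C}"
   have Q: "smod A M ?Q" using submod_vimage[OF lmM lmZ' j'] C by blast
   obtain x where x: "x:?Q" "x ~= 0[M]" "x:i ` car N" using m iess[OF Q] by blast
   have "?j' x ~= 0[Z']" using x(1,2) j'inj lmap_inj_iff[OF j'.lmap_axioms] by blast
   moreover have "?j' x:(%x. ?j' (i x)) ` car N" using x(3) by blast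
   ultimately show "EX x:C. x ~= 0[Z'] & x:(%x. ?j' (i x)) ` car N" using x(1) by blast
  qed
  \<comment> \<open>By maximality of the length of \<open>M\<close>, its embedding into the
    essential extension \<open>Z'\<close> is onto. The inverse turns the canonical map from
    \<open>Y\<close> to \<open>Z'\<close> into the required extension of \<open>h\<close>.\<close>
  hence "?j':liso A M Z'" using Mmax klen_strict[OF M Z'(1) j' j'inj] j' j'inj by(force simp: liso_def bij_betw_def)
  then obtain r where r: "r:liso A Z' M" "ALL x:car M. r (?j' x) = x" "ALL y:car Z'. ?j' (r y) = y" by(rule liso_inv[OF _ lmM])
  let ?k = "%y. r (p' (p (e (0[M], y))))"
  have "?k (g x) = h x" if x: "x:car X" for x
  proof -
   have qx: "?q x:car D" "p (?q x) = 0[Z]"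
   proof -
    show c: "?q x:car D" using x by simp
    show "p (?q x) = 0[Z]" using bspec[OF Z(4) c] imageI[OF x, of ?q] by simp
   qed
   have "e (h x, 0[Y]) = e (0[M], g x) +[D] ?q x" using x e.add[of "(0[M], g x)" "(h x, -[Y] g x)"] by(simp add: g.N.M.r_neg)
   hence "p (e (0[M], g x)) = ?j (h x)" using qx x by simp
   thus ?thesis using r(2) x by simp
  qed
  thus "EX h':lhom A Y M. ALL x:car X. h' (g x) = h x" by(metis lcomp[OF lcomp[OF lcomp[OF lcomp[OF lhom_inr[OF lmM] e(1)] Z(2)] Z'(2)] liso_lhom[OF r(1)]])
 qed(rule M)
 thus ?thesis by(rule that[OF _ i])
qed

end

section \<open>Cosyzygies of iterated extensions\<close>

context artin_alg
begin

text \<open>Induction along the construction of \<open>ext_gen A T (Suc n)\<close>. The rule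
  \<open>retract\<close> covers zero modules, isomorphisms, sums and summands at once, so an
  invariant is checked on one kind of diagram besides short exact sequences. The index of
  \<open>E\<close> is one less than that of \<open>ext_gen\<close>.\<close>

lemma ext_gen_induct:
 fixes E :: "nat => 'a fgm => bool"
 assumes T: "T:Mods A" "!!n. E n T" and retract: "!!n N N1 N2 i1 p1 i2 p2. [|E n N1; E n N2; N:Mods A; N1:Mods A; N2:Mods A;
   i1:lhom A N N1; p1:lhom A N1 N; i2:lhom A N N2; p2:lhom A N2 N;
   !!x. x:car N ==> p1 (i1 x) +[N] p2 (i2 x) = x|] ==> E n N" and ext: "!!n U X V f g. [|ses A U f X g V; E 0 U; E n V|] ==> E (Suc n) X"
 shows "N:ext_gen A T (Suc n) ==> E n N"
proof -
 have clos: "E n N" if \<X>: "!!M. M:\<X> ==> M:Mods A ==> E n M" and N: "N:addc A \<X>" for n \<X> N using N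
 proof(induction rule: add_closure.induct)
  case (base M)
  thus ?case by(rule \<X>)
 next
  case (empty_sum M)
  note l = ModsD(1)[OF empty_sum.hyps(1)] ModsD(1)[OF T(1)]
  interpret M: left_module A M by(rule l)
  show ?case by(rule retract[OF T(2) T(2) empty_sum.hyps(1) T(1) T(1) lhom_zero[OF l(2)] lhom_zero[OF l(1)] lhom_zero[OF l(2)] lhom_zero[OF l(1)]])
    (use zmodD[OF empty_sum.hyps(2)] in simp)
 next
  case (sum M N L)
  have MN: "M:Mods A" "N:Mods A" using sum.hyps add_closure_Mods by blast+
  note l = ModsD(1)[OF MN(1)] ModsD(1)[OF MN(2)] ModsD(1)[OF sum.hyps(3)]
  obtain e where e: "e:liso A L (dsum M N)" using sum.hyps(4) unfolding mod_iso_def by blast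
  obtain e' where e': "e':liso A (dsum M N) L" "ALL x:car L. e' (e x) = x" by(rule liso_inv[OF e l(3)])
  interpret e: lmap A L "dsum M N" e by(intro lmapI l dsum_lm liso_lhom e)
  interpret e': lmap A "dsum M N" L e' by(intro lmapI l dsum_lm liso_lhom e')
  interpret M: left_module A M by(rule l)
  interpret N: left_module A N by(rule l)
  show ?case using retract[OF sum.IH sum.hyps(3) MN lcomp[OF liso_lhom[OF e] lhom_dsum(1)] lcomp[OF lhom_inl[OF l(2)] liso_lhom[OF e'(1)]]
    lcomp[OF liso_lhom[OF e] lhom_dsum(2)] lcomp[OF lhom_inr[OF l(1)] liso_lhom[OF e'(1)]]] e.closed e'.add[symmetric] e' by force
 next
  case (summand M L N)
  have M: "M:Mods A" using summand.hyps add_closure_Mods by blast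
  note l = ModsD(1)[OF M] ModsD(1)[OF summand.hyps(2)] ModsD(1)[OF summand.hyps(3)]
  obtain e where e: "e:liso A M (dsum L N)" using summand.hyps(4) unfolding mod_iso_def by blast
  obtain e' where e': "e':liso A (dsum L N) M" "ALL x:car M. e' (e x) = x" "ALL y:car (dsum L N). e (e' y) = y" by(rule liso_inv[OF e l(1)])
  interpret L: left_module A L by(rule l)
  interpret N: left_module A N by(rule l)
  show ?case
   by(rule retract[OF summand.IH summand.IH summand.hyps(2) M M lcomp[OF lhom_inl[OF l(3)] liso_lhom[OF e'(1)]] lcomp[OF liso_lhom[OF e] lhom_dsum(1)]
     lhom_zero[OF l(1)] lhom_zero[OF l(2)]]) (use e'(3) in simp)
 qed
 show "N:ext_gen A T (Suc n) ==> E n N"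
 proof(induction n arbitrary: N)
  case 0
  show ?case by(rule clos[of "{T}"]) (use 0 T in simp_all)
 next
  case (Suc n)
  hence N: "N:addc A {X:Mods A. EX T1:ext_gen A T (Suc 0). EX T2:ext_gen A T (Suc n). short_exact A T1 X T2}" by(simp add: ext_prod_def)
  show ?case
  proof(rule clos[OF _ N])
   fix M assume "M:{X:Mods A. EX T1:ext_gen A T (Suc 0). EX T2:ext_gen A T (Suc n). short_exact A T1 X T2}" and M: "M:Mods A"
   then obtain U V where U: "U:ext_gen A T (Suc 0)" "V:ext_gen A T (Suc n)" "short_exact A U M V" by blast
   have "E 0 U" by(rule clos[of "{T}"]) (use U(1) T in simp_all)
   moreover obtain f g where "ses A U f M g V" using U(3) short_exact_iff_ses[OF ext_gen_Mods[OF U(1)] M ext_gen_Mods[OF U(2)]] by blast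
   ultimately show "E (Suc n) M" using ext Suc.IH[OF U(2)] by blast
  qed
 qed
qed

text \<open>The injective module must itself lie in \<open>addc A {T}\<close>: cokernels of
  different embeddings are compared only up to maps through it, and these have to be absorbed by the
  class of \<open>T\<close>.\<close>

definition cosyz :: "'a fgm => nat => 'a fgm => bool" where
 "cosyz T n U <-> (EX I C f g. injective A I & I:addc A {T} & ses A U f I g C & C:ext_gen A T (Suc n))"

lemma injective_biproduct:
 assumes I: "injective A I" "I:addc A {T}" and J: "injective A J" "J:addc A {T}"
 obtains D e e' where "injective A D" "D:addc A {T}" "e:lhom A (dsum I J) D" "e':lhom A D (dsum I J)"
  "ALL x:car I. ALL y:car J. e' (e (x, y)) = (x, y)" "ALL y:car D. e (e' y) = y"
proof -
 note M = injective_Mods[OF I(1)] injective_Mods[OF J(1)]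
 obtain D e where D: "D:Mods A" "e:liso A (dsum I J) D" by(rule Mods_dsum[OF M])
 obtain e' where e': "e':liso A D (dsum I J)" "ALL x:car (dsum I J). e' (e x) = x" "ALL y:car D. e (e' y) = y"
  by(rule liso_inv[OF D(2) dsum_lm[OF ModsD(1)[OF M(1)] ModsD(1)[OF M(2)]]])
 show ?thesis by(rule that[OF injective_dsum[OF I(1) J(1) D(1) liso_lhom[OF D(2)] liso_lhom[OF e'(1)] e'(3)] add_closure_dsum[OF I(2) J(2) D]
    liso_lhom[OF D(2)] liso_lhom[OF e'(1)] _ e'(3)]) (use e'(2) in simp)
qed

lemma cosyz_map:
 assumes s: "ses A U f I g C" and s': "ses A U' f' I' g' C'" and I': "injective A I'" and u: "u:lhom A U U'"
 obtains v w where "v:lhom A I I'" "ALL x:car U. v (f x) = f' (u x)" "w:lhom A C C'" "ALL y:car I. w (g y) = g' (v y)"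
proof -
 note d = sesD[OF s] and d' = sesD[OF s']
 obtain v where v: "v:lhom A I I'" "ALL x:car U. v (f x) = f' (u x)" by(rule injectiveD[OF I' d(4) lcomp[OF u d'(4)] d(6) d(1,2)])
 obtain w where "w:lhom A C C'" "ALL y:car I. w (g y) = g' (v y)" using u ses_factor[OF s ModsD(1)[OF d'(3)] lcomp[OF v(1) d'(5)]] by(auto simp: lhom_def Pi_iff v(2) d'(11))
 thus ?thesis by(rule that[OF v])
qed

text \<open>The identity of \<open>C\<close> and the map induced by \<open>p1 \<circ> i1 + p2 \<circ> i2\<close> differ by a map that factors through the
  injective module \<open>I\<close>.\<close>

lemma cosyz_retract:
 assumes c: "cosyz T n N1" "cosyz T n N2" and N: "N:Mods A" and m: "i1:lhom A N N1" "p1:lhom A N1 N" "i2:lhom A N N2" "p2:lhom A N2 N"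
  and id: "!!x. x:car N ==> p1 (i1 x) +[N] p2 (i2 x) = x"
 shows "cosyz T n N"
proof -
 obtain I1 C1 f1 g1 where 1: "injective A I1" "ses A N1 f1 I1 g1 C1" "C1:ext_gen A T (Suc n)" and I1: "I1:addc A {T}"
  using c(1) unfolding cosyz_def by blast
 obtain I2 C2 f2 g2 where 2: "injective A I2" "ses A N2 f2 I2 g2 C2" "C2:ext_gen A T (Suc n)" and I2: "I2:addc A {T}"
  using c(2) unfolding cosyz_def by blast
 obtain I q q' where I: "injective A I" "I:addc A {T}" and q: "q:lhom A (dsum I1 I2) I"
  "ALL x:car I1. ALL y:car I2. q' (q (x, y)) = (x, y)" by(rule injective_biproduct[OF 1(1) I1 2(1) I2])
 note d1 = sesD[OF 1(2)] and d2 = sesD[OF 2(2)] and IM = injective_Mods[OF I(1)]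
 interpret N: left_module A N by(rule ModsD(1)[OF N])
 interpret f1: lmap A N1 I1 f1 by(rule d1)
 interpret f2: lmap A N2 I2 f2 by(rule d2)
 interpret p1: lmap A N1 N p1 by(intro lmapI ModsD d1 N m)
 interpret p2: lmap A N2 N p2 by(intro lmapI ModsD d2 N m)
 interpret q: lmap A "dsum I1 I2" I q by(intro lmapI dsum_lm ModsD d1 d2 IM q)
 \<comment> \<open>\<open>N\<close> is embedded into \<open>I1 + I2\<close> by means of
   \<open>i1\<close> and \<open>i2\<close>, which are jointly injective by \<open>id\<close>. In
   this way the injective module stays in \<open>addc A {T}\<close>.\<close>
 define f where "f x = q (f1 (i1 x), f2 (i2 x))" for x
 have fl: "f:lhom A N I" unfolding f_def[abs_def] by(rule lcomp[OF lhom_dsum(3)[OF lcomp[OF m(1) d1(4)] lcomp[OF m(3) d2(4)]] q(1)])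
 have cl: "i1 x:car N1" "i2 x:car N2" "p1 (i1 x):car N" "p2 (i2 x):car N" if "x:car N" for x using m that by(simp_all add: lhom_def Pi_iff)
 have "inj_on f (car N)" unfolding lmap_inj_iff[OF lmapI[OF N.lmA ModsD(1)[OF IM] fl]]
 proof(intro ballI impI)
  fix x assume x: "x:car N" "f x = 0[I]"
  have "q' (f x) = q' (q (0[I1], 0[I2]))" using x(2) q.zero by simp
  hence "i1 x = 0[N1]" "i2 x = 0[N2]" using q(2) cl(1,2)[OF x(1)] ses_inj[OF 1(2)] ses_inj[OF 2(2)] by(auto simp: f_def)
  thus "x = 0[N]" using id[OF x(1)] by simp
 qed
 then obtain C g where s: "ses A N f I g C" using ses_cokernel[OF N IM fl] by metis
 note d = sesD[OF s] and lC = ModsD(1)[OF sesD(3)[OF s]] ModsD(1)[OF sesD(3)[OF 1(2)]] ModsD(1)[OF sesD(3)[OF 2(2)]]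
 interpret f: lmap A N I f by(rule d)
 interpret g: lmap A I C g by(rule d)
 obtain v1 w1 where 3: "v1:lhom A I I1" "ALL x:car N. v1 (f x) = f1 (i1 x)" "w1:lhom A C C1" "ALL y:car I. w1 (g y) = g1 (v1 y)"
  by(rule cosyz_map[OF s 1(2,1) m(1)])
 obtain v2 w2 where 4: "v2:lhom A I I2" "ALL x:car N. v2 (f x) = f2 (i2 x)" "w2:lhom A C C2" "ALL y:car I. w2 (g y) = g2 (v2 y)"
  by(rule cosyz_map[OF s 2(2,1) m(3)])
 obtain a1 b1 where 5: "a1:lhom A I1 I" "ALL x:car N1. a1 (f1 x) = f (p1 x)" "b1:lhom A C1 C" "ALL y:car I1. b1 (g1 y) = g (a1 y)"
  by(rule cosyz_map[OF 1(2) s I(1) m(2)])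
 obtain a2 b2 where 6: "a2:lhom A I2 I" "ALL x:car N2. a2 (f2 x) = f (p2 x)" "b2:lhom A C2 C" "ALL y:car I2. b2 (g2 y) = g (a2 y)"
  by(rule cosyz_map[OF 2(2) s I(1) m(4)])
 define r where "r y = a1 (v1 y) +[I] a2 (v2 y)" for y
 have rl: "r:lhom A I I" unfolding r_def[abs_def] by(intro lhom_add q.N.lmA lcomp[OF 3(1) 5(1)] lcomp[OF 4(1) 6(1)])
 interpret r: lmap A I I r by(intro lmapI q.N.lmA rl)
 have rf: "r (f x) = f x" if "x:car N" for x
 proof -
  have "f (p1 (i1 x)) +[I] f (p2 (i2 x)) = f x" using f.add[OF cl(3,4)[OF that]] id[OF that] by simp
  thus ?thesis using that by(simp add: r_def 3(2) 4(2) 5(2) 6(2) cl)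
 qed
 \<comment> \<open>\<open>y - r y\<close> vanishes on the image of \<open>N\<close> and so descends
   to a map from \<open>C\<close> to \<open>I\<close>. Followed by \<open>g\<close> it is the
   difference between the identity of \<open>C\<close> and the map through \<open>C1\<close> and
   \<open>C2\<close>.\<close>
 obtain t where t: "t:lhom A C I" "ALL y:car I. t (g y) = y -[I] r y"
  by(rule ses_factor[OF s q.N.lmA lhom_minus[OF q.N.lmA lhom_id rl]]) (simp add: rf)
 obtain D e where D: "D:Mods A" "e:liso A (dsum C1 C2) D" by(rule Mods_dsum[OF sesD(3)[OF 1(2)] sesD(3)[OF 2(2)]])
 obtain e' where e': "e':liso A D (dsum C1 C2)" "ALL x:car (dsum C1 C2). e' (e x) = x" by(rule liso_inv[OF D(2) dsum_lm[OF lC(2,3)]])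
 have DE: "D:ext_gen A T (Suc n)"
  by(rule ext_gen_add_closure[OF add_closure_dsum[OF add_closure.base[OF 1(3) sesD(3)[OF 1(2)]] add_closure.base[OF 2(3) sesD(3)[OF 2(2)]] D]])
 have "C:ext_gen A T (Suc n)"
 proof(rule ext_gen_retract2[OF DE _ d(3) _ t(1) _ d(5)])
  show "I:ext_gen A T (Suc n)" using ext_gen_mono[of I T 1 "Suc n"] I(2) by simp
  show "(%x. e (w1 x, w2 x)):lhom A C D" by(rule lcomp[OF lhom_dsum(3)[OF 3(3) 4(3)] liso_lhom[OF D(2)]])
  show "(%x. b1 (fst (e' x)) +[C] b2 (snd (e' x))):lhom A D C"
   by(intro lhom_add lC lcomp[OF lcomp[OF liso_lhom[OF e'(1)] lhom_dsum(1)] 5(3)] lcomp[OF lcomp[OF liso_lhom[OF e'(1)] lhom_dsum(2)] 6(3)])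
  fix x assume x: "x:car C"
  then obtain y where y: "y:car I" "g y = x" by(rule ses_lift[OF s])
  have yc: "v1 y:car I1" "v2 y:car I2" "a1 (v1 y):car I" "a2 (v2 y):car I" "w1 x:car C1" "w2 x:car C2"
   using 3(1,3) 4(1,3) 5(1) 6(1) x y(1) by(simp_all add: lhom_def Pi_iff)
  have "w1 x = g1 (v1 y)" "w2 x = g2 (v2 y)" "t x = y -[I] r y" unfolding y(2)[symmetric] using 3(4) 4(4) t(2) y(1) by simp_all
  hence "b1 (w1 x) +[C] b2 (w2 x) +[C] g (t x) = g (r y) +[C] (g y -[C] g (r y))" using y(1) yc 5(4) 6(4) by(simp add: r_def)
  also have "... = x" unfolding y(2)[symmetric] using g.closed[OF y(1)] g.closed[OF r.closed[OF y(1)]] by algebra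
  finally show "b1 (fst (e' (e (w1 x, w2 x)))) +[C] b2 (snd (e' (e (w1 x, w2 x)))) +[C] g (t x) = x" using yc bspec[OF e'(2)] by simp
 qed
 thus ?thesis unfolding cosyz_def using I s by blast
qed

text \<open>The horseshoe construction. \<open>alp\<close> extends \<open>fU\<close> to
  \<open>X\<close> by injectivity, \<open>X\<close> embeds into \<open>IU + IV\<close> by
  \<open>alp\<close> and \<open>fV b\<close>, and the cokernels form a short exact sequence from
  \<open>CU\<close> through \<open>C\<close> to \<open>CV\<close>.\<close>

lemma cosyz_extension:
 assumes s: "ses A U a X b V" and cU: "cosyz T 0 U" and cV: "cosyz T n V"
 shows "cosyz T (Suc n) X"
proof -
 note d = sesD[OF s]
 interpret a: lmap A U X a by(rule d)
 interpret b: lmap A X V b by(rule d)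
 obtain IU CU fU gU where U: "injective A IU" "IU:addc A {T}" and sU: "ses A U fU IU gU CU" and CU: "CU:ext_gen A T 1"
  using cU unfolding cosyz_def One_nat_def by blast
 obtain IV CV fV gV where V: "injective A IV" "IV:addc A {T}" and sV: "ses A V fV IV gV CV" and CV: "CV:ext_gen A T (Suc n)"
  using cV unfolding cosyz_def by blast
 note dU = sesD[OF sU] and dV = sesD[OF sV]
 interpret fU: lmap A U IU fU by(rule dU)
 interpret gU: lmap A IU CU gU by(rule dU)
 interpret fV: lmap A V IV fV by(rule dV)
 interpret gV: lmap A IV CV gV by(rule dV)
 obtain alp where alp: "alp:lhom A X IU" "ALL u:car U. alp (a u) = fU u" by(rule injectiveD[OF U(1) d(4) dU(4) d(6) d(1,2)])
 interpret alp: lmap A X IU alp by(intro lmapI a.N.lmA fU.N.lmA alp)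
 obtain D e e' where DI: "injective A D" "D:addc A {T}" and e: "e:lhom A (dsum IU IV) D" "e':lhom A D (dsum IU IV)"
  "ALL x:car IU. ALL y:car IV. e' (e (x, y)) = (x, y)" "ALL y:car D. e (e' y) = y" by(rule injective_biproduct[OF U V])
 note D = injective_Mods[OF DI(1)]
 interpret e: lmap A "dsum IU IV" D e by(intro lmapI dsum_lm fU.N.lmA fV.N.lmA ModsD(1)[OF D] e)
 have ee: "e' (e (x, y)) = (x, y)" if "x:car IU" "y:car IV" for x y using that e(3) by blast
 have ei: "x = x' & y = y'" if "x:car IU" "y:car IV" "x':car IU" "y':car IV" "e (x, y) = e (x', y')" for x y x' y'
  using arg_cong[OF that(5), of e'] unfolding ee[OF that(1,2)] ee[OF that(3,4)] by simp
 let ?F = "%x. e (alp x, fV (b x))"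
 have F: "?F:lhom A X D" by(rule lcomp[OF lhom_dsum(3)[OF alp(1) lcomp[OF d(5) dV(4)]] e(1)])
 have Fk: "EX u:car U. a u = x & alp x = fU u" if x: "x:car X" "fV (b x) = 0[IV]" for x
 proof -
  have "b x = 0[V]" by(rule ses_inj[OF sV]) (use x in simp_all)
  then obtain u where "u:car U" "a u = x" by(rule ses_kernel[OF s x(1)])
  thus ?thesis using alp(2) by blast
 qed
 have "inj_on ?F (car X)" unfolding lmap_inj_iff[OF lmapI[OF a.N.lmA ModsD(1)[OF D] F]]
 proof(intro ballI impI)
  fix x assume x: "x:car X" "?F x = 0[D]"
  hence *: "alp x = 0[IU]" "fV (b x) = 0[IV]" using ei[of "alp x" "fV (b x)" "0[IU]" "0[IV]"] e.zero by simp_all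
  then obtain u where u: "u:car U" "a u = x" "fU u = 0[IU]" using Fk[OF x(1) *(2)] unfolding *(1) by(elim bexE) simp
  show "x = 0[X]" unfolding u(2)[symmetric] ses_inj[OF sU u(1,3)] by simp
 qed
 then obtain C G where sX: "ses A X ?F D G C" using ses_cokernel[OF d(2) D F] by metis
 note dX = sesD[OF sX]
 interpret G: lmap A D C G by(rule dX)
 have l1: "(%y. G (e (y, 0[IV]))):lhom A IU C" by(rule lcomp[OF lcomp[OF lhom_inl[OF fV.N.lmA] e(1)] dX(5)])
 obtain cl where cl: "cl:lhom A CU C" "ALL y:car IU. cl (gU y) = G (e (y, 0[IV]))"
 proof(rule ses_factor[OF sU G.N.lmA l1])
  fix u assume u: "u:car U"
  hence "?F (a u) = e (fU u, 0[IV])" using alp(2) d(11) by simp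
  thus "G (e (fU u, 0[IV])) = 0[C]" using dX(11)[of "a u"] u by simp
 qed
 have m1: "(%z. gV (snd (e' z))):lhom A D CV" by(rule lcomp[OF lcomp[OF e(2) lhom_dsum(2)] dV(5)])
 obtain mu where mu: "mu:lhom A C CV" "ALL z:car D. mu (G z) = gV (snd (e' z))" by(rule ses_factor[OF sX gV.N.lmA m1]) (simp add: ee dV(11))
 have se: "ses A CU cl C mu CV"
 proof(rule sesI[OF dU(3) dX(3) dV(3) cl(1) mu(1)])
  fix c assume "c:car CU" and c0: "cl c = 0[C]"
  then obtain y where y: "y:car IU" "gU y = c" by(auto elim: ses_lift[OF sU])
  have "G (e (y, 0[IV])) = cl (gU y)" using cl(2) y(1) by simp
  hence G0: "G (e (y, 0[IV])) = 0[C]" unfolding y(2) c0 .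
  obtain x where x: "x:car X" "?F x = e (y, 0[IV])" by(rule ses_kernel[OF sX _ G0]) (use y in simp)
  hence yx: "alp x = y" "fV (b x) = 0[IV]" using ei[of "alp x" "fV (b x)" y "0[IV]"] y by simp_all
  then obtain u where "u:car U" "y = fU u" using Fk[OF x(1)] by auto
  thus "c = 0[CU]" using y dU(11) by auto
 next
  fix z assume "z:car CV"
  then obtain y where y: "y:car IV" "gV y = z" by(rule ses_lift[OF sV])
  thus "EX c:car C. mu c = z" using mu(2) ee[of "0[IU]" y] by(intro bexI[of _ "G (e (0[IU], y))"]) simp_all
 next
  fix t assume "t:car CU"
  then obtain y where "y:car IU" "gU y = t" by(rule ses_lift[OF sU])
  thus "mu (cl t) = 0[CV]" using cl(2) mu(2) ee[of y "0[IV]"] by auto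
 next
  fix c assume "c:car C" and c0: "mu c = 0[CV]"
  then obtain z where z: "z:car D" "G z = c" by(auto elim: ses_lift[OF sX])
  obtain y w where yw: "e' z = (y, w)" by fastforce
  have "e' z:car (dsum IU IV)" using e(2) z(1) by(auto simp: lhom_def)
  hence ywc: "y:car IU" "w:car IV" using yw by simp_all
  have zyw: "z = e (y, w)" using bspec[OF e(4) z(1)] yw by simp
  have "gV w = 0[CV]" using c0 mu(2) z yw by auto
  then obtain v where v: "v:car V" "fV v = w" by(rule ses_kernel[OF sV ywc(2)])
  obtain x where x: "x:car X" "b x = v" by(rule ses_lift[OF s v(1)])
  have "y -[IU] alp x +[IU] alp x = y" using ywc(1) alp.closed[OF x(1)] by algebra
  hence "z = e (y -[IU] alp x, 0[IV]) +[D] ?F x" using zyw e.add[of "(y -[IU] alp x, 0[IV])" "(alp x, fV (b x))"] x v ywc by simp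
  hence "cl (gU (y -[IU] alp x)) = c" using z(2) dX(11)[OF x(1)] v bspec[OF cl(2), of ] ywc x by(simp del: gU.minus)
  thus "EX t:car CU. cl t = c" by(rule) (use ywc x in simp)
 qed
 show ?thesis using ext_gen_extension[OF _ dX(3) CU CV] short_exact_iff_ses[OF dU(3) dX(3) dV(3)] se cosyz_def sX DI by blast
qed

lemma projective_add_closure:
 assumes "projective A P" shows "P:addc A {rgm A}"
proof -
 note P = projective_Mods[OF assms]
 obtain Q g where Q: "projective A Q" "Q:addc A {rgm A}" "g:lhom A Q P" "g ` car Q = car P" by(rule enough_projectives[OF P])
 obtain h where h: "h:lhom A P Q" "ALL x:car P. g (h x) = x" using projectiveD[OF assms Q(3) lhom_id Q(4) projective_Mods[OF Q(1)] P] by blast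
 show ?thesis by(rule add_closure_retract[OF Q(2) P h(1) Q(3)]) (use h(2) in simp)
qed

text \<open>If \<open>0 \<rightarrow> U \<rightarrow> P \<rightarrow> V \<rightarrow> 0\<close> is exact with \<open>P\<close> projective and \<open>I\<close> is an injective module
  containing \<open>U\<close>, then \<open>0 \<rightarrow> P \<rightarrow> V \<oplus> I \<rightarrow> I/U \<rightarrow> 0\<close> is exact.\<close>

theorem cosyzygy_step:
 assumes W: "W:Mods A"
 obtains W' where "W':Mods A" "ALL n U P V f g. projective A P & ses A U f P g V & U:ext_gen A W (Suc n) -->
  V:ext_gen A W' (Suc (Suc n))"
proof -
 obtain IW fW where IW: "injective A IW" "fW:lhom A W IW" "inj_on fW (car W)" by(rule enough_injectives[OF W])
 obtain CW gW where sW: "ses A W fW IW gW CW" by(rule ses_cokernel[OF W injective_Mods[OF IW(1)] IW(2,3)])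
 \<comment> \<open>An injective module containing \<open>W\<close> and its cokernel are what
   \<open>cosyz T n W\<close> asks for; the regular module is added for the sake of the projective
   term \<open>P\<close> of the final sequence.\<close>
 let ?S = "%i::nat. if i = 0 then CW else if i = 1 then IW else rgm A"
 obtain T where T: "T:Mods A" "ALL i<3. ?S i:addc A {T}" by(metis sesD(2,3)[OF sW] regular_module_Mods(1)[OF ring_A] dominating_module[of 3 ?S])
 have CT: "CW:addc A {T}" and IT: "IW:addc A {T}" and AT: "rgm A:addc A {T}"
  using T(2)[rule_format, of 0] T(2)[rule_format, of 1] T(2)[rule_format, of 2] by simp_all
 have "cosyz T n W" for n unfolding cosyz_def using IW sW IT ext_gen_mono[of CW T 1 "Suc n"] CT by auto
 hence cos: "cosyz T n U" if "U:ext_gen A W (Suc n)" for U n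
 proof(rule ext_gen_induct[where E = "cosyz T", OF W _ _ _ that])
  fix n N N1 N2 i1 p1 i2 p2
  assume a: "cosyz T n N1" "cosyz T n N2" "N:Mods A" "i1:lhom A N N1" "p1:lhom A N1 N"
   "i2:lhom A N N2" "p2:lhom A N2 N" "!!x. x:car N ==> p1 (i1 x) +[N] p2 (i2 x) = x"
  show "cosyz T n N" by(rule cosyz_retract[OF a])
 qed(use cosyz_extension in simp_all)
 have "V:ext_gen A T (Suc (Suc n))" if P: "projective A P" and s: "ses A U f P g V" and U: "U:ext_gen A W (Suc n)" for n U P V f g
 proof -
  note d = sesD[OF s]
  interpret f: lmap A U P f by(rule d)
  interpret g: lmap A P V g by(rule d)
  obtain I C h q where I: "injective A I" and sI: "ses A U h I q C" and C: "C:ext_gen A T (Suc n)" using cos[OF U] unfolding cosyz_def by blast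
  note dI = sesD[OF sI]
  interpret h: lmap A U I h by(rule dI)
  interpret q: lmap A I C q by(rule dI)
  obtain p where p: "p:lhom A P I" "ALL u:car U. p (f u) = h u" by(rule injectiveD[OF I d(4) dI(4) d(6) d(1,2)])
  interpret p: lmap A P I p by(intro lmapI f.N.lmA h.N.lmA p)
  obtain D e e' where D: "D:Mods A" and e: "e:lhom A (dsum V I) D" "e':lhom A D (dsum V I)"
   "ALL x:car (dsum V I). e' (e x) = x" "ALL y:car D. e (e' y) = y" by(rule biproduct_Mods[OF d(3) dI(2)])
  interpret e: lmap A "dsum V I" D e by(intro lmapI dsum_lm g.N.lmA h.N.lmA ModsD(1)[OF D] e)
  have ee: "e' (e (x, y)) = (x, y)" if "x:car V" "y:car I" for x y using that by(intro bspec[OF e(3)]) simp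
  obtain ps where ps: "ps:lhom A V C" "ALL x:car P. ps (g x) = q (p x)" by(rule ses_factor[OF s q.N.lmA lcomp[OF p(1) dI(5)]]) (simp add: p(2) dI(11))
  interpret ps: lmap A V C ps by(intro lmapI g.N.lmA q.N.lmA ps)
  \<comment> \<open>\<open>p\<close> extends \<open>h\<close> to \<open>P\<close>, and
    \<open>ps\<close> is the map it induces on cokernels. The sequence is the total complex of the
    square formed by \<open>g\<close>, \<open>p\<close>, \<open>ps\<close> and \<open>q\<close>; it
    is exact because both rows have the same kernel \<open>U\<close>.\<close>
  let ?F = "%x. e (g x, p x)" and ?G = "%z. q (snd (e' z)) -[C] ps (fst (e' z))"
  have F: "?F:lhom A P D" by(rule lcomp[OF lhom_dsum(3)[OF d(5) p(1)] e(1)])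
  have "ses A P ?F D ?G C"
  proof(rule sesI[OF d(2) D dI(3) F])
   show "?G:lhom A D C" by(rule lhom_minus[OF q.N.lmA lcomp[OF lcomp[OF e(2) lhom_dsum(2)] dI(5)] lcomp[OF lcomp[OF e(2) lhom_dsum(1)] ps(1)]])
  next
   fix x assume x: "x:car P" "?F x = 0[D]"
   hence x0: "g x = 0[V]" "p x = 0[I]" using ee[of "g x" "p x"] ee[of "0[V]" "0[I]"] e.zero by simp_all
   obtain u where u: "u:car U" "f u = x" by(rule ses_kernel[OF s x(1) x0(1)])
   thus "x = 0[P]" using p(2) x0 ses_inj[OF sI u(1)] by auto
  next
   fix c assume c: "c:car C"
   then obtain y where "y:car I" "q y = c" by(rule ses_lift[OF sI])
   thus "EX z:car D. ?G z = c" using ee[of "0[V]" y] c by(intro bexI[of _ "e (0[V], y)"]) (simp_all add: q.N.M.minus_eq)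
  next
   fix x assume "x:car P"
   thus "?G (?F x) = 0[C]" using ee[of "g x" "p x"] ps(2) by simp
  next
   fix z assume z: "z:car D" and z0: "?G z = 0[C]"
   obtain v y where vy: "e' z = (v, y)" by fastforce
   have "e' z:car (dsum V I)" using e(2) z by(auto simp: lhom_def)
   hence vyc: "v:car V" "y:car I" using vy by simp_all
   obtain x where x: "x:car P" "g x = v" by(rule ses_lift[OF s vyc(1)])
   have q0: "q (y -[I] p x) = 0[C]" using z0 vy vyc x ps(2) by auto
   obtain u where u: "u:car U" "h u = y -[I] p x" by(rule ses_kernel[OF sI _ q0]) (use vyc x in simp)
   have px: "p x:car I" using x by simp
   have "p (f u +[P] x) = (y -[I] p x) +[I] p x" using x u p(2) by simp
   also have "... = y" using vyc(2) px by algebra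
   finally show "EX x:car P. ?F x = z" using bspec[OF e(4) z] vy x u d(11) vyc by(intro bexI[of _ "f u +[P] x"]) simp_all
  qed
  hence se: "short_exact A P D C" using short_exact_iff_ses[OF d(2) D dI(3)] by blast
  have "P:ext_gen A T 1" using add_closure_trans[OF projective_add_closure[OF P]] AT by simp
  note DT = ext_gen_extension[OF se D this C]
  show ?thesis
  proof(rule ext_gen_retract[OF DT d(3) lcomp[OF lhom_inl[OF h.N.lmA] e(1)] lcomp[OF e(2) lhom_dsum(1)]])
   show "fst (e' (e (x, 0[I]))) = x" if "x:car V" for x using ee[of x "0[I]"] that by simp
  qed
 qed
 thus ?thesis by(intro that[OF T(1)] allI impI) (elim conjE)
qed

end

subsection \<open>Complexes and homotopies\<close>

text \<open>Boundedness is left out because projective resolutions of bounded complexes are in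
  general infinite to the left.\<close>

definition cplx :: "'a ring => 'a fgcpx => bool" where
 "cplx A X <-> ring A & (ALL n. ob X n:Mods A & df X n:lhom A (ob X n) (ob X (n+1)) &
   (ALL x:el X n. df X (n+1) (df X n x) = 0[ob X (n+2)]))"

lemma Cb_cplx: "ring A ==> X:Cb A ==> cplx A X"
 by(simp add: Cb_def cplx_def)

lemma Cb_iff: "ring A ==> X:Cb A <-> cplx A X & (EX N. ALL n. \<bar>n\<bar> > N --> zmod (ob X n))"
 by(simp add: Cb_def cplx_def)

locale cx =
 fixes A :: "'a ring" and X :: "'a fgcpx"
 assumes cplx: "cplx A X"
begin

lemma ob_Mods: "ob X n:Mods A" and d_lhom: "df X n:lhom A (ob X n) (ob X (n+1))"
 using cplx by(simp_all add: cplx_def)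

sublocale M: left_module A "ob X n" for n by(rule ModsD(1)[OF ob_Mods])

lemmas lm = M.lmA

sublocale d: lmap A "ob X n" "ob X (n+1)" "df X n" for n by(intro lmapI lm d_lhom)

lemma d_lhom': "df X (n-1):lhom A (ob X (n-1)) (ob X n)"
 using d_lhom[of "n-1"] by simp

sublocale d': lmap A "ob X (n-1)" "ob X n" "df X (n-1)" for n by(intro lmapI lm d_lhom')

lemma dd [simp]: "x:el X n ==> df X (n+1) (df X n x) = 0[ob X (n+2)]"
 using cplx by(simp add: cplx_def)

lemma dd' [simp]: "x:el X (n-1) ==> df X n (df X (n-1) x) = 0[ob X (n+1)]"
 using dd[of x "n-1"] by(simp add: add.commute)

end

locale cxmap = X: cx A X + Y: cx A Y for A :: "'a ring" and X Y and f :: "'a fgmap" +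
 assumes map: "f:cmap A X Y"
begin

lemma f_lhom: "f n:lhom A (ob X n) (ob Y n)"
 using map by(simp add: chain_maps_def)

sublocale f: lmap A "ob X n" "ob Y n" "f n" for n by(intro lmapI X.lm Y.lm f_lhom)

lemma comm: "x:el X n ==> f (n+1) (df X n x) = df Y n (f n x)"
 using map by(simp add: chain_maps_def)

lemma comm': "x:el X (n-1) ==> f n (df X (n-1) x) = df Y (n-1) (f (n-1) x)"
 using comm[of x "n-1"] by simp

end

lemma cxI: "cplx A X ==> cx A X" by(simp add: cx_def)

lemma cxmapI: "cplx A X ==> cplx A Y ==> f:cmap A X Y ==> cxmap A X Y f"
 by(simp add: cxmap_def cxmap_axioms_def cx_def)

lemma cmI:
 assumes "!!n. f n:lhom A (ob X n) (ob Y n)"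
  "!!n x. x:el X n ==> f (n+1) (df X n x) = df Y n (f n x)"
 shows "f:cmap A X Y" using assms by(simp add: chain_maps_def)

lemma cm_comp: "f:cmap A X Y ==> g:cmap A Y Z ==> ccomp g f:cmap A X Z"
 unfolding chain_maps_def ccomp_def by simp (simp add: lhom_def Pi_iff)

lemma cm_id: "cid:cmap A X X"
 by(simp add: chain_maps_def cid_def lhom_id)

lemma homotopicI:
 assumes "!!n. h n:lhom A (ob X n) (ob Y (n-1))"
  "!!n x. x:el X n ==> f n x -[ob Y n] g n x = df Y (n-1) (h n x) +[ob Y n] h (n+1) (df X n x)"
 shows "htp A X Y f g" using assms unfolding homotopic_def by blast

locale htpy = X: cx A X + Y: cx A Y for A :: "'a ring" and X Y and f g :: "'a fgmap" +
 fixes h :: "'a fgmap"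
 assumes h_lhom: "h n:lhom A (ob X n) (ob Y (n-1))" and eq: "x:el X n ==> f n x -[ob Y n] g n x = df Y (n-1) (h n x) +[ob Y n] h (n+1) (df X n x)"
begin

sublocale h: lmap A "ob X n" "ob Y (n-1)" "h n" for n by(intro lmapI X.lm Y.lm h_lhom)

lemma hd_closed [simp]: "x:el X n ==> h (n+1) (df X n x):el Y n"
 using h.closed[of "df X n x" "n+1"] by simp

end

lemma homotopicE:
 assumes "htp A X Y f g" "cplx A X" "cplx A Y"
 obtains h where "htpy A X Y f g h" using assms unfolding homotopic_def htpy_def htpy_axioms_def cx_def by blast

context
 fixes A :: "'a ring" and X Y :: "'a fgcpx"
 assumes X: "cplx A X" and Y: "cplx A Y"
begin

interpretation X: cx A X by(rule cxI[OF X])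
interpretation Y: cx A Y by(rule cxI[OF Y])

lemma homotopic_zeroI:
 assumes "f:cmap A X Y" "g:cmap A X Y" "!!n x. x:el X n ==> f n x = g n x"
 shows "htp A X Y f g"
proof(rule homotopicI)
 interpret g: cxmap A X Y g by(intro cxmapI X Y assms)
 fix n
 show "(%_. 0[ob Y (n-1)]):lhom A (ob X n) (ob Y (n-1))" by(rule lhom_zero[OF Y.lm])
 fix x assume "x:el X n"
 thus "f n x -[ob Y n] g n x = df Y (n-1) 0[ob Y (n-1)] +[ob Y n] 0[ob Y (n+1-1)]" by(simp add: assms(3))
qed

lemma homotopic_refl: "f:cmap A X Y ==> htp A X Y f f"
 by(rule homotopic_zeroI) simp_all

text \<open>Symmetry, transitivity and additivity are instances of subtracting one homotopy from
  another, where \<open>k\<close> and \<open>k'\<close> are any maps with the right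
  difference.\<close>

lemma homotopic_minus:
 assumes "htp A X Y f g" "htp A X Y f' g'"
  "!!n x. x:el X n ==> k n x -[ob Y n] k' n x = (f n x -[ob Y n] g n x) -[ob Y n] (f' n x -[ob Y n] g' n x)"
 shows "htp A X Y k k'"
proof -
 obtain h where "htpy A X Y f g h" by(rule homotopicE[OF assms(1) X Y])
 then interpret h: htpy A X Y f g h .
 obtain h' where "htpy A X Y f' g' h'" by(rule homotopicE[OF assms(2) X Y])
 then interpret h': htpy A X Y f' g' h' .
 show ?thesis
 proof(rule homotopicI)
  fix n
  show "(%x. h n x -[ob Y (n-1)] h' n x):lhom A (ob X n) (ob Y (n-1))" by(intro lhom_minus Y.lm h.h_lhom h'.h_lhom)
  fix x assume x: "x:el X n"
  note c = Y.d'.closed[OF h.h.closed[OF x]] Y.d'.closed[OF h'.h.closed[OF x]] h.hd_closed[OF x] h'.hd_closed[OF x]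
  have "(df Y (n-1) (h n x) +[ob Y n] h (n+1) (df X n x)) -[ob Y n] (df Y (n-1) (h' n x) +[ob Y n] h' (n+1) (df X n x)) =
   (df Y (n-1) (h n x) -[ob Y n] df Y (n-1) (h' n x)) +[ob Y n] (h (n+1) (df X n x) -[ob Y n] h' (n+1) (df X n x))" using c by algebra
  thus "k n x -[ob Y n] k' n x = df Y (n-1) (h n x -[ob Y (n-1)] h' n x) +[ob Y n]
    (h (n+1) (df X n x) -[ob Y (n+1-1)] h' (n+1) (df X n x))" using x by(simp add: assms(3) h.eq h'.eq)
 qed
qed

lemma homotopic_sym:
 assumes "htp A X Y f g" and m: "f:cmap A X Y" "g:cmap A X Y"
 shows "htp A X Y g f"
proof(rule homotopic_minus[OF homotopic_refl[OF m(1)] assms(1)])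
 interpret f: cxmap A X Y f by(intro cxmapI X Y m)
 interpret g: cxmap A X Y g by(intro cxmapI X Y m)
 fix n x assume "x:el X n"
 note f.f.closed[OF this] g.f.closed[OF this]
 thus "g n x -[ob Y n] f n x = (f n x -[ob Y n] f n x) -[ob Y n] (f n x -[ob Y n] g n x)" by algebra
qed

lemma homotopic_trans:
 assumes "htp A X Y f g" "htp A X Y g k" and
  m: "f:cmap A X Y" "g:cmap A X Y" "k:cmap A X Y"
 shows "htp A X Y f k"
proof(rule homotopic_minus[OF assms(1) homotopic_sym[OF assms(2) m(2,3)]])
 interpret f: cxmap A X Y f by(intro cxmapI X Y m)
 interpret g: cxmap A X Y g by(intro cxmapI X Y m)
 interpret k: cxmap A X Y k by(intro cxmapI X Y m)
 fix n x assume "x:el X n"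
 note f.f.closed[OF this] g.f.closed[OF this] k.f.closed[OF this]
 thus "f n x -[ob Y n] k n x = (f n x -[ob Y n] g n x) -[ob Y n] (k n x -[ob Y n] g n x)" by algebra
qed

lemma homotopic_add:
 assumes "htp A X Y f g" "htp A X Y f' g'" and
  m: "f:cmap A X Y" "g:cmap A X Y" "f':cmap A X Y" "g':cmap A X Y"
 shows "htp A X Y (%n x. f n x +[ob Y n] f' n x) (%n x. g n x +[ob Y n] g' n x)"
proof(rule homotopic_minus[OF assms(1) homotopic_sym[OF assms(2) m(3,4)]])
 interpret f: cxmap A X Y f by(intro cxmapI X Y m)
 interpret g: cxmap A X Y g by(intro cxmapI X Y m)
 interpret f': cxmap A X Y f' by(intro cxmapI X Y m)
 interpret g': cxmap A X Y g' by(intro cxmapI X Y m)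
 fix n x assume "x:el X n"
 note f.f.closed[OF this] g.f.closed[OF this] f'.f.closed[OF this] g'.f.closed[OF this]
 thus "(f n x +[ob Y n] f' n x) -[ob Y n] (g n x +[ob Y n] g' n x) = (f n x -[ob Y n] g n x) -[ob Y n] (g' n x -[ob Y n] f' n x)" by algebra
qed

lemma htp_left:
 assumes Z: "cplx A Z" and "htp A X Y f g" and u: "u:cmap A Y Z" and m: "f:cmap A X Y" "g:cmap A X Y"
 shows "htp A X Z (ccomp u f) (ccomp u g)"
proof -
 interpret u: cxmap A Y Z u by(intro cxmapI Y Z u)
 interpret f: cxmap A X Y f by(intro cxmapI X Y m)
 interpret g: cxmap A X Y g by(intro cxmapI X Y m)
 obtain h where "htpy A X Y f g h" by(rule homotopicE[OF assms(2) X Y])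
 then interpret h: htpy A X Y f g h .
 show ?thesis
 proof(rule homotopicI)
  fix n
  show "(%x. u (n-1) (h n x)):lhom A (ob X n) (ob Z (n-1))" by(rule lcomp[OF h.h_lhom u.f_lhom])
  fix x assume x: "x:el X n"
  have "ccomp u f n x -[ob Z n] ccomp u g n x = u n (f n x -[ob Y n] g n x)" using x by(simp add: ccomp_def)
  thus "ccomp u f n x -[ob Z n] ccomp u g n x = df Z (n-1) (u (n-1) (h n x)) +[ob Z n] u (n+1-1) (h (n+1) (df X n x))"
   using x by(simp add: h.eq u.comm')
 qed
qed

lemma htp_right:
 assumes W: "cplx A W" and "htp A X Y f g" and u: "u:cmap A W X" and m: "f:cmap A X Y" "g:cmap A X Y"
 shows "htp A W Y (ccomp f u) (ccomp g u)"
proof -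
 interpret u: cxmap A W X u by(intro cxmapI X W u)
 obtain h where "htpy A X Y f g h" by(rule homotopicE[OF assms(2) X Y])
 then interpret h: htpy A X Y f g h .
 show ?thesis by(rule homotopicI, rule lcomp[OF u.f_lhom h.h_lhom]) (simp add: ccomp_def u.comm h.eq)
qed

end

subsection \<open>Quasi-isomorphisms\<close>

definition coh_class :: "'a fgcpx => int => 'a list set => 'a list set set" where
 "coh_class X n z = {b +[ob X n] z | b. b:coboundaries X n}"

lemma cohomology_eq: "cohomology X n = coh_class X n ` cocycles X n"
 by(auto simp: cohomology_def A_RCOSETS_def RCOSETS_def r_coset_def coh_class_def)

lemma cocycle_iff: "z:cocycles X n <-> z:el X n & df X n z = 0[ob X (n+1)]"
 by(simp add: cocycles_def a_kernelD)

context cx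
begin

lemma coh_class_alt: "z:el X n ==> coh_class X n z = (%v. z +[ob X n] df X (n-1) v) ` el X (n-1)"
 unfolding coh_class_def coboundaries_def setcompr_eq_image Collect_mem_eq image_image by(rule) (simp_all add: M.a_comm)

lemma coh_class_eq:
 assumes z: "z:el X n" "z':el X n"
 shows "coh_class X n z = coh_class X n z' <-> (EX v:el X (n-1). z = z' +[ob X n] df X (n-1) v)"
proof
 assume "coh_class X n z = coh_class X n z'"
 moreover have "z:coh_class X n z" unfolding coh_class_alt[OF z(1)] by(rule image_eqI[of _ _ "0[ob X (n-1)]"]) (use z in simp_all)
 ultimately show "EX v:el X (n-1). z = z' +[ob X n] df X (n-1) v" by(simp add: coh_class_alt[OF z(2)] image_iff)
next
 have sub: "coh_class X n (z +[ob X n] df X (n-1) v) <= coh_class X n z" if c: "z:el X n" "v:el X (n-1)" for z v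
 proof
  fix y assume "y:coh_class X n (z +[ob X n] df X (n-1) v)"
  then obtain u where u: "u:el X (n-1)" "y = z +[ob X n] df X (n-1) v +[ob X n] df X (n-1) u" using c by(auto simp: coh_class_alt)
  hence "y = z +[ob X n] df X (n-1) (v +[ob X (n-1)] u)" using c by(simp add: M.a_assoc)
  thus "y:coh_class X n z" unfolding coh_class_alt[OF c(1)] by(rule) (use c u in simp)
 qed
 assume "EX v:el X (n-1). z = z' +[ob X n] df X (n-1) v"
 then obtain v where v: "v:el X (n-1)" and zv: "z = z' +[ob X n] df X (n-1) v" by blast
 have "z' = z +[ob X n] df X (n-1) (-[ob X (n-1)] v)" using v z by(simp add: zv M.a_assoc M.r_neg)
 thus "coh_class X n z = coh_class X n z'" using sub[OF z(2) v] sub[OF z(1), of "-[ob X (n-1)] v"] v by(simp add: zv)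
qed

end

context cxmap
begin

lemma coh_map_class:
 assumes z: "z:el X n"
 shows "cohomology_map Y f n (coh_class X n z) = coh_class Y n (f n z)"
proof -
 have "cohomology_map Y f n (coh_class X n z) =
   (%(u, v). df Y (n-1) u +[ob Y n] f n (z +[ob X n] df X (n-1) v)) ` (el Y (n-1) \<times> el X (n-1))"
  unfolding cohomology_map_def X.coh_class_alt[OF z] set_add_def' coboundaries_def by blast
 also have "... = (%(u, v). f n z +[ob Y n] df Y (n-1) (u +[ob Y (n-1)] f (n-1) v)) ` (el Y (n-1) \<times> el X (n-1))"
  by(rule) (use z in "simp_all add: case_prod_unfold mem_Times_iff comm' Y.M.a_ac")
 also have "... = (%u. f n z +[ob Y n] df Y (n-1) u) ` (%(u, v). u +[ob Y (n-1)] f (n-1) v) ` (el Y (n-1) \<times> el X (n-1))"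
  by(simp add: image_image case_prod_unfold)
 also have "(%(u, v). u +[ob Y (n-1)] f (n-1) v) ` (el Y (n-1) \<times> el X (n-1)) = el Y (n-1)"
  by(intro subset_antisym image_subsetI subsetI, simp add: case_prod_unfold mem_Times_iff)
   (rule image_eqI[of _ _ "(_, 0[ob X (n-1)])"], simp_all)
 finally show ?thesis using z by(simp add: Y.coh_class_alt)
qed

lemma cocycle_map: "z:cocycles X n ==> f n z:cocycles Y n"
 by(simp add: cocycle_iff flip: comm)

lemma cohomology_map_closed: "c:cohomology X n ==> cohomology_map Y f n c:cohomology Y n"
 using cocycle_map unfolding cohomology_eq by(auto simp: coh_map_class cocycle_iff)

end

definition qis :: "'a ring => 'a fgcpx => 'a fgcpx => 'a fgmap => bool" where
 "qis A W X s <-> cxmap A W X s & (ALL n. bij_betw (cohomology_map X s n) (cohomology W n) (cohomology X n))"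

lemma quasi_isos_iff: "cplx A W ==> cplx A X ==> s:quasi_isos A W X <-> qis A W X s"
 by(simp add: quasi_isos_def qis_def cxmap_def cxmap_axioms_def cx_def)

lemma qis_cxmap: "qis A W X s ==> cxmap A W X s"
 by(simp add: qis_def)

lemma qis_map: "qis A W X s ==> s:cmap A W X"
 by(simp add: qis_def cxmap.map)

text \<open>The condition says that the mapping cone of \<open>s\<close> is exact.\<close>

lemma qisI:
 assumes "cxmap A W X s" and ex: "!!n x y. [|x:el W (n+1); df W (n+1) x = 0[ob W (n+1+1)]; y:el X n; s (n+1) x = df X n y|] ==>
   EX w:el W n. EX v:el X (n-1). x = df W n w & y = s n w +[ob X n] df X (n-1) v"
 shows "qis A W X s"
proof -
 interpret cxmap A W X s by fact
 have "inj_on (cohomology_map X s n) (cohomology W n)" for n unfolding cohomology_eq inj_on_def ball_simps(9)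
 proof(intro ballI impI)
  fix w w' assume "w:cocycles W n" "w':cocycles W n" and eq: "cohomology_map X s n (coh_class W n w) = cohomology_map X s n (coh_class W n w')"
  hence w: "w:el W n" "w':el W n" "df W n w = 0[ob W (n+1)]" "df W n w' = 0[ob W (n+1)]" by(simp_all add: cocycle_iff)
  obtain y where y: "y:el X (n-1)" "s n w = s n w' +[ob X n] df X (n-1) y" using eq w by(auto simp: coh_map_class Y.coh_class_eq)
  have "s n (w -[ob W n] w') = df X (n-1) y"
  proof -
   have "s n w':el X n" "df X (n-1) y:el X n" using w y by simp_all
   hence "(s n w' +[ob X n] df X (n-1) y) -[ob X n] s n w' = df X (n-1) y" by algebra
   thus ?thesis using w y(2) by simp
  qed
  then obtain v where v: "v:el W (n-1)" "w -[ob W n] w' = df W (n-1) v" using ex[of "w -[ob W n] w'" "n-1" y] w y by auto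
  have "w = w' +[ob W n] (w -[ob W n] w')" using w(1,2) by algebra
  thus "coh_class W n w = coh_class W n w'" using w v by(auto simp: X.coh_class_eq)
 qed
 moreover have "cohomology X n <= cohomology_map X s n ` cohomology W n" for n
 proof
  fix c assume "c:cohomology X n"
  then obtain x where x: "x:el X n" "df X n x = 0[ob X (n+1)]" "c = coh_class X n x" unfolding cohomology_eq by(auto simp: cocycle_iff)
  obtain w v where w: "w:el W n" "v:el X (n-1)" "df W n w = 0[ob W (n+1)]" "x = s n w +[ob X n] df X (n-1) v"
   using ex[of "0[ob W (n+1)]" n x] x by auto
  have "c = cohomology_map X s n (coh_class W n w)" using w x by(auto simp: coh_map_class Y.coh_class_eq)
  thus "c:cohomology_map X s n ` cohomology W n" using w by(simp add: cohomology_eq cocycle_iff)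
 qed
 ultimately show ?thesis using cohomology_map_closed cxmap_axioms unfolding qis_def bij_betw_def by blast
qed

context
 fixes A :: "'a ring" and W X s
 assumes s: "qis A W X s"
begin

interpretation cxmap A W X s by(rule qis_cxmap[OF s])

lemma qis_surj:
 assumes x: "x:el X n" "df X n x = 0[ob X (n+1)]"
 obtains w y where "w:el W n" "df W n w = 0[ob W (n+1)]" "y:el X (n-1)" "x = s n w +[ob X n] df X (n-1) y"
proof -
 have "cohomology_map X s n ` cohomology W n = cohomology X n" using s by(simp add: qis_def bij_betw_def)
 moreover have "coh_class X n x:cohomology X n" using x by(simp add: cohomology_eq cocycle_iff)
 ultimately have "coh_class X n x:cohomology_map X s n ` cohomology W n" by simp
 then obtain w where w: "w:el W n" "df W n w = 0[ob W (n+1)]" "coh_class X n x = cohomology_map X s n (coh_class W n w)"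
  unfolding cohomology_eq by(auto simp: cocycle_iff)
 thus ?thesis using that x by(auto simp: coh_map_class Y.coh_class_eq)
qed

lemma qis_inj:
 assumes w: "w:el W n" "df W n w = 0[ob W (n+1)]" and y: "y:el X (n-1)" "s n w = df X (n-1) y"
 obtains v where "v:el W (n-1)" "w = df W (n-1) v"
proof -
 have "inj_on (cohomology_map X s n) (cohomology W n)" using s by(simp add: qis_def bij_betw_def)
 moreover have "cohomology_map X s n (coh_class W n w) = cohomology_map X s n (coh_class W n 0[ob W n])"
  using w y by(auto simp: coh_map_class Y.coh_class_eq)
 ultimately have "coh_class W n w = coh_class W n 0[ob W n]" by(rule inj_onD) (use w in "simp_all add: cohomology_eq cocycle_iff")
 thus ?thesis using that w by(auto simp: X.coh_class_eq)
qed

text \<open>The converse of \<open>qisI\<close>: the cone of a quasi-isomorphism is exact. All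
  lifting arguments use quasi-isomorphisms in this form.\<close>

lemma qis_ex:
 assumes x: "x:el W (n+1)" "df W (n+1) x = 0[ob W (n+1+1)]" and y: "y:el X n" "s (n+1) x = df X n y"
 obtains w v where "w:el W n" "v:el X (n-1)" "x = df W n w" "y = s n w +[ob X n] df X (n-1) v"
proof -
 obtain w0 where w0: "w0:el W n" "x = df W n w0" using qis_inj[of x "n+1" y] x y by auto
 have e: "df X n (y -[ob X n] s n w0) = 0[ob X (n+1)]" using y w0 by(simp flip: comm)
 obtain w1 v where w: "w1:el W n" "df W n w1 = 0[ob W (n+1)]" "v:el X (n-1)" "y -[ob X n] s n w0 = s n w1 +[ob X n] df X (n-1) v"
  by(rule qis_surj[OF _ e]) (use y w0 in simp)
 have c: "s n w0:el X n" "s n w1:el X n" "df X (n-1) v:el X n" using w0 w by simp_all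
 have "y = s n w0 +[ob X n] (y -[ob X n] s n w0)" using y(1) c by algebra
 also have "... = s n (w0 +[ob W n] w1) +[ob X n] df X (n-1) v" using w0 w by(simp add: Y.M.a_assoc)
 finally show ?thesis using that[of "w0 +[ob W n] w1" v] w0 w by simp
qed

end

text \<open>Dependent choice towards minus infinity. Homotopies out of complexes bounded above and
  resolutions are both built from the top degree downwards.\<close>

lemma int_descend:
 fixes N :: int
 assumes "EX x. P N x" "!!n x. n <= N ==> P n x ==> EX y. P (n-1) y & Q (n-1) y x"
 shows "EX f. ALL n<=N. P n (f n) & (n < N --> Q n (f n) (f (n+1)))"
proof -
 have "EX g. ALL k. P (N-int k) (g k) & Q (N-int (Suc k)) (g (Suc k)) (g k)"
 proof(rule dependent_nat_choice)
  show "EX x. P (N-int 0) x" using assms(1) by simp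
  fix x k assume "P (N-int k) x"
  thus "EX y. P (N-int (Suc k)) y & Q (N-int (Suc k)) y x" using assms(2)[of "N-int k" x] by(simp add: algebra_simps)
 qed
 then obtain g where g: "!!k. P (N-int k) (g k)" "!!k. Q (N-int (Suc k)) (g (Suc k)) (g k)" by blast
 show ?thesis
 proof(intro exI[of _ "%n. g (nat (N-n))"] allI impI conjI)
  fix n assume n: "n <= N"
  thus "P n (g (nat (N-n)))" using g(1)[of "nat (N-n)"] by simp
  assume "n < N"
  hence *: "nat (N-n) = Suc (nat (N-(n+1)))" by simp
  have "N-int (nat (N-n)) = n" using n by simp
  thus "Q n (g (nat (N-n))) (g (nat (N-(n+1))))" using g(2)[of "nat (N-(n+1))"] unfolding *[symmetric] by simp
 qed
qed

text \<open>The objects of K^-(A-proj): bounded above, but not below.\<close>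

definition bproj :: "'a ring => 'a fgcpx => bool" where
 "bproj A R <-> cplx A R & (ALL n. projective A (ob R n)) & (EX N. ALL n>N. zmod (ob R n))"

lemma bprojD: "bproj A R ==> cplx A R" "bproj A R ==> projective A (ob R n)"
 by(simp_all add: bproj_def)

text \<open>Once \<open>et\<close> is known in degree \<open>n+1\<close>, the map
  \<open>ph - et d\<close> in degree \<open>n\<close> lands in the kernel of \<open>b\<close>, hence
  in the preceding image, and lifts by projectivity. Exactness is required only in degrees where
  \<open>R\<close> is nonzero, which is the source of all vanishing by degrees. \<open>C\<close> may
  live on any carrier type, so that a mapping cone can be inserted on its product type.\<close>

lemma null_homotopy:
 fixes C :: "int => ('a, 'c) module"
 assumes R: "bproj A R" and C: "!!n. lmod A (C n)" "!!n. fin_gen A (C n)" and b: "!!n. b n:lhom A (C n) (C (n+1))"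
  and ex: "!!n c. ~ zmod (ob R n) ==> c:car (C n) ==> b n c = 0[C (n+1)] ==> c:b (n-1) ` car (C (n-1))"
  and ph: "!!n. ph n:lhom A (ob R n) (C n)" "!!n x. x:el R n ==> b n (ph n x) = ph (n+1) (df R n x)"
 shows "EX et. ALL n. et n:lhom A (ob R n) (C (n-1)) &
  (ALL x:el R n. ph n x = b (n-1) (et n x) +[C n] et (n+1) (df R n x))"
proof -
 interpret R: cx A R by(rule cxI[OF bprojD(1)[OF R]])
 have b': "b (n-1):lhom A (C (n-1)) (C n)" for n using b[of "n-1"] by simp
 interpret b: lmap A "C n" "C (n+1)" "b n" for n by(intro lmapI C b)
 interpret b': lmap A "C (n-1)" "C n" "b (n-1)" for n by(intro lmapI C b')
 interpret ph: lmap A "ob R n" "C n" "ph n" for n by(intro lmapI C R.lm ph)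
 obtain N where N: "!!n. n > N ==> zmod (ob R n)" using R unfolding bproj_def by blast
 \<comment> \<open>The invariant asks that \<open>et\<close> solves the equation on cocycles, where
   the term from the next degree vanishes. This is all that the construction one degree lower
   uses.\<close>
 define P where "P n et <-> et:lhom A (ob R n) (C (n-1)) &
  (ALL r:el R n. df R n r = 0[ob R (n+1)] --> b (n-1) (et r) = ph n r)" for n et
 define Q where "Q n et et' <-> (ALL x:el R n. ph n x = b (n-1) (et x) +[C n] et' (df R n x))" for n et et'
 have z: "P n (%_. 0[C (n-1)])" if "n > N" for n unfolding P_def using zmodD[OF N[OF that]] by(intro conjI lhom_zero C) (metis ph.zero b'.zero)
 have "EX f. ALL n<=N+1. P n (f n) & (n < N+1 --> Q n (f n) (f (n+1)))"
 proof(rule int_descend)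
  show "EX x. P (N+1) x" using z[of "N+1"] by auto
  fix n' et assume "P n' et"
  then obtain n where n: "n' = n+1" and P: "P (n+1) et" by(metis diff_add_cancel)
  interpret et: lmap A "ob R (n+1)" "C n" et using P by(intro lmapI C R.lm) (simp add: P_def)
  have k: "b n (et r) = ph (n+1) r" if "r:el R (n+1)" "df R (n+1) r = 0[ob R (n+2)]" for r using P that by(simp add: P_def add.commute)
  define ps where "ps x = ph n x -[C n] et (df R n x)" for x
  have ps: "ps:lhom A (ob R n) (C n)" unfolding ps_def by(intro lhom_minus C ph lcomp[OF R.d_lhom, of et] et.lhom)
  have im: "ps x:b (n-1) ` car (C (n-1))" if x: "x:el R n" for x
  proof -
   have c: "ps x:car (C n)" unfolding ps_def using x by simp
   show "ps x:b (n-1) ` car (C (n-1))"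
   proof(cases "zmod (ob R n)")
    case True
    hence "ps x = b (n-1) 0[C (n-1)]" using zmodD[OF _ x] ps_def by simp
    thus ?thesis by blast
   next
    case False
    have "b n (ps x) = ph (n+1) (df R n x) -[C (n+1)] b n (et (df R n x))" unfolding ps_def using x by(simp add: ph(2))
    also have "b n (et (df R n x)) = ph (n+1) (df R n x)" using x by(intro k) simp_all
    finally have "b n (ps x) = 0[C (n+1)]" using x by simp
    thus ?thesis by(rule ex[OF False c])
   qed
  qed
  obtain h where h: "h:lhom A (ob R n) (C (n-1))" "ALL x:el R n. b (n-1) (h x) = ps x"
   using projective_lift[OF bprojD(2)[OF R] C(1) C(1) C(2) b' ps im] .
  interpret h: lmap A "ob R n" "C (n-1)" h by(intro lmapI C R.lm h)
  have e: "ph n x = b (n-1) (h x) +[C n] et (df R n x)" if "x:el R n" for x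
  proof -
   have "ph n x:car (C n)" "et (df R n x):car (C n)" using that by simp_all
   hence "ph n x = (ph n x -[C n] et (df R n x)) +[C n] et (df R n x)" by algebra
   thus ?thesis using h(2) that by(simp add: ps_def)
  qed
  show "EX y. P (n'-1) y & Q (n'-1) y et" using exI[of _ h] h(1) by(simp add: Q_def n P_def e)
 qed
 then obtain f where f: "ALL n<=N+1. P n (f n) & (n < N+1 --> Q n (f n) (f (n+1)))" ..
 define et where "et n = (if n <= N+1 then f n else (%_. 0[C (n-1)]))" for n
 have Pet: "P n (et n)" for n using f z by(simp add: et_def)
 show ?thesis
 proof(intro exI[of _ et] allI conjI ballI)
  fix n
  show l: "et n:lhom A (ob R n) (C (n-1))" using Pet[of n] by(simp add: P_def)
  interpret et: lmap A "ob R n" "C (n-1)" "et n" by(intro lmapI l C R.lm)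
  have "et (n+1):lhom A (ob R (n+1)) (C n)" using Pet[of "n+1"] by(simp add: P_def)
  then interpret et_1: lmap A "ob R (n+1)" "C n" "et (n+1)" by(intro lmapI C R.lm)
  fix x assume x: "x:el R n"
  show "ph n x = b (n-1) (et n x) +[C n] et (n+1) (df R n x)"
  proof(cases "n < N+1")
   case True
   thus ?thesis using f x by(simp add: Q_def et_def)
  next
   case False
   thus ?thesis using zmodD[OF N x] by simp
  qed
 qed
qed

text \<open>The map \<open>(0, p)\<close> from \<open>R\<close> to the cone of \<open>s\<close> is
  null-homotopic. The first component of a null-homotopy is the lift \<open>w\<close>, and the
  second is a homotopy between \<open>s w\<close> and \<open>p\<close>.\<close>

lemma qis_lift:
 assumes R: "bproj A R" and W: "cplx A W" and X: "cplx A X" and s: "qis A W X s" and p: "p:cmap A R X"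
 obtains w where "w:cmap A R W" "htp A R X (ccomp s w) p"
proof -
 interpret R: cx A R by(rule cxI[OF bprojD(1)[OF R]])
 interpret s: cxmap A W X s by(intro cxmapI W X qis_map[OF s])
 interpret p: cxmap A R X p by(intro cxmapI bprojD[OF R] X p)
 define C where "C n = dsum (ob W (n+1)) (ob X n)" for n
 define b where "b n z = (-[ob W (n+1+1)] df W (n+1) (fst z), s (n+1) (fst z) +[ob X (n+1)] df X n (snd z))" for n z
 define ph where "ph n x = (0[ob W (n+1)], p n x)" for n x
 have "EX et. ALL n. et n:lhom A (ob R n) (C (n-1)) &
  (ALL x:el R n. ph n x = b (n-1) (et n x) +[C n] et (n+1) (df R n x))"
 proof(rule null_homotopy[OF R])
  fix n
  show "lmod A (C n)" unfolding C_def by(intro dsum_lm s.X.lm s.Y.lm)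
  show "fin_gen A (C n)" unfolding C_def by(intro dsum_fin_gen s.X.lm s.Y.lm ModsD(2) s.X.ob_Mods s.Y.ob_Mods)
  show "b n:lhom A (C n) (C (n+1))" unfolding C_def b_def[abs_def]
   by(intro lhom_dsum(3) lhom_neg lhom_add s.X.lm s.Y.lm lcomp[OF lhom_dsum(1)] lcomp[OF lhom_dsum(2)] s.X.d_lhom s.Y.d_lhom s.f_lhom)
  show "ph n:lhom A (ob R n) (C n)" unfolding C_def ph_def[abs_def] by(intro lhom_dsum(3) lhom_zero s.X.lm p.f_lhom)
  fix x assume x: "x:el R n"
  show "b n (ph n x) = ph (n+1) (df R n x)" using x by(simp add: b_def ph_def p.comm)
 next
  fix n c assume c: "c:car (C n)" "b n c = 0[C (n+1)]"
  obtain w x where wx: "c = (w, x)" by(cases c)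
  have w: "w:el W (n+1)" and x: "x:el X n" using c by(simp_all add: C_def wx)
  have e: "-[ob W (n+2)] df W (n+1) w = 0[ob W (n+2)]" "s (n+1) w +[ob X (n+1)] df X n x = 0[ob X (n+1)]"
   using c(2) by(simp_all add: C_def b_def wx add.assoc)
  have m: "s (n+1) (-[ob W (n+1)] w) = df X n x" using s.Y.M.minus_equality[where x = "s (n+1) w" and y = "df X n x" and n = "n+1"] e(2) w x by(simp add: s.Y.M.a_comm)
  obtain v y where v: "v:el W n" "y:el X (n-1)" "-[ob W (n+1)] w = df W n v" "x = s n v +[ob X n] df X (n-1) y"
   by(rule qis_ex[OF s _ _ x m]) (use w e(1) in "simp_all add: add.assoc")
  hence "c = b (n-1) (v, y)" using w by(simp add: b_def wx flip: v(3))
  thus "c:b (n-1) ` car (C (n-1))" by(rule) (simp add: C_def v)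
 qed
 then obtain et where et: "!!n. et n:lhom A (ob R n) (C (n-1))"
  "!!n x. x:el R n ==> ph n x = b (n-1) (et n x) +[C n] et (n+1) (df R n x)" by blast
 have et': "et n:lhom A (ob R n) (dsum (ob W n) (ob X (n-1)))" for n using et(1)[of n] by(simp add: C_def)
 define w where "w n x = fst (et n x)" for n x
 define k where "k n x = snd (et n x)" for n x
 have w: "w n:lhom A (ob R n) (ob W n)" for n unfolding w_def[abs_def] by(rule lcomp[OF et' lhom_dsum(1)])
 have k: "k n:lhom A (ob R n) (ob X (n-1))" for n unfolding k_def[abs_def] by(rule lcomp[OF et' lhom_dsum(2)])
 interpret w: lmap A "ob R n" "ob W n" "w n" for n by(intro lmapI w R.lm s.X.lm)
 interpret k: lmap A "ob R n" "ob X (n-1)" "k n" for n by(intro lmapI k R.lm s.Y.lm)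
 have et_eq: "et n x = (w n x, k n x)" for n x by(simp add: w_def k_def)
 have eq: "0[ob W (n+1)] = -[ob W (n+1)] df W n (w n x) +[ob W (n+1)] w (n+1) (df R n x)"
  "p n x = (s n (w n x) +[ob X n] df X (n-1) (k n x)) +[ob X n] k (n+1) (df R n x)" if "x:el R n" for n x
  using et(2)[OF that] by(simp_all add: ph_def C_def et_eq b_def)
 have kc: "k (n+1) (df R n x):el X n" if "x:el R n" for n x using k.closed[OF R.d.closed[OF that]] by simp
 have wm: "w:cmap A R W"
 proof(rule cmI)
  fix n x assume x: "x:el R n"
  have c: "w (n+1) (df R n x):el W (n+1)" "df W n (w n x):el W (n+1)" using x by simp_all
  have "w (n+1) (df R n x) = df W n (w n x) +[ob W (n+1)] (-[ob W (n+1)] df W n (w n x) +[ob W (n+1)] w (n+1) (df R n x))" using c by algebra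
  thus "w (n+1) (df R n x) = df W n (w n x)" unfolding eq(1)[OF x, symmetric] using c by simp
 qed(rule w)
 have "htp A R X p (ccomp s w)"
 proof(rule homotopicI)
  fix n x assume x: "x:el R n"
  have c: "s n (w n x):el X n" "df X (n-1) (k n x):el X n" using x by simp_all
  show "p n x -[ob X n] ccomp s w n x = df X (n-1) (k n x) +[ob X n] k (n+1) (df R n x)"
   unfolding eq(2)[OF x] ccomp_def comp_def using c kc[OF x] by algebra
 qed(rule k)
 hence "htp A R X (ccomp s w) p" by(rule homotopic_sym[OF bprojD(1)[OF R] X _ p cm_comp[OF wm s.map]])
 with wm show ?thesis by(rule)
qed

text \<open>The difference \<open>w1 - w2\<close> and the given homotopy \<open>k\<close>, with a
  sign, form a chain map from \<open>R\<close> to the cone of \<open>s\<close> moved by one degree.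
  The first component of a null-homotopy of it is the homotopy sought.\<close>

lemma qis_cancel:
 assumes R: "bproj A R" and W: "cplx A W" and X: "cplx A X" and s: "qis A W X s"
  and w1: "w1:cmap A R W" and w2: "w2:cmap A R W" and h: "htp A R X (ccomp s w1) (ccomp s w2)"
 shows "htp A R W w1 w2"
proof -
 interpret s: cxmap A W X s by(intro cxmapI W X qis_map[OF s])
 interpret w1: cxmap A R W w1 by(intro cxmapI bprojD[OF R] W w1)
 interpret w2: cxmap A R W w2 by(intro cxmapI bprojD[OF R] W w2)
 obtain k where "htpy A R X (ccomp s w1) (ccomp s w2) k" by(rule homotopicE[OF h bprojD(1)[OF R] X])
 then interpret k: htpy A R X "ccomp s w1" "ccomp s w2" k .
 define C where "C n = dsum (ob W n) (ob X (n-1))" for n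
 define b where "b n z = (df W n (fst z), -[ob X n] (s n (fst z) +[ob X n] df X (n-1) (snd z)))" for n z
 define ph where "ph n x = (w1 n x -[ob W n] w2 n x, -[ob X (n-1)] k n x)" for n x
 have "EX et. ALL n. et n:lhom A (ob R n) (C (n-1)) &
  (ALL x:el R n. ph n x = b (n-1) (et n x) +[C n] et (n+1) (df R n x))"
 proof(rule null_homotopy[OF R])
  fix n
  show "lmod A (C n)" unfolding C_def by(intro dsum_lm s.X.lm s.Y.lm)
  show "fin_gen A (C n)" unfolding C_def by(intro dsum_fin_gen s.X.lm s.Y.lm ModsD(2) s.X.ob_Mods s.Y.ob_Mods)
  have "b n:lhom A (C n) (dsum (ob W (n+1)) (ob X n))" unfolding C_def b_def[abs_def]
   by(intro lhom_dsum(3) lhom_neg lhom_add s.Y.lm lcomp[OF lhom_dsum(1)] lcomp[OF lhom_dsum(2)] s.X.d_lhom s.Y.d_lhom' s.f_lhom)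
  thus "b n:lhom A (C n) (C (n+1))" by(simp add: C_def)
  show "ph n:lhom A (ob R n) (C n)" unfolding C_def ph_def[abs_def]
   by(intro lhom_dsum(3) lhom_minus lhom_neg s.X.lm s.Y.lm w1.f_lhom w2.f_lhom k.h_lhom)
  fix x assume x: "x:el R n"
  have c: "s n (w1 n x):el X n" "s n (w2 n x):el X n" "df X (n-1) (k n x):el X n"
    "k (n+1) (df R n x):el X n" using x by simp_all
  have "-[ob X n] ((s n (w1 n x) -[ob X n] s n (w2 n x)) +[ob X n] -[ob X n] df X (n-1) (k n x)) = -[ob X n] k (n+1) (df R n x)"
   unfolding k.eq[OF x, unfolded ccomp_def comp_def] using c by algebra
  thus "b n (ph n x) = ph (n+1) (df R n x)" using x by(simp add: b_def ph_def w1.comm w2.comm)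
 next
  fix n c assume c: "c:car (C n)" "b n c = 0[C (n+1)]"
  obtain w x where wx: "c = (w, x)" by(cases c)
  have w: "w:el W n" and x: "x:el X (n-1)" using c by(simp_all add: C_def wx)
  have e: "df W n w = 0[ob W (n+1)]" "-[ob X n] (s n w +[ob X n] df X (n-1) x) = 0[ob X n]" using c(2) by(simp_all add: C_def b_def wx)
  have "s n w +[ob X n] df X (n-1) x:el X n" using w x by simp
  hence e2: "s n w +[ob X n] df X (n-1) x = 0[ob X n]" using e(2) by simp
  have m: "s (n-1+1) (-[ob W (n-1+1)] w) = df X (n-1) x"
   using s.Y.M.minus_equality[where x = "s n w" and y = "df X (n-1) x" and n = n] e2 w x by(simp add: s.Y.M.a_comm)
  obtain v y where "v:el W (n-1)" "y:el X (n-1-1)"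
   "-[ob W (n-1+1)] w = df W (n-1) v" "x = s (n-1) v +[ob X (n-1)] df X (n-1-1) y" by(rule qis_ex[OF s _ _ x m]) (use w e(1) in simp_all)
  hence v: "v:el W (n-1)" "y:el X (n-1-1)" "-[ob W n] w = df W (n-1) v" "x = s (n-1) v +[ob X (n-1)] df X (n-1-1) y" by simp_all
  have "c = b (n-1) (-[ob W (n-1)] v, -[ob X (n-1-1)] y)" using s.Y.d'.neg[OF v(2)] s.Y.d'.closed[OF v(2)] w v(1) by(simp add: b_def wx v(4) s.Y.M.minus_add del: flip: v(3))
  thus "c:b (n-1) ` car (C (n-1))" by(rule) (use v in "simp add: C_def del: diff_diff_add")
 qed
 then obtain et where et: "!!n. et n:lhom A (ob R n) (C (n-1))"
  "!!n x. x:el R n ==> ph n x = b (n-1) (et n x) +[C n] et (n+1) (df R n x)" by blast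
 show ?thesis
 proof(rule homotopicI)
  fix n
  show "(%x. fst (et n x)):lhom A (ob R n) (ob W (n-1))" using et(1)[of n] unfolding C_def by(rule lcomp[OF _ lhom_dsum(1)])
  fix x assume x: "x:el R n"
  have "fst (ph n x) = fst (b (n-1) (et n x) +[C n] et (n+1) (df R n x))" using et(2)[OF x] by simp
  also have "... = df W (n-1) (fst (et n x)) +[ob W n] fst (et (n+1) (df R n x))" unfolding C_def by(cases "et (n+1) (df R n x)") (simp add: b_def)
  finally show "w1 n x -[ob W n] w2 n x = df W (n-1) (fst (et n x)) +[ob W n] fst (et (n+1) (df R n x))" by(simp add: ph_def)
 qed
qed

context
 fixes A :: "'a ring" and X Y Z :: "'a fgcpx"
 assumes X: "cplx A X" and Y: "cplx A Y" and Z: "cplx A Z"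
begin

lemma bij_comp:
 assumes "cxmap A X Y f" "cxmap A Y Z g"
 shows "bij_betw (cohomology_map Z (ccomp g f) n) (cohomology X n) (cohomology Z n) <->
  bij_betw (cohomology_map Z g n o cohomology_map Y f n) (cohomology X n) (cohomology Z n)"
proof(rule bij_betw_cong)
 interpret f: cxmap A X Y f by fact
 interpret g: cxmap A Y Z g by fact
 interpret gf: cxmap A X Z "ccomp g f" by(intro cxmapI X Z cm_comp[OF f.map g.map])
 fix c assume "c:cohomology X n"
 then obtain x where "x:el X n" "c = coh_class X n x" unfolding cohomology_eq by(auto simp: cocycle_iff)
 thus "cohomology_map Z (ccomp g f) n c = (cohomology_map Z g n o cohomology_map Y f n) c"
  by(simp add: gf.coh_map_class f.coh_map_class g.coh_map_class) (simp add: ccomp_def)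
qed

lemma qis_comp:
 assumes f: "qis A X Y f" and g: "qis A Y Z g"
 shows "qis A X Z (ccomp g f)" using f g bij_comp[OF qis_cxmap[OF f] qis_cxmap[OF g]] cm_comp[OF qis_map[OF f] qis_map[OF g]]
 by(auto simp: qis_def intro: bij_betw_trans cxmapI X Z)

lemma qis_cancel_left:
 assumes f: "f:cmap A X Y" and g: "qis A Y Z g" and gf: "qis A X Z (ccomp g f)"
 shows "qis A X Y f"
proof -
 interpret f: cxmap A X Y f by(intro cxmapI X Y f)
 have "bij_betw (cohomology_map Y f n) (cohomology X n) (cohomology Y n)" for n
  using g gf bij_comp[OF f.cxmap_axioms qis_cxmap[OF g], of n] f.cohomology_map_closed
   bij_betw_comp_iff2[of "cohomology_map Z g n" "cohomology Y n" "cohomology Z n" "cohomology_map Y f n" "cohomology X n"]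
  by(simp add: qis_def image_subset_iff)
 thus ?thesis using f.cxmap_axioms by(simp add: qis_def)
qed

lemma qis_cancel_right:
 assumes f: "qis A X Y f" and g: "g:cmap A Y Z" and gf: "qis A X Z (ccomp g f)"
 shows "qis A Y Z g"
proof -
 have "bij_betw (cohomology_map Z g n) (cohomology Y n) (cohomology Z n)" for n using f gf bij_comp[OF qis_cxmap[OF f] cxmapI[OF Y Z g], of n]
   bij_betw_comp_iff[of "cohomology_map Y f n" "cohomology X n" "cohomology Y n" "cohomology_map Z g n" "cohomology Z n"] by(simp add: qis_def)
 thus ?thesis using cxmapI[OF Y Z g] by(simp add: qis_def)
qed

lemma qis_homotopic:
 assumes f: "qis A X Y f" and g: "g:cmap A X Y" and h: "htp A X Y f g"
 shows "qis A X Y g"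
proof -
 interpret f: cxmap A X Y f by(rule qis_cxmap[OF f])
 interpret g: cxmap A X Y g by(intro cxmapI X Y g)
 obtain h where "htpy A X Y f g h" by(rule homotopicE[OF h X Y])
 then interpret h: htpy A X Y f g h .
 have "cohomology_map Y f n c = cohomology_map Y g n c" if c: "c:cohomology X n" for n c
 proof -
  obtain x where x: "x:el X n" "df X n x = 0[ob X (n+1)]" "c = coh_class X n x" using c unfolding cohomology_eq by(auto simp: cocycle_iff)
  have cl: "f n x:el Y n" "g n x:el Y n" using x by simp_all
  have "f n x = g n x +[ob Y n] (f n x -[ob Y n] g n x)" using cl by algebra
  also have "f n x -[ob Y n] g n x = df Y (n-1) (h n x)" using h.eq[OF x(1)] x by simp
  finally show ?thesis using x by(auto simp: f.coh_map_class g.coh_map_class f.Y.coh_class_eq)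
 qed
 hence "bij_betw (cohomology_map Y f n) (cohomology X n) (cohomology Y n) <-> bij_betw (cohomology_map Y g n) (cohomology X n) (cohomology Y n)" for n
  by(rule bij_betw_cong)
 thus ?thesis using f g.cxmap_axioms by(simp add: qis_def)
qed

end

lemma qis_id: assumes "cplx A X" shows "qis A X X cid"
proof(rule qisI)
 interpret X: cx A X by(rule cxI[OF assms])
 show "cxmap A X X cid" by(intro cxmapI assms cm_id)
 fix n x y assume "x:el X (n+1)" "y:el X n" "cid (n+1) x = df X n y"
 thus "EX w:el X n. EX v:el X (n-1). x = df X n w & y = cid n w +[ob X n] df X (n-1) v"
  by(intro bexI[of _ y] bexI[of _ "0[ob X (n-1)]"]) (simp_all add: cid_def)
qed

definition heq :: "'a ring => 'a fgcpx => 'a fgcpx => 'a fgmap => 'a fgmap => bool" where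
 "heq A X Y f g <-> f:cmap A X Y & g:cmap A Y X &
   htp A X X (ccomp g f) cid & htp A Y Y (ccomp f g) cid"

lemma Kb_iso_heq: "Kb_iso A X Y <-> (EX f g. heq A X Y f g)"
 unfolding Kb_iso_def heq_def by blast

lemma heq_sym: "heq A X Y f g ==> heq A Y X g f"
 by(simp add: heq_def)

lemma ccomp_assoc: "ccomp h (ccomp g f) = ccomp (ccomp h g) f"
 by(simp add: ccomp_def comp_assoc)

lemma ccomp_cid [simp]: "ccomp f cid = f" "ccomp cid f = f"
 by(simp_all add: ccomp_def cid_def comp_def)

lemma heq_trans:
 assumes "heq A X Y f g" "heq A Y Z f' g'" and c: "cplx A X" "cplx A Y" "cplx A Z"
 shows "heq A X Z (ccomp f' f) (ccomp g g')"
proof -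
 have *: "htp A X X (ccomp (ccomp g g') (ccomp f' f)) cid"
  if "heq A X Y f g" "heq A Y Z f' g'" and c: "cplx A X" "cplx A Y" "cplx A Z" for X Y Z f g f' g'
 proof -
  note m = that(1,2)[unfolded heq_def]
  have m': "ccomp g' f':cmap A Y Y" "ccomp g (ccomp g' f'):cmap A Y X" "ccomp g cid:cmap A Y X"
   using m cm_comp[of f' A Y Z g' Y] cm_comp[of "ccomp g' f'" A Y Y g X] by simp_all
  have "htp A Y X (ccomp g (ccomp g' f')) (ccomp g cid)" by(rule htp_left[OF c(2) c(2) c(1)]) (use m in "blast intro: cm_comp cm_id")+
  hence "htp A X X (ccomp (ccomp g (ccomp g' f')) f) (ccomp (ccomp g cid) f)" by(rule htp_right[OF c(2) c(1) c(1)]) (use m m' in blast)+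
  thus ?thesis by(simp add: ccomp_assoc) (rule homotopic_trans[OF c(1) c(1)], assumption, (use m in "blast intro: cm_comp cm_id")+)
 qed
 show ?thesis using *[OF assms] *[OF heq_sym[OF assms(2)] heq_sym[OF assms(1)] c(3,2,1)] assms(1,2) by(auto simp: heq_def intro: cm_comp)
qed

lemma heq_qis:
 assumes X: "cplx A X" and Y: "cplx A Y" and h: "heq A X Y f g"
 shows "qis A X Y f"
proof -
 note h' = h[unfolded heq_def]
 have "qis A X X (ccomp g f)" by(rule qis_homotopic[OF X X X qis_id[OF X]]) (use h' cm_comp cm_id homotopic_sym[OF X X] in blast)+
 have fg: "qis A Y Y (ccomp f g)" by(rule qis_homotopic[OF Y Y Y qis_id[OF Y]]) (use h' cm_comp cm_id homotopic_sym[OF Y Y] in blast)+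
 have f: "cxmap A X Y f" "cxmap A Y X g" by(intro cxmapI X Y; use h' in blast)+
 note bij = bij_comp[OF X Y X f, THEN iffD1] bij_comp[OF Y X Y f(2,1), THEN iffD1]
 have "bij_betw (cohomology_map Y f n) (cohomology X n) (cohomology Y n)" for n
 proof -
  have b: "inj_on (cohomology_map X g n o cohomology_map Y f n) (cohomology X n)"
   "cohomology_map Y f n ` cohomology_map X g n ` cohomology Y n = cohomology Y n"
   using bij[of n] \<open>qis A X X (ccomp g f)\<close> fg by(simp_all add: qis_def bij_betw_def image_comp)
  have "cohomology_map Y f n ` cohomology X n = cohomology Y n"
   using b(2) cxmap.cohomology_map_closed[OF f(1), of _ n] cxmap.cohomology_map_closed[OF f(2), of _ n] by blast
  thus ?thesis using inj_on_imageI2[OF b(1)] by(simp add: bij_betw_def)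
 qed
 thus ?thesis using f by(simp add: qis_def)
qed

text \<open>Lifting the identity of \<open>S\<close> along \<open>f\<close> gives a right inverse
  \<open>g\<close>; cancelling \<open>f\<close> in \<open>f g f = f\<close> shows that it is a left
  inverse too.\<close>

lemma qis_heq:
 assumes R: "bproj A R" and S: "bproj A S" and f: "qis A R S f"
 obtains g where "heq A R S f g"
proof -
 note c = bprojD(1)[OF R] bprojD(1)[OF S]
 obtain g where g: "g:cmap A S R" "htp A S S (ccomp f g) cid" using qis_lift[OF S c f cm_id] .
 have "htp A R S (ccomp f (ccomp g f)) (ccomp f cid)" using cm_comp[OF g(1) qis_map[OF f]] htp_right[OF c(2) c(2) c(1)] g qis_map[OF f] cm_id[of A S] by(force simp: ccomp_assoc)
 hence "htp A R R (ccomp g f) cid" by(rule qis_cancel[OF R c f, rotated 2]) (use cm_comp[OF qis_map[OF f] g(1)] in "simp_all add: cm_id")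
 with g qis_map[OF f] show ?thesis by(intro that[of g]) (simp add: heq_def)
qed

definition exact_at :: "'a fgcpx => int => bool" where
 "exact_at X n <-> (ALL x:el X n. df X n x = 0[ob X (n+1)] --> (EX y:el X (n-1). x = df X (n-1) y))"

lemma exact_atD:
 assumes "exact_at X n" "x:el X n" "df X n x = 0[ob X (n+1)]"
 obtains y where "y:el X (n-1)" "x = df X (n-1) y" using assms unfolding exact_at_def by blast

lemma exact_at_zero: "cplx A X ==> zmod (ob X n) ==> exact_at X n"
proof -
 assume *: "cplx A X" "zmod (ob X n)"
 interpret X: cx A X by(rule cxI[OF *(1)])
 show ?thesis unfolding exact_at_def using zmodD[OF *(2)] by(intro ballI impI bexI[of _ "0[ob X (n-1)]"]) simp_all
qed

lemma qis_exact_at: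
 assumes X: "cplx A X" and Y: "cplx A Y" and f: "qis A X Y f"
 shows "exact_at X n <-> exact_at Y n"
proof -
 interpret f: cxmap A X Y f by(intro cxmapI X Y qis_map[OF f])
 show ?thesis
 proof
  assume ex: "exact_at X n"
  show "exact_at Y n" unfolding exact_at_def
  proof(intro ballI impI)
   fix y assume y: "y:el Y n" "df Y n y = 0[ob Y (n+1)]"
   from qis_surj[OF f y] obtain x y' where x: "x:el X n" "df X n x = 0[ob X (n+1)]"
    "y':el Y (n-1)" "y = f n x +[ob Y n] df Y (n-1) y'" .
   obtain x' where x': "x':el X (n-1)" "x = df X (n-1) x'" by(rule exact_atD[OF ex x(1,2)])
   have "y = df Y (n-1) (f (n-1) x' +[ob Y (n-1)] y')" unfolding x(4) x'(2) using x(3) x'(1) by(simp add: f.comm')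
   thus "EX y':el Y (n-1). y = df Y (n-1) y'" by(rule) (use x x' in simp)
  qed
 next
  assume ex: "exact_at Y n"
  show "exact_at X n" unfolding exact_at_def
  proof(intro ballI impI)
   fix x assume x: "x:el X n" "df X n x = 0[ob X (n+1)]"
   have "f n x:el Y n" "df Y n (f n x) = 0[ob Y (n+1)]" using x f.comm[OF x(1)] by simp_all
   from exact_atD[OF ex this] obtain y where "y:el Y (n-1)" "f n x = df Y (n-1) y" .
   thus "EX y':el X (n-1). x = df X (n-1) y'" by(rule qis_inj[OF f x]) (rule)
  qed
 qed
qed

section \<open>Projective resolutions of complexes\<close>

context artin_alg
begin

text \<open>\<open>K\<close> is the module of cocycles already constructed in degree
  \<open>n+1\<close>. The new projective module \<open>P'\<close> covers the pullback of
  \<open>K\<close> and the n-th term of \<open>X\<close> over the term of \<open>X\<close> in degree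
  \<open>n+1\<close>, so it has the prescribed differential and augmentation.\<close>

lemma resolution_step:
 assumes X: "cplx A X" and P: "P:Mods A" and t: "t:lhom A P (ob X (n+1))" and K: "smod A P K"
 shows "EX P' t' de. projective A P' & t':lhom A P' (ob X n) & de:lhom A P' P &
  (ALL p:car P'. de p:K & t (de p) = df X n (t' p)) &
  (ALL q:K. ALL x:el X n. t q = df X n x --> (EX p:car P'. de p = q & t' p = x))"
proof -
 interpret X: cx A X by(rule cxI[OF X])
 interpret t: lmap A P "ob X (n+1)" t by(intro lmapI t ModsD P X.lm)
 obtain D e e' where D: "D:Mods A" "e:lhom A (dsum P (ob X n)) D" "e':lhom A D (dsum P (ob X n))"
  "ALL x:car (dsum P (ob X n)). e' (e x) = x" "ALL y:car D. e (e' y) = y" by(rule biproduct_Mods[OF P X.ob_Mods])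
 have e1: "(%z. fst (e' z)):lhom A D P" and e2: "(%z. snd (e' z)):lhom A D (ob X n)"
  by(rule lcomp[OF D(3) lhom_dsum(1)], rule lcomp[OF D(3) lhom_dsum(2)])
 note lD = ModsD(1)[OF D(1)] and lP = ModsD(1)[OF P]
 define C where "C = {z:car D. fst (e' z):K} Int {z:car D. t (fst (e' z)) -[ob X (n+1)] df X n (snd (e' z)) = 0[ob X (n+1)]}"
 have C: "smod A D C" unfolding C_def
  by(intro submod_Int submod_vimage[OF lD lP e1 K] submod_kernel[OF lD X.lm] lhom_minus X.lm lcomp[OF e1 t] lcomp[OF e2 X.d_lhom])
 obtain P' g where P': "projective A P'" "g:lhom A P' (restr D C)" "g ` car P' = car (restr D C)" using enough_projectives[OF restr_Mods[OF D(1) C]] .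
 have sub: "C <= car D" using C by(simp add: submod_def)
 have gC: "g p:C" if "p:car P'" for p using P'(3) that by auto
 have Cd: "fst (e' z):K" "t (fst (e' z)) = df X n (snd (e' z))" "z:car D" if "z:C" for z using that e1 e2 by(auto simp: C_def lhom_def Pi_iff)
 show ?thesis
 proof(rule exI[of _ P'], rule exI[of _ "%p. snd (e' (g p))"], rule exI[of _ "%p. fst (e' (g p))"], intro conjI ballI impI)
  show "projective A P'" by(rule P'(1))
  show "(%p. snd (e' (g p))):lhom A P' (ob X n)" by(rule lcomp[OF P'(2) lhom_from_restr[OF e2 sub]])
  show "(%p. fst (e' (g p))):lhom A P' P" by(rule lcomp[OF P'(2) lhom_from_restr[OF e1 sub]])
  fix p assume "p:car P'"
  thus "fst (e' (g p)):K" "t (fst (e' (g p))) = df X n (snd (e' (g p)))" using Cd(1,2)[OF gC] by simp_all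
 next
  fix q x assume q: "q:K" and x: "x:el X n" and e: "t q = df X n x"
  have qP: "q:car P" using q K by(auto simp: submod_def)
  have ee: "e' (e (q, x)) = (q, x)" using D(4) qP x by simp
  have "e (q, x):g ` car P'" using D(2) qP x C_def q P'(3) by(simp add: lhom_def Pi_iff ee e)
  then obtain p where "p:car P'" "e (q, x) = g p" by blast
  thus "EX p:car P'. fst (e' (g p)) = q & snd (e' (g p)) = x" using ee by(intro bexI[of _ p]) simp_all
 qed
qed

text \<open>The bound \<open>N\<close> is one on the cohomology of \<open>X\<close>, not on its
  terms, and the resolution respects it. The vanishing of morphisms between complexes with separated
  cohomology rests on this.\<close>

lemma resolution_exists:
 assumes X: "cplx A X" and ex: "!!n. n > N ==> exact_at X n"
 obtains R t where "bproj A R" "ALL n>N. zmod (ob R n)" "qis A R X t"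
proof -
 interpret X: cx A X by(rule cxI[OF X])
 have Z: "zero_module:Mods A" by(rule zero_module_Mods[OF ring_A])
 note lZ = ModsD(1)[OF Z]
 have Zm: "zmod (zero_module :: 'a fgm)" by(simp add: is_zero_mod_def)
 \<comment> \<open>A stage consists of a term \<open>P\<close>, its map \<open>t\<close> to
   \<open>X\<close> and its cocycles \<open>K\<close>; the invariant says that \<open>K\<close>
   meets every cohomology class of \<open>X\<close> in degree \<open>n\<close>. It starts with the
   zero module in degree \<open>N+1\<close>, where \<open>X\<close> is exact.\<close>
 define Pr where "Pr n s <-> (case s of (P, t, K) => projective A P & (n > N --> zmod P) & t:lhom A P (ob X n) & smod A P K &
  (ALL x:el X n. df X n x = 0[ob X (n+1)] --> (EX q:K. EX y:el X (n-1). x = t q +[ob X n] df X (n-1) y)))"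
  for n and s :: "'a fgm \<times> ('a list set => 'a list set) \<times> 'a list set set"
 define Qr where "Qr n s' s <-> (case s' of (P', t', K') => case s of (P, t, K) => EX de. de:lhom A P' P & K' = {p:car P'. de p = 0[P]} &
   (ALL p:car P'. de p:K & t (de p) = df X n (t' p)) &
   (ALL q:K. ALL x:el X n. t q = df X n x --> (EX p:car P'. de p = q & t' p = x)))"
  for n and s' s :: "'a fgm \<times> ('a list set => 'a list set) \<times> 'a list set set"
 have "EX f. ALL n<=N+1. Pr n (f n) & (n < N+1 --> Qr n (f n) (f (n+1)))"
 proof(rule int_descend)
  have "Pr (N+1) (zero_module, %_. 0[ob X (N+1)], {0[zero_module]})" unfolding Pr_def prod.case
  proof(intro conjI ballI impI)
   fix x assume "x:el X (N+1)" "df X (N+1) x = 0[ob X (N+1+1)]"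
   then obtain y where "y:el X (N+1-1)" "x = df X (N+1-1) y" using exact_atD[OF ex[of "N+1"]] by auto
   thus "EX q:{0[zero_module]}. EX y:el X (N+1-1). x = 0[ob X (N+1)] +[ob X (N+1)] df X (N+1-1) y" by simp blast
  qed(simp_all add: projective_zero Z lhom_zero X.lm submod_zero lZ Zm del: zero_module_simps)
  thus "EX s. Pr (N+1) s" ..
  fix n' s assume "n' <= N+1" "Pr n' s"
  then obtain n P t K where n: "n' = n+1" and s: "s = (P, t, K)" and P: "Pr (n+1) (P, t, K)" and nN: "n <= N"
   using that[of "n'-1" "fst s" "fst (snd s)" "snd (snd s)"] by simp
  have p: "projective A P" "t:lhom A P (ob X (n+1))" "smod A P K" using P by(simp_all add: Pr_def)
  obtain P' t' de where P': "projective A P'" "t':lhom A P' (ob X n)" "de:lhom A P' P"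
   "ALL p:car P'. de p:K & t (de p) = df X n (t' p)"
   "ALL q:K. ALL x:el X n. t q = df X n x --> (EX p:car P'. de p = q & t' p = x)"
   using resolution_step[OF X projective_Mods[OF p(1)] p(2,3)] by(elim exE conjE)
  note lP = ModsD(1)[OF projective_Mods[OF p(1)]] and lP' = ModsD(1)[OF projective_Mods[OF P'(1)]]
  interpret t: lmap A P "ob X (n+1)" t by(intro lmapI p lP X.lm)
  let ?K = "{p:car P'. de p = 0[P]}"
  have "Pr n (P', t', ?K)" unfolding Pr_def prod.case
  proof(intro conjI ballI impI)
   show "smod A P' ?K" by(rule submod_kernel[OF lP' lP P'(3)])
   fix x assume x: "x:el X n" "df X n x = 0[ob X (n+1)]"
   have "0[P]:K" using p(3) by(simp add: submod_def)
   then obtain q where "q:car P'" "de q = 0[P]" "t' q = x" using P'(5)[rule_format, of "0[P]" x] x by auto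
   thus "EX q:?K. EX y:el X (n-1). x = t' q +[ob X n] df X (n-1) y" by(intro bexI[of _ q] bexI[of _ "0[ob X (n-1)]"]) (use x in simp_all)
  qed(use P'(1,2) nN in simp_all)
  moreover have "Qr n (P', t', ?K) s" unfolding Qr_def s prod.case using P'(3-5) by(intro exI[of _ de] conjI refl)
  ultimately show "EX s'. Pr (n'-1) s' & Qr (n'-1) s' s" unfolding n by(intro exI[of _ "(P', t', ?K)"]) simp
 qed
 then obtain f where f: "ALL n<=N+1. Pr n (f n) & (n < N+1 --> Qr n (f n) (f (n+1)))" ..
 define O' where "O' n = (if n <= N+1 then fst (f n) else zero_module)" for n
 define t where "t n = (if n <= N+1 then fst (snd (f n)) else (%_. 0[ob X n]))" for n
 define K where "K n = (if n <= N+1 then snd (snd (f n)) else {0[zero_module]})" for n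
 have *: "Pr n (O' n, t n, K n)" if "n <= N+1" for n using f that by(simp add: O'_def t_def K_def)
 have base: "projective A (O' n) & t n:lhom A (O' n) (ob X n) & smod A (O' n) (K n) & (n > N --> zmod (O' n))" for n
 proof(cases "n <= N+1")
  case True
  show ?thesis using *[OF True] by(simp add: Pr_def)
 next
  case False
  thus ?thesis by(simp add: O'_def t_def K_def projective_zero Z lhom_zero X.lm submod_zero lZ Zm del: zero_module_simps)
 qed
 have proj: "projective A (O' n)" and tl: "t n:lhom A (O' n) (ob X n)" and sK: "smod A (O' n) (K n)" for n using base[of n] by simp_all
 note Om = projective_Mods[OF proj]
 note lO = ModsD(1)[OF Om]
 interpret t: lmap A "O' n" "ob X n" "t n" for n by(intro lmapI lO X.lm tl)
 have zO: "zmod (O' n)" if "n > N" for n using base[of n] that by simp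
 have K0: "0[O' n]:K n" for n using sK by(simp add: submod_def)
 have KO: "K n = {0[O' n]}" if "n > N" for n using sK[of n] zO[OF that] by(auto simp: submod_def is_zero_mod_def)
 have surj: "EX q:K n. EX y:el X (n-1). x = t n q +[ob X n] df X (n-1) y" if x: "x:el X n" "df X n x = 0[ob X (n+1)]" for x n
 proof(cases "n <= N")
  case True
  thus ?thesis using *[of] x by(simp add: Pr_def)
 next
  case False
  then obtain y where "y:el X (n-1)" "x = df X (n-1) y" using exact_atD[OF ex x] by auto
  thus ?thesis by(intro bexI[OF _ K0] bexI[of _ y]) simp_all
 qed
 define S where "S n de <-> de:lhom A (O' n) (O' (n+1)) & K n = {p:car (O' n). de p = 0[O' (n+1)]} &
   (ALL p:car (O' n). de p:K (n+1) & t (n+1) (de p) = df X n (t n p)) &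
   (ALL q:K (n+1). ALL x:el X n. t (n+1) q = df X n x --> n < N+1 --> (EX p:car (O' n). de p = q & t n p = x))" for n de
 have "ALL n. EX de. S n de"
 proof
  fix n
  show "EX de. S n de"
  proof(cases "n < N+1")
   case True
   hence "Qr n (f n) (f (n+1))" using f[rule_format, of n] by simp
   moreover have "f n = (O' n, t n, K n)" "f (n+1) = (O' (n+1), t (n+1), K (n+1))" using True by(simp_all add: O'_def t_def K_def)
   ultimately have "Qr n (O' n, t n, K n) (O' (n+1), t (n+1), K (n+1))" by simp
   thus ?thesis unfolding Qr_def S_def using True by simp
  next
   case False
   hence c: "car (O' n) = {0[O' n]}" using zO[of n] by(simp add: is_zero_mod_def)
   have "S n (%_. 0[O' (n+1)])" unfolding S_def using False by(simp add: lhom_zero lO KO c)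
   thus ?thesis by blast
  qed
 qed
 from choice[OF this] obtain d where d: "ALL n. S n (d n)" ..
 have dl: "d n:lhom A (O' n) (O' (n+1))" and dK: "q:K n <-> q:car (O' n) & d n q = 0[O' (n+1)]"
  and dt: "p:car (O' n) ==> d n p:K (n+1) & t (n+1) (d n p) = df X n (t n p)"
  and ds: "[|q:K (n+1); x:el X n; t (n+1) q = df X n x; n < N+1|] ==> EX p:car (O' n). d n p = q & t n p = x" for n q p x
  using d[rule_format, of n] unfolding S_def by simp_all
 define R where "R = \<lparr>ob = O', df = d\<rparr>"
 have R: "cplx A R" unfolding cplx_def R_def using ring_A dl dt dK by(simp add: Om add.assoc)
 show ?thesis
 proof(rule that[of R t])
  show "ALL n>N. zmod (ob R n)" using zO by(simp add: R_def)
  thus "bproj A R" unfolding bproj_def using R proj by(auto simp: R_def)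
  show "qis A R X t"
  proof(rule qisI)
   show "cxmap A R X t" by(intro cxmapI R X cmI) (use tl dt in "simp_all add: R_def")
   fix n x y assume x: "x:el R (n+1)" "df R (n+1) x = 0[ob R (n+1+1)]" and y: "y:el X n" "t (n+1) x = df X n y"
   hence "x:K (n+1)" using dK by(simp add: R_def)
   show "EX w:el R n. EX v:el X (n-1). x = df R n w & y = t n w +[ob X n] df X (n-1) v"
   proof(cases "n < N+1")
    case True
    obtain w where "w:car (O' n)" "d n w = x" "t n w = y" using ds[OF \<open>x : K (n + 1)\<close> y True] by blast
    thus ?thesis using y by(intro bexI[of _ w] bexI[of _ "0[ob X (n-1)]"]) (simp_all add: R_def)
   next
    case False
    hence x0: "x = 0[O' (n+1)]" using zmodD[OF zO[of "n+1"]] x(1) by(simp add: R_def)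
    hence "df X n y = 0[ob X (n+1)]" using y by simp
    from surj[OF y(1) this] obtain q v where q: "q:K n" "v:el X (n-1)" "y = t n q +[ob X n] df X (n-1) v" by blast
    moreover have "q:car (O' n) & d n q = 0[O' (n+1)]" using dK q(1) by blast
    ultimately show ?thesis by(intro bexI[of _ q] bexI[of _ v]) (simp_all add: R_def x0)
   qed
  qed
 qed
qed

end

text \<open>The truncation of \<open>R\<close> to degrees at least \<open>s\<close> that has the
  cokernel of the incoming differential as its lowest term. Above \<open>s\<close> it is literally
  equal to \<open>R\<close>, so projectivity and differentials carry over without comparison
  maps.\<close>

definition trunc :: "'a ring => int => 'a fgcpx => 'a fgcpx => 'a fgmap => bool" where
 "trunc A s R V rh <-> cplx A R & cplx A V & rh:cmap A R V & (ALL n<s. zmod (ob V n)) &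
   rh s ` el R s = el V s &
   (ALL x:el R s. rh s x = 0[ob V s] <-> x:coboundaries R s) &
   (ALL n>s. ob V n = ob R n & df V n = df R n & rh n = (%x. x))"

lemma coboundaries_submod: "cplx A X ==> smod A (ob X n) (coboundaries X n)"
proof -
 assume "cplx A X"
 then interpret X: cx A X by(rule cxI)
 show ?thesis unfolding coboundaries_def by(rule submod_image[OF X.lm X.lm X.d_lhom' submod_top[OF X.lm]])
qed

lemma trunc_exists:
 assumes R: "cplx A R" and Q: "Q:Mods A" "pj:lhom A (ob R s) Q" "pj ` el R s = car Q"
  "ALL x:el R s. pj x = 0[Q] <-> x:coboundaries R s"
 obtains V rh where "trunc A s R V rh" "ob V s = Q" "rh s = pj"
proof -
 interpret R: cx A R by(rule cxI[OF R])
 have rA: "ring A" using R by(simp add: cplx_def)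
 note Z = zero_module_Mods[OF rA]
 note lQ = ModsD(1)[OF Q(1)]
 obtain db where db: "db:lhom A Q (ob R (s+1))" "ALL x:el R s. db (pj x) = df R s x"
 proof(rule lmap_factor[OF R.lm lQ R.lm Q(2) R.d_lhom Q(3)])
  fix x assume x: "x:el R s" "pj x = 0[Q]"
  then obtain y where "x = df R (s-1) y" "y:el R (s-1)" using Q(4) unfolding coboundaries_def by(metis imageE)
  thus "df R s x = 0[ob R (s+1)]" by simp
 qed
 define V where "V = \<lparr>ob = (%n. if n < s then zero_module else if n = s then Q else ob R n),
  df = (%n x. if n+1 < s then {} else if n+1 = s then 0[Q] else if n = s then db x else df R n x)\<rparr>"
 define rh where "rh n x = (if n < s then {} else if n = s then pj x else x)" for n x
 have obV: "ob V n = (if n < s then zero_module else if n = s then Q else ob R n)" for n by(simp add: V_def)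
 have dfV: "df V n = (if n+1 < s then (%x. 0[zero_module]) else if n+1 = s then (%x. 0[Q]) else if n = s then db else df R n)" for n
  by(auto simp: V_def)
 have rh: "rh n = (if n < s then (%x. 0[zero_module]) else if n = s then pj else (%x. x))" for n by(auto simp: rh_def)
 have obM: "ob V n:Mods A" for n by(simp add: obV Z Q R.ob_Mods)
 have dl: "df V n:lhom A (ob V n) (ob V (n+1))" for n
 proof -
  consider "n+1 < s" | "n+1 = s" | "n = s" | "n > s" by linarith
  thus ?thesis by cases (simp_all add: dfV obV lhom_zero ModsD(1)[OF Z] lQ db R.d_lhom del: zero_module_simps)
 qed
 have rh_l: "rh n:lhom A (ob R n) (ob V n)" for n by(simp add: rh obV lhom_zero ModsD(1)[OF Z] Q lhom_id del: zero_module_simps)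
 interpret Vm: left_module A "ob V n" for n by(rule ModsD(1)[OF obM])
 interpret dV: lmap A "ob V n" "ob V (n+1)" "df V n" for n by(intro lmapI Vm.lmA dl)
 have comm: "rh (n+1) (df R n x) = df V n (rh n x)" if x: "x:el R n" for n x
 proof -
  consider "n+1 < s" | "n+1 = s" | "n = s" | "n > s" by linarith
  thus ?thesis
  proof cases
   case 2
   have "df R n x:coboundaries R s" unfolding coboundaries_def using x 2 by auto
   hence "pj (df R n x) = 0[Q]" using Q(4) R.d.closed[OF x] unfolding 2 by blast
   thus ?thesis using 2 by(simp add: rh dfV)
  qed(use x db in \<open>simp_all add: rh dfV\<close>)
 qed
 have sur: "EX y:el R n. x = rh n y" if "x:el V n" "n \<ge> s" for n x using that Q(3) by(cases "n = s") (auto simp: obV rh)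
 have Zs: "x = 0[ob V n]" if "x:el V n" "n < s" for n x using that by(simp add: obV)
 have "cplx A V" unfolding cplx_def
 proof(intro conjI allI ballI rA obM dl)
  fix n x assume x: "x:el V n"
  show "df V (n+1) (df V n x) = 0[ob V (n+2)]"
  proof(cases "n < s")
   case True
   thus ?thesis using Zs[OF x True] by(simp add: add.assoc)
  next
   case False
   then obtain y where y: "y:el R n" "x = rh n y" using sur[OF x] by auto
   have "df V (n+1) (df V n x) = rh (n+1+1) (df R (n+1) (df R n y))"
    unfolding y(2) comm[OF y(1), symmetric] using comm[OF R.d.closed[OF y(1)]] by simp
   also have "... = 0[ob V (n+1+1)]" using R.dd[OF y(1)] False by(simp add: rh obV add.assoc)
   finally show ?thesis by(simp add: add.assoc)
  qed
 qed
 moreover have "rh:cmap A R V" by(rule cmI[OF rh_l comm])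
 ultimately show ?thesis using Q(3,4) R by(intro that[of V rh]) (simp_all add: trunc_def obV rh dfV is_zero_mod_def)
qed

context
 fixes A :: "'a ring" and s R V rh
 assumes T: "trunc A s R V rh"
begin

lemma trunc_cplx: "cplx A R" "cplx A V" "rh:cmap A R V"
 using T by(simp_all add: trunc_def)

interpretation rh: cxmap A R V rh by(intro cxmapI trunc_cplx)

lemma trunc_zero: "n < s ==> x:el V n ==> x = 0[ob V n]"
 using T by(simp add: trunc_def zmodD)

lemma trunc_surj:
 assumes "n \<ge> s" "v:el V n"
 obtains x where "x:el R n" "v = rh n x"
proof(cases "n = s")
 case True
 hence "v:rh s ` el R s" using T assms by(simp add: trunc_def)
 thus ?thesis using that True by blast
next
 case False
 thus ?thesis using that[of v] T assms by(simp add: trunc_def)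
qed

lemma trunc_kernel: "x:el R s ==> rh s x = 0[ob V s] <-> (EX y:el R (s-1). x = df R (s-1) y)"
 using T by(auto simp: trunc_def coboundaries_def)

lemma trunc_above: "n > s ==> ob V n = ob R n" "n > s ==> df V n = df R n" "n > s ==> rh n = (%x. x)"
 using T by(simp_all add: trunc_def)

lemma trunc_qis:
 assumes ex: "!!n. n < s ==> exact_at R n"
 shows "qis A R V rh"
proof(rule qisI)
 show "cxmap A R V rh" by(rule rh.cxmap_axioms)
 fix n x y assume x: "x:el R (n+1)" "df R (n+1) x = 0[ob R (n+1+1)]" and y: "y:el V n" "rh (n+1) x = df V n y"
 show "EX w:el R n. EX v:el V (n-1). x = df R n w & y = rh n w +[ob V n] df V (n-1) v"
 proof(cases "n < s")
  case True
  hence z: "v = 0[ob V n]" if "v:el V n" for v using trunc_zero that by blast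
  have "EX w:el R n. x = df R n w"
  proof(cases "n+1 = s")
   case True
   thus ?thesis using trunc_kernel[of x] x(1) y(2) z[OF y(1)] by auto
  next
   case False
   hence "n+1 < s" using True by simp
   from exact_atD[OF ex[OF this] x] show ?thesis by auto
  qed
  then obtain w where w: "w:el R n" "x = df R n w" by blast
  thus ?thesis using z[OF y(1)] z[OF rh.f.closed[OF w(1)]] by(intro bexI[of _ w] bexI[of _ "0[ob V (n-1)]"]) simp_all
 next
  case False
  then obtain y' where y': "y':el R n" "y = rh n y'" using trunc_surj[OF _ y(1)] by auto
  have "x = df R n y'" using y(2) False y' by(simp add: trunc_above flip: rh.comm)
  thus ?thesis using y' by(intro bexI[of _ y'] bexI[of _ "0[ob V (n-1)]"]) simp_all
 qed
qed

text \<open>In degree \<open>s\<close> a chain map to \<open>W\<close> kills the coboundaries,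
  because \<open>W\<close> is zero one degree lower. Together with \<open>trunc_homotopic\<close>
  this allows a bounded complex to replace an unbounded resolution as the source of maps into given
  bounded complexes.\<close>

lemma trunc_factor:
 assumes W: "cplx A W" "!!n. n < s ==> zmod (ob W n)" and f: "f:cmap A R W"
 obtains g where "g:cmap A V W" "ALL n. ALL x:el R n. g n (rh n x) = f n x"
proof -
 interpret f: cxmap A R W f by(intro cxmapI trunc_cplx W f)
 have Wz: "x = 0[ob W n]" if "n < s" "x:el W n" for n x using W(2) that by(blast dest: zmodD)
 have "EX g. g:lhom A (ob V n) (ob W n) & (ALL x:el R n. g (rh n x) = f n x)" for n
 proof(cases "n < s")
  case True
  thus ?thesis using Wz[OF True f.f.closed] by(intro exI[of _ "%_. 0[ob W n]"]) (simp add: lhom_zero f.Y.lm)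
 next
  case False
  have im: "rh n ` el R n = el V n"
  proof(intro subset_antisym image_subsetI subsetI)
   fix v assume v: "v:el V n"
   show "v:rh n ` el R n" by(rule trunc_surj[OF _ v]) (use False in "simp_all add: image_eqI")
  qed simp
  have k: "f n x = 0[ob W n]" if x: "x:el R n" "rh n x = 0[ob V n]" for x
  proof(cases "n = s")
   case True
   then obtain y where y: "y:el R (n-1)" "x = df R (n-1) y" using trunc_kernel x by auto
   have "f (n-1) y = 0[ob W (n-1)]" by(rule Wz) (use True y in simp_all)
   thus ?thesis using y by(simp add: f.comm')
  next
   case F: False
   thus ?thesis using x False by(simp add: trunc_above)
  qed
  obtain g where "g:lhom A (ob V n) (ob W n)" "ALL x:el R n. g (rh n x) = f n x"
   by(rule lmap_factor[OF rh.X.lm rh.Y.lm f.Y.lm rh.f_lhom f.f_lhom im k])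
  thus ?thesis by blast
 qed
 hence "ALL n. EX g. g:lhom A (ob V n) (ob W n) & (ALL x:el R n. g (rh n x) = f n x)" by blast
 from choice[OF this] obtain g where g: "ALL n. g n:lhom A (ob V n) (ob W n) & (ALL x:el R n. g n (rh n x) = f n x)" ..
 interpret g: lmap A "ob V n" "ob W n" "g n" for n using g by(intro lmapI rh.Y.lm f.Y.lm) simp
 have "g:cmap A V W"
 proof(rule cmI)
  fix n show "g n:lhom A (ob V n) (ob W n)" using g by simp
  fix v assume v: "v:el V n"
  show "g (n+1) (df V n v) = df W n (g n v)"
  proof(cases "n < s")
   case True
   thus ?thesis using trunc_zero[OF True v] by simp
  next
   case False
   then obtain x where x: "x:el R n" "v = rh n x" using trunc_surj[OF _ v] by auto
   have "g (n+1) (rh (n+1) (df R n x)) = f (n+1) (df R n x)" using g x by simp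
   thus ?thesis using g x by(simp add: rh.comm f.comm)
  qed
 qed
 thus ?thesis using g by(intro that[of g]) simp_all
qed

lemma trunc_homotopic:
 assumes W: "cplx A W" "!!n. n < s ==> zmod (ob W n)" and f: "f:cmap A V W" and g: "g:cmap A V W" and h: "htp A R W (ccomp f rh) (ccomp g rh)"
 shows "htp A V W f g"
proof -
 interpret f: cxmap A V W f by(intro cxmapI trunc_cplx W f)
 interpret g: cxmap A V W g by(intro cxmapI trunc_cplx W g)
 have Wz: "x = 0[ob W n]" if "n < s" "x:el W n" for n x using W(2) that by(blast dest: zmodD)
 obtain h where "htpy A R W (ccomp f rh) (ccomp g rh) h" by(rule homotopicE[OF h trunc_cplx(1) W(1)])
 then interpret h: htpy A R W "ccomp f rh" "ccomp g rh" h .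
 define k where "k n = (if n > s then h n else (%_. 0[ob W (n-1)]))" for n
 show ?thesis
 proof(rule homotopicI)
  fix n show kl: "k n:lhom A (ob V n) (ob W (n-1))" using h.h_lhom by(simp add: k_def lhom_zero f.Y.lm trunc_above)
  fix v assume v: "v:el V n"
  show "f n v -[ob W n] g n v = df W (n-1) (k n v) +[ob W n] k (n+1) (df V n v)"
  proof(cases "n < s")
   case True
   thus ?thesis using trunc_zero[OF True v] by(simp add: k_def)
  next
   case False
   then obtain x where x: "x:el R n" "v = rh n x" using trunc_surj[OF _ v] by auto
   have 1: "k (n+1) (df V n v) = h (n+1) (df R n x)" using False x by(simp add: k_def trunc_above flip: rh.comm)
   have "df W (n-1) (h n x) = df W (n-1) (k n v)"
   proof(cases "n = s")
    case True
    hence "h n x = 0[ob W (n-1)]" using x by(intro Wz) simp_all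
    thus ?thesis using True by(simp add: k_def)
   next
    case F: False
    thus ?thesis using False x by(simp add: k_def trunc_above)
   qed
   thus ?thesis using h.eq[OF x(1)] 1 by(simp add: ccomp_def flip: x(2))
  qed
 qed
qed

end

section \<open>Mapping cones\<close>

definition cone :: "'a ring => 'a fgcpx => 'a fgcpx => 'a fgmap => 'a fgcpx => (int => 'a list set \<times> 'a list set => 'a list set) => bool" where
 "cone A X Y f C te <-> cplx A X & cplx A Y & cplx A C & f:cmap A X Y &
   (ALL n. te n:liso A (dsum (ob X (n+1)) (ob Y n)) (ob C n) &
    (ALL x:el X (n+1). ALL y:el Y n. df C n (te n (x, y)) =
       te (n+1) (-[ob X (n+2)] df X (n+1) x, f (n+1) x +[ob Y (n+1)] df Y n y)))"

lemma (in cx) d_closed2 [simp]: "x:el X (n+1) ==> df X (n+1) x:el X (n+2)"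
 using d.closed[of x "n+1"] by(simp add: add.assoc)

lemma (in cxmap) comm2: "x:el X (n+1) ==> f (n+2) (df X (n+1) x) = df Y (n+1) (f (n+1) x)"
 using comm[of x "n+1"] by(simp add: add.assoc)

locale cone_cx = cxmap A X Y f for A :: "'a ring" and X Y f +
 fixes C te
 assumes cone: "cone A X Y f C te"
begin

sublocale C: cx A C by(rule cxI) (use cone in "simp add: cone_def")

lemma te_liso: "te n:liso A (dsum (ob X (n+1)) (ob Y n)) (ob C n)"
 using cone by(simp add: cone_def)

lemma te_lmap: "lmap A (dsum (ob X (n+1)) (ob Y n)) (ob C n) (te n)"
 by(intro lmapI dsum_lm X.lm Y.lm C.lm liso_lhom te_liso)

lemma te_closed [simp]: "x:el X (n+1) ==> y:el Y n ==> te n (x, y):el C n"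
 using lmap.closed[OF te_lmap[of n], of "(x, y)"] by simp

lemma te_surj:
 assumes "c:el C n"
 obtains x y where "x:el X (n+1)" "y:el Y n" "c = te n (x, y)"
proof -
 have "c:te n ` (el X (n+1) \<times> el Y n)" using te_liso[of n] assms by(simp add: liso_def bij_betw_def)
 thus ?thesis using that by blast
qed

lemma te_inj:
 assumes "x:el X (n+1)" "y:el Y n" "x':el X (n+1)" "y':el Y n"
 shows "te n (x, y) = te n (x', y') <-> x = x' & y = y'"
proof -
 have "inj_on (te n) (el X (n+1) \<times> el Y n)" using te_liso[of n] by(simp add: liso_def bij_betw_def)
 hence "te n (x, y) = te n (x', y') <-> (x, y) = (x', y')" by(rule inj_on_eq_iff) (use assms in simp_all)
 thus ?thesis by simp
qed

lemma te_zero: "te n (0[ob X (n+1)], 0[ob Y n]) = 0[ob C n]"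
 using lmap.zero[OF te_lmap[of n]] by simp

lemma te_add:
 assumes "x:el X (n+1)" "y:el Y n" "x':el X (n+1)" "y':el Y n"
 shows "te n (x, y) +[ob C n] te n (x', y') = te n (x +[ob X (n+1)] x', y +[ob Y n] y')"
 using lmap.add[OF te_lmap[of n], of "(x, y)" "(x', y')"] assms by simp

lemma te_d:
 assumes "x:el X (n+1)" "y:el Y n"
 shows "df C n (te n (x, y)) = te (n+1) (-[ob X (n+2)] df X (n+1) x, f (n+1) x +[ob Y (n+1)] df Y n y)" using cone assms by(simp add: cone_def)

lemma te_d':
 assumes "x:el X n" "y:el Y (n-1)"
 shows "df C (n-1) (te (n-1) (x, y)) = te n (-[ob X (n+1)] df X n x, f n x +[ob Y n] df Y (n-1) y)"
 using te_d[of x "n-1" y] assms by(simp add: add.commute)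

lemma te_cocycle:
 assumes x: "x:el X (n+1)" and y: "y:el Y n"
 shows "df C n (te n (x, y)) = 0[ob C (n+1)] <->
  df X (n+1) x = 0[ob X (n+2)] & f (n+1) x +[ob Y (n+1)] df Y n y = 0[ob Y (n+1)]"
proof -
 have c: "df X (n+1) x:el X (n+1+1)" using X.d_closed2[OF x] by(simp add: add.assoc)
 have z: "te (n+1) (0[ob X (n+1+1)], 0[ob Y (n+1)]) = 0[ob C (n+1)]" by(rule te_zero)
 have m: "-[ob X (n+2)] df X (n+1) x = 0[ob X (n+2)] <-> df X (n+1) x = 0[ob X (n+2)]"
  using X.M.minus_minus[OF X.d_closed2[OF x]] by(metis X.M.a_inv_zero)
 show ?thesis unfolding te_d[OF x y] z[symmetric] by(subst te_inj) (use x y in "simp_all add: add.assoc")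
qed

lemma cone_map_out:
 assumes u: "!!n. u n:lhom A (dsum (ob X (n+1)) (ob Y n)) (M n)"
 obtains c where "ALL n. c n:lhom A (ob C n) (M n)"
  "ALL n. ALL x:el X (n+1). ALL y:el Y n. c n (te n (x, y)) = u n (x, y)"
proof -
 have "EX b. b:liso A (ob C n) (dsum (ob X (n+1)) (ob Y n)) & (ALL z:car (dsum (ob X (n+1)) (ob Y n)). b (te n z) = z)" for n
  by(rule liso_inv[OF te_liso dsum_lm[OF X.lm Y.lm]]) blast
 then obtain b where b: "!!n. b n:liso A (ob C n) (dsum (ob X (n+1)) (ob Y n))"
  "!!n z. z:car (dsum (ob X (n+1)) (ob Y n)) ==> b n (te n z) = z" by metis
 show ?thesis by(rule that[of "%n z. u n (b n z)"]) (simp_all add: lcomp[OF liso_lhom[OF b(1)] u] b(2))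
qed

end

lemma cone_cxI: "cone A X Y f C te ==> cone_cx A X Y f C te"
 unfolding cone_cx_def cone_cx_axioms_def by(intro conjI cxmapI) (simp_all add: cone_def)

lemma is_cone_cone:
 assumes "ring A" "X:Cb A" "Y:Cb A" "f:cmap A X Y" "is_cone A X Y f C io pj"
 obtains te where "cone A X Y f C te"
proof -
 obtain te where te: "ALL n. te n:liso A (dsum (ob X (n+1)) (ob Y n)) (ob C n) &
    (ALL x:el X (n+1). ALL y:el Y n.
      df C n (te n (x, y)) =
       te (n+1) (-[ob X (n+2)] df X (n+1) x, f (n+1) x +[ob Y (n+1)] df Y n y) &
      io n y = te n (0[ob X (n+1)], y) & pj n (te n (x, y)) = x)"
  using assms(5)[unfolded is_cone_def, THEN conjunct2, THEN conjunct2, THEN conjunct2] ..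
 have "C:Cb A" using assms(5) by(simp add: is_cone_def)
 hence "cone A X Y f C te" unfolding cone_def using te assms(1-4) by(simp add: Cb_cplx)
 thus ?thesis by(rule)
qed

lemma cone_exists:
 assumes X: "cplx A X" and Y: "cplx A Y" and f: "f:cmap A X Y"
 obtains C te where "cone A X Y f C te"
proof -
 interpret cxmap A X Y f by(intro cxmapI X Y f)
 have "ALL n. EX p. fst p:Mods A & snd p:liso A (dsum (ob X (n+1)) (ob Y n)) (fst p)"
  using Mods_dsum[OF X.ob_Mods Y.ob_Mods] by(metis fst_conv snd_conv)
 from choice[OF this] obtain p where p: "ALL n. fst (p n):Mods A & snd (p n):liso A (dsum (ob X (n+1)) (ob Y n)) (fst (p n))" ..
 define O' where "O' n = fst (p n)" for n
 define te where "te n = snd (p n)" for n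
 have O': "O' n:Mods A" and te: "te n:liso A (dsum (ob X (n+1)) (ob Y n)) (O' n)" for n using p by(simp_all add: O'_def te_def)
 note lD = dsum_lm[OF X.lm Y.lm]
 have "ALL n. EX bet. bet:liso A (O' n) (dsum (ob X (n+1)) (ob Y n)) & (ALL z:car (dsum (ob X (n+1)) (ob Y n)). bet (te n z) = z) & (ALL c:car (O' n). te n (bet c) = c)" by(metis liso_inv[OF te lD])
 from choice[OF this] obtain bet where bet: "ALL n. bet n:liso A (O' n) (dsum (ob X (n+1)) (ob Y n)) & (ALL z:car (dsum (ob X (n+1)) (ob Y n)). bet n (te n z) = z) & (ALL c:car (O' n). te n (bet n c) = c)" ..
 define b where "b n z = (-[ob X (n+1+1)] df X (n+1) (fst z), f (n+1) (fst z) +[ob Y (n+1)] df Y n (snd z))" for n z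
 have b: "b n:lhom A (dsum (ob X (n+1)) (ob Y n)) (dsum (ob X (n+1+1)) (ob Y (n+1)))" for n unfolding b_def[abs_def]
   by(intro lhom_dsum(3) lhom_neg lhom_add X.lm Y.lm lcomp[OF lhom_dsum(1)] lcomp[OF lhom_dsum(2)] X.d_lhom Y.d_lhom f_lhom)
 define C where "C = \<lparr>ob = O', df = (%n c. te (n+1) (b n (bet n c)))\<rparr>"
 have d: "df C n (te n z) = te (n+1) (b n z)" if "z:car (dsum (ob X (n+1)) (ob Y n))" for n z using bet that by(cases z) (simp add: C_def)
 have te_s: "EX x:el X (n+1). EX y:el Y n. c = te n (x, y)" if "c:car (O' n)" for c n
 proof -
  have "c:te n ` (el X (n+1) \<times> el Y n)" using te[of n] that by(simp add: liso_def bij_betw_def)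
  thus ?thesis by blast
 qed
 have "cplx A C" unfolding cplx_def
 proof(intro conjI allI ballI)
  show "ring A" using X by(simp add: cplx_def)
  fix n show "ob C n:Mods A" using O' by(simp add: C_def)
  show "df C n:lhom A (ob C n) (ob C (n+1))" unfolding C_def by simp (rule lcomp[OF lcomp[OF liso_lhom b] liso_lhom[OF te]], use bet in simp)
  fix c assume "c:el C n"
  then obtain x y where x: "x:el X (n+1)" "y:el Y n" "c = te n (x, y)" using te_s[of c n] by(auto simp: C_def)
  have c1: "b n (x, y):car (dsum (ob X (n+1+1)) (ob Y (n+1)))" using b[of n] x by(simp add: lhom_def Pi_iff)
  have 1: "df X (n+1) x:el X (n+1+1)" by(rule X.d.closed[OF x(1)])
  have 2: "df X (n+1+1) (df X (n+1) x) = 0[ob X (n+1+1+1)]" using X.dd[OF x(1)] by simp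
  have 3: "f (n+1+1) (df X (n+1) x) = df Y (n+1) (f (n+1) x)" by(rule comm[OF x(1)])
  have 4: "df Y (n+1) (df Y n y) = 0[ob Y (n+1+1)]" using Y.dd[OF x(2)] by(simp add: add.assoc)
  have 5: "df Y (n+1) (f (n+1) x):el Y (n+1+1)" using x(1) by(intro Y.d.closed) simp
  have "b (n+1) (b n (x, y)) = (0[ob X (n+1+1+1)], 0[ob Y (n+1+1)])" unfolding b_def fst_conv X.d.neg[OF 1] 2 f.neg[OF 1] 3
   using 5 by(simp add: Y.d.add[OF f.closed[OF x(1)] Y.d.closed[OF x(2)]] 4 Y.M.l_neg del:)
  hence "df C (n+1) (df C n c) = te (n+1+1) (0[dsum (ob X (n+1+1+1)) (ob Y (n+1+1))])" using d[OF c1] d[of "(x, y)" n] x by simp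
  also have "... = 0[ob C (n+1+1)]" using lmap.zero[OF lmapI[OF lD ModsD(1)[OF O'] liso_lhom[OF te]], of "n+1+1"] by(simp add: C_def)
  finally show "df C (n+1) (df C n c) = 0[ob C (n+2)]" by(simp add: add.assoc)
 qed
 moreover have "df C n (te n (x, y)) = te (n+1) (-[ob X (n+2)] df X (n+1) x, f (n+1) x +[ob Y (n+1)] df Y n y)" if "x:el X (n+1)" "y:el Y n" for n x y
  using d[of "(x, y)" n] that by(simp add: b_def add.assoc)
 ultimately have "cone A X Y f C te" using X Y f te by(simp add: cone_def) (simp add: C_def)
 thus ?thesis by(rule)
qed

text \<open>The map is \<open>(x, y) -> g y\<close>. In this way degreewise short exact sequences of
  complexes, and with them short exact sequences of modules, become triangles.\<close>

lemma cone_ses: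
 assumes cone: "cone A X Y f C te" and Z: "cplx A Z" and g: "g:cmap A Y Z" and inj: "!!n x. x:el X n ==> f n x = 0[ob Y n] ==> x = 0[ob X n]"
  and ex: "!!n y. y:el Y n ==> g n y = 0[ob Z n] <-> (EX x:el X n. y = f n x)" and surj: "!!n z. z:el Z n ==> EX y:el Y n. z = g n y"
 obtains gam where "qis A C Z gam"
proof -
 interpret cone_cx A X Y f C te by(rule cone_cxI[OF cone])
 interpret g: cxmap A Y Z g by(intro cxmapI Y.cplx Z g)
 have gf: "g n (f n x) = 0[ob Z n]" if "x:el X n" for n x using ex[of "f n x" n] that by auto
 obtain gam where gam: "ALL n. gam n:lhom A (ob C n) (ob Z n)"
  "ALL n. ALL x:el X (n+1). ALL y:el Y n. gam n (te n (x, y)) = g n (snd (x, y))" by(rule cone_map_out[OF lcomp[OF lhom_dsum(2) g.f_lhom]])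
 have gam_te: "gam n (te n (x, y)) = g n y" if "x:el X (n+1)" "y:el Y n" for n x y using gam(2) that by simp
 have "qis A C Z gam"
 proof(rule qisI)
  show "cxmap A C Z gam"
  proof(intro cxmapI C.cplx Z cmI gam(1)[rule_format])
   fix n c assume "c:el C n"
   then obtain x y where x: "x:el X (n+1)" "y:el Y n" "c = te n (x, y)" by(rule te_surj)
   show "gam (n+1) (df C n c) = df Z n (gam n c)" using te_d[OF x(1,2)] x by(simp add: add.assoc gam_te gf g.comm)
  qed
  fix n c z assume c: "c:el C (n+1)" "df C (n+1) c = 0[ob C (n+1+1)]" and z: "z:el Z n" "gam (n+1) c = df Z n z"
  obtain x y where x: "x:el X (n+1+1)" "y:el Y (n+1)" "c = te (n+1) (x, y)" using c(1) by(rule te_surj)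
  note co = c(2)[unfolded x(3) te_cocycle[OF x(1,2)]]
  obtain y0 where y0: "y0:el Y n" "z = g n y0" using surj[OF z(1)] by blast
  have "g (n+1) (y -[ob Y (n+1)] df Y n y0) = 0[ob Z (n+1)]" using z(2) x y0 by(simp add: gam_te g.comm)
  then obtain x0 where x0: "x0:el X (n+1)" "y -[ob Y (n+1)] df Y n y0 = f (n+1) x0" using ex[of "y -[ob Y (n+1)] df Y n y0" "n+1"] x(2) y0(1) by auto
  have "df Y n y0:el Y (n+1)" using y0 by simp
  hence y: "y = f (n+1) x0 +[ob Y (n+1)] df Y n y0" unfolding x0(2)[symmetric] using x(2) by algebra
  have "f (n+1+1) (x +[ob X (n+1+1)] df X (n+1) x0) = 0[ob Y (n+1+1)]" using co[THEN conjunct2] x(1) x0(1) y0(1) by(simp add: y comm2 add.assoc)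
  hence "x +[ob X (n+1+1)] df X (n+1) x0 = 0[ob X (n+1+1)]" by(intro inj) (use x x0 in "simp_all add: add.assoc")
  hence "c = df C n (te n (x0, y0))" using x(1) x0(1) te_d[OF x0(1) y0(1)] by(simp add: X.M.minus_equality add.assoc x(3) y)
  thus "EX w:el C n. EX v:el Z (n-1). c = df C n w & z = gam n w +[ob Z n] df Z (n-1) v"
   using x0 y0 by(intro bexI[of _ "te n (x0, y0)"] bexI[of _ "0[ob Z (n-1)]"]) (simp_all add: gam_te)
 qed
 thus ?thesis by(rule)
qed

text \<open>A homotopy \<open>k\<close> for the square gives the map
  \<open>(x, y) -> (a x, b y + k x)\<close> of cones. That it is a quasi-isomorphism is shown by a
  direct chase with \<open>qis_ex\<close> for \<open>a\<close> and then for \<open>b\<close>, in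
  place of long exact sequences.\<close>

lemma cone_map_qis:
 assumes cone: "cone A X Y f C te" and cone': "cone A X' Y' f' C' te'"
  and a: "qis A X X' a" and b: "qis A Y Y' b" and h: "htp A X Y' (ccomp b f) (ccomp f' a)"
 obtains c where "qis A C C' c"
proof -
 interpret P: cone_cx A X Y f C te by(rule cone_cxI[OF cone])
 interpret Q: cone_cx A X' Y' f' C' te' by(rule cone_cxI[OF cone'])
 interpret a: cxmap A X X' a by(intro cxmapI P.X.cplx Q.X.cplx qis_map[OF a])
 interpret b: cxmap A Y Y' b by(intro cxmapI P.Y.cplx Q.Y.cplx qis_map[OF b])
 obtain h where "htpy A X Y' (ccomp b f) (ccomp f' a) h" by(rule homotopicE[OF h P.X.cplx Q.Y.cplx])
 then interpret h: htpy A X Y' "ccomp b f" "ccomp f' a" h .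
 define k where "k n = h (n+1)" for n
 have kl: "k n:lhom A (ob X (n+1)) (ob Y' n)" for n using h.h_lhom[of "n+1"] by(simp add: k_def)
 interpret k: lmap A "ob X (n+1)" "ob Y' n" "k n" for n by(intro lmapI kl P.X.lm Q.Y.lm)
 have bf: "b (n+1) (f (n+1) x) = f' (n+1) (a (n+1) x) +[ob Y' (n+1)] (df Y' n (k n x) +[ob Y' (n+1)] k (n+1) (df X (n+1) x))"
  if x: "x:el X (n+1)" for n x
 proof -
  have c: "b (n+1) (f (n+1) x):el Y' (n+1)" "f' (n+1) (a (n+1) x):el Y' (n+1)" using x by simp_all
  have "b (n+1) (f (n+1) x) = f' (n+1) (a (n+1) x) +[ob Y' (n+1)] (b (n+1) (f (n+1) x) -[ob Y' (n+1)] f' (n+1) (a (n+1) x))" using c by algebra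
  thus ?thesis using h.eq[OF x] by(simp add: ccomp_def k_def)
 qed
 obtain c where c: "ALL n. c n:lhom A (ob C n) (ob C' n)"
  "ALL n. ALL x:el X (n+1). ALL y:el Y n. c n (te n (x, y)) = te' n (a (n+1) (fst (x, y)), b n (snd (x, y)) +[ob Y' n] k n (fst (x, y)))"
  by(rule P.cone_map_out[OF lcomp[OF lhom_dsum(3)[OF lcomp[OF lhom_dsum(1) a.f_lhom]
     lhom_add[OF Q.Y.lm lcomp[OF lhom_dsum(2) b.f_lhom] lcomp[OF lhom_dsum(1) kl]]] liso_lhom[OF Q.te_liso]]])
 have cte: "c n (te n (x, y)) = te' n (a (n+1) x, b n y +[ob Y' n] k n x)" if "x:el X (n+1)" "y:el Y n" for n x y using c(2) that by simp
 have "qis A C C' c"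
 proof(rule qisI)
  show "cxmap A C C' c"
  proof(intro cxmapI P.C.cplx Q.C.cplx cmI c(1)[rule_format])
   fix n w assume "w:el C n"
   then obtain x y where x: "x:el X (n+1)" and y: "y:el Y n" and w: "w = te n (x, y)" by(rule P.te_surj)
   have dx: "df X (n+1) x:el X (n+1+1)" by(rule P.X.d.closed[OF x])
   have c1: "f' (n+1) (a (n+1) x):el Y' (n+1)" "df Y' n (k n x):el Y' (n+1)"
    "k (n+1) (df X (n+1) x):el Y' (n+1)" "df Y' n (b n y):el Y' (n+1)" using x y k.closed[OF dx] by simp_all
   have "c (n+1) (df C n w) = te' (n+1) (a (n+1+1) (-[ob X (n+2)] df X (n+1) x),
     b (n+1) (f (n+1) x +[ob Y (n+1)] df Y n y) +[ob Y' (n+1)] k (n+1) (-[ob X (n+2)] df X (n+1) x))"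
    unfolding w P.te_d[OF x y] by(rule cte) (use x y in "simp_all add: add.assoc")
   also have "a (n+1+1) (-[ob X (n+2)] df X (n+1) x) = -[ob X' (n+2)] df X' (n+1) (a (n+1) x)"
    using a.f.neg[OF dx] a.comm[OF x] by(simp add: add.assoc)
   also have "k (n+1) (-[ob X (n+2)] df X (n+1) x) = -[ob Y' (n+1)] k (n+1) (df X (n+1) x)" using k.neg[OF dx] by(simp add: add.assoc)
   also have "b (n+1) (f (n+1) x +[ob Y (n+1)] df Y n y) = b (n+1) (f (n+1) x) +[ob Y' (n+1)] df Y' n (b n y)" using x y by(simp add: b.comm)
   also have "b (n+1) (f (n+1) x) +[ob Y' (n+1)] df Y' n (b n y) +[ob Y' (n+1)] -[ob Y' (n+1)] k (n+1) (df X (n+1) x)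
    = f' (n+1) (a (n+1) x) +[ob Y' (n+1)] (df Y' n (b n y) +[ob Y' (n+1)] df Y' n (k n x))" unfolding bf[OF x] using c1 by algebra
   also have "df Y' n (b n y) +[ob Y' (n+1)] df Y' n (k n x) = df Y' n (b n y +[ob Y' n] k n x)" using x y by simp
   also have "te' (n+1) (-[ob X' (n+2)] df X' (n+1) (a (n+1) x), f' (n+1) (a (n+1) x) +[ob Y' (n+1)] df Y' n (b n y +[ob Y' n] k n x))
    = df C' n (te' n (a (n+1) x, b n y +[ob Y' n] k n x))" by(rule Q.te_d[symmetric]) (use x y in simp_all)
   finally show "c (n+1) (df C n w) = df C' n (c n w)" unfolding w cte[OF x y] .
  qed
  fix n w w' assume w: "w:el C (n+1)" "df C (n+1) w = 0[ob C (n+1+1)]" and w': "w':el C' n" "c (n+1) w = df C' n w'"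
  obtain x y where x: "x:el X (n+1+1)" and y: "y:el Y (n+1)" and ww: "w = te (n+1) (x, y)" using w(1) by(rule P.te_surj)
  obtain x' y' where x': "x':el X' (n+1)" and y': "y':el Y' n" and ww': "w' = te' n (x', y')" using w'(1) by(rule Q.te_surj)
  have co: "df X (n+1+1) x = 0[ob X (n+1+1+1)]" "f (n+1+1) x +[ob Y (n+1+1)] df Y (n+1) y = 0[ob Y (n+1+1)]"
   using w(2)[unfolded ww P.te_cocycle[OF x y]] by simp_all
  have "te' (n+1) (a (n+1+1) x, b (n+1) y +[ob Y' (n+1)] k (n+1) x) =
    te' (n+1) (-[ob X' (n+1+1)] df X' (n+1) x', f' (n+1) x' +[ob Y' (n+1)] df Y' n y')"
   using w'(2) Q.te_d[OF x' y'] cte[OF x y] by(simp add: ww ww' add.assoc)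
  hence "a (n+1+1) x = -[ob X' (n+1+1)] df X' (n+1) x' & b (n+1) y +[ob Y' (n+1)] k (n+1) x = f' (n+1) x' +[ob Y' (n+1)] df Y' n y'"
   by(rule iffD1[OF Q.te_inj, rotated 4]) (use x y x' y' in "simp_all add: add.assoc")
  note e = this[THEN conjunct1] this[THEN conjunct2]
  have ax: "a (n+1+1) x = df X' (n+1) (-[ob X' (n+1)] x')" using e(1) x' by simp
  obtain z p where z: "z:el X (n+1)" "x = df X (n+1) z" and "p:el X' (n+1-1)" "-[ob X' (n+1)] x' = a (n+1) z +[ob X' (n+1)] df X' (n+1-1) p"
   by(rule qis_ex[OF a x co(1) _ ax]) (use x' in simp)
  hence p: "p:el X' n" and "x' = -[ob X' (n+1)] (a (n+1) z +[ob X' (n+1)] df X' n p)" using x' Q.X.M.minus_minus[of x' "n+1"] by simp_all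
  hence xp: "x' = -[ob X' (n+1)] a (n+1) z -[ob X' (n+1)] df X' n p" using z by(simp add: Q.X.M.minus_add a_minus_def)
  \<comment> \<open>Solving the first coordinate along \<open>a\<close> changes what remains in the
    second one. \<open>e\<close> is the corrected element, chosen so that \<open>b\<close> sends the
    cocycle \<open>y + f z\<close> to its differential.\<close>
  define e where "e = (y' +[ob Y' n] k n z) -[ob Y' n] f' n p"
  have ec: "e:el Y' n" unfolding e_def using y' z p by simp
  have cc: "f' (n+1) (a (n+1) z):el Y' (n+1)" "df Y' n (f' n p):el Y' (n+1)" "df Y' n y':el Y' (n+1)" "df Y' n (k n z):el Y' (n+1)"
   "k (n+1) x:el Y' (n+1)" "b (n+1) y:el Y' (n+1)" using x y y' z(1) p by simp_all
  have "b (n+1) y = (b (n+1) y +[ob Y' (n+1)] k (n+1) x) -[ob Y' (n+1)] k (n+1) x" using cc by algebra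
  also have "... = (-[ob Y' (n+1)] f' (n+1) (a (n+1) z) -[ob Y' (n+1)] df Y' n (f' n p) +[ob Y' (n+1)] df Y' n y') -[ob Y' (n+1)] k (n+1) x"
   unfolding e(2) xp using z p by(simp add: Q.comm)
  finally have by1: "b (n+1) y = ..." .
  have "b (n+1) (y +[ob Y (n+1)] f (n+1) z) = b (n+1) y +[ob Y' (n+1)] (f' (n+1) (a (n+1) z) +[ob Y' (n+1)] (df Y' n (k n z) +[ob Y' (n+1)] k (n+1) x))"
   using y z bf[OF z(1)] by simp
  also have "... = (df Y' n y' +[ob Y' (n+1)] df Y' n (k n z)) -[ob Y' (n+1)] df Y' n (f' n p)" unfolding by1 using cc by algebra
  also have "... = df Y' n e" unfolding e_def using y' z p by simp
  finally have be: "b (n+1) (y +[ob Y (n+1)] f (n+1) z) = df Y' n e" .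
  have dz: "df Y (n+1) (y +[ob Y (n+1)] f (n+1) z) = 0[ob Y (n+1+1)]" using co(2) y z by(simp add: P.Y.M.a_comm P.comm2 add.assoc)
  obtain v q where v: "v:el Y n" "q:el Y' (n-1)" "y +[ob Y (n+1)] f (n+1) z = df Y n v" "e = b n v +[ob Y' n] df Y' (n-1) q"
   by(rule qis_ex[OF b _ dz ec be]) (use y z in simp)
  have fz: "f (n+1) z:el Y (n+1)" using z by simp
  have "y = -[ob Y (n+1)] f (n+1) z +[ob Y (n+1)] (y +[ob Y (n+1)] f (n+1) z)" using y fz by algebra
  hence "w = df C n (te n (-[ob X (n+1)] z, v))" by(subst P.te_d) (use z v in "simp_all add: ww add.assoc P.X.M.minus_minus")
  moreover have "w' = c n (te n (-[ob X (n+1)] z, v)) +[ob C' n] df C' (n-1) (te' (n-1) (p, q))"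
  proof -
   have dc: "f' n p:el Y' n" "k n z:el Y' n" "b n v:el Y' n" "df Y' (n-1) q:el Y' n" using z p v by simp_all
   have "y' = (e +[ob Y' n] f' n p) -[ob Y' n] k n z" unfolding e_def using y' dc by algebra
   also have "... = (b n v -[ob Y' n] k n z) +[ob Y' n] (f' n p +[ob Y' n] df Y' (n-1) q)" unfolding v(4) using dc by algebra
   finally show ?thesis using z p v by(subst Q.te_d') (simp_all add: cte Q.te_add ww' xp a_minus_def)
  qed
  ultimately show "EX u:el C n. EX v:el C' (n-1). w = df C n u & w' = c n u +[ob C' n] df C' (n-1) v"
   using z p v by(intro bexI[of _ "te n (-[ob X (n+1)] z, v)"] bexI[of _ "te' (n-1) (p, q)"]) simp_all
 qed
 thus ?thesis by(rule)
qed

lemma cone_bproj: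
 assumes "cone A R S p C te" "bproj A R" "bproj A S"
 shows "bproj A C"
proof -
 interpret cone_cx A R S p C te by(rule cone_cxI[OF assms(1)])
 have "projective A (ob C n)" for n by(rule projective_dsum[OF bprojD(2)[OF assms(2)] bprojD(2)[OF assms(3)] C.ob_Mods te_liso])
 moreover obtain N M where N: "ALL n>N. zmod (ob R n)" "ALL n>M. zmod (ob S n)" using assms(2,3) unfolding bproj_def by blast
 have "zmod (ob C n)" if n: "n > max N M" for n
 proof(rule zmodI[OF C.lm])
  fix c assume "c:el C n"
  then obtain x y where x: "x:el R (n+1)" "y:el S n" "c = te n (x, y)" by(rule te_surj)
  show "c = 0[ob C n]" using zmodD[OF N(1)[rule_format] x(1)] zmodD[OF N(2)[rule_format] x(2)] n x(3) te_zero by simp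
 qed
 ultimately show ?thesis unfolding bproj_def using C.cplx by blast
qed

subsection \<open>The derived category via projective resolutions\<close>

text \<open>Homotopy together with all typing conditions, so that it can be chained and composed
  without side conditions on the maps compared.\<close>

definition hm :: "'a ring => 'a fgcpx => 'a fgcpx => 'a fgmap => 'a fgmap => bool" where
 "hm A X Y f g <-> cplx A X & cplx A Y & f:cmap A X Y & g:cmap A X Y & htp A X Y f g"

lemma hmI: "[|cplx A X; cplx A Y; f:cmap A X Y; g:cmap A X Y; htp A X Y f g|] ==> hm A X Y f g"
 by(simp add: hm_def)

lemma hmD: assumes "hm A X Y f g" shows "cplx A X" "cplx A Y" "f:cmap A X Y" "g:cmap A X Y" "htp A X Y f g"
 using assms by(simp_all add: hm_def)

lemma hm_refl: "[|cplx A X; cplx A Y; f:cmap A X Y|] ==> hm A X Y f f"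
 by(simp add: hm_def homotopic_refl)

lemma hm_sym: "hm A X Y f g ==> hm A X Y g f"
 by(simp add: hm_def homotopic_sym)

lemma hm_trans: "hm A X Y f g ==> hm A X Y g h ==> hm A X Y f h"
 unfolding hm_def using homotopic_trans by blast

lemma hm_comp:
 assumes "hm A X Y f f'" "hm A Y Z g g'" shows "hm A X Z (ccomp g f) (ccomp g' f')"
proof -
 note 1 = hmD[OF assms(1)] and 2 = hmD[OF assms(2)]
 have "hm A X Z (ccomp g f) (ccomp g f')" by(intro hmI 1 2 cm_comp[OF 1(3) 2(3)] cm_comp[OF 1(4) 2(3)] htp_left[OF 1(1,2) 2(2) 1(5) 2(3) 1(3,4)])
 moreover have "hm A X Z (ccomp g f') (ccomp g' f')"
  by(intro hmI 1 2 cm_comp[OF 1(4) 2(3)] cm_comp[OF 1(4) 2(4)] htp_right[OF 2(1,2) 1(1) 2(5) 1(4) 2(3,4)])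
 ultimately show ?thesis by(rule hm_trans)
qed

lemma hm_left: "hm A X Y f f' ==> cplx A Z ==> g:cmap A Y Z ==> hm A X Z (ccomp g f) (ccomp g f')"
 by(rule hm_comp[OF _ hm_refl[OF hmD(2)]])

lemma hm_right: "hm A Y Z g g' ==> cplx A X ==> f:cmap A X Y ==> hm A X Z (ccomp g f) (ccomp g' f)"
 by(rule hm_comp[OF hm_refl[OF _ hmD(1)]])

lemma hm_eq:
 assumes "cplx A X" "cplx A Y" "f:cmap A X Y" "g:cmap A X Y" "!!n x. x:el X n ==> f n x = g n x"
 shows "hm A X Y f g" by(intro hmI homotopic_zeroI) (use assms in auto)

lemma hm_qis: "qis A X Y f ==> hm A X Y f g ==> qis A X Y g"
 using qis_homotopic[of A X Y X f g] by(simp add: hm_def)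

lemma hm_lift:
 assumes "bproj A R" "cplx A W" "cplx A X" "qis A W X s" "p:cmap A R X"
 obtains w where "w:cmap A R W" "hm A R X (ccomp s w) p"
proof -
 obtain w where w: "w:cmap A R W" "htp A R X (ccomp s w) p" by(rule qis_lift[OF assms])
 have "hm A R X (ccomp s w) p" by(intro hmI w(2) assms bprojD cm_comp[OF w(1) qis_map[OF assms(4)]])
 with w(1) show ?thesis by(rule)
qed

lemma hm_cancel:
 assumes "bproj A R" "cplx A W" "qis A W X s" "w1:cmap A R W" "w2:cmap A R W" "hm A R X (ccomp s w1) (ccomp s w2)"
 shows "hm A R W w1 w2" by(intro hmI assms bprojD qis_cancel[OF assms(1,2) hmD(2)[OF assms(6)] assms(3-5) hmD(5)[OF assms(6)]])

lemma heq_hm: "cplx A X ==> cplx A Y ==> heq A X Y f g <-> f:cmap A X Y & g:cmap A Y X &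
   hm A X X (ccomp g f) cid & hm A Y Y (ccomp f g) cid" unfolding heq_def hm_def by(auto simp: cm_id intro: cm_comp)

lemma hm_fac:
 "hm A R W (ccomp u rh) w ==> cplx A Z ==> f:cmap A W Z ==> hm A R Z (ccomp f w) t ==> hm A R Z (ccomp (ccomp f u) rh) t"
 using hm_trans[OF hm_left[of A R W "ccomp u rh" w Z f]] by(simp add: ccomp_assoc)

context artin_alg
begin

definition res :: "'a fgcpx => 'a fgmap => 'a fgcpx => bool" where
 "res R t X <-> bproj A R & qis A R X t"

definition rs :: "'a fgcpx => 'a fgcpx \<times> 'a fgmap" where
 "rs X = (SOME p. res (fst p) (snd p) X)"

abbreviation "rr X \<equiv> fst (rs X)"
abbreviation "tt X \<equiv> snd (rs X)"

lemma Cb_cx: "X:Cb A ==> cplx A X"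
 by(rule Cb_cplx[OF ring_A])

lemma Cb_bounds:
 assumes "X:Cb A"
 obtains N where "ALL n. \<bar>n\<bar> > N --> zmod (ob X n)" using assms unfolding Cb_def by blast

lemma res_rs: assumes "X:Cb A" shows "bproj A (rr X)" "qis A (rr X) X (tt X)"
proof -
 obtain N where N: "ALL n. \<bar>n\<bar> > N --> zmod (ob X n)" by(rule Cb_bounds[OF assms])
 have "exact_at X n" if "n > \<bar>N\<bar>" for n by(rule exact_at_zero[OF Cb_cx[OF assms]]) (use N that in simp)
 then obtain R t where "bproj A R" "qis A R X t" using resolution_exists[OF Cb_cx[OF assms], of "\<bar>N\<bar>"] by metis
 hence "res (fst (R, t)) (snd (R, t)) X" by(simp add: res_def)
 hence "res (rr X) (tt X) X" unfolding rs_def by(rule someI[where P = "%p. res (fst p) (snd p) X"])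
 thus "bproj A (rr X)" "qis A (rr X) X (tt X)" by(simp_all add: res_def)
qed

lemma rr_cx: "X:Cb A ==> cplx A (rr X)" and tt_map: "X:Cb A ==> tt X:cmap A (rr X) X"
 using res_rs[of X] bprojD(1) qis_map by blast+

lemma Cb_trunc:
 assumes R: "bproj A R" and T: "trunc A s R V rh"
 shows "V:Cb A"
proof -
 obtain N where N: "ALL n>N. zmod (ob R n)" using R unfolding bproj_def by blast
 have "zmod (ob V n)" if "\<bar>n\<bar> > \<bar>s\<bar>+\<bar>N\<bar>" for n
 proof(cases "n < s")
  case True
  thus ?thesis using T by(simp add: trunc_def)
 next
  case False
  thus ?thesis using N that by(simp add: trunc_above[OF T])
 qed
 thus ?thesis using Cb_iff[OF ring_A] trunc_cplx(2)[OF T] by blast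
qed

text \<open>\<open>V\<close> is a bounded stand-in for the resolution of \<open>X\<close>: maps from
  the resolution to members of \<open>S\<close> factor through it, uniquely up to homotopy. It can
  serve as the apex of a roof, which the possibly unbounded \<open>rr X\<close> cannot.\<close>

definition cofac :: "'a fgcpx => 'a fgcpx set => 'a fgcpx => 'a fgmap => bool" where
 "cofac X S V rh <-> V:Cb A & cplx A V & rh:cmap A (rr X) V &
  (ALL Z:S. (ALL f:cmap A (rr X) Z. EX g:cmap A V Z. hm A (rr X) Z (ccomp g rh) f) &
   (ALL f:cmap A V Z. ALL g:cmap A V Z. hm A (rr X) Z (ccomp f rh) (ccomp g rh) --> htp A V Z f g)) &
  (ALL f:cmap A V X. hm A (rr X) X (ccomp f rh) (tt X) --> qis A V X f)"

lemma cofacD: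
 assumes "cofac X S V rh"
 shows "V:Cb A" "cplx A V" "rh:cmap A (rr X) V"
  "Z:S ==> f:cmap A (rr X) Z ==> EX g:cmap A V Z. hm A (rr X) Z (ccomp g rh) f"
  "Z:S ==> f:cmap A V Z ==> g:cmap A V Z ==> hm A (rr X) Z (ccomp f rh) (ccomp g rh) ==> htp A V Z f g"
  "f:cmap A V X ==> hm A (rr X) X (ccomp f rh) (tt X) ==> qis A V X f" using assms by(simp_all add: cofac_def)

text \<open>The truncation is made below \<open>X\<close> and all members of \<open>S\<close>, which
  are finitely many bounded complexes. Since \<open>X\<close> is zero below the cut, no cohomology
  is lost.\<close>

lemma rr_trunc:
 assumes X: "X:Cb A" and "finite S" "S <= Cb A"
 obtains V rh where "cofac X S V rh"
proof -
 have "EX s. ALL Y:insert X S. ALL n<s. zmod (ob Y n)" using assms(2,3)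
 proof(induction S rule: finite_induct)
  case empty
  obtain N where "ALL n. \<bar>n\<bar> > N --> zmod (ob X n)" by(rule Cb_bounds[OF X])
  thus ?case by(intro exI[of _ "- \<bar>N\<bar>"]) auto
 next
  case (insert Y S)
  then obtain s where s: "ALL Y:insert X S. ALL n<s. zmod (ob Y n)" by blast
  obtain N where "ALL n. \<bar>n\<bar> > N --> zmod (ob Y n)" using insert.prems by(auto elim: Cb_bounds)
  thus ?case using s by(intro exI[of _ "min s (- \<bar>N\<bar>)"]) auto
 qed
 then obtain s where s: "ALL Y:insert X S. ALL n<s. zmod (ob Y n)" ..
 note R = res_rs[OF X]
 have cR: "cplx A (rr X)" by(rule bprojD[OF R(1)])
 interpret R: cx A "rr X" by(rule cxI[OF cR])
 obtain Q pj where Q: "Q:Mods A" "pj:lhom A (ob (rr X) s) Q" "pj ` el (rr X) s = car Q"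
  "ALL x:el (rr X) s. pj x = 0[Q] <-> x:coboundaries (rr X) s" by(rule quotient_Mods[OF R.ob_Mods coboundaries_submod[OF cR]])
 obtain V rh where T: "trunc A s (rr X) V rh" by(rule trunc_exists[OF cR Q])
 note cV = trunc_cplx(2)[OF T] and rh = trunc_cplx(3)[OF T]
 have q: "qis A (rr X) V rh" using qis_exact_at[OF cR Cb_cx[OF X] R(2)] exact_at_zero[OF Cb_cx[OF X]] s trunc_qis[OF T] by simp
 have "cofac X S V rh" unfolding cofac_def
 proof(intro conjI ballI impI Cb_trunc[OF R(1) T] cV rh)
  fix Z f assume Z: "Z:S"
  hence z: "n < s ==> zmod (ob Z n)" and cZ: "cplx A Z" for n using s assms(3) Cb_cx by auto
  show "EX g:cmap A V Z. hm A (rr X) Z (ccomp g rh) f" if f: "f:cmap A (rr X) Z"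
  proof -
   obtain g where g: "g:cmap A V Z" "ALL n. ALL x:el (rr X) n. g n (rh n x) = f n x" by(rule trunc_factor[OF T cZ z f])
   thus ?thesis by(intro bexI[OF _ g(1)] hm_eq cR cZ f cm_comp[OF rh g(1)]) (simp add: ccomp_def)
  qed
  show "htp A V Z f g" if "f:cmap A V Z" "g:cmap A V Z" "hm A (rr X) Z (ccomp f rh) (ccomp g rh)" for g
   by(rule trunc_homotopic[OF T cZ z that(1,2) hmD(5)[OF that(3)]])
 next
  fix f assume "f:cmap A V X" "hm A (rr X) X (ccomp f rh) (tt X)"
  thus "qis A V X f" using qis_cancel_right[OF cR cV Cb_cx[OF X] q] hm_qis[OF R(2) hm_sym] by blast
 qed
 thus ?thesis by(rule that)
qed

text \<open>The roofs whose morphism lifts to \<open>p\<close> on the chosen resolutions. All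
  operations on classes of roofs are translated into operations on homotopy classes of such
  \<open>p\<close>.\<close>

definition cls :: "'a fgcpx => 'a fgcpx => 'a fgmap => 'a roof set" where
 "cls X Y p = {(W, s, f). (W, s, f):roofs A X Y &
   (EX w:cmap A (rr X) W. hm A (rr X) X (ccomp s w) (tt X) & hm A (rr X) Y (ccomp f w) (ccomp (tt Y) p))}"

lemma roofsD:
 assumes "(W, s, f):roofs A X Y" "X:Cb A"
 shows "W:Cb A" "qis A W X s" "f:cmap A W Y" "cplx A W" using assms quasi_isos_iff[OF Cb_cx Cb_cx, of W X s] Cb_cx[of W] by(auto simp: roofs_def)

lemma roofsI: "[|W:Cb A; X:Cb A; qis A W X s; f:cmap A W Y|] ==> (W, s, f):roofs A X Y"
 using quasi_isos_iff[OF Cb_cx Cb_cx, of W X s] by(simp add: roofs_def)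

lemma cls_roofs: "cls X Y p <= roofs A X Y"
 by(auto simp: cls_def)

lemma clsI:
 "[|W:Cb A; X:Cb A; qis A W X s; f:cmap A W Y; w:cmap A (rr X) W;
  hm A (rr X) X (ccomp s w) (tt X); hm A (rr X) Y (ccomp f w) (ccomp (tt Y) p)|] ==> (W, s, f):cls X Y p" unfolding cls_def by(auto intro: roofsI)

context
 fixes X Y :: "'a fgcpx"
 assumes X: "X:Cb A" and Y: "Y:Cb A"
begin

lemmas cX = Cb_cx[OF X] and cY = Cb_cx[OF Y]
lemmas R = res_rs(1)[OF X] and S = res_rs(1)[OF Y] and cR = rr_cx[OF X] and cS = rr_cx[OF Y]
lemmas tX = res_rs(2)[OF X] and tY = res_rs(2)[OF Y] and mX = tt_map[OF X] and mY = tt_map[OF Y]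

lemma cls_any:
 assumes r: "(W, s, f):cls X Y p" and w: "w:cmap A (rr X) W" "hm A (rr X) X (ccomp s w) (tt X)"
 shows "hm A (rr X) Y (ccomp f w) (ccomp (tt Y) p)"
proof -
 from r obtain w' where ro: "(W, s, f):roofs A X Y" and w': "w':cmap A (rr X) W"
  "hm A (rr X) X (ccomp s w') (tt X)" "hm A (rr X) Y (ccomp f w') (ccomp (tt Y) p)" unfolding cls_def by blast
 note ro = roofsD[OF ro X]
 have "hm A (rr X) W w w'" by(rule hm_cancel[OF R ro(4,2) w(1) w'(1) hm_trans[OF w(2) hm_sym[OF w'(2)]]])
 from hm_left[OF this cY ro(3)] w'(3) show ?thesis by(rule hm_trans)
qed

lemma roof_rep:
 assumes r: "(W, s, f):roofs A X Y"
 obtains p where "p:cmap A (rr X) (rr Y)" "(W, s, f):cls X Y p"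
proof -
 note ro = roofsD[OF r X]
 obtain w where w: "w:cmap A (rr X) W" "hm A (rr X) X (ccomp s w) (tt X)" by(rule hm_lift[OF R ro(4) cX ro(2) mX])
 obtain p where p: "p:cmap A (rr X) (rr Y)" "hm A (rr X) Y (ccomp (tt Y) p) (ccomp f w)" by(rule hm_lift[OF R cS cY tY cm_comp[OF w(1) ro(3)]])
 have "(W, s, f):cls X Y p" unfolding cls_def using p w r by(auto intro: hm_sym)
 with p(1) show ?thesis by(rule)
qed

lemma cls_hm:
 assumes "r:cls X Y p" "r:cls X Y p'" and p: "p:cmap A (rr X) (rr Y)" "p':cmap A (rr X) (rr Y)"
 shows "hm A (rr X) (rr Y) p p'"
proof -
 obtain W s f where r: "r = (W, s, f)" by(cases r)
 from assms(1) obtain w where w: "w:cmap A (rr X) W"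
  "hm A (rr X) X (ccomp s w) (tt X)" "hm A (rr X) Y (ccomp f w) (ccomp (tt Y) p)" unfolding cls_def r by blast
 have "hm A (rr X) Y (ccomp f w) (ccomp (tt Y) p')" using assms(2) w(1,2) unfolding r by(rule cls_any)
 with w(3) have "hm A (rr X) Y (ccomp (tt Y) p) (ccomp (tt Y) p')" using hm_sym hm_trans by blast
 thus ?thesis by(rule hm_cancel[OF R cS tY p])
qed

lemma cls_cong:
 assumes "hm A (rr X) (rr Y) p p'" shows "cls X Y p = cls X Y p'"
proof -
 have "cls X Y p <= cls X Y p'" if "hm A (rr X) (rr Y) p p'" for p p' using hm_left[OF that cY mY] unfolding cls_def by(auto intro: hm_trans)
 from this[OF assms] this[OF hm_sym[OF assms]] show ?thesis by blast
qed

text \<open>Sums of classes are defined on roofs with a common denominator. A truncation of the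
  resolution of \<open>X\<close> provides one for any two morphisms.\<close>

lemma cls_common:
 assumes p: "p:cmap A (rr X) (rr Y)" "q:cmap A (rr X) (rr Y)"
 obtains V s f g where "(V, s, f):cls X Y p" "(V, s, g):cls X Y q"
proof -
 have F: "finite {X, Y}" "{X, Y} <= Cb A" using X Y by simp_all
 from X F obtain V rh where "cofac X {X, Y} V rh" by(rule rr_trunc)
 note V = cofacD(1-3)[OF this] and fac = cofacD(4)[OF this] and can = cofacD(5)[OF this] and q = cofacD(6)[OF this]
 obtain s where s: "s:cmap A V X" "hm A (rr X) X (ccomp s rh) (tt X)" using fac[OF _ mX] by blast
 have "EX f:cmap A V Y. hm A (rr X) Y (ccomp f rh) (ccomp (tt Y) p)" if "p:cmap A (rr X) (rr Y)" for p by(rule fac[OF _ cm_comp[OF that mY]]) simp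
 from this[OF p(1)] this[OF p(2)] show ?thesis using that clsI[OF V(1) X q[OF s] _ V(3) s(2)] by blast
qed

text \<open>From a common refinement of two roofs both lifts are computed through its apex.
  Conversely, two roofs with the same lift are both refined by a truncation of the resolution of
  \<open>X\<close> that is fine enough for both apexes.\<close>

lemma roof_eq_cls:
 assumes r: "r:cls X Y p" and r': "r':roofs A X Y" and p: "p:cmap A (rr X) (rr Y)"
 shows "roof_eq A X Y r r' <-> r':cls X Y p"
proof -
 obtain W s f W' s' f' where rr: "r = (W, s, f)" "r' = (W', s', f')" by(cases r, cases r')
 from r obtain w where ro: "(W, s, f):roofs A X Y" and w: "w:cmap A (rr X) W"
  "hm A (rr X) X (ccomp s w) (tt X)" "hm A (rr X) Y (ccomp f w) (ccomp (tt Y) p)" unfolding cls_def rr by blast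
 note ro = roofsD[OF ro X] and ro' = roofsD[OF r'[unfolded rr] X]
 show ?thesis
 proof
  assume "roof_eq A X Y r r'"
  then obtain V u u' where V: "V:Cb A" "u:cmap A V W" "u':cmap A V W'" "ccomp s u:quasi_isos A V X"
   "htp A V X (ccomp s u) (ccomp s' u')" "htp A V Y (ccomp f u) (ccomp f' u')" unfolding roof_eq_def rr by blast
  note cV = Cb_cx[OF V(1)]
  have su: "qis A V X (ccomp s u)" using V(4) quasi_isos_iff[OF cV cX] by simp
  have h1: "hm A V X (ccomp s u) (ccomp s' u')" and h2: "hm A V Y (ccomp f u) (ccomp f' u')"
   by(intro hmI cV cX cY V(5,6) cm_comp[OF V(2)] cm_comp[OF V(3)] qis_map[OF ro(2)] ro(3) qis_map[OF ro'(2)] ro'(3))+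
  obtain v where v: "v:cmap A (rr X) V" "hm A (rr X) X (ccomp (ccomp s u) v) (tt X)" by(rule hm_lift[OF R cV cX su mX])
  have "hm A (rr X) Y (ccomp (ccomp f' u') v) (ccomp (tt Y) p)" using cls_any[OF r[unfolded rr] cm_comp[OF v(1) V(2)]] v(2) hm_trans[OF hm_sym[OF hm_right[OF h2 cR v(1)]]] by(simp add: ccomp_assoc)
  moreover have "hm A (rr X) X (ccomp (ccomp s' u') v) (tt X)" by(rule hm_trans[OF hm_sym[OF hm_right[OF h1 cR v(1)]] v(2)])
  ultimately show "r':cls X Y p" unfolding rr by(intro clsI[OF ro'(1) X ro'(2,3) cm_comp[OF v(1) V(3)]]) (simp_all add: ccomp_assoc)
 next
  assume "r':cls X Y p"
  then obtain w' where w': "w':cmap A (rr X) W'"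
   "hm A (rr X) X (ccomp s' w') (tt X)" "hm A (rr X) Y (ccomp f' w') (ccomp (tt Y) p)" unfolding cls_def rr by blast
  have F: "finite {X, Y, W, W'}" "{X, Y, W, W'} <= Cb A" using X Y ro(1) ro'(1) by simp_all
  from X F obtain V rh where "cofac X {X, Y, W, W'} V rh" by(rule rr_trunc)
  note V = cofacD(1-3)[OF this] and fac = cofacD(4)[OF this] and can = cofacD(5)[OF this] and q = cofacD(6)[OF this]
  obtain u where u: "u:cmap A V W" "hm A (rr X) W (ccomp u rh) w" using fac[OF _ w(1)] by blast
  obtain u' where u': "u':cmap A V W'" "hm A (rr X) W' (ccomp u' rh) w'" using fac[OF _ w'(1)] by blast
  note sm = qis_map[OF ro(2)] qis_map[OF ro'(2)]
  note 1 = hm_fac[OF u(2) cX sm(1) w(2)] hm_fac[OF u'(2) cX sm(2) w'(2)] hm_fac[OF u(2) cY ro(3) w(3)] hm_fac[OF u'(2) cY ro'(3) w'(3)]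
  note m = cm_comp[OF u(1)] cm_comp[OF u'(1)]
  have "ccomp s u:quasi_isos A V X" using q[OF m(1)[OF sm(1)] 1(1)] quasi_isos_iff[OF V(2) cX] by simp
  moreover have "htp A V X (ccomp s u) (ccomp s' u')" by(rule can[OF _ m(1)[OF sm(1)] m(2)[OF sm(2)] hm_trans[OF 1(1) hm_sym[OF 1(2)]]]) simp
  moreover have "htp A V Y (ccomp f u) (ccomp f' u')" by(rule can[OF _ m(1)[OF ro(3)] m(2)[OF ro'(3)] hm_trans[OF 1(3) hm_sym[OF 1(4)]]]) simp
  ultimately show "roof_eq A X Y r r'" unfolding roof_eq_def rr using V(1) u(1) u'(1) by blast
 qed
qed

lemma roof_class_cls:
 assumes r: "r:cls X Y p" and p: "p:cmap A (rr X) (rr Y)"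
 shows "roof_class A X Y r = cls X Y p" unfolding roof_class_def using roof_eq_cls[OF r _ p] cls_roofs by blast

text \<open>With \<open>cls_eq\<close> and \<open>comp_cls\<close> this identifies the morphisms of
  the derived category with homotopy classes of maps between resolutions.\<close>

lemma arr_cls: "alp:arr (Db_lin A ph) X Y <-> (EX p:cmap A (rr X) (rr Y). alp = cls X Y p)"
proof
 assume "alp:arr (Db_lin A ph) X Y"
 then obtain W s f where r: "(W, s, f):roofs A X Y" "alp = roof_class A X Y (W, s, f)" by(auto simp: Db_lin_def)
 obtain p where "p:cmap A (rr X) (rr Y)" "(W, s, f):cls X Y p" by(rule roof_rep[OF r(1)])
 thus "EX p:cmap A (rr X) (rr Y). alp = cls X Y p" using roof_class_cls r(2) by blast
next
 assume "EX p:cmap A (rr X) (rr Y). alp = cls X Y p"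
 then obtain p where p: "p:cmap A (rr X) (rr Y)" "alp = cls X Y p" by blast
 obtain V s f g where "(V, s, f):cls X Y p" "(V, s, g):cls X Y p" by(rule cls_common[OF p(1,1)])
 hence "roof_class A X Y (V, s, f) = cls X Y p" "(V, s, f):roofs A X Y" using roof_class_cls p(1) cls_roofs by blast+
 thus "alp:arr (Db_lin A ph) X Y" unfolding p(2) by(auto simp: Db_lin_def)
qed

lemma cls_eq:
 assumes p: "p:cmap A (rr X) (rr Y)" "q:cmap A (rr X) (rr Y)"
 shows "cls X Y p = cls X Y q <-> hm A (rr X) (rr Y) p q" by(metis cls_common[OF p(1,1)] cls_hm p cls_cong)

lemma loc_cls:
 assumes f: "f:cmap A X Y" and p: "p:cmap A (rr X) (rr Y)" "hm A (rr X) Y (ccomp (tt Y) p) (ccomp f (tt X))"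
 shows "loc A X Y f = cls X Y p"
using clsI[OF X X qis_id[OF cX] f mX _ hm_sym[OF p(2)]] loc_def roof_class_cls[OF _ p(1)] by(force simp: hm_refl cR cX mX)

lemma loc_cls_exists:
 assumes f: "f:cmap A X Y"
 obtains p where "p:cmap A (rr X) (rr Y)" "hm A (rr X) Y (ccomp (tt Y) p) (ccomp f (tt X))" "loc A X Y f = cls X Y p"
proof -
 obtain p where p: "p:cmap A (rr X) (rr Y)" "hm A (rr X) Y (ccomp (tt Y) p) (ccomp f (tt X))" by(rule hm_lift[OF R cS cY tY cm_comp[OF mX f]])
 thus ?thesis using loc_cls[OF f p] by(rule)
qed

lemma plus_cls:
 assumes p: "p:cmap A (rr X) (rr Y)" "q:cmap A (rr X) (rr Y)"
 shows "(%n x. p n x +[ob (rr Y) n] q n x):cmap A (rr X) (rr Y)"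
  "Db_plus A X Y (cls X Y p) (cls X Y q) = cls X Y (%n x. p n x +[ob (rr Y) n] q n x)"
proof -
 have add: "(%n x. u n x +[ob Z n] v n x):cmap A W Z" if "cplx A W" "cplx A Z" "u:cmap A W Z" "v:cmap A W Z" for W Z u v
 proof(rule cmI)
  interpret u: cxmap A W Z u by(intro cxmapI that)
  interpret v: cxmap A W Z v by(intro cxmapI that)
  fix n show "(%x. u n x +[ob Z n] v n x):lhom A (ob W n) (ob Z n)" by(intro lhom_add u.Y.lm u.f_lhom v.f_lhom)
  fix x assume "x:el W n"
  thus "u (n+1) (df W n x) +[ob Z (n+1)] v (n+1) (df W n x) = df Z n (u n x +[ob Z n] v n x)" by(simp add: u.comm v.comm)
 qed
 let ?s = "%n x. p n x +[ob (rr Y) n] q n x"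
 show s: "?s:cmap A (rr X) (rr Y)" by(rule add[OF cR cS p])
 have sum: "(W, s, %n x. f n x +[ob Y n] g n x):cls X Y ?s" if r: "(W, s, f):cls X Y p" "(W, s, g):cls X Y q" for W s f g
 proof -
  from r(1) obtain w where ro: "(W, s, f):roofs A X Y" and w: "w:cmap A (rr X) W"
   "hm A (rr X) X (ccomp s w) (tt X)" "hm A (rr X) Y (ccomp f w) (ccomp (tt Y) p)" unfolding cls_def by blast
  have w': "hm A (rr X) Y (ccomp g w) (ccomp (tt Y) q)" by(rule cls_any[OF r(2) w(1,2)])
  have ro': "(W, s, g):roofs A X Y" using r(2) cls_roofs by blast
  note ro = roofsD[OF ro X] and ro' = roofsD[OF ro' X]
  note h1 = hmD[OF w(3)] and h2 = hmD[OF w']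
  interpret t: cxmap A "rr Y" Y "tt Y" by(intro cxmapI cS cY mY)
  interpret p: cxmap A "rr X" "rr Y" p by(intro cxmapI cS cR p)
  interpret q: cxmap A "rr X" "rr Y" q by(intro cxmapI cS cR p)
  have "hm A (rr X) Y (%n x. ccomp f w n x +[ob Y n] ccomp g w n x) (%n x. ccomp (tt Y) p n x +[ob Y n] ccomp (tt Y) q n x)"
   by(rule hmI[OF cR cY add[OF cR cY h1(3) h2(3)] add[OF cR cY h1(4) h2(4)] homotopic_add[OF cR cY h1(5) h2(5) h1(3,4) h2(3,4)]])
  moreover have "hm A (rr X) Y (%n x. ccomp (tt Y) p n x +[ob Y n] ccomp (tt Y) q n x) (ccomp (tt Y) ?s)"
   by(rule hm_eq[OF cR cY add[OF cR cY h1(4) h2(4)] cm_comp[OF s mY]]) (simp add: ccomp_def)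
  ultimately have "hm A (rr X) Y (%n x. ccomp f w n x +[ob Y n] ccomp g w n x) (ccomp (tt Y) ?s)" by(rule hm_trans)
  moreover have "(%n x. ccomp f w n x +[ob Y n] ccomp g w n x) = ccomp (%n x. f n x +[ob Y n] g n x) w" by(simp add: ccomp_def comp_def)
  ultimately show ?thesis by(intro clsI[OF ro(1) X ro(2) add[OF ro(4) cY ro(3) ro'(3)] w(1,2)]) simp
 qed
 obtain V t f g where r: "(V, t, f):cls X Y p" "(V, t, g):cls X Y q" by(rule cls_common[OF p])
 show "Db_plus A X Y (cls X Y p) (cls X Y q) = cls X Y ?s"
 proof(intro subset_antisym subsetI)
  fix r assume "r:Db_plus A X Y (cls X Y p) (cls X Y q)"
  thus "r:cls X Y ?s" unfolding Db_plus_def using roof_class_cls[OF sum s] by blast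
 next
  fix r' assume "r':cls X Y ?s"
  thus "r':Db_plus A X Y (cls X Y p) (cls X Y q)" using roof_class_cls[OF sum[OF r] s] Db_plus_def r by blast
 qed
qed

end

text \<open>Lifts along the two roofs compose. For the reverse inclusion a square over
  \<open>W\<close> and \<open>V\<close> must be found; its corner is a truncation of the resolution
  of \<open>X\<close>, mapped to \<open>W\<close> by the lift \<open>w\<close> and to
  \<open>V\<close> by \<open>b p\<close>.\<close>

lemma comp_cls:
 assumes X: "X:Cb A" and Y: "Y:Cb A" and Z: "Z:Cb A" and p: "p:cmap A (rr X) (rr Y)" and q: "q:cmap A (rr Y) (rr Z)"
 shows "Db_comp A X Y Z (cls Y Z q) (cls X Y p) = cls X Z (ccomp q p)"
proof -
 note cX = Cb_cx[OF X] and cY = Cb_cx[OF Y] and cZ = Cb_cx[OF Z]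
 note R = res_rs[OF X] and S = res_rs[OF Y]
 note cR = bprojD(1)[OF R(1)] and cS = bprojD(1)[OF S(1)]
 have qp: "ccomp q p:cmap A (rr X) (rr Z)" by(rule cm_comp[OF p q])
 have main: "(U, ccomp s u, ccomp g v):cls X Z (ccomp q p)"
  if r: "(W, s, f):cls X Y p" "(V, t, g):cls Y Z q" and U: "U:Cb A" "qis A U W u" "v:cmap A U V"
   "htp A U Y (ccomp f u) (ccomp t v)" for W s f V t g U u v
 proof -
  have ro: "(W, s, f):roofs A X Y" and ro': "(V, t, g):roofs A Y Z" using r cls_roofs by blast+
  note ro = roofsD[OF ro X] and ro' = roofsD[OF ro' Y]
  note cU = Cb_cx[OF U(1)]
  have su: "qis A U X (ccomp s u)" by(rule qis_comp[OF cU ro(4) cX U(2) ro(2)])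
  have h: "hm A U Y (ccomp f u) (ccomp t v)" by(intro hmI cU cY U(4) cm_comp[OF qis_map[OF U(2)] ro(3)] cm_comp[OF U(3) qis_map[OF ro'(2)]])
  obtain a where a: "a:cmap A (rr X) U" "hm A (rr X) X (ccomp (ccomp s u) a) (tt X)" by(rule hm_lift[OF R(1) cU cX su tt_map[OF X]])
  have 1: "hm A (rr X) Y (ccomp t (ccomp v a)) (ccomp (tt Y) p)" using cls_any[OF X Y r(1) cm_comp[OF a(1) qis_map[OF U(2)]]] a(2) hm_trans[OF hm_sym[OF hm_right[OF h cR a(1)]]] by(simp add: ccomp_assoc)
  obtain b where b: "b:cmap A (rr Y) V" "hm A (rr Y) Y (ccomp t b) (tt Y)" by(rule hm_lift[OF S(1) ro'(4) cY ro'(2) tt_map[OF Y]])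
  have "hm A (rr X) V (ccomp v a) (ccomp b p)" using hm_trans[OF 1 hm_sym[OF hm_right[OF b(2) cR p]]] hm_cancel[OF R(1) ro'(4,2) cm_comp[OF a(1) U(3)] cm_comp[OF p b(1)]] by(simp add: ccomp_assoc)
  from hm_left[OF this cZ ro'(3)] have "hm A (rr X) Z (ccomp (ccomp g v) a) (ccomp (ccomp g b) p)" by(simp add: ccomp_assoc)
  moreover have "hm A (rr X) Z (ccomp (ccomp g b) p) (ccomp (tt Z) (ccomp q p))"
   using hm_right[OF cls_any[OF Y Z r(2) b] cR p] by(simp add: ccomp_assoc)
  ultimately have "hm A (rr X) Z (ccomp (ccomp g v) a) (ccomp (tt Z) (ccomp q p))" by(rule hm_trans)
  thus ?thesis by(rule clsI[OF U(1) X su cm_comp[OF U(3) ro'(3)] a])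
 qed
 show ?thesis
 proof(intro subset_antisym subsetI)
  fix r assume "r:Db_comp A X Y Z (cls Y Z q) (cls X Y p)"
  then obtain W s f V t g U u v where *: "(W, s, f):cls X Y p" "(V, t, g):cls Y Z q" "U:Cb A" "u:quasi_isos A U W"
   "v:cmap A U V" "htp A U Y (ccomp f u) (ccomp t v)" "r:roof_class A X Z (U, ccomp s u, ccomp g v)" unfolding Db_comp_def by blast
  have "W:Cb A" using *(1) cls_roofs by(auto simp: roofs_def)
  hence "qis A U W u" using *(4) quasi_isos_iff[OF Cb_cx[OF *(3)] Cb_cx] by blast
  from main[OF *(1-3) this *(5,6)] show "r:cls X Z (ccomp q p)" using roof_class_cls[OF X Z _ qp] *(7) by blast
 next
  fix r assume r0: "r:cls X Z (ccomp q p)"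
  obtain W s f f' where r: "(W, s, f):cls X Y p" "(W, s, f'):cls X Y p" by(rule cls_common[OF X Y p p])
  obtain V t g g' where r': "(V, t, g):cls Y Z q" "(V, t, g'):cls Y Z q" by(rule cls_common[OF Y Z q q])
  have "(W, s, f):roofs A X Y" "(V, t, g):roofs A Y Z" using r r' cls_roofs by blast+
  note ro = roofsD[OF this(1) X] and ro' = roofsD[OF this(2) Y]
  from r(1) obtain w where w: "w:cmap A (rr X) W" "hm A (rr X) X (ccomp s w) (tt X)" "hm A (rr X) Y (ccomp f w) (ccomp (tt Y) p)"
   unfolding cls_def by blast
  obtain b where b: "b:cmap A (rr Y) V" "hm A (rr Y) Y (ccomp t b) (tt Y)" by(rule hm_lift[OF S(1) ro'(4) cY ro'(2) tt_map[OF Y]])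
  have F: "finite {Y, W, V}" "{Y, W, V} <= Cb A" using Y ro(1) ro'(1) by simp_all
  from X F obtain U rh where "cofac X {Y, W, V} U rh" by(rule rr_trunc)
  note T = cofacD(1-3)[OF this] and fac = cofacD(4)[OF this] and can = cofacD(5)[OF this] and q = cofacD(6)[OF this]
  obtain u where u: "u:cmap A U W" "hm A (rr X) W (ccomp u rh) w" using fac[OF _ w(1)] by blast
  obtain v where v: "v:cmap A U V" "hm A (rr X) V (ccomp v rh) (ccomp b p)" using fac[OF _ cm_comp[OF p b(1)]] by blast
  note sm = qis_map[OF ro(2)] qis_map[OF ro'(2)]
  have uq: "qis A U W u" by(rule qis_cancel_left[OF T(2) ro(4) cX u(1) ro(2) q[OF cm_comp[OF u(1) sm(1)] hm_fac[OF u(2) cX sm(1) w(2)]]])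
  have "hm A (rr X) Y (ccomp t (ccomp b p)) (ccomp (tt Y) p)" using hm_right[OF b(2) cR p] by(simp add: ccomp_assoc)
  note 2 = hm_fac[OF v(2) cY sm(2) this]
  have h: "htp A U Y (ccomp f u) (ccomp t v)"
   by(rule can[OF _ cm_comp[OF u(1) ro(3)] cm_comp[OF v(1) sm(2)] hm_trans[OF hm_fac[OF u(2) cY ro(3) w(3)] hm_sym[OF 2]]]) simp
  have "r:roof_class A X Z (U, ccomp s u, ccomp g v)" unfolding roof_class_cls[OF X Z main[OF r(1) r'(1) T(1) uq v(1) h] qp] by(rule r0)
  moreover have "u:quasi_isos A U W" using uq quasi_isos_iff[OF T(2) ro(4)] by simp
  ultimately show "r:Db_comp A X Y Z (cls Y Z q) (cls X Y p)" unfolding Db_comp_def using r(1) r'(1) T(1) v(1) h by blast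
 qed
qed

end

subsection \<open>Equivalences of categories\<close>

definition category :: "('k, 'o, 'm, 'z) lincat_scheme => bool" where
 "category C <-> (ALL X:objs C. ident C X:arr C X X) &
   (ALL X:objs C. ALL Y:objs C. ALL f:arr C X Y. cpa C X X Y f (ident C X) = f & cpa C X Y Y (ident C Y) f = f) &
   (ALL X:objs C. ALL Y:objs C. ALL Z:objs C. ALL f:arr C X Y. ALL g:arr C Y Z. cpa C X Y Z g f:arr C X Z &
    (ALL W:objs C. ALL h:arr C Z W. cpa C X Y W (cpa C Y Z W h g) f = cpa C X Z W h (cpa C X Y Z g f)))"

lemma categoryD:
 assumes "category C"
 shows "X:objs C ==> ident C X:arr C X X" and "[|X:objs C; Y:objs C; f:arr C X Y|] ==> cpa C X X Y f (ident C X) = f"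
  and "[|X:objs C; Y:objs C; f:arr C X Y|] ==> cpa C X Y Y (ident C Y) f = f"
  and "[|X:objs C; Y:objs C; Z:objs C; f:arr C X Y; g:arr C Y Z|] ==> cpa C X Y Z g f:arr C X Z"
  and "[|X:objs C; Y:objs C; Z:objs C; W:objs C; f:arr C X Y; g:arr C Y Z; h:arr C Z W|] ==>
   cpa C X Y W (cpa C Y Z W h g) f = cpa C X Z W h (cpa C X Y Z g f)" using assms unfolding category_def by simp_all

lemma iso_arrE:
 assumes "a:iso_arr C X Y"
 obtains b where "a:arr C X Y" "b:arr C Y X" "cpa C X Y X b a = ident C X" "cpa C Y X Y a b = ident C Y" using assms unfolding iso_arr_def by blast

lemma iso_arr_sym: "iso_arr C X Y ~= {} ==> iso_arr C Y X ~= {}"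
 unfolding iso_arr_def by blast

lemma functor_iso:
 assumes F: "lin_functor k C D F" and X: "X:objs C" "Y:objs C" and a: "a:iso_arr C X Y"
 shows "far F X Y a:iso_arr D (fob F X) (fob F Y)"
proof -
 obtain b where b: "a:arr C X Y" "b:arr C Y X" "cpa C X Y X b a = ident C X" "cpa C Y X Y a b = ident C Y" using a by(rule iso_arrE)
 have 1: "far F X X (cpa C X Y X b a) = cpa D (fob F X) (fob F Y) (fob F X) (far F Y X b) (far F X Y a)"
  "far F Y Y (cpa C Y X Y a b) = cpa D (fob F Y) (fob F X) (fob F Y) (far F X Y a) (far F Y X b)"
  using F X b(1,2) unfolding lin_functor_def by simp_all
 have 2: "far F X Y a:arr D (fob F X) (fob F Y)" "far F Y X b:arr D (fob F Y) (fob F X)"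
  "far F X X (ident C X) = ident D (fob F X)" "far F Y Y (ident C Y) = ident D (fob F Y)" using F X b(1,2) unfolding lin_functor_def by simp_all
 show ?thesis unfolding iso_arr_def using 1 2 b(3,4) by(intro CollectI conjI bexI[of _ "far F Y X b"]) simp_all
qed

text \<open>Vanishing of Hom(X, Y), expressed as uniqueness of arrows. In this form it passes along
  a faithful functor without any reference to zero morphisms.\<close>

definition hz :: "('k, 'o, 'm, 'z) lincat_scheme => 'o => 'o => bool" where
 "hz C X Y <-> (ALL f:arr C X Y. ALL g:arr C X Y. f = g)"

lemma hz_iso_left:
 assumes C: "category C" and o: "X:objs C" "X':objs C" "Y:objs C" and i: "iso_arr C X X' ~= {}" and h: "hz C X Y"
 shows "hz C X' Y"
proof -
 obtain a b where b: "a:arr C X X'" "b:arr C X' X" "cpa C X' X X' a b = ident C X'" using i unfolding iso_arr_def by blast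
 show ?thesis unfolding hz_def
 proof(intro ballI)
  fix f g assume f: "f:arr C X' Y" and g: "g:arr C X' Y"
  have *: "u = cpa C X' X Y (cpa C X X' Y u a) b" if u: "u:arr C X' Y" for u
   using categoryD(5)[OF C o(2,1,2,3) b(2,1) u] categoryD(2)[OF C o(2,3) u] b(3) by simp
  have "cpa C X X' Y f a = cpa C X X' Y g a" using h categoryD(4)[OF C o(1,2,3) b(1)] f g by(simp add: hz_def)
  thus "f = g" using *[OF f] *[OF g] by simp
 qed
qed

lemma hz_iso_right:
 assumes C: "category C" and o: "X:objs C" "Y:objs C" "Y':objs C" and i: "iso_arr C Y Y' ~= {}" and h: "hz C X Y"
 shows "hz C X Y'"
proof -
 obtain a b where b: "a:arr C Y Y'" "b:arr C Y' Y" "cpa C Y' Y Y' a b = ident C Y'" using i unfolding iso_arr_def by blast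
 show ?thesis unfolding hz_def
 proof(intro ballI)
  fix f g assume f: "f:arr C X Y'" and g: "g:arr C X Y'"
  have *: "u = cpa C X Y Y' a (cpa C X Y' Y b u)" if u: "u:arr C X Y'" for u
   using categoryD(5)[OF C o(1,3,2,3) u b(2,1)] categoryD(3)[OF C o(1,3) u] b(3) by simp
  have "cpa C X Y' Y b f = cpa C X Y' Y b g" using h categoryD(4)[OF C o(1,3,2) _ b(2)] f g by(simp add: hz_def)
  thus "f = g" using *[OF f] *[OF g] by simp
 qed
qed

lemma iso_arr_trans:
 assumes C: "category C" and o: "X:objs C" "Y:objs C" "Z:objs C" and i: "iso_arr C X Y ~= {}" "iso_arr C Y Z ~= {}"
 shows "iso_arr C X Z ~= {}"
proof -
 obtain a b where b: "a:arr C X Y" "b:arr C Y X" "cpa C X Y X b a = ident C X" "cpa C Y X Y a b = ident C Y" using i(1) unfolding iso_arr_def by blast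
 obtain a' b' where b': "a':arr C Y Z" "b':arr C Z Y" "cpa C Y Z Y b' a' = ident C Y" "cpa C Z Y Z a' b' = ident C Z"
  using i(2) unfolding iso_arr_def by blast
 note cl = categoryD(4)[OF C] and as = categoryD(5)[OF C] and idl = categoryD(3)[OF C]
 have "cpa C X Z X (cpa C Z Y X b b') (cpa C X Y Z a' a) = ident C X"
  using as[OF o(1,3,2,1) cl[OF o b(1) b'(1)] b'(2) b(2)] as[OF o(1,2,3,2) b(1) b'(1,2)] b'(3) b(3) idl[OF o(1,2) b(1)] by simp
 moreover have "cpa C Z X Z (cpa C X Y Z a' a) (cpa C Z Y X b b') = ident C Z"
  using as[OF o(3,1,2,3) cl[OF o(3,2,1) b'(2) b(2)] b(1) b'(1)] as[OF o(3,2,1,2) b'(2) b(2,1)] b(4) b'(4) idl[OF o(3,2) b'(2)] by simp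
 ultimately have "cpa C X Y Z a' a:iso_arr C X Z" unfolding iso_arr_def using cl[OF o b(1) b'(1)] cl[OF o(3,2,1) b'(2) b(2)] by blast
 thus ?thesis by blast
qed

text \<open>Naturality of \<open>alp\<close> recovers \<open>f\<close> from its image under
  \<open>G F\<close>, hence from \<open>far F X Y f\<close>, because the component of
  \<open>alp\<close> at \<open>X\<close> has an inverse.\<close>

lemma hz_faithful:
 assumes C: "category C" and F: "lin_functor k C D F" and G: "lin_functor k D C G" and n: "nat_iso C C (fcomp G F) fidentity alp"
  and o: "X:objs C" "Y:objs C" and h: "hz D (fob F X) (fob F Y)"
 shows "hz C X Y" unfolding hz_def
proof(intro ballI)
 fix f g assume f: "f:arr C X Y" and g: "g:arr C X Y"
 let ?X = "fob G (fob F X)" and ?Y = "fob G (fob F Y)"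
 have oX: "?X:objs C" using F o G by(simp add: lin_functor_def)
 have "alp X:iso_arr C ?X X" using n o by(simp add: nat_iso_def fcomp_def fidentity_def)
 then obtain b where b: "alp X:arr C ?X X" "b:arr C X ?X" "cpa C X ?X X (alp X) b = ident C X" by(rule iso_arrE)
 have nat: "cpa C ?X ?Y Y (alp Y) (far G (fob F X) (fob F Y) (far F X Y u)) = cpa C ?X X Y u (alp X)" if "u:arr C X Y" for u
  using n o that by(simp add: nat_iso_def fcomp_def fidentity_def)
 have "far F X Y f = far F X Y g" using h F o f g by(simp add: hz_def lin_functor_def)
 hence e: "cpa C ?X X Y f (alp X) = cpa C ?X X Y g (alp X)" using nat[OF f] nat[OF g] by simp
 have *: "u = cpa C X ?X Y (cpa C ?X X Y u (alp X)) b" if u: "u:arr C X Y" for u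
  using categoryD(5)[OF C o(1) oX o b(2,1) u] categoryD(2)[OF C o u] b(3) by simp
 show "f = g" using *[OF f] *[OF g] e by simp
qed

locale cat_equiv =
 fixes k :: "'k ring" and C :: "('k, 'o, 'm, 'z) lincat_scheme" and D :: "('k, 'p, 'n, 'y) lincat_scheme" and F G alp bet
 assumes C: "category C" and D: "category D" and F: "lin_functor k C D F" and G: "lin_functor k D C G"
  and alp: "nat_iso C C (fcomp G F) fidentity alp" and bet: "nat_iso D D (fcomp F G) fidentity bet"
begin

lemma fob_F: "X:objs C ==> fob F X:objs D" and fob_G: "Z:objs D ==> fob G Z:objs C"
 using F G by(simp_all add: lin_functor_def)

lemma GF: "X:objs C ==> iso_arr C (fob G (fob F X)) X ~= {}" and FG: "Z:objs D ==> iso_arr D (fob F (fob G Z)) Z ~= {}"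
 using alp bet by(auto simp: nat_iso_def fcomp_def fidentity_def)

lemma hz_adj:
 assumes X: "X:objs C" and Z: "Z:objs D"
 shows "hz D (fob F X) Z <-> hz C X (fob G Z)"
using hz_iso_right[OF D fob_F[OF X] Z fob_F[OF fob_G[OF Z]] iso_arr_sym[OF FG[OF Z]]] hz_faithful[OF C F G alp X fob_G[OF Z]] hz_iso_left[OF C X fob_G[OF fob_F[OF X]] fob_G[OF Z] iso_arr_sym[OF GF[OF X]]] hz_faithful[OF D G F bet fob_F[OF X] Z] by blast

end

lemma cat_equiv_sym: "cat_equiv k C D F G alp bet ==> cat_equiv k D C G F bet alp"
 by(simp add: cat_equiv_def)

lemma Db_simps [simp]:
 "objs (Db A ph) = Cb A" "arr (Db A ph) = arr (Db_lin A ph)" "cpa (Db A ph) = Db_comp A"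
 "ident (Db A ph) X = loc A X X cid" "plus_arr (Db A ph) = Db_plus A"
 "shift_ob (Db A ph) = shc" "shift_arr (Db A ph) = Db_shift A" "triangles (Db A ph) = Db_triangles A ph"
 by(simp_all add: Db_def lincat.extend_def tricat.fields_def Db_lin_def)

lemma Db_lin_simps [simp]:
 "objs (Db_lin A ph) = Cb A" "cpa (Db_lin A ph) = Db_comp A" "ident (Db_lin A ph) X = loc A X X cid" "plus_arr (Db_lin A ph) = Db_plus A"
 by(simp_all add: Db_lin_def)

lemma Db_iso_arr: "iso_arr (Db A ph) = iso_arr (Db_lin A ph)"
 by(intro ext) (simp add: iso_arr_def)

context artin_alg
begin

lemma ident_cls: assumes X: "X:Cb A" shows "loc A X X cid = cls X X cid"
 by(rule loc_cls[OF X X cm_id cm_id]) (simp add: hm_refl rr_cx X Cb_cx tt_map)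

lemma category_Db: "category (Db A ph)"
 unfolding category_def Db_simps
proof(intro conjI ballI)
 fix X assume X: "X:Cb A"
 show "loc A X X cid:arr (Db_lin A ph) X X" unfolding ident_cls[OF X] using arr_cls[OF X X] cm_id by blast
 fix Y f assume Y: "Y:Cb A" and f: "f:arr (Db_lin A ph) X Y"
 obtain p where p: "p:cmap A (rr X) (rr Y)" "f = cls X Y p" using f arr_cls[OF X Y] by blast
 show "Db_comp A X X Y f (loc A X X cid) = f" "Db_comp A X Y Y (loc A Y Y cid) f = f"
  unfolding ident_cls[OF X] ident_cls[OF Y] p(2) using comp_cls[OF X X Y cm_id p(1)] comp_cls[OF X Y Y p(1) cm_id] by simp_all
 fix Z g assume Z: "Z:Cb A" and g: "g:arr (Db_lin A ph) Y Z"
 obtain q where q: "q:cmap A (rr Y) (rr Z)" "g = cls Y Z q" using g arr_cls[OF Y Z] by blast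
 note qp = cm_comp[OF p(1) q(1)]
 show "Db_comp A X Y Z g f:arr (Db_lin A ph) X Z" unfolding p(2) q(2) comp_cls[OF X Y Z p(1) q(1)] using arr_cls[OF X Z] qp by blast
 fix W h assume W: "W:Cb A" and h: "h:arr (Db_lin A ph) Z W"
 obtain r where r: "r:cmap A (rr Z) (rr W)" "h = cls Z W r" using h arr_cls[OF Z W] by blast
 show "Db_comp A X Y W (Db_comp A Y Z W h g) f = Db_comp A X Z W h (Db_comp A X Y Z g f)"
  unfolding p(2) q(2) r(2) comp_cls[OF X Y Z p(1) q(1)] comp_cls[OF Y Z W q(1) r(1)] comp_cls[OF X Z W qp r(1)]
   comp_cls[OF X Y W p(1) cm_comp[OF q(1) r(1)]] by(simp add: ccomp_assoc)
qed

lemma iso_cls: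
 assumes X: "X:Cb A" and Y: "Y:Cb A" and p: "p:cmap A (rr X) (rr Y)"
 shows "cls X Y p:iso_arr (Db A ph) X Y <-> (EX q. heq A (rr X) (rr Y) p q)"
proof -
 have "cls X Y p:iso_arr (Db A ph) X Y <-> (EX g:arr (Db_lin A ph) Y X.
   Db_comp A X Y X g (cls X Y p) = cls X X cid & Db_comp A Y X Y (cls X Y p) g = cls Y Y cid)" using arr_cls[OF X Y] p by(auto simp: iso_arr_def ident_cls X Y)
 also have "... <-> (EX q:cmap A (rr Y) (rr X).
   Db_comp A X Y X (cls Y X q) (cls X Y p) = cls X X cid & Db_comp A Y X Y (cls X Y p) (cls Y X q) = cls Y Y cid)"
  unfolding Bex_def arr_cls[OF Y X] by blast
 also have "... <-> (EX q:cmap A (rr Y) (rr X). heq A (rr X) (rr Y) p q)"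
 proof(intro bex_cong refl)
  fix q assume q: "q:cmap A (rr Y) (rr X)"
  show "(Db_comp A X Y X (cls Y X q) (cls X Y p) = cls X X cid & Db_comp A Y X Y (cls X Y p) (cls Y X q) = cls Y Y cid) <-> heq A (rr X) (rr Y) p q"
   unfolding heq_hm[OF rr_cx[OF X] rr_cx[OF Y]] comp_cls[OF X Y X p q] comp_cls[OF Y X Y q p]
    cls_eq[OF X X cm_comp[OF p q] cm_id] cls_eq[OF Y Y cm_comp[OF q p] cm_id] using p q by blast
 qed
 finally show ?thesis unfolding heq_def by blast
qed

definition dis :: "'a fgcpx => 'a fgcpx => bool" where
 "dis X Y <-> iso_arr (Db A ph) X Y ~= {}"

lemma dis_heq:
 assumes X: "X:Cb A" and Y: "Y:Cb A"
 shows "dis X Y <-> (EX p q. heq A (rr X) (rr Y) p q)"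
proof
 assume "dis X Y"
 then obtain alp where a: "alp:iso_arr (Db A ph) X Y" unfolding dis_def by blast
 then obtain p where "p:cmap A (rr X) (rr Y)" "alp = cls X Y p" using arr_cls[OF X Y] by(auto simp: iso_arr_def)
 thus "EX p q. heq A (rr X) (rr Y) p q" using a iso_cls[OF X Y] by blast
next
 assume "EX p q. heq A (rr X) (rr Y) p q"
 then obtain p q where "heq A (rr X) (rr Y) p q" by blast
 moreover from this have "p:cmap A (rr X) (rr Y)" by(simp add: heq_def)
 ultimately show "dis X Y" unfolding dis_def using iso_cls[OF X Y] by blast
qed

lemma resD: "res R t X ==> bproj A R" "res R t X ==> qis A R X t" "res R t X ==> cplx A R"
 by(simp_all add: res_def bprojD)

lemma res_self: "X:Cb A ==> res (rr X) (tt X) X"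
 using res_rs by(simp add: res_def)

lemma res_unique:
 assumes X: "cplx A X" and "res R t X" "res S s X"
 obtains e e' where "heq A R S e e'" "hm A R X (ccomp s e) t"
proof -
 note R = resD[OF assms(2)] and S = resD[OF assms(3)]
 obtain e where e: "e:cmap A R S" "hm A R X (ccomp s e) t" by(rule hm_lift[OF R(1) S(3) X S(2) qis_map[OF R(2)]])
 obtain e' where "heq A R S e e'" using qis_cancel_left[OF R(3) S(3) X e(1) S(2) hm_qis[OF R(2) hm_sym[OF e(2)]]] qis_heq[OF R(1) S(1)] by blast
 thus ?thesis using e(2) by(rule)
qed

lemma dis_common:
 assumes X: "X:Cb A" and Y: "Y:Cb A" and "res R t X" "res R s Y"
 shows "dis X Y"
proof -
 note c = Cb_cx[OF X] Cb_cx[OF Y] rr_cx[OF X] rr_cx[OF Y] resD(3)[OF assms(3)]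
 obtain e e' where "heq A (rr X) R e e'" using res_unique[OF c(1) res_self[OF X] assms(3)] by metis
 moreover obtain d d' where "heq A R (rr Y) d d'" using res_unique[OF c(2) assms(4) res_self[OF Y]] by metis
 ultimately show ?thesis unfolding dis_heq[OF X Y] using heq_trans c by blast
qed

lemma dis_res:
 assumes X: "X:Cb A" and Y: "Y:Cb A" and d: "dis X Y" and r: "res R t X"
 obtains s where "res R s Y"
proof -
 note c = Cb_cx[OF X] Cb_cx[OF Y] rr_cx[OF X] rr_cx[OF Y] resD(3)[OF r]
 obtain e e' where e: "heq A R (rr X) e e'" using res_unique[OF c(1) r res_self[OF X]] by metis
 obtain p q where p: "heq A (rr X) (rr Y) p q" using d unfolding dis_heq[OF X Y] by blast
 show ?thesis using heq_qis[OF c(5,4) heq_trans[OF e p c(5,3,4)]] qis_comp[OF c(5,4,2) _ res_rs(2)[OF Y]] resD(1)[OF r] that res_def by blast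
qed

lemma dis_qis: "[|X:Cb A; Y:Cb A; qis A X Y f|] ==> dis X Y"
 by(rule dis_common[OF _ _ res_self, where s = "ccomp f (tt X)"]) (simp_all add: res_def res_rs qis_comp[of A _ X] Cb_cx rr_cx)

lemma dis_sym: "dis X Y ==> dis Y X"
 unfolding dis_def by(rule iso_arr_sym)

lemma dis_trans: "[|X:Cb A; Y:Cb A; Z:Cb A; dis X Y; dis Y Z|] ==> dis X Z"
 unfolding dis_def using iso_arr_trans[OF category_Db, of X Y Z] by simp

lemma dis_exact_at:
 assumes X: "X:Cb A" and Y: "Y:Cb A" and d: "dis X Y"
 shows "exact_at X n <-> exact_at Y n"
proof -
 obtain s where s: "res (rr X) s Y" by(rule dis_res[OF X Y d res_self[OF X]])
 show ?thesis using qis_exact_at[OF rr_cx[OF X] Cb_cx[OF X] res_rs(2)[OF X]] qis_exact_at[OF rr_cx[OF X] Cb_cx[OF Y] resD(2)[OF s]] by simp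
qed

text \<open>Any resolution of \<open>X\<close> may be used, and maps are taken into \<open>Y\<close>
  itself: maps into \<open>Y\<close> lift along \<open>tt Y\<close>, uniquely up to
  homotopy.\<close>

lemma hz_iff:
 assumes X: "X:Cb A" and Y: "Y:Cb A" and r: "res R t X"
 shows "hz (Db A ph) X Y <-> (ALL f:cmap A R Y. ALL g:cmap A R Y. hm A R Y f g)"
proof -
 note c = Cb_cx[OF X] Cb_cx[OF Y] rr_cx[OF X] rr_cx[OF Y] resD(3)[OF r]
 obtain e e' where e: "heq A R (rr X) e e'" using res_unique[OF c(1) r res_self[OF X]] by metis
 have em: "e:cmap A R (rr X)" "e':cmap A (rr X) R" "hm A R R (ccomp e' e) cid" "hm A (rr X) (rr X) (ccomp e e') cid"
  using e heq_hm[OF c(5,3)] by simp_all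
 have "hz (Db A ph) X Y <-> (ALL p:cmap A (rr X) (rr Y). ALL q:cmap A (rr X) (rr Y). cls X Y p = cls X Y q)"
  unfolding hz_def Db_simps Ball_def arr_cls[OF X Y] by blast
 also have "... <-> (ALL p:cmap A (rr X) (rr Y). ALL q:cmap A (rr X) (rr Y). hm A (rr X) (rr Y) p q)" by(intro ball_cong refl cls_eq[OF X Y])
 also have "... <-> (ALL f:cmap A R Y. ALL g:cmap A R Y. hm A R Y f g)"
 proof(intro iffI ballI)
  fix f g assume h: "ALL p:cmap A (rr X) (rr Y). ALL q:cmap A (rr X) (rr Y). hm A (rr X) (rr Y) p q" and f: "f:cmap A R Y" and g: "g:cmap A R Y"
  have *: "EX p:cmap A (rr X) (rr Y). hm A R Y (ccomp (tt Y) (ccomp p e)) f" if f: "f:cmap A R Y" for f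
  proof -
   obtain p where p: "p:cmap A (rr X) (rr Y)" "hm A (rr X) Y (ccomp (tt Y) p) (ccomp f e')"
    by(rule hm_lift[OF res_rs(1)[OF X] c(4,2) res_rs(2)[OF Y] cm_comp[OF em(2) f]])
   have "hm A R Y (ccomp (tt Y) (ccomp p e)) (ccomp f (ccomp e' e))" using hm_right[OF p(2) c(5) em(1)] by(simp add: ccomp_assoc)
   moreover have "hm A R Y (ccomp f (ccomp e' e)) f" using hm_left[OF em(3) c(2) f] by simp
   ultimately show ?thesis using p(1) hm_trans by blast
  qed
  obtain p q where p: "p:cmap A (rr X) (rr Y)" "hm A R Y (ccomp (tt Y) (ccomp p e)) f"
   and q: "q:cmap A (rr X) (rr Y)" "hm A R Y (ccomp (tt Y) (ccomp q e)) g" using *[OF f] *[OF g] by blast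
  have "hm A R Y (ccomp (tt Y) (ccomp p e)) (ccomp (tt Y) (ccomp q e))"
   by(rule hm_left[OF hm_right[OF _ c(5) em(1)] c(2) tt_map[OF Y]]) (use h p q in blast)
  thus "hm A R Y f g" using p(2) q(2) hm_trans hm_sym by blast
 next
  fix p q assume h: "ALL f:cmap A R Y. ALL g:cmap A R Y. hm A R Y f g" and p: "p:cmap A (rr X) (rr Y)" and q: "q:cmap A (rr X) (rr Y)"
  have *: "hm A (rr X) Y (ccomp (ccomp (ccomp (tt Y) p) e) e') (ccomp (tt Y) p)" if p: "p:cmap A (rr X) (rr Y)" for p
   using hm_left[OF em(4) c(2) cm_comp[OF p tt_map[OF Y]]] by(simp add: ccomp_assoc)
  have m: "ccomp (ccomp (tt Y) p) e:cmap A R Y" if p: "p:cmap A (rr X) (rr Y)" for p by(rule cm_comp[OF em(1) cm_comp[OF p tt_map[OF Y]]])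
  have "hm A (rr X) Y (ccomp (ccomp (ccomp (tt Y) p) e) e') (ccomp (ccomp (ccomp (tt Y) q) e) e')"
   by(rule hm_right[OF _ c(3) em(2)]) (use h m[OF p] m[OF q] in blast)
  hence "hm A (rr X) Y (ccomp (tt Y) p) (ccomp (tt Y) q)" using *[OF p] *[OF q] hm_trans hm_sym by blast
  thus "hm A (rr X) (rr Y) p q" by(rule hm_cancel[OF res_rs(1)[OF X] c(4) res_rs(2)[OF Y] p q])
 qed
 finally show ?thesis .
qed

text \<open>The difference of two chain maps is contracted by \<open>null_homotopy\<close>, with
  \<open>Y\<close> in the role of the exact sequence.\<close>

lemma hz_null:
 assumes X: "X:Cb A" and Y: "Y:Cb A" and r: "res R t X" and z: "!!n. ~ zmod (ob R n) ==> exact_at Y n"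
 shows "hz (Db A ph) X Y" unfolding hz_iff[OF X Y r]
proof(intro ballI)
 fix f g assume f: "f:cmap A R Y" and g: "g:cmap A R Y"
 note c = resD(3)[OF r] Cb_cx[OF Y]
 interpret f: cxmap A R Y f by(intro cxmapI c f)
 interpret g: cxmap A R Y g by(intro cxmapI c g)
 have "EX et. ALL n. et n:lhom A (ob R n) (ob Y (n-1)) &
  (ALL x:el R n. f n x -[ob Y n] g n x = df Y (n-1) (et n x) +[ob Y n] et (n+1) (df R n x))"
 proof(rule null_homotopy[OF resD(1)[OF r]])
  fix n
  show "lmod A (ob Y n)" "fin_gen A (ob Y n)" "df Y n:lhom A (ob Y n) (ob Y (n+1))" by(rule f.Y.lm, rule ModsD(2)[OF f.Y.ob_Mods], rule f.Y.d_lhom)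
  show "(%x. f n x -[ob Y n] g n x):lhom A (ob R n) (ob Y n)" by(intro lhom_minus f.Y.lm f.f_lhom g.f_lhom)
  fix x assume "x:el R n"
  thus "df Y n (f n x -[ob Y n] g n x) = f (n+1) (df R n x) -[ob Y (n+1)] g (n+1) (df R n x)" by(simp add: f.comm g.comm)
 next
  fix n y assume "~ zmod (ob R n)" "y:el Y n" "df Y n y = 0[ob Y (n+1)]"
  thus "y:df Y (n-1) ` el Y (n-1)" using exact_atD[OF z, of n y] by auto
 qed
 thus "hm A R Y f g" by(intro hmI c f g) (auto simp: homotopic_def)
qed

end

subsection \<open>Truncation and vanishing of morphisms\<close>

definition st :: "int => 'a fgm => 'a fgcpx" where
 "st s M = \<lparr>ob = (%n. if n = s then M else zero_module), df = (%n x. 0[if n+1 = s then M else zero_module])\<rparr>"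

lemma stalk_st: "stalk M = st 0 M"
 by(simp add: stalk_def st_def)

lemma st_simps [simp]: "ob (st s M) s = M" "n ~= s ==> ob (st s M) n = zero_module" "df (st s M) n x = 0[ob (st s M) (n+1)]"
 by(auto simp: st_def)

text \<open>Conditions on the cohomology of \<open>X\<close>, not on its terms, and hence invariant
  under isomorphism in the derived category.\<close>

definition dge :: "int => 'a fgcpx => bool" where "dge s X <-> (ALL n<s. exact_at X n)"
definition dle :: "int => 'a fgcpx => bool" where "dle s X <-> (ALL n>s. exact_at X n)"

lemma trunc_at:
 assumes R: "cplx A R"
 obtains V rh where "trunc A s R V rh"
proof -
 interpret R: cx A R by(rule cxI[OF R])
 obtain Q pj where Q: "Q:Mods A" "pj:lhom A (ob R s) Q" "pj ` el R s = car Q"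
  "ALL x:el R s. pj x = 0[Q] <-> x:coboundaries R s" by(rule quotient_Mods[OF R.ob_Mods coboundaries_submod[OF R]])
 obtain V rh where T: "trunc A s R V rh" by(rule trunc_exists[OF R Q])
 thus ?thesis by(rule)
qed

context artin_alg
begin

lemma zero_mod_zero: "zmod (zero_module :: 'a fgm)"
 by(simp add: is_zero_mod_def)

lemma zero_Mods: "zero_module:Mods A"
 by(rule zero_module_Mods[OF ring_A])

lemma st_cplx:
 assumes "M:Mods A" shows "cplx A (st s M)" "st s M:Cb A"
proof -
 have ob: "ob (st s M) n:Mods A" for n using assms zero_Mods by(cases "n = s") simp_all
 have d: "df (st s M) n:lhom A (ob (st s M) n) (ob (st s M) (n+1))" for n
 proof -
  have "df (st s M) n = (%x. 0[ob (st s M) (n+1)])" by(rule) simp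
  thus ?thesis using lhom_zero[OF ModsD(1)[OF ob]] by simp
 qed
 show c: "cplx A (st s M)" unfolding cplx_def by(intro conjI allI ring_A ob d) (simp add: add.assoc)
 have "ALL n. \<bar>n\<bar> > \<bar>s\<bar> --> zmod (ob (st s M) n)" by(auto simp: zero_mod_zero)
 thus "st s M:Cb A" unfolding Cb_iff[OF ring_A] using c by blast
qed

lemma Kb_proj_res: "T:Kb_proj A ==> res T cid T" "T:Kb_proj A ==> T:Cb A" "T:Kb_proj A ==> bproj A T"
proof -
 assume T: "T:Kb_proj A"
 thus 1: "T:Cb A" by(simp add: Kb_proj_def)
 obtain N where "ALL n. \<bar>n\<bar> > N --> zmod (ob T n)" by(rule Cb_bounds[OF 1])
 hence "ALL n>\<bar>N\<bar>. zmod (ob T n)" by simp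
 thus "bproj A T" using T Cb_cx[OF 1] unfolding bproj_def Kb_proj_def by blast
 thus "res T cid T" unfolding res_def using qis_id[OF Cb_cx[OF 1]] by simp
qed

lemma st_regular: "st i (rgm A):Kb_proj A"
proof -
 have P: "projective A (rgm A)" by(rule projective_regular[OF ring_A])
 have "projective A (ob (st i (rgm A)) n)" for n by(cases "n = i") (simp_all add: P projective_zero zero_Mods zero_mod_zero)
 thus ?thesis unfolding Kb_proj_def using st_cplx(2)[OF projective_Mods[OF P]] by simp
qed

text \<open>This is Hom(A[-i], Y) = H^i(Y): a map from the stalk complex is given by the cocycle to
  which it sends 1, and it is null-homotopic exactly if that cocycle is a coboundary.\<close>

lemma hz_st_regular:
 assumes Y: "Y:Cb A"
 shows "hz (Db A ph) (st i (rgm A)) Y <-> exact_at Y i"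
proof
 let ?S = "st i (rgm A)"
 note S = Kb_proj_res[OF st_regular[of i]]
 interpret Y: cx A Y by(rule cxI[OF Cb_cx[OF Y]])
 interpret S: cx A ?S by(rule cxI[OF Cb_cx[OF S(2)]])
 assume h: "hz (Db A ph) ?S Y"
 show "exact_at Y i" unfolding exact_at_def
 proof(intro ballI impI)
  fix y assume y: "y:el Y i" "df Y i y = 0[ob Y (i+1)]"
  obtain ep where e: "ep:liso A (rgm A) (lreg A)" by(rule regular_liso[OF ring_A])
  have ec: "ep a:car A" if "a:car (rgm A)" for a using liso_lhom[OF e] that by(simp add: lhom_def Pi_iff)
  define f where "f n = (if n = i then (%a. ep a *[ob Y i] y) else (%_. 0[ob Y n]))" for n
  have fl: "f n:lhom A (ob ?S n) (ob Y n)" for n using lcomp[OF liso_lhom[OF e] lhom_from_regular[OF Y.lm y(1)]] by(simp add: f_def lhom_zero Y.lm)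
  interpret fl: lmap A "ob ?S n" "ob Y n" "f n" for n by(intro lmapI fl S.lm Y.lm)
  have fm: "f:cmap A ?S Y"
  proof(rule cmI[OF fl])
   fix n x assume x: "x:el ?S n"
   show "f (n+1) (df ?S n x) = df Y n (f n x)" using x y ec fl.zero by(auto simp: f_def)
  qed
  have zm: "(%n x. 0[ob Y n]):cmap A ?S Y" by(rule cmI) (simp_all add: lhom_zero Y.lm)
  have "hm A ?S Y f (%n x. 0[ob Y n])" using h unfolding hz_iff[OF S(2) Y S(1)] using fm zm by blast
  from hmD(5)[OF this] obtain h where h: "ALL n. h n:lhom A (ob ?S n) (ob Y (n-1))"
   "ALL n. ALL x:el ?S n. f n x -[ob Y n] 0[ob Y n] = df Y (n-1) (h n x) +[ob Y n] h (n+1) (df ?S n x)" unfolding homotopic_def by blast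
  have "1[A]:ep ` car (rgm A)" using e by(simp add: liso_def bij_betw_def)
  then obtain u where u: "u:car (rgm A)" "1[A] = ep u" by blast
  have hl: "lmap A (ob ?S n) (ob Y (n-1)) (h n)" for n using h(1) by(intro lmapI S.lm Y.lm) simp
  have "h (i+1) (df ?S i u) = 0[ob Y i]" using lmap.zero[OF hl[of "i+1"]] by simp
  moreover have "h i u:el Y (i-1)" using lmap.closed[OF hl[of i]] u by simp
  moreover have "f i u = y" using y(1) by(simp add: f_def flip: u(2))
  ultimately have "y = df Y (i-1) (h i u)" using h(2)[rule_format, of u i] u y(1) by(simp add: a_minus_def)
  thus "EX z:el Y (i-1). y = df Y (i-1) z" using \<open>h i u : _\<close> by(rule)
 qed
next
 assume "exact_at Y i"
 thus "hz (Db A ph) (st i (rgm A)) Y"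
  by(intro hz_null[OF Kb_proj_res(2)[OF st_regular] Y Kb_proj_res(1)[OF st_regular]]) (metis st_simps(2) zero_mod_zero)
qed

lemma hz_dle_dge:
 assumes W: "W:Cb A" "dle s W" and Z: "Z:Cb A" "dge (s+1) Z"
 shows "hz (Db A ph) W Z"
proof -
 obtain R t where R: "bproj A R" "ALL n>s. zmod (ob R n)" "qis A R W t"
  using resolution_exists[OF Cb_cx[OF W(1)], of s] W(2) unfolding dle_def by metis
 show ?thesis
 proof(rule hz_null[OF W(1) Z(1)])
  show "res R t W" using R by(simp add: res_def)
  fix n assume "~ zmod (ob R n)"
  thus "exact_at Z n" using R(2) linorder_not_le Z(2) by(auto simp: dge_def)
 qed
qed

text \<open>The regular module placed in a degree \<open>i < t\<close> is one of the test objects,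
  and it detects the cohomology of \<open>W\<close> in that degree. Written as an orthogonality
  relation, the condition can be moved along an equivalence.\<close>

lemma dge_iff:
 assumes W: "W:Cb A"
 shows "dge t W <-> (ALL Z:Cb A. dle (t-1) Z --> hz (Db A ph) Z W)"
proof
 assume "dge t W"
 thus "ALL Z:Cb A. dle (t-1) Z --> hz (Db A ph) Z W" using hz_dle_dge[of _ "t-1" W] W by simp
next
 assume h: "ALL Z:Cb A. dle (t-1) Z --> hz (Db A ph) Z W"
 show "dge t W" unfolding dge_def
 proof(intro allI impI)
  fix i assume i: "i < t"
  note S = Kb_proj_res[OF st_regular[of i]]
  show "exact_at W i" using dle_def i exact_at_zero[OF Cb_cx[OF S(2)]] h S(2) hz_st_regular[OF W, of i] by(force simp: zero_mod_zero)
 qed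
qed

lemma dle_iff:
 assumes W: "W:Cb A"
 shows "dle s W <-> (ALL Z:Cb A. dge (s+1) Z --> hz (Db A ph) W Z)"
proof
 assume "dle s W"
 thus "ALL Z:Cb A. dge (s+1) Z --> hz (Db A ph) W Z" using hz_dle_dge[OF W] by simp
next
 assume h: "ALL Z:Cb A. dge (s+1) Z --> hz (Db A ph) W Z"
 note R = res_rs[OF W] and cR = rr_cx[OF W]
 obtain V rh where T: "trunc A (s+1) (rr W) V rh" by(rule trunc_at[OF cR])
 have V: "V:Cb A" by(rule Cb_trunc[OF R(1) T])
 interpret r: cxmap A "rr W" V rh by(intro cxmapI trunc_cplx[OF T])
 have zm: "(%n x. 0[ob V n]):cmap A (rr W) V" by(rule cmI) (simp_all add: lhom_zero r.Y.lm)
 have "dge (s+1) V" unfolding dge_def using T by(auto simp: trunc_def intro: exact_at_zero[OF r.Y.cplx])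
 hence "hm A (rr W) V rh (%n x. 0[ob V n])" using h V hz_iff[OF W V res_self[OF W]] r.map zm by blast
 from hmD(5)[OF this] obtain h where h: "ALL n. h n:lhom A (ob (rr W) n) (ob V (n-1))"
  "ALL n. ALL x:el (rr W) n. rh n x -[ob V n] 0[ob V n] = df V (n-1) (h n x) +[ob V n] h (n+1) (df (rr W) n x)" unfolding homotopic_def by blast
 have hl: "lmap A (ob (rr W) n) (ob V (n-1)) (h n)" for n using h(1) by(intro lmapI r.X.lm r.Y.lm) simp
 show "dle s W" unfolding dle_def
 proof(intro allI impI)
  fix n assume n: "n > s"
  have "exact_at (rr W) n" unfolding exact_at_def
  proof(intro ballI impI)
   fix x assume x: "x:el (rr W) n" "df (rr W) n x = 0[ob (rr W) (n+1)]"
   have "h (n+1) (df (rr W) n x) = 0[ob V n]" unfolding x(2) using lmap.zero[OF hl[of "n+1"]] by simp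
   moreover have hc: "h n x:el V (n-1)" using lmap.closed[OF hl x(1)] .
   ultimately have e: "rh n x = df V (n-1) (h n x)" using h(2)[rule_format, OF x(1)] x(1) by(simp add: a_minus_def)
   show "EX y:el (rr W) (n-1). x = df (rr W) (n-1) y"
   proof(cases "n = s+1")
    case True
    thus ?thesis using trunc_zero[OF T _ hc] e trunc_kernel[OF T, of x] x(1) by simp
   next
    case False
    then obtain y where y: "y:el (rr W) (n-1)" "h n x = rh (n-1) y" using trunc_surj[OF T _ hc] n by auto
    have "rh n x = rh n (df (rr W) (n-1) y)" using e y by(simp add: r.comm')
    thus ?thesis using y(1) False n by(intro bexI[of _ y]) (simp_all add: trunc_above[OF T])
   qed
  qed
  thus "exact_at W n" using qis_exact_at[OF cR Cb_cx[OF W] R(2)] by simp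
 qed
qed

text \<open>Maps from \<open>R\<close> to a stalk complex are maps on one term that kill
  coboundaries, and null-homotopies are extensions over the next differential. Vanishing of an Ext
  group thus becomes an extension problem in a single degree.\<close>

lemma hz_st_iff:
 assumes X: "X:Cb A" and N: "N:Mods A" and r: "res R t X"
 shows "hz (Db A ph) X (st s N) <-> (ALL f:lhom A (ob R s) N. (ALL y:el R (s-1). f (df R (s-1) y) = 0[N]) -->
  (EX h:lhom A (ob R (s+1)) N. ALL x:el R s. f x = h (df R s x)))"
proof -
 note S = st_cplx[OF N]
 interpret R: cx A R by(rule cxI[OF resD(3)[OF r]])
 interpret S: cx A "st s N" by(rule cxI[OF S(1)])
 interpret N: left_module A N by(rule ModsD(1)[OF N])
 have zS: "x = 0[ob (st s N) n]" if "n ~= s" "x:el (st s N) n" for n x using that by simp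
 have zm: "(%n x. 0[ob (st s N) n]):cmap A R (st s N)" by(rule cmI) (simp_all add: lhom_zero S.lm)
 have zm_all: "hz (Db A ph) X (st s N) <-> (ALL f:cmap A R (st s N). hm A R (st s N) f (%n x. 0[ob (st s N) n]))"
  unfolding hz_iff[OF X S(2) r] using zm hm_trans hm_sym by blast
 show ?thesis unfolding zm_all
 proof(intro iffI ballI impI)
  fix f assume a: "ALL f:cmap A R (st s N). hm A R (st s N) f (%n x. 0[ob (st s N) n])"
   and f: "f:lhom A (ob R s) N" "ALL y:el R (s-1). f (df R (s-1) y) = 0[N]"
  define g where "g n = (if n = s then f else (%_. 0[ob (st s N) n]))" for n
  have gl: "g n:lhom A (ob R n) (ob (st s N) n)" for n using f lhom_zero[OF S.lm[of n], of "ob R n"] by(simp add: g_def del: st_simps(2))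
  have "g:cmap A R (st s N)"
  proof(rule cmI[OF gl])
   fix n x assume x: "x:el R n"
   show "g (n+1) (df R n x) = df (st s N) n (g n x)" using f(2) x by(auto simp: g_def)
  qed
  from hmD(5)[OF a[rule_format, OF this]] obtain h where h: "ALL n. h n:lhom A (ob R n) (ob (st s N) (n-1))"
   "ALL n. ALL x:el R n. g n x -[ob (st s N) n] 0[ob (st s N) n] = df (st s N) (n-1) (h n x) +[ob (st s N) n] h (n+1) (df R n x)"
   unfolding homotopic_def by blast
  have hl: "h (s+1):lhom A (ob R (s+1)) N" using h(1)[rule_format, of "s+1"] by simp
  interpret hl: lmap A "ob R (s+1)" N "h (s+1)" by(intro lmapI hl R.lm N.lmA)
  interpret f: lmap A "ob R s" N f by(intro lmapI f R.lm N.lmA)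
  show "EX h:lhom A (ob R (s+1)) N. ALL x:el R s. f x = h (df R s x)"
  proof(intro bexI[OF _ hl] ballI)
   fix x assume "x:el R s"
   thus "f x = h (s+1) (df R s x)" using h(2)[rule_format, of x s] by(simp add: g_def a_minus_def)
  qed
 next
  fix f assume a: "ALL f:lhom A (ob R s) N. (ALL y:el R (s-1). f (df R (s-1) y) = 0[N]) -->
  (EX h:lhom A (ob R (s+1)) N. ALL x:el R s. f x = h (df R s x))" and f: "f:cmap A R (st s N)"
  interpret f: cxmap A R "st s N" f by(intro cxmapI R.cplx S f)
  have fs: "f s:lhom A (ob R s) N" using f.f_lhom[of s] by simp
  have f0: "f s (df R (s-1) y) = 0[N]" if "y:el R (s-1)" for y using f.comm'[OF that] by simp
  obtain h where h: "h:lhom A (ob R (s+1)) N" "ALL x:el R s. f s x = h (df R s x)" using a[rule_format, OF fs f0] by blast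
  interpret h: lmap A "ob R (s+1)" N h by(intro lmapI h R.lm N.lmA)
  show "hm A R (st s N) f (%n x. 0[ob (st s N) n])"
  proof(intro hmI R.cplx S f zm homotopicI)
   fix n
   let ?k = "%n. if n = s+1 then h else (%_. 0[ob (st s N) (n-1)])"
   show "?k n:lhom A (ob R n) (ob (st s N) (n-1))" using h(1) lhom_zero[OF S.lm[of "n-1"], of "ob R n"] by(simp del: st_simps(2))
   fix x assume x: "x:el R n"
   show "f n x -[ob (st s N) n] 0[ob (st s N) n] = df (st s N) (n-1) (?k n x) +[ob (st s N) n] ?k (n+1) (df R n x)"
   proof(cases "n = s")
    case True
    thus ?thesis using h(2) x by(simp add: a_minus_def)
   next
    case False
    show ?thesis unfolding zS[OF False f.f.closed[OF x]] using False by(simp add: del: st_simps(2))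
   qed
  qed
 qed
qed

text \<open>The hypothesis is applied to one module, the lowest term of the truncation at
  \<open>s\<close>. It splits the inclusion of this syzygy into the projective module in degree
  \<open>s+1\<close>, so the next syzygy is projective and the truncation at \<open>s+1\<close> is a
  bounded complex of projectives. It represents \<open>Z\<close> because \<open>Z\<close> has no
  cohomology below \<open>s+1\<close>.\<close>

lemma perfect_criterion:
 assumes Z: "Z:Cb A" "dge (s+1) Z" and h: "!!N. N:Mods A ==> hz (Db A ph) Z (st s N)"
 obtains V where "V:Kb_proj A" "dis Z V" "ALL n<=s. zmod (ob V n)"
proof -
 note R = res_rs[OF Z(1)] and cR = rr_cx[OF Z(1)]
 have ex: "exact_at (rr Z) n" if "n < s+1" for n using Z(2) that qis_exact_at[OF cR Cb_cx[OF Z(1)] R(2)] by(simp add: dge_def)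
 obtain V rh where T: "trunc A s (rr Z) V rh" by(rule trunc_at[OF cR])
 obtain V' rh' where T': "trunc A (s+1) (rr Z) V' rh'" by(rule trunc_at[OF cR])
 have V: "V:Cb A" and V': "V':Cb A" by(rule Cb_trunc[OF R(1) T], rule Cb_trunc[OF R(1) T'])
 interpret r: cxmap A "rr Z" V rh by(intro cxmapI trunc_cplx[OF T])
 interpret r': cxmap A "rr Z" V' rh' by(intro cxmapI trunc_cplx[OF T'])
 have k: "rh s (df (rr Z) (s-1) y) = 0[ob V s]" if "y:el (rr Z) (s-1)" for y using trunc_kernel[OF T r.X.d'.closed[OF that]] that by blast
 obtain h where h: "h:lhom A (ob (rr Z) (s+1)) (ob V s)" "ALL x:el (rr Z) s. rh s x = h (df (rr Z) s x)" using h[OF r.Y.ob_Mods[of s], unfolded hz_st_iff[OF Z(1) r.Y.ob_Mods res_self[OF Z(1)]], rule_format, OF r.f_lhom[of s] k] by blast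
 interpret h: lmap A "ob (rr Z) (s+1)" "ob V s" h by(intro lmapI h r.X.lm r.Y.lm)
 have dV: "df V s:lhom A (ob V s) (ob (rr Z) (s+1))" using r.Y.d_lhom[of s] by(simp add: trunc_above[OF T])
 interpret dV: lmap A "ob V s" "ob (rr Z) (s+1)" "df V s" by(intro lmapI dV r.X.lm r.Y.lm)
 have dVr: "df V s (rh s x) = df (rr Z) s x" if "x:el (rr Z) s" for x using r.comm[OF that] by(simp add: trunc_above[OF T])
 text \<open>\<open>1 - d h\<close> vanishes on the coboundaries, so it factors through the quotient and splits it off.\<close>
 define e where "e x = x -[ob (rr Z) (s+1)] df V s (h x)" for x
 have el: "e:lhom A (ob (rr Z) (s+1)) (ob (rr Z) (s+1))" unfolding e_def[abs_def] by(intro lhom_minus r.X.lm lhom_id lcomp[OF h(1) dV])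
 have hV: "h (df V s v) = v" if v: "v:el V s" for v
 proof -
  obtain x where x: "x:el (rr Z) s" "v = rh s x" by(rule trunc_surj[OF T _ v]) simp
  thus ?thesis using h(2) dVr by simp
 qed
 have e0: "e x = 0[ob (rr Z) (s+1)]" if x: "x:el (rr Z) (s+1)" "rh' (s+1) x = 0[ob V' (s+1)]" for x
 using trunc_kernel[OF T' x(1)] x(2) h(2) dVr x(1) by(auto simp: e_def)
 have im: "rh' (s+1) ` el (rr Z) (s+1) = el V' (s+1)" using T' by(simp add: trunc_def)
 obtain i where i: "i:lhom A (ob V' (s+1)) (ob (rr Z) (s+1))" "ALL x:el (rr Z) (s+1). i (rh' (s+1) x) = e x"
  by(rule lmap_factor[OF r.X.lm r'.Y.lm r.X.lm r'.f_lhom el im e0])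
 have "rh' (s+1) (i v) = v" if v: "v:el V' (s+1)" for v
 proof -
  obtain x where x: "x:el (rr Z) (s+1)" "v = rh' (s+1) x" by(rule trunc_surj[OF T' _ v]) simp
  obtain y where y: "y:el (rr Z) s" "h x = rh s y" by(rule trunc_surj[OF T _ h.closed[OF x(1)]]) simp
  show ?thesis using trunc_kernel[OF T', of ] y(1) y(2) dVr[OF y(1)] i(2) x by(auto simp: e_def a_minus_def)
 qed
 hence p1: "projective A (ob V' (s+1))" using projective_retract[OF bprojD(2)[OF R(1)] r'.Y.ob_Mods i(1) r'.f_lhom] by blast
 have "projective A (ob V' n)" for n
 proof -
  consider "n < s+1" | "n = s+1" | "n > s+1" by linarith
  thus ?thesis by(metis T' r'.Y.ob_Mods projective_zero p1 bprojD(2)[OF R(1)] trunc_def)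
 qed
 hence K: "V':Kb_proj A" using V' by(simp add: Kb_proj_def)
 have "dis Z V'" using trunc_qis[OF T' ex] R(1) dis_common[OF Z(1) V' res_self[OF Z(1)]] by(simp add: res_def)
 moreover have "ALL n<=s. zmod (ob V' n)" using T' by(simp add: trunc_def)
 ultimately show ?thesis using K by(intro that)
qed

end

subsection \<open>Shifts and triangles\<close>

text \<open>Differentials are functions on the whole carrier type and are meaningful only on the
  carriers; complexes that agree in this sense may differ as records and are compared by the
  identity map.\<close>

lemma qis_same:
 assumes X: "cplx A X" and Y: "cplx A Y" and ob: "!!n. ob X n = ob Y n" and d: "!!n x. x:el X n ==> df X n x = df Y n x"
 shows "qis A X Y cid"
proof(rule qisI)
 interpret X: cx A X by(rule cxI[OF X])
 interpret Y: cx A Y by(rule cxI[OF Y])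
 show "cxmap A X Y cid" by(intro cxmapI X Y cmI) (use ob d lhom_id in "auto simp: cid_def")
 fix n x y assume "x:el X (n+1)" "y:el Y n" "cid (n+1) x = df Y n y"
 thus "EX w:el X n. EX v:el Y (n-1). x = df X n w & y = cid n w +[ob Y n] df Y (n-1) v"
  using ob d by(intro bexI[of _ y] bexI[of _ "0[ob Y (n-1)]"]) (simp_all add: cid_def)
qed

definition unshift :: "'a fgcpx => 'a fgcpx" where
 "unshift X = \<lparr>ob = (%n. ob X (n-1)), df = (%n x. -[ob X n] df X (n-1) x)\<rparr>"

lemma shift_simps [simp]: "ob (shc X) n = ob X (n+1)" "df (shc X) n x = -[ob X (n+2)] df X (n+1) x"
 by(simp_all add: shift_cpx_def)

lemma unshift_simps [simp]: "ob (unshift X) n = ob X (n-1)" "df (unshift X) n x = -[ob X n] df X (n-1) x"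
 by(simp_all add: unshift_def)

context
 fixes A :: "'a ring" and X :: "'a fgcpx"
 assumes X: "cplx A X"
begin

interpretation X: cx A X by(rule cxI[OF X])

lemma d2_closed: "x:el X (n+1) ==> df X (n+1) x:el X (n+2)"
 using X.d.closed[of x "n+1"] by(simp add: add.assoc)

lemma neg_zero_iff: "x:el X n ==> -[ob X n] x = 0[ob X n] <-> x = 0[ob X n]"
 by simp

lemma cplx_shift: "cplx A (shc X)"
 unfolding cplx_def
proof(intro conjI allI ballI)
 show "ring A" using X by(simp add: cplx_def)
 fix n
 show "ob (shc X) n:Mods A" by(simp add: X.ob_Mods)
 have "df (shc X) n = (%x. -[ob X (n+1+1)] df X (n+1) x)" by(rule) (simp add: add.assoc)
 thus "df (shc X) n:lhom A (ob (shc X) n) (ob (shc X) (n+1))" using lhom_neg[OF X.lm X.d_lhom[of "n+1"]] by simp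
 fix x assume "x:el (shc X) n"
 hence x: "x:el X (n+1)" by simp
 show "df (shc X) (n+1) (df (shc X) n x) = 0[ob (shc X) (n+2)]" using X.d.neg[OF d2_closed[OF x]] X.dd[OF x] by(simp add: add.commute)
qed

lemma cplx_unshift: "cplx A (unshift X)"
 unfolding cplx_def
proof(intro conjI allI ballI)
 show "ring A" using X by(simp add: cplx_def)
 fix n
 show "ob (unshift X) n:Mods A" by(simp add: X.ob_Mods)
 have "df (unshift X) n = (%x. -[ob X n] df X (n-1) x)" by(rule) simp
 thus "df (unshift X) n:lhom A (ob (unshift X) n) (ob (unshift X) (n+1))" using lhom_neg[OF X.lm X.d_lhom'[of n]] by simp
 fix x assume "x:el (unshift X) n"
 thus "df (unshift X) (n+1) (df (unshift X) n x) = 0[ob (unshift X) (n+2)]" by(simp add: add.commute)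
qed

lemma exact_at_shift: "exact_at (shc X) n <-> exact_at X (n+1)"
proof -
 have z: "df (shc X) n x = 0[ob (shc X) (n+1)] <-> df X (n+1) x = 0[ob X (n+1+1)]" if "x:el X (n+1)" for x
  using neg_zero_iff[OF d2_closed[OF that]] by(simp add: add.assoc)
 have b: "(EX y:el X n. x = -[ob X (n+1)] df X n y) <-> (EX y:el X n. x = df X n y)" for x
 proof
  assume "EX y:el X n. x = -[ob X (n+1)] df X n y"
  then obtain y where "y:el X n" "x = -[ob X (n+1)] df X n y" by blast
  thus "EX y:el X n. x = df X n y" by(intro bexI[of _ "-[ob X n] y"]) simp_all
 next
  assume "EX y:el X n. x = df X n y"
  then obtain y where "y:el X n" "x = df X n y" by blast
  thus "EX y:el X n. x = -[ob X (n+1)] df X n y" by(intro bexI[of _ "-[ob X n] y"]) simp_all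
 qed
 have e: "n-1+2 = n+1" by simp
 show ?thesis unfolding exact_at_def using z b by(simp add: add.commute[of 1] cong:)
qed

end

lemma shift_unshift_qis: assumes X: "cplx A X" shows "qis A (shc (unshift X)) X cid"
proof(rule qis_same[OF cplx_shift[OF cplx_unshift[OF X]] X])
 interpret X: cx A X by(rule cxI[OF X])
 fix n x show "ob (shc (unshift X)) n = ob X n" by simp
 assume "x:car (ob (shc (unshift X)) n)"
 hence x: "x:el X n" by simp
 thus "df (shc (unshift X)) n x = df X n x" using X.M.minus_minus[OF X.d.closed[OF x]] by(simp add: add.commute)
qed

lemma chain_maps_shift:
 assumes X: "cplx A X" and Y: "cplx A Y" and f: "f:cmap A X Y"
 shows "shift_map f:cmap A (shc X) (shc Y)"
proof(rule cmI)
 interpret f: cxmap A X Y f by(intro cxmapI X Y f)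
 fix n show "shift_map f n:lhom A (ob (shc X) n) (ob (shc Y) n)" by(simp add: shift_map_def f.f_lhom)
 fix x assume "x:el (shc X) n"
 hence x: "x:el X (n+1)" by simp
 show "shift_map f (n+1) (df (shc X) n x) = df (shc Y) n (shift_map f n x)"
  using f.f.neg[OF f.X.d.closed[OF x]] f.comm[OF x] by(simp add: shift_map_def add.commute)
qed

lemma homotopic_shift:
 assumes X: "cplx A X" and Y: "cplx A Y" and h: "htp A X Y f g"
 shows "htp A (shc X) (shc Y) (shift_map f) (shift_map g)"
proof -
 obtain h where "htpy A X Y f g h" by(rule homotopicE[OF h X Y])
 then interpret H: htpy A X Y f g h .
 have hl: "h (n+1):lhom A (ob X (n+1)) (ob Y n)" for n using H.h_lhom[of "n+1"] by simp
 interpret h: lmap A "ob X (n+1)" "ob Y n" "h (n+1)" for n by(intro lmapI hl H.X.lm H.Y.lm)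
 show ?thesis
 proof(rule homotopicI)
  fix n
  show "(%x. -[ob Y n] h (n+1) x):lhom A (ob (shc X) n) (ob (shc Y) (n-1))" using lhom_neg[OF H.Y.lm hl] by simp
  fix x assume "x:el (shc X) n"
  hence x: "x:el X (n+1)" by simp
  note dx = H.X.d.closed[OF x]
  have e: "h (n+1+1) (-[ob X (n+1+1)] df X (n+1) x) = -[ob Y (n+1)] h (n+1+1) (df X (n+1) x)" by(rule h.neg[OF dx])
  have c: "h (n+1+1) (df X (n+1) x):el Y (n+1)" by(rule h.closed[OF dx])
  have "-[ob Y (n+1)] df Y n (-[ob Y n] h (n+1) x) = df Y n (h (n+1) x)" using h.closed[OF x] by simp
  moreover have "n-1+2 = n+1" by simp
  ultimately show "shift_map f n x -[ob (shc Y) n] shift_map g n x = df (shc Y) (n-1) (-[ob Y n] h (n+1) x) +[ob (shc Y) n]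
    -[ob Y (n+1)] h (n+1+1) (df (shc X) n x)" using e c H.eq[OF x] x by(simp add: shift_map_def add.commute)
 qed
qed

lemma hm_shift: "hm A X Y f g ==> hm A (shc X) (shc Y) (shift_map f) (shift_map g)"
 by(simp add: hm_def cplx_shift chain_maps_shift homotopic_shift)

lemma qis_shift:
 assumes X: "cplx A X" and Y: "cplx A Y" and f: "qis A X Y f"
 shows "qis A (shc X) (shc Y) (shift_map f)"
proof(rule qisI)
 interpret f: cxmap A X Y f by(intro cxmapI X Y qis_map[OF f])
 show "cxmap A (shc X) (shc Y) (shift_map f)" by(intro cxmapI cplx_shift X Y chain_maps_shift[OF X Y f.map])
 fix n x y assume "x:el (shc X) (n+1)" "df (shc X) (n+1) x = 0[ob (shc X) (n+1+1)]"
  "y:el (shc Y) n" "shift_map f (n+1) x = df (shc Y) n y"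
 hence x: "x:el X (n+1+1)" "df X (n+1+1) x = 0[ob X (n+1+1+1)]" and y: "y:el Y (n+1)"
  "f (n+1+1) x = df Y (n+1) (-[ob Y (n+1)] y)" using neg_zero_iff[OF X d2_closed[OF X], of x "n+1"] by(simp_all add: shift_map_def add.assoc)
 obtain w v where w: "w:el X (n+1)" "v:el Y (n+1-1)" "x = df X (n+1) w" "-[ob Y (n+1)] y = f (n+1) w +[ob Y (n+1)] df Y (n+1-1) v"
  by(rule qis_ex[OF f x _ y(2)]) (use y in simp)
 have "y = -[ob Y (n+1)] (f (n+1) w +[ob Y (n+1)] df Y n v)" using w(4) f.Y.M.minus_minus[OF y(1)] by simp
 hence "y = shift_map f n (-[ob X (n+1)] w) +[ob (shc Y) n] df (shc Y) (n-1) v" using w(1,2)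
  by(simp add: shift_map_def f.Y.M.minus_add add.commute[of 1 n])
 moreover have "x = df (shc X) n (-[ob X (n+1)] w)" using w(1,3) by(simp add: add.assoc)
 ultimately show "EX w:el (shc X) n. EX v:el (shc Y) (n-1). x = df (shc X) n w & y = shift_map f n w +[ob (shc Y) n] df (shc Y) (n-1) v"
  by(rule_tac bexI[where x = "-[ob X (n+1)] w"], rule_tac bexI[where x = v], intro conjI) (use w(1,2) in simp_all)
qed

lemma bproj_shift: assumes "bproj A R" shows "bproj A (shc R)"
proof -
 obtain N where "ALL n>N. zmod (ob R n)" using assms unfolding bproj_def by blast
 hence "ALL n>N. zmod (ob (shc R) n)" by simp
 moreover have "ALL n. projective A (ob (shc R) n)" using bprojD(2)[OF assms] by simp
 ultimately show ?thesis unfolding bproj_def using cplx_shift[OF bprojD(1)[OF assms]] by blast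
qed

lemma shift_ccomp: "shift_map (ccomp g f) = ccomp (shift_map g) (shift_map f)"
 by(simp add: shift_map_def ccomp_def comp_def)

context artin_alg
begin

lemma Cb_shift: assumes "X:Cb A" shows "shc X:Cb A" "unshift X:Cb A"
proof -
 obtain N where N: "ALL n. \<bar>n\<bar> > N --> zmod (ob X n)" by(rule Cb_bounds[OF assms])
 have "ALL n. \<bar>n\<bar> > N+1 --> zmod (ob (shc X) n)" using N by simp
 thus "shc X:Cb A" unfolding Cb_iff[OF ring_A] using cplx_shift[OF Cb_cx[OF assms]] by blast
 have "ALL n. \<bar>n\<bar> > N+1 --> zmod (ob (unshift X) n)" using N by simp
 thus "unshift X:Cb A" unfolding Cb_iff[OF ring_A] using cplx_unshift[OF Cb_cx[OF assms]] by blast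
qed

lemma shift_st: assumes "M:Mods A" shows "shc (st s M) = st (s-1) M"
proof -
 interpret S: cx A "st s M" by(rule cxI[OF st_cplx(1)[OF assms]])
 have 1: "(%n. ob (st s M) (n+1)) = (%n. if n = s-1 then M else zero_module)" by(rule) auto
 have 2: "(%n x. -[ob (st s M) (n+2)] df (st s M) (n+1) x) = (%n x. 0[if n+1 = s-1 then M else zero_module])"
 proof(intro ext)
  fix n and x :: "'a list set"
  have "-[ob (st s M) (n+2)] df (st s M) (n+1) x = 0[ob (st s M) (n+2)]" by(simp add: add.assoc)
  also have "... = 0[if n+1 = s-1 then M else zero_module]" by(simp add: st_def)
  finally show "-[ob (st s M) (n+2)] df (st s M) (n+1) x = 0[if n+1 = s-1 then M else zero_module]" .
 qed
 show ?thesis unfolding shift_cpx_def 1 2 by(simp add: st_def)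
qed

text \<open>Serves the third square when a standard triangle is compared with itself by
  identities.\<close>

lemma Db_shift_ident:
 assumes X: "X:Cb A"
 shows "Db_shift A X X (loc A X X cid) = loc A (shc X) (shc X) cid"
proof -
 let ?S = "shc X"
 note S = Cb_shift(1)[OF X] and cX = Cb_cx[OF X] and cR = rr_cx[OF X]
 note cS = Cb_cx[OF S]
 have q: "qis A (shc (rr X)) ?S (shift_map (tt X))" by(rule qis_shift[OF cR cX res_rs(2)[OF X]])
 obtain e where e: "e:cmap A (rr ?S) (shc (rr X))" "hm A (rr ?S) ?S (ccomp (shift_map (tt X)) e) (tt ?S)"
  by(rule hm_lift[OF res_rs(1)[OF S] cplx_shift[OF cR] cS q tt_map[OF S]])
 have main: "(shc W, shift_map s, shift_map f):cls ?S ?S cid" if r: "(W, s, f):cls X X cid" for W s f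
 proof -
  from r obtain w where ro: "(W, s, f):roofs A X X" and w: "w:cmap A (rr X) W"
   "hm A (rr X) X (ccomp s w) (tt X)" "hm A (rr X) X (ccomp f w) (tt X)" unfolding cls_def by auto
  note ro = roofsD[OF ro X]
  have h: "hm A (rr ?S) ?S (ccomp (shift_map g) (ccomp (shift_map w) e)) (tt ?S)" if "hm A (rr X) X (ccomp g w) (tt X)" for g
   using hm_trans[OF hm_right[OF hm_shift[OF that] rr_cx[OF S] e(1)] e(2)] by(simp add: shift_ccomp ccomp_assoc)
  show ?thesis by(rule clsI[OF Cb_shift(1)[OF ro(1)] S qis_shift[OF ro(4) cX ro(2)] chain_maps_shift[OF ro(4) cX ro(3)]
      cm_comp[OF e(1) chain_maps_shift[OF cR ro(4) w(1)]] h[OF w(2)]]) (simp add: h[OF w(3)])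
 qed
 obtain V s f g where r: "(V, s, f):cls X X cid" "(V, s, g):cls X X cid" by(rule cls_common[OF X X cm_id cm_id])
 show ?thesis unfolding ident_cls[OF X] ident_cls[OF S]
 proof(intro subset_antisym subsetI)
  fix r assume "r:Db_shift A X X (cls X X cid)"
  thus "r:cls ?S ?S cid" unfolding Db_shift_def using roof_class_cls[OF S S main cm_id] by blast
 next
  fix r' assume "r':cls ?S ?S cid"
  thus "r':Db_shift A X X (cls X X cid)" using roof_class_cls[OF S S main[OF r(1)] cm_id] Db_shift_def r(1) by blast
 qed
qed

text \<open>The third vertex of a distinguished triangle on \<open>u\<close>. The remaining two
  arrows are forgotten, since syzygies depend on the object only.\<close>

definition cone_obj :: "'a fgcpx => 'a fgcpx => 'a roof set => 'a fgcpx => bool" where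
 "cone_obj X Y u Z <-> (EX v w. (X, Y, Z, u, v, w):triangles (Db A ph))"

lemma cone_obj_objs: "cone_obj X Y u Z ==> X:Cb A & Y:Cb A & Z:Cb A & u:arr (Db_lin A ph) X Y"
 by(auto simp: cone_obj_def Db_triangles_def Let_def)

text \<open>The isomorphism with a standard triangle lifts to homotopy equivalences between
  resolutions, and these induce a quasi-isomorphism of cones. So the third vertex of a triangle is
  resolved by the cone of the lifted map.\<close>

lemma cone_obj_res:
 assumes Z: "cone_obj X Y (cls X Y p) Z" and p: "p:cmap A (rr X) (rr Y)" and C: "cone A (rr X) (rr Y) p C te"
 obtains t where "res C t Z"
proof -
 from Z have o: "X:Cb A" "Y:Cb A" "Z:Cb A" using cone_obj_objs by blast+
 from Z obtain v w where "(X, Y, Z, cls X Y p, v, w):Db_triangles A ph" unfolding cone_obj_def by auto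
 then obtain X' Y' f C' io pj a b c where o': "X':Cb A" "Y':Cb A" and f: "f:cmap A X' Y'" "is_cone A X' Y' f C' io pj"
  and iso: "a:iso_arr (Db A ph) X X'" "b:iso_arr (Db A ph) Y Y'" "c:iso_arr (Db A ph) Z C'"
  and sq: "Db_comp A X Y Y' b (cls X Y p) = Db_comp A X X' Y' (loc A X' Y' f) a" unfolding Db_triangles_def Let_def Db_iso_arr by auto
 have C': "C':Cb A" using f(2) by(simp add: is_cone_def)
 obtain te' where cone: "cone A X' Y' f C' te'" by(rule is_cone_cone[OF ring_A o' f])
 have "a:arr (Db_lin A ph) X X'" "b:arr (Db_lin A ph) Y Y'" using iso by(simp_all add: iso_arr_def)
 note ab = this(1)[unfolded arr_cls[OF o(1) o'(1)]] this(2)[unfolded arr_cls[OF o(2) o'(2)]]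
 obtain alp where alp: "alp:cmap A (rr X) (rr X')" "a = cls X X' alp" using ab(1) by(elim bexE)
 obtain bet where bet: "bet:cmap A (rr Y) (rr Y')" "b = cls Y Y' bet" using ab(2) by(elim bexE)
 obtain alp' bet' where "heq A (rr X) (rr X') alp alp'" "heq A (rr Y) (rr Y') bet bet'"
  using iso(1,2) iso_cls[OF o(1) o'(1) alp(1)] iso_cls[OF o(2) o'(2) bet(1)] unfolding alp(2) bet(2) by blast
 note qalp = heq_qis[OF rr_cx[OF o(1)] rr_cx[OF o'(1)] this(1)] and qbet = heq_qis[OF rr_cx[OF o(2)] rr_cx[OF o'(2)] this(2)]
 obtain p' where p': "p':cmap A (rr X') (rr Y')" "hm A (rr X') Y' (ccomp (tt Y') p') (ccomp f (tt X'))" "loc A X' Y' f = cls X' Y' p'"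
  by(rule loc_cls_exists[OF o' f(1)])
 have h: "hm A (rr X) (rr Y') (ccomp bet p) (ccomp p' alp)" using sq alp(2) bet(2) p'(3) comp_cls[OF o(1,2) o'(2) p bet(1)] comp_cls[OF o(1) o' alp(1) p'(1)] cls_eq[OF o(1) o'(2) cm_comp[OF p bet(1)] cm_comp[OF alp(1) p'(1)]] by simp
 obtain d where "qis A C C' d" by(metis hm_trans[OF hm_left[OF h Cb_cx[OF o'(2)] tt_map[OF o'(2)]]] hm_right[OF p'(2) rr_cx[OF o(1)] alp(1)] cone_map_qis[OF C cone qis_comp[OF rr_cx[OF o(1)] rr_cx[OF o'(1)] Cb_cx[OF o'(1)] qalp res_rs(2)[OF o'(1)]]
   qis_comp[OF rr_cx[OF o(2)] rr_cx[OF o'(2)] Cb_cx[OF o'(2)] qbet res_rs(2)[OF o'(2)]]] hmD(5) ccomp_assoc)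
 hence "res C d C'" using cone_bproj[OF C res_rs(1)[OF o(1)] res_rs(1)[OF o(2)]] by(simp add: res_def)
 moreover have "dis C' Z" using iso(3) dis_sym unfolding dis_def by blast
 ultimately obtain t where "res C t Z" using dis_res[OF C' o(3)] by blast
 thus ?thesis by(rule)
qed

lemma cone_obj_cone:
 assumes Z: "cone_obj X Y u Z"
 obtains p C te t where "u = cls X Y p" "p:cmap A (rr X) (rr Y)" "cone A (rr X) (rr Y) p C te" "res C t Z"
proof -
 from Z have o: "X:Cb A" "Y:Cb A" and u: "u:arr (Db_lin A ph) X Y" using cone_obj_objs by blast+
 obtain p where p: "p:cmap A (rr X) (rr Y)" "u = cls X Y p" using u arr_cls[OF o] by blast
 obtain C te where C: "cone A (rr X) (rr Y) p C te" by(rule cone_exists[OF rr_cx[OF o(1)] rr_cx[OF o(2)] p(1)])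
 obtain t where "res C t Z" using cone_obj_res[OF Z[unfolded p(2)] p(1) C] .
 thus ?thesis using that p C by blast
qed

lemma cone_obj_unique:
 assumes Z: "cone_obj X Y u Z" and Z': "cone_obj X' Y' u' Z'"
  and a: "a:iso_arr (Db A ph) X X'" and b: "b:iso_arr (Db A ph) Y Y'" and sq: "Db_comp A X Y Y' b u = Db_comp A X X' Y' u' a"
 shows "dis Z Z'"
proof -
 from Z have o: "X:Cb A" "Y:Cb A" "Z:Cb A" using cone_obj_objs by blast+
 from Z' have o': "X':Cb A" "Y':Cb A" "Z':Cb A" using cone_obj_objs by blast+
 obtain p C te t where p: "u = cls X Y p" "p:cmap A (rr X) (rr Y)" "cone A (rr X) (rr Y) p C te" "res C t Z" by(rule cone_obj_cone[OF Z])
 obtain p' C' te' t' where p': "u' = cls X' Y' p'" "p':cmap A (rr X') (rr Y')" "cone A (rr X') (rr Y') p' C' te'" "res C' t' Z'" by(rule cone_obj_cone[OF Z'])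
 have "a:arr (Db_lin A ph) X X'" "b:arr (Db_lin A ph) Y Y'" using a b by(simp_all add: iso_arr_def)
 note ab = this(1)[unfolded arr_cls[OF o(1) o'(1)]] this(2)[unfolded arr_cls[OF o(2) o'(2)]]
 obtain alp where alp: "alp:cmap A (rr X) (rr X')" "a = cls X X' alp" using ab(1) by(elim bexE)
 obtain bet where bet: "bet:cmap A (rr Y) (rr Y')" "b = cls Y Y' bet" using ab(2) by(elim bexE)
 obtain alp' bet' where "heq A (rr X) (rr X') alp alp'" "heq A (rr Y) (rr Y') bet bet'"
  using a b iso_cls[OF o(1) o'(1) alp(1)] iso_cls[OF o(2) o'(2) bet(1)] unfolding alp(2) bet(2) by blast
 note qalp = heq_qis[OF rr_cx[OF o(1)] rr_cx[OF o'(1)] this(1)] and qbet = heq_qis[OF rr_cx[OF o(2)] rr_cx[OF o'(2)] this(2)]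
 have h: "hm A (rr X) (rr Y') (ccomp bet p) (ccomp p' alp)" using sq alp(2) bet(2) p(1) p'(1) comp_cls[OF o(1,2) o'(2) p(2) bet(1)] comp_cls[OF o(1) o'(1,2) alp(1) p'(2)] cls_eq[OF o(1) o'(2) cm_comp[OF p(2) bet(1)] cm_comp[OF alp(1) p'(2)]] by simp
 obtain d where d: "qis A C C' d" by(rule cone_map_qis[OF p(3) p'(3) qalp qbet hmD(5)[OF h]])
 show ?thesis using res_def resD(1)[OF p(4)] qis_comp[OF resD(3)[OF p(4)] resD(3)[OF p'(4)] Cb_cx[OF o'(3)] d resD(2)[OF p'(4)]] dis_common[OF o(3) o'(3) p(4)] by simp
qed

lemma ident_iso: "X:Cb A ==> loc A X X cid:iso_arr (Db A ph) X X"
 using categoryD(1)[OF category_Db, of X] categoryD(2)[OF category_Db, of X X "loc A X X cid"] unfolding iso_arr_def by auto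

lemma cone_obj_exists:
 assumes X: "X:Cb A" and Y: "Y:Cb A" and f: "f:cmap A X Y"
 obtains C te where "C:Cb A" "cone A X Y f C te" "cone_obj X Y (loc A X Y f) C"
proof -
 obtain C te where cone: "cone A X Y f C te" by(rule cone_exists[OF Cb_cx[OF X] Cb_cx[OF Y] f])
 interpret cone_cx A X Y f C te by(rule cone_cxI[OF cone])
 obtain N where N: "ALL n. \<bar>n\<bar> > N --> zmod (ob X n)" by(rule Cb_bounds[OF X])
 obtain M where M: "ALL n. \<bar>n\<bar> > M --> zmod (ob Y n)" by(rule Cb_bounds[OF Y])
 have "zmod (ob C n)" if n: "\<bar>n\<bar> > max N M+1" for n
 proof(rule zmodI[OF C.lm])
  fix c assume "c:el C n"
  then obtain x y where x: "x:el X (n+1)" "y:el Y n" "c = te n (x, y)" by(rule te_surj)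
  have "x = 0[ob X (n+1)]" by(rule zmodD[OF N[rule_format] x(1)]) (use n in simp)
  moreover have "y = 0[ob Y n]" by(rule zmodD[OF M[rule_format] x(2)]) (use n in simp)
  ultimately show "c = 0[ob C n]" using x(3) te_zero by simp
 qed
 hence C: "C:Cb A" unfolding Cb_iff[OF ring_A] using C.cplx by blast
 define io where "io n y = te n (0[ob X (n+1)], y)" for n y
 have io: "io:cmap A Y C"
 proof(rule cmI)
  fix n show "io n:lhom A (ob Y n) (ob C n)" unfolding io_def[abs_def] by(rule lcomp[OF lhom_inr[OF X.lm] liso_lhom[OF te_liso]])
  fix y assume y: "y:el Y n"
  have "df X (n+1) 0[ob X (n+1)] = 0[ob X (n+2)]" using X.d.zero[of "n+1"] by(simp add: add.assoc)
  thus "io (n+1) (df Y n y) = df C n (io n y)" using y te_d[of "0[ob X (n+1)]" n y] by(simp add: io_def add.assoc)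
 qed
 obtain pj where pj: "ALL n. pj n:lhom A (ob C n) (ob X (n+1))" "ALL n. ALL x:el X (n+1). ALL y:el Y n. pj n (te n (x, y)) = fst (x, y)"
  by(rule cone_map_out[OF lhom_dsum(1)])
 have pj_te: "pj n (te n (x, y)) = x" if "x:el X (n+1)" "y:el Y n" for n x y using pj(2) that by simp
 have pj_m: "pj:cmap A C (shc X)"
 proof(rule cmI)
  fix n show "pj n:lhom A (ob C n) (ob (shc X) n)" using pj by simp
  fix c assume "c:el C n"
  then obtain x y where x: "x:el X (n+1)" "y:el Y n" "c = te n (x, y)" by(rule te_surj)
  have "pj (n+1) (df C n c) = -[ob X (n+2)] df X (n+1) x"
   unfolding x(3) te_d[OF x(1,2)] by(rule pj_te) (use x X.d_closed2[OF x(1)] in "simp_all add: add.assoc")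
  thus "pj (n+1) (df C n c) = df (shc X) n (pj n c)" using x by(simp add: pj_te)
 qed
 have ic: "is_cone A X Y f C io pj" unfolding is_cone_def
 proof(intro conjI C io pj_m exI[of _ te] allI ballI)
  fix n show "te n:liso A (dsum (ob X (n+1)) (ob Y n)) (ob C n)" by(rule te_liso)
  fix x y assume "x:el X (n+1)" "y:el Y n"
  thus "df C n (te n (x, y)) = te (n+1) (-[ob X (n+2)] df X (n+1) x, f (n+1) x +[ob Y (n+1)] df Y n y)"
   "io n y = te n (0[ob X (n+1)], y)" "pj n (te n (x, y)) = x" by(simp_all add: te_d io_def pj_te)
 qed
 let ?S = "shc X"
 note S = Cb_shift(1)[OF X]
 have la: "loc A V W g:arr (Db_lin A ph) V W" if "V:Cb A" "W:Cb A" "g:cmap A V W" for V W g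
  using loc_cls_exists[OF that] arr_cls[OF that(1,2)] by metis
 note lf = la[OF X Y f] and li = la[OF Y C io] and lp = la[OF C S pj_m]
 have cl: "Db_comp A V W W (loc A W W cid) g = g" "Db_comp A V V W g (loc A V V cid) = g" if "V:Cb A" "W:Cb A" "g:arr (Db_lin A ph) V W" for V W g
  using categoryD(2,3)[OF category_Db, of V W g] that by simp_all
 note I = ident_iso[unfolded Db_iso_arr]
 have "(X, Y, C, loc A X Y f, loc A Y C io, loc A C ?S pj):Db_triangles A ph" unfolding Db_triangles_def Let_def mem_Collect_eq prod.case Db_lin_simps
 proof(intro conjI X Y C lf li lp, rule bexI[OF _ X], rule bexI[OF _ Y], rule bexI[OF _ f], rule exI[of _ C], rule exI[of _ io],
   rule exI[of _ pj], rule conjI, rule ic, rule bexI[OF _ I[OF X]], rule bexI[OF _ I[OF Y]], rule bexI[OF _ I[OF C]], intro conjI)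
  show "Db_comp A X Y Y (loc A Y Y cid) (loc A X Y f) = Db_comp A X X Y (loc A X Y f) (loc A X X cid)" by(simp add: cl X Y lf)
  show "Db_comp A Y C C (loc A C C cid) (loc A Y C io) = Db_comp A Y Y C (loc A Y C io) (loc A Y Y cid)" by(simp add: cl Y C li)
  show "Db_comp A C ?S ?S (Db_shift A X X (loc A X X cid)) (loc A C ?S pj) = Db_comp A C C ?S (loc A C ?S pj) (loc A C C cid)"
   by(simp add: cl C S lp Db_shift_ident[OF X])
 qed
 hence "cone_obj X Y (loc A X Y f) C" unfolding cone_obj_def by auto
 with C cone show ?thesis by(rule that)
qed

end

subsection \<open>Radical complexes\<close>

lemma funpow_lhom: "lmod A M ==> u:lhom A M M ==> (u ^^ m):lhom A M M"
proof(induction m)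
 case (Suc m)
 thus ?case using lcomp[of "u ^^ m" A M M u M] by simp
qed(simp add: id_def lhom_id)

context artin_alg
begin

lemma inj_endo_liso:
 assumes M: "M:Mods A" and f: "f:lhom A M M" "inj_on f (car M)"
 shows "f:liso A M M" using klen_strict[OF M M f] f by(auto simp: liso_def bij_betw_def)

lemma klen_restr:
 assumes M: "M:Mods A" and C: "smod A M C" and D: "smod A M D" "C < D"
 shows "klen (restr M C) < klen (restr M D)"
proof(rule klen_strict[OF restr_Mods[OF M C] restr_Mods[OF M D(1)], of "%x. x"])
 show "(%x. x):lhom A (restr M C) (restr M D)" by(rule lhom_restr[OF lhom_from_restr[OF lhom_id]]) (use C D in "auto simp: submod_def")
qed(use D in auto)

text \<open>Half of Fitting's lemma: the kernels of the powers of \<open>u\<close> increase and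
  their lengths are bounded.\<close>

lemma kernel_stable:
 assumes M: "M:Mods A" and u: "u:lhom A M M"
 obtains m where "!!x j. x:car M ==> (u ^^ (m+j)) x = 0[M] ==> (u ^^ m) x = 0[M]"
proof -
 note lM = ModsD(1)[OF M]
 interpret u: lmap A M M "u ^^ j" for j by(intro lmapI lM funpow_lhom u)
 define K where "K m = {x:car M. (u ^^ m) x = 0[M]}" for m
 have K: "smod A M (K m)" for m unfolding K_def by(rule submod_kernel[OF lM lM funpow_lhom[OF lM u]])
 have "klen (restr M (K m)) < Suc (klen M)" for m
  using klen_restr[OF M K submod_top[OF lM], of m] K[of m] by(cases "K m = car M") (simp_all add: restr_def submod_def psubset_eq)
 then obtain m where m: "klen (restr M (K j)) <= klen (restr M (K m))" for j
  using ex_has_greatest_nat[of "%_. True" 0 "%m. klen (restr M (K m))" "Suc (klen M)"] by auto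
 have "K (m+j) = K m" for j
 proof -
  have "(u ^^ (m+j)) x = (u ^^ j) ((u ^^ m) x)" for x by(metis add.commute funpow_add comp_apply)
  hence "K m <= K (m+j)" by(auto simp: K_def)
  thus ?thesis using klen_restr[OF M K K, of m "m+j"] m[of "m+j"] by(metis leD psubsetI)
 qed
 thus ?thesis by(intro that[of m]) (auto simp: K_def)
qed

text \<open>Applied in both directions, this shows that homotopy equivalent radical complexes are
  nonzero in the same degrees. For the length this replaces uniqueness of radical representatives.
  If the identity of the n-th term is null-homotopic there, it is a sum \<open>u + v\<close> of maps
  through the two adjacent differentials.\<close>

lemma radical_heq_zero:
 assumes R: "radical_cpx A R" and R': "cplx A R'" and h: "heq A R R' f g" and z: "zmod (ob R' n)"
 shows "zmod (ob R n)"
proof(rule ccontr)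
 assume nz: "~ zmod (ob R n)"
 have cR: "cplx A R" using R Cb_cx by(simp add: radical_cpx_def)
 note hh = h[unfolded heq_hm[OF cR R']]
 interpret f: cxmap A R R' f by(intro cxmapI cR R') (use hh in blast)
 interpret g: cxmap A R' R g by(intro cxmapI cR R') (use hh in blast)
 from hh have "htp A R R (ccomp g f) cid" using hmD(5) by blast
 then obtain k where "htpy A R R (ccomp g f) cid k" by(rule homotopicE[OF _ cR cR])
 then interpret H: htpy A R R "ccomp g f" cid k .
 let ?M = "ob R n"
 note M = f.X.ob_Mods[of n] and lM = f.X.lm[of n]
 define a where "a x = -[ob R (n-1)] k n x" for x
 define b where "b x = -[?M] k (n+1) x" for x
 have al: "a:lhom A ?M (ob R (n-1))" unfolding a_def[abs_def] by(intro lhom_neg f.X.lm H.h_lhom)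
 have "k (n+1):lhom A (ob R (n+1)) ?M" using H.h_lhom[of "n+1"] by simp
 hence bl: "b:lhom A (ob R (n+1)) ?M" unfolding b_def[abs_def] by(intro lhom_neg f.X.lm)
 interpret a: lmap A ?M "ob R (n-1)" a by(intro lmapI al f.X.lm)
 interpret b: lmap A "ob R (n+1)" ?M b by(intro lmapI bl f.X.lm)
 define u where "u x = df R (n-1) (a x)" for x
 define v where "v x = b (df R n x)" for x
 have ul: "u:lhom A ?M ?M" unfolding u_def[abs_def] by(rule lcomp[OF al f.X.d_lhom'])
 have vl: "v:lhom A ?M ?M" unfolding v_def[abs_def] by(rule lcomp[OF f.X.d_lhom bl])
 interpret u: lmap A ?M ?M u by(intro lmapI ul lM)
 interpret v: lmap A ?M ?M v by(intro lmapI vl lM)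
 have uv: "x = u x +[?M] v x" if x: "x:car ?M" for x
 proof -
  have "f n x = 0[ob R' n]" by(rule zmodD[OF z f.f.closed[OF x]])
  hence e: "0[?M] -[?M] x = df R (n-1) (k n x) +[?M] k (n+1) (df R n x)" using H.eq[OF x] by(simp add: ccomp_def cid_def)
  have c: "df R (n-1) (k n x):car ?M" "k (n+1) (df R n x):car ?M" using x by simp_all
  have "x = -[?M] (0[?M] -[?M] x)" using x by algebra
  also have "... = u x +[?M] v x" unfolding e using c x by(simp add: u_def v_def a_def b_def f.X.M.minus_add)
  finally show ?thesis .
 qed
 obtain m where m: "!!x j. x:car ?M ==> (u ^^ (m+j)) x = 0[?M] ==> (u ^^ m) x = 0[?M]" by(rule kernel_stable[OF M ul]) blast
 have ml: "(u ^^ j):lhom A ?M ?M" for j by(rule funpow_lhom[OF lM ul])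
 have mc: "(u ^^ j) x:car ?M" if "x:car ?M" for j x using ml[of j] that by(simp add: lhom_def Pi_iff)
 define Z where "Z = (u ^^ m) ` car ?M"
 have Zs: "smod A ?M Z" unfolding Z_def by(rule submod_image[OF lM lM ml submod_top[OF lM]])
 have Zc: "Z <= car ?M" using Zs by(simp add: submod_def)
 note ZM = restr_Mods[OF M Zs]
 have rad: "radical_hom A (ob R i) (ob R (i+1)) (df R i)" for i using R by(simp add: radical_cpx_def)
 \<comment> \<open>On the image \<open>Z\<close> of the m-th power of \<open>u\<close>, the power
   with exponent \<open>m+1\<close> is injective because kernels have stabilised, hence bijective.
   It factors through the radical differential \<open>df R (n-1)\<close>, so \<open>Z\<close> must
   vanish, that is, \<open>u\<close> is nilpotent.\<close>
 have "zmod (restr ?M Z)"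
 proof(rule ccontr)
  assume nZ: "~ zmod (restr ?M Z)"
  have h1: "a:lhom A (restr ?M Z) (ob R (n-1))" by(rule lhom_from_restr[OF al Zc])
  have h2: "(u ^^ m):lhom A (ob R (n-1+1)) (restr ?M Z)" using lhom_restr[OF ml, of m Z] by(simp add: Z_def)
  have c: "((u ^^ m) o df R (n-1) o a):lhom A (restr ?M Z) (restr ?M Z)" using lhom_comp'[OF lhom_comp'[OF h1 f.X.d_lhom] h2] by(simp add: comp_assoc)
  have e: "((u ^^ m) o df R (n-1) o a) z = (u ^^ Suc m) z" for z by(simp add: u_def funpow_swap1)
  interpret c: lmap A "restr ?M Z" "restr ?M Z" "(u ^^ m) o df R (n-1) o a" by(intro lmapI c ModsD(1)[OF ZM])
  have "inj_on ((u ^^ m) o df R (n-1) o a) (car (restr ?M Z))" unfolding lmap_inj_iff[OF c.lmap_axioms]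
  proof(intro ballI impI)
   fix z assume "z:car (restr ?M Z)" and z0: "((u ^^ m) o df R (n-1) o a) z = 0[restr ?M Z]"
   then obtain y where y: "y:car ?M" "z = (u ^^ m) y" unfolding Z_def by auto
   have "(u ^^ (m+Suc m)) y = (u ^^ Suc m) z" unfolding y(2) by(simp only: funpow_add comp_apply add.commute[of m "Suc m"])
   also have "... = 0[?M]" using z0 unfolding e by simp
   finally have "(u ^^ m) y = 0[?M]" by(rule m[OF y(1)])
   thus "z = 0[restr ?M Z]" unfolding y(2) by simp
  qed
  hence "((u ^^ m) o df R (n-1) o a):liso A (restr ?M Z) (restr ?M Z)" by(rule inj_endo_liso[OF ZM c])
  thus False using rad[of "n-1"] ZM nZ h1 h2 unfolding radical_hom_def by blast
 qed
 hence u0: "(u ^^ m) x = 0[?M]" if "x:car ?M" for x using zmodD[of "restr ?M Z" "(u ^^ m) x"] that by(simp add: Z_def)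
 \<comment> \<open>An element killed by \<open>v\<close> is fixed by the nilpotent map
   \<open>u\<close>. Hence \<open>v\<close> is bijective, and it factors through the radical
   differential \<open>df R n\<close>.\<close>
 have "inj_on v (car ?M)" unfolding lmap_inj_iff[OF v.lmap_axioms]
 proof(intro ballI impI)
  fix x assume x: "x:car ?M" "v x = 0[?M]"
  hence ux: "u x = x" using uv[OF x(1)] by simp
  have "(u ^^ j) x = x" for j by(induction j) (simp_all add: ux)
  thus "x = 0[?M]" using u0[OF x(1)] by simp
 qed
 hence "v:liso A ?M ?M" by(rule inj_endo_liso[OF M vl])
 moreover have "b o df R n o (%x. x) = v" by(rule ext) (simp add: v_def)
 ultimately show False using rad[of n] M nz bl lhom_id[of A ?M] unfolding radical_hom_def by metis
qed

text \<open>A differential that is not radical has an isomorphism between copies of some nonzero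
  \<open>Z\<close> as a direct summand. Splitting off this contractible piece keeps the homotopy
  type and lowers the total length of the terms.\<close>

lemma radical_representative:
 assumes "T:Kb_proj A"
 obtains R where "R:Kb_proj A" "radical_cpx A R" "EX f g. heq A T R f g"
proof -
 obtain N where "ALL n. \<bar>n\<bar> > N --> zmod (ob T n)" using assms Cb_bounds Kb_proj_def by blast
 with assms have "EX R. R:Kb_proj A & radical_cpx A R & (EX f g. heq A T R f g)"
 proof(induction "\<Sum>n\<in>{-N..N}. klen (ob T n)" arbitrary: T rule: less_induct)
  case less
  have TC: "T:Cb A" using less.prems(1) by(simp add: Kb_proj_def)
  have cT: "cplx A T" by(rule Cb_cx[OF TC])
  interpret T: cx A T by(rule cxI[OF cT])
  show ?case
  proof(cases "radical_cpx A T")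
   case True
   have "heq A T T cid cid" unfolding heq_hm[OF cT cT] by(simp add: cm_id hm_refl cT)
   thus ?thesis using True less.prems(1) by blast
  next
   case False
   then obtain n where "~ radical_hom A (ob T n) (ob T (n+1)) (df T n)" using TC by(auto simp: radical_cpx_def)
   then obtain Z h g where Z: "Z:Mods A" "~ zmod Z" and h: "h:lhom A Z (ob T n)" and g: "g:lhom A (ob T (n+1)) Z"
    and i: "g o df T n o h:liso A Z Z" unfolding radical_hom_def using T.d_lhom by blast
   note lZ = ModsD(1)[OF Z(1)]
   obtain ps where ps: "ps:liso A Z Z" "ALL x:car Z. ps ((g o df T n o h) x) = x" "ALL y:car Z. (g o df T n o h) (ps y) = y"
    by(rule liso_inv[OF i lZ])
   interpret h: lmap A Z "ob T n" h by(intro lmapI h lZ T.lm)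
   interpret g: lmap A "ob T (n+1)" Z g by(intro lmapI g lZ T.lm)
   interpret ps: lmap A Z Z ps by(intro lmapI lZ liso_lhom[OF ps(1)])
   \<comment> \<open>This map of degree -1 satisfies \<open>kk d kk = kk\<close> and
     \<open>kk kk = 0\<close>. Therefore \<open>d kk + kk d\<close> is an idempotent chain map
     \<open>p\<close>, null-homotopic by construction, and \<open>1 - p\<close> projects onto the
     complement that is kept.\<close>
   define kk where "kk m = (if m = n+1 then (%y. h (ps (g y))) else (%y. 0[ob T (m-1)]))" for m
   have kl: "kk m:lhom A (ob T m) (ob T (m-1))" for m using lcomp[OF lcomp[OF g liso_lhom[OF ps(1)]] h] lhom_zero[OF T.lm] by(auto simp: kk_def)
   have kl': "kk (m+1):lhom A (ob T (m+1)) (ob T m)" for m using kl[of "m+1"] by simp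
   interpret kk: lmap A "ob T m" "ob T (m-1)" "kk m" for m by(intro lmapI kl T.lm)
   interpret k1: lmap A "ob T (m+1)" "ob T m" "kk (m+1)" for m by(intro lmapI kl' T.lm)
   have kdk: "kk (m+1) (df T m (kk (m+1) x)) = kk (m+1) x" if "x:el T (m+1)" for m x using that ps(2) by(auto simp: kk_def)
   have kk0: "kk m (kk (m+1) x) = 0[ob T (m-1)]" if "x:el T (m+1)" for m x
   proof(cases "m = n+1")
    case True
    hence "kk (m+1) x = 0[ob T m]" by(simp add: kk_def add.commute)
    thus ?thesis using kk.zero[of m] by simp
   qed(simp add: kk_def)
   have dd: "df T m (df T (m-1) y) = 0[ob T (m+1)]" if "y:el T (m-1)" for y m using T.dd[OF that] by(simp add: add.commute)
   define p where "p m x = df T (m-1) (kk m x) +[ob T m] kk (m+1) (df T m x)" for m x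
   have pl: "p m:lhom A (ob T m) (ob T m)" for m unfolding p_def[abs_def] by(intro lhom_add T.lm lcomp[OF kl T.d_lhom'] lcomp[OF T.d_lhom kl'])
   interpret p: lmap A "ob T m" "ob T m" "p m" for m by(intro lmapI pl T.lm)
   have pp: "p m (p m x) = p m x" if x: "x:el T m" for m x
   proof -
    have "kk m (p m x) = kk m x" using x kdk[of "kk m x" "m-1"] kdk[of x "m-1"] kk0 by(simp add: p_def)
    moreover have "df T m (p m x) = df T m (kk (m+1) (df T m x))" using x dd by(simp add: p_def)
    ultimately show ?thesis using x kdk by(simp add: p_def)
   qed
   have pd: "p (m+1) (df T m x) = df T m (p m x)" if x: "x:el T m" for m x
   proof -
    have "kk (m+1+1) (df T (m+1) (df T m x)) = 0[ob T (m+1)]" using T.dd[OF x] k1.zero[of "m+1"] by(simp add: add.assoc)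
    thus ?thesis using x dd by(simp add: p_def)
   qed
   define r where "r m x = x -[ob T m] p m x" for m x
   define C where "C m = {x:el T m. p m x = 0[ob T m]}" for m
   have C: "smod A (ob T m) (C m)" for m unfolding C_def by(rule submod_kernel[OF T.lm T.lm pl])
   have Cc: "x:el T m" if "x:C m" for x m using that by(simp add: C_def)
   have Csub: "C m <= el T m" for m using Cc by blast
   have dC: "df T m x:C (m+1)" if "x:C m" for m x using that pd[of x m] by(simp add: C_def)
   have rl0: "r m:lhom A (ob T m) (ob T m)" for m unfolding r_def[abs_def] by(intro lhom_minus T.lm lhom_id pl)
   have rC: "r m x:C m" if x: "x:el T m" for m x using x pp[OF x] by(simp add: C_def r_def)
   have rid: "r m x = x" if "x:C m" for m x using that by(simp add: C_def r_def a_minus_def)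
   have rd: "r (m+1) (df T m x) = df T m (r m x)" if x: "x:el T m" for m x using x pd[OF x] by(simp add: r_def)
   define S where "S = \<lparr>ob = (%m. restr (ob T m) (C m)), df = df T\<rparr>"
   have obS: "ob S m = restr (ob T m) (C m)" and dS: "df S = df T" for m by(simp_all add: S_def)
   have SM: "ob S m:Mods A" for m unfolding obS by(rule restr_Mods[OF T.ob_Mods C])
   have cS: "cplx A S" unfolding cplx_def
   proof(intro conjI allI ballI ring_A SM)
    fix m
    show "df S m:lhom A (ob S m) (ob S (m+1))" unfolding obS dS by(rule lhom_restr[OF lhom_from_restr[OF T.d_lhom Csub]]) (use dC in auto)
    fix x assume "x:el S m"
    thus "df S (m+1) (df S m x) = 0[ob S (m+2)]" using Cc by(simp add: obS dS)
   qed
   have rl: "r m:lhom A (ob T m) (ob S m)" for m unfolding obS by(rule lhom_restr[OF rl0]) (use rC in auto)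
   have jl: "(%x. x):lhom A (ob S m) (ob T m)" for m unfolding obS by(rule lhom_from_restr[OF lhom_id Csub])
   have "projective A (ob S m)" for m by(rule projective_retract[OF _ SM jl rl]) (use less.prems(1) rid in "simp_all add: Kb_proj_def obS")
   moreover have zS: "ALL m. \<bar>m\<bar> > N --> zmod (ob S m)"
   proof(intro allI impI)
    fix m assume "\<bar>m\<bar> > N"
    hence "zmod (ob T m)" using less.prems(2) by simp
    thus "zmod (ob S m)" using C[of m] unfolding obS is_zero_mod_def submod_def by auto
   qed
   ultimately have SK: "S:Kb_proj A" unfolding Kb_proj_def Cb_iff[OF ring_A] using cS by blast
   \<comment> \<open>The complement is strictly smaller in degree \<open>n\<close>, because
     \<open>p\<close> fixes the elements \<open>h z\<close>, and \<open>h\<close> is injective on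
     the nonzero module \<open>Z\<close>.\<close>
   have "C n ~= el T n"
   proof
    assume e: "C n = el T n"
    have "z = 0[Z]" if z: "z:car Z" for z
    proof -
     have "p n (h z) = 0[ob T n]" using e h.closed[OF z] unfolding C_def by blast
     hence "h z = 0[ob T n]" using z ps(2) by(simp add: p_def kk_def)
     thus ?thesis using ps(2)[rule_format, OF z] by simp
    qed
    thus False using Z(2) zmodI[OF lZ] by blast
   qed
   hence Cn: "C n < el T n" using Csub by blast
   have kT: "klen (restr (ob T m) (el T m)) = klen (ob T m)" for m by(simp add: restr_def)
   have "n:{-N..N}" using Cn C[of n] less.prems(2)[rule_format, of n] by(cases "N < \<bar>n\<bar>") (auto simp: submod_def is_zero_mod_def)
   moreover have "klen (ob S n) < klen (ob T n)" using klen_restr[OF T.ob_Mods C submod_top[OF T.lm] Cn] unfolding obS kT .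
   moreover have "klen (ob S m) <= klen (ob T m)" for m
    using klen_restr[OF T.ob_Mods C submod_top[OF T.lm], of m] kT[of m] Csub[of m] unfolding obS by(metis less_imp_le order_refl psubsetI)
   ultimately have "(\<Sum>n\<in>{-N..N}. klen (ob S n)) < (\<Sum>n\<in>{-N..N}. klen (ob T n))" by(intro sum_strict_mono_ex1) auto
   from less.hyps[OF this SK zS] obtain R f' g' where R: "R:Kb_proj A" "radical_cpx A R" "heq A S R f' g'" by blast
   have rm: "r:cmap A T S" by(rule cmI[OF rl]) (simp add: rd dS)
   have jm: "cid:cmap A S T" by(rule cmI) (simp_all add: cid_def jl dS)
   have "htp A T T cid (ccomp cid r)"
   proof(rule homotopicI[OF kl])
    fix m x assume x: "x:el T m"
    have "x -[ob T m] (x -[ob T m] p m x) = p m x" using x p.closed[OF x] by algebra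
    thus "cid m x -[ob T m] ccomp cid r m x = df T (m-1) (kk m x) +[ob T m] kk (m+1) (df T m x)" unfolding ccomp_cid by(simp add: cid_def r_def p_def)
   qed
   hence h1: "hm A T T (ccomp cid r) cid" by(intro hm_sym[OF hmI] cT cm_id cm_comp[OF rm jm])
   have h2: "hm A S S (ccomp r cid) cid" by(rule hm_eq[OF cS cS cm_comp[OF jm rm] cm_id]) (use rid in "simp add: cid_def obS ccomp_def")
   have hq: "heq A T S r cid" unfolding heq_hm[OF cT cS] using rm jm h1 h2 by blast
   show ?thesis using heq_trans[OF hq R(3) cT cS] Cb_cx Kb_proj_def R by blast
  qed
 qed
 thus ?thesis using that by blast
qed

text \<open>Every object of \<open>Kb_proj A\<close> isomorphic to \<open>X\<close> is homotopy
  equivalent to \<open>T\<close>, and every radical complex homotopy equivalent to it has the same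
  nonzero degrees as \<open>T\<close>. So both definite descriptions are determined.\<close>

lemma perfect_length_radical:
 assumes X: "X:Cb A" and T: "T:Kb_proj A" "radical_cpx A T" "dis X T"
 shows "perfect_length A ph X = radical_length T"
proof -
 note TT = Kb_proj_res[OF T(1)]
 have same: "radical_length R = radical_length T" if R: "radical_cpx A R" "heq A R T f g" for R f g
 proof -
  have cR: "cplx A R" using R(1) Cb_cx by(simp add: radical_cpx_def)
  have "zmod (ob R n) <-> zmod (ob T n)" for n
   using radical_heq_zero[OF R(1) Cb_cx[OF TT(2)] R(2)] radical_heq_zero[OF T(2) cR heq_sym[OF R(2)]] by blast
  thus ?thesis by(simp add: radical_length_def)
 qed
 have len: "cpx_length A S = radical_length T" if S: "S:Kb_proj A" "dis X S" for S
 proof -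
  note SS = Kb_proj_res[OF S(1)]
  obtain s where s: "res S s T" using dis_trans[OF SS(2) X TT(2) dis_sym[OF S(2)] T(3)] dis_res[OF SS(2) TT(2) _ SS(1)] by blast
  obtain e e' where e: "heq A S T e e'" using res_unique[OF Cb_cx[OF TT(2)] s TT(1)] by metis
  show ?thesis unfolding cpx_length_def
  proof(rule the_equality)
   show "EX R. radical_cpx A R & Kb_iso A S R & radical_length T = radical_length R" using T(2) e Kb_iso_heq by blast
   fix l assume "EX R. radical_cpx A R & Kb_iso A S R & l = radical_length R"
   then obtain R f g where R: "radical_cpx A R" "heq A S R f g" "l = radical_length R" unfolding Kb_iso_heq by blast
   have cR: "cplx A R" using R(1) Cb_cx by(simp add: radical_cpx_def)
   show "l = radical_length T" unfolding R(3) by(rule same[OF R(1) heq_trans[OF heq_sym[OF R(2)] e cR Cb_cx[OF SS(2)] Cb_cx[OF TT(2)]]])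
  qed
 qed
 show ?thesis unfolding perfect_length_def
 proof(rule the_equality)
  show "EX S:Kb_proj A. iso_arr (Db A ph) X S ~= {} & radical_length T = cpx_length A S"
   using T len[OF T(1,3)] unfolding dis_def by(intro bexI[OF _ T(1)]) simp
  fix l assume "EX S:Kb_proj A. iso_arr (Db A ph) X S ~= {} & l = cpx_length A S"
  thus "l = radical_length T" using len unfolding dis_def by blast
 qed
qed

lemma radical_length_support:
 assumes T: "T:Cb A" and nz: "~ zmod (ob T i)"
 obtains a b where "a <= b" "ALL n. ~ zmod (ob T n) --> a <= n & n <= b" "radical_length T = b-a+1"
proof -
 let ?S = "{n. ~ zmod (ob T n)}"
 obtain N where N: "ALL n. \<bar>n\<bar> > N --> zmod (ob T n)" by(rule Cb_bounds[OF T])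
 have "?S <= {-N..N}" using N by force
 hence fin: "finite ?S" by(rule finite_subset) simp
 have ne: "?S ~= {}" using nz by blast
 have "radical_length T = Max ?S-Min ?S+1" unfolding radical_length_def using cSup_eq_Max[OF fin ne] cInf_eq_Min[OF fin ne] by simp
 moreover have "ALL n. ~ zmod (ob T n) --> Min ?S <= n & n <= Max ?S" using fin by simp
 moreover have "Min ?S <= Max ?S" using fin ne by(meson Min_le Max_in)
 ultimately show ?thesis by(intro that[of "Min ?S" "Max ?S"])
qed

end

subsection \<open>Syzygies of complexes\<close>

text \<open>\<open>Q\<close> is the cokernel of \<open>df R (s-1)\<close>. For a projective
  resolution of a module placed in degree 0, the choice \<open>s = -n\<close> gives the n-th
  syzygy.\<close>

definition syz :: "'a ring => int => 'a fgcpx => 'a fgm => ('a list set => 'a list set) => bool" where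
 "syz A s R Q pj <-> Q:Mods A & pj:lhom A (ob R s) Q & pj ` el R s = car Q &
   (ALL x:el R s. pj x = 0[Q] <-> x:coboundaries R s)"

lemma syz_exists:
 assumes R: "cplx A R"
 obtains Q pj where "syz A s R Q pj"
proof -
 interpret R: cx A R by(rule cxI[OF R])
 obtain Q pj where "Q:Mods A" "pj:lhom A (ob R s) Q" "pj ` el R s = car Q"
  "ALL x:el R s. pj x = 0[Q] <-> x:coboundaries R s" by(rule quotient_Mods[OF R.ob_Mods coboundaries_submod[OF R]])
 thus ?thesis by(intro that) (simp add: syz_def)
qed

locale syzygy = cx A R for A :: "'a ring" and R +
 fixes s Q pj
 assumes syz: "syz A s R Q pj"
begin

lemma Q_Mods: "Q:Mods A" and pi_lhom: "pj:lhom A (ob R s) Q" and pi_surj: "pj ` el R s = car Q"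
 using syz by(simp_all add: syz_def)

sublocale Q: left_module A Q by(rule ModsD(1)[OF Q_Mods])

sublocale pi: lmap A "ob R s" Q pj by(intro lmapI lm Q.lmA pi_lhom)

lemma pi_zero: "x:el R s ==> pj x = 0[Q] <-> (EX y:el R (s-1). x = df R (s-1) y)"
 using syz unfolding syz_def coboundaries_def image_iff by blast

lemma pi_d [simp]: "y:el R (s-1) ==> pj (df R (s-1) y) = 0[Q]"
 using pi_zero[of "df R (s-1) y"] by auto

lemma pi_obtain:
 assumes "q:car Q"
 obtains x where "x:el R s" "q = pj x" using assms unfolding pi_surj[symmetric] by blast

lemma pi_factor:
 assumes "lmod A N" "f:lhom A (ob R s) N" "!!y. y:el R (s-1) ==> f (df R (s-1) y) = 0[N]"
 obtains g where "g:lhom A Q N" "ALL x:el R s. g (pj x) = f x"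
using lmap_factor[OF lm Q.lmA assms(1) pi_lhom assms(2) pi_surj] pi_zero assms(3) by blast

end

lemma syzygyI: "cplx A R ==> syz A s R Q pj ==> syzygy A R s Q pj"
 by(simp add: syzygy_def syzygy_axioms_def cx_def)

lemma syz_map:
 assumes f: "f:cmap A R S" and R: "cplx A R" "syz A s R Q pj" and S: "cplx A S" "syz A s S P rh"
 obtains g where "g:lhom A Q P" "ALL x:el R s. g (pj x) = rh (f s x)"
proof -
 interpret R: syzygy A R s Q pj by(rule syzygyI[OF R])
 interpret S: syzygy A S s P rh by(rule syzygyI[OF S])
 interpret f: cxmap A R S f by(intro cxmapI R S f)
 show ?thesis by(rule R.pi_factor[OF S.Q.lmA lcomp[OF f.f_lhom S.pi_lhom]]) (use that in "simp_all add: f.comm'")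
qed

context artin_alg
begin

text \<open>A map homotopic to the identity acts on the syzygy as the identity up to a map which factors
  through the projective module in the next degree.\<close>

lemma syz_retract:
 assumes R: "cplx A R" "syz A s R Q pj" and S1: "cplx A S1" "syz A s S1 Q1 pj_1" and S2: "cplx A S2" "syz A s S2 Q2 pj_2"
  and f1: "f1:cmap A R S1" and g1: "g1:cmap A S1 R" and f2: "f2:cmap A R S2" and g2: "g2:cmap A S2 R"
  and h: "htp A R R (%n x. g1 n (f1 n x) +[ob R n] g2 n (f2 n x)) cid"
  and Q1: "Q1:ext_gen A T (Suc j)" and Q2: "Q2:ext_gen A T (Suc j)" and P: "ob R (s+1):ext_gen A T (Suc j)"
 shows "Q:ext_gen A T (Suc j)"
proof -
 interpret R: syzygy A R s Q pj by(rule syzygyI[OF R])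
 interpret S2: syzygy A S2 s Q2 pj_2 by(rule syzygyI[OF S2])
 interpret f1: cxmap A R S1 f1 by(intro cxmapI R S1 f1)
 interpret g1: cxmap A S1 R g1 by(intro cxmapI R S1 g1)
 interpret f2: cxmap A R S2 f2 by(intro cxmapI R S2 f2)
 interpret g2: cxmap A S2 R g2 by(intro cxmapI R S2 g2)
 obtain F1 where F1: "F1:lhom A Q Q1" "ALL x:el R s. F1 (pj x) = pj_1 (f1 s x)" by(rule syz_map[OF f1 R S1])
 obtain F2 where F2: "F2:lhom A Q Q2" "ALL x:el R s. F2 (pj x) = pj_2 (f2 s x)" by(rule syz_map[OF f2 R S2])
 obtain G1 where G1: "G1:lhom A Q1 Q" "ALL x:el S1 s. G1 (pj_1 x) = pj (g1 s x)" by(rule syz_map[OF g1 S1 R])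
 obtain G2 where G2: "G2:lhom A Q2 Q" "ALL x:el S2 s. G2 (pj_2 x) = pj (g2 s x)" by(rule syz_map[OF g2 S2 R])
 obtain k where "htpy A R R (%n x. g1 n (f1 n x) +[ob R n] g2 n (f2 n x)) cid k" by(rule homotopicE[OF h R(1) R(1)])
 then interpret H: htpy A R R "%n x. g1 n (f1 n x) +[ob R n] g2 n (f2 n x)" cid k .
 have kl: "k (s+1):lhom A (ob R (s+1)) (ob R s)" using H.h_lhom[of "s+1"] by simp
 obtain d where d: "d:lhom A Q (ob R (s+1))" "ALL x:el R s. d (pj x) = df R s x" by(rule R.pi_factor[OF R.lm R.d_lhom]) simp
 define ka where "ka x = -[Q] pj (k (s+1) x)" for x
 have ka: "ka:lhom A (ob R (s+1)) Q" unfolding ka_def[abs_def] by(intro lhom_neg R.Q.lmA lcomp[OF kl R.pi_lhom])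
 have sum: "G1 (F1 q) +[Q] (G2 (F2 q) +[Q] ka (d q)) = q" if q: "q:car Q" for q
 proof -
  obtain x where x: "x:el R s" "q = pj x" by(rule R.pi_obtain[OF q])
  let ?a = "g1 s (f1 s x)" and ?b = "g2 s (f2 s x)" and ?c = "df R (s-1) (k s x)" and ?e = "k (s+1) (df R s x)"
  have c: "?a:el R s" "?b:el R s" "?c:el R s" "?e:el R s" using x(1) by simp_all
  have "?a +[ob R s] ?b = x +[ob R s] ((?a +[ob R s] ?b) -[ob R s] x)" using c x(1) by algebra
  also have "... = x +[ob R s] (?c +[ob R s] ?e)" using H.eq[OF x(1)] by(simp add: cid_def)
  finally have "pj (?a +[ob R s] ?b) = pj (x +[ob R s] (?c +[ob R s] ?e))" by simp
  hence e: "pj ?a +[Q] pj ?b = pj x +[Q] pj ?e" using x(1) by simp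
  have pc: "pj ?a:car Q" "pj ?b:car Q" "pj ?e:car Q" "pj x:car Q" using x(1) by simp_all
  have "G1 (F1 q) +[Q] (G2 (F2 q) +[Q] ka (d q)) = pj ?a +[Q] (pj ?b +[Q] -[Q] pj ?e)" using x F1(2) F2(2) G1(2) G2(2) d(2) by(simp add: ka_def)
  also have "... = (pj ?a +[Q] pj ?b) -[Q] pj ?e" using pc by algebra
  also have "... = q" unfolding e x(2) using pc by algebra
  finally show ?thesis .
 qed
 obtain D e e' where D: "D:Mods A" "e:lhom A (dsum Q2 (ob R (s+1))) D" "e':lhom A D (dsum Q2 (ob R (s+1)))"
  "ALL x:car (dsum Q2 (ob R (s+1))). e' (e x) = x" "ALL y:car D. e (e' y) = y" by(rule biproduct_Mods[OF S2.Q_Mods R.ob_Mods])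
 interpret e: lmap A "dsum Q2 (ob R (s+1))" D e by(intro lmapI dsum_lm S2.Q.lmA R.lm ModsD D)
 have DE: "D:ext_gen A T (Suc j)" using ext_gen_retract2[OF Q2 P D(1) lcomp[OF D(3) lhom_dsum(1)] lcomp[OF D(3) lhom_dsum(2)]
    lcomp[OF lhom_inl[OF R.lm] D(2)] lcomp[OF lhom_inr[OF S2.Q.lmA] D(2)]] e.add[symmetric] D by(force simp: lhom_def Pi_iff)
 define q where "q z = G2 (fst (e' z)) +[Q] ka (snd (e' z))" for z
 have ql: "q:lhom A D Q" unfolding q_def[abs_def]
  by(intro lhom_add R.Q.lmA lcomp[OF lcomp[OF D(3) lhom_dsum(1)] G2(1)] lcomp[OF lcomp[OF D(3) lhom_dsum(2)] ka])
 show ?thesis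
 using ext_gen_retract2[OF Q1 DE R.Q_Mods F1(1) lcomp[OF lhom_dsum(3)[OF F2(1) d(1)] D(2)] G1(1) ql] F2(1) d(1) sum D(4) by(simp add: lhom_def Pi_iff q_def)
qed

text \<open>The syzygies of a cone fit into a short exact sequence from that of \<open>R\<close> to
  that of \<open>C\<close>, whose middle term is the sum of the projective-type term
  \<open>ob R (s+1)\<close> and the syzygy of \<open>S\<close>. Exactness of the cone in degree
  \<open>s-1\<close> is what makes the left map injective. Only the retraction of the middle term
  onto \<open>QS\<close> is passed on, since classes are closed under summands.\<close>

lemma syz_triangle:
 assumes cone: "cone A R S p C te" and ex: "exact_at C (s-1)" and QR: "syz A s R QR pj_R" and QS: "syz A s S QS pj_S" and QC: "syz A s C QC pj_C"
 obtains D e e' f g where "ses A QR f D g QC" "e:lhom A QS D" "e':lhom A D QS" "ALL x:car QS. e' (e x) = x"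
proof -
 interpret cone_cx A R S p C te by(rule cone_cxI[OF cone])
 interpret R: syzygy A R s QR pj_R by(rule syzygyI[OF X.cplx QR])
 interpret S: syzygy A S s QS pj_S by(rule syzygyI[OF Y.cplx QS])
 interpret C: syzygy A C s QC pj_C by(rule syzygyI[OF C.cplx QC])
 let ?P = "ob R (s+1)"
 let ?D = "dsum ?P QS"
 have lD: "lmod A ?D" by(intro dsum_lm X.lm S.Q.lmA)
 obtain D e e' where D: "D:Mods A" "e:lhom A ?D D" "e':lhom A D ?D"
  "ALL x:car ?D. e' (e x) = x" "ALL y:car D. e (e' y) = y" by(rule biproduct_Mods[OF X.ob_Mods S.Q_Mods])
 interpret e: lmap A ?D D e by(intro lmapI lD ModsD D)
 interpret e': lmap A D ?D e' by(intro lmapI lD ModsD D)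
 text \<open>\<open>QR \<rightarrow> P \<oplus> QS\<close> is \<open>(-d, p)\<close>, and \<open>P \<oplus> QS \<rightarrow> QC\<close> is induced by \<open>te\<close>.\<close>
 obtain f1 where f1: "f1:lhom A QR ?P" "ALL x:el R s. f1 (pj_R x) = -[?P] df R s x" by(rule R.pi_factor[OF X.lm lhom_neg[OF X.lm X.d_lhom]]) simp
 obtain f2 where f2: "f2:lhom A QR QS" "ALL x:el R s. f2 (pj_R x) = pj_S (p s x)" by(rule syz_map[OF map X.cplx QR Y.cplx QS])
 have g1l: "(%r. pj_C (te s (r, 0[ob S s]))):lhom A ?P QC" by(rule lcomp[OF lcomp[OF lhom_inl[OF Y.lm] liso_lhom[OF te_liso]] C.pi_lhom])
 have g2l: "(%y. pj_C (te s (0[?P], y))):lhom A (ob S s) QC" by(rule lcomp[OF lcomp[OF lhom_inr[OF X.lm] liso_lhom[OF te_liso]] C.pi_lhom])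
 obtain g2 where g2: "g2:lhom A QS QC" "ALL y:el S s. g2 (pj_S y) = pj_C (te s (0[?P], y))"
 proof(rule S.pi_factor[OF C.Q.lmA g2l])
  fix y assume y: "y:el S (s-1)"
  have "df C (s-1) (te (s-1) (0[ob R s], y)) = te s (0[?P], df S (s-1) y)" by(subst te_d') (use y in simp_all)
  moreover have "te (s-1) (0[ob R s], y):el C (s-1)" using y by simp
  ultimately show "pj_C (te s (0[?P], df S (s-1) y)) = 0[QC]" using C.pi_d by metis
 qed
 define f where "f x = e (f1 x, f2 x)" for x
 define g where "g z = pj_C (te s (fst (e' z), 0[ob S s])) +[QC] g2 (snd (e' z))" for z
 have fl: "f:lhom A QR D" unfolding f_def[abs_def] by(rule lcomp[OF lhom_dsum(3)[OF f1(1) f2(1)] D(2)])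
 have gl: "g:lhom A D QC" unfolding g_def[abs_def]
  by(intro lhom_add C.Q.lmA lcomp[OF lcomp[OF D(3) lhom_dsum(1)] g1l] lcomp[OF lcomp[OF D(3) lhom_dsum(2)] g2(1)])
 interpret f: lmap A QR D f by(intro lmapI fl ModsD D R.Q.lmA)
 interpret f1: lmap A QR ?P f1 by(intro lmapI f1 X.lm R.Q.lmA)
 interpret f2: lmap A QR QS f2 by(intro lmapI f2 S.Q.lmA R.Q.lmA)
 have g_eq: "g (e (r, pj_S y)) = pj_C (te s (r, y))" if r: "r:car ?P" and y: "y:el S s" for r y
 proof -
  have "g (e (r, pj_S y)) = pj_C (te s (r, 0[ob S s])) +[QC] pj_C (te s (0[?P], y))" using D(4) r y g2(2) by(simp add: g_def)
  also have "... = pj_C (te s (r, 0[ob S s]) +[ob C s] te s (0[?P], y))" using r y by simp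
  also have "... = pj_C (te s (r, y))" using r y by(simp add: te_add del:)
  finally show ?thesis .
 qed
 have D_obtain: "EX r:car ?P. EX y:el S s. z = e (r, pj_S y)" if z: "z:car D" for z
 proof -
  obtain r q where rq: "e' z = (r, q)" by(cases "e' z")
  have "e' z:car ?D" using z by(rule e'.closed)
  hence c: "r:car ?P" "q:car QS" by(simp_all add: rq)
  obtain y where "y:el S s" "q = pj_S y" by(rule S.pi_obtain[OF c(2)])
  moreover have "z = e (r, q)" using D(5) z rq by metis
  ultimately show ?thesis using c(1) by blast
 qed
 have inj: "inj_on f (car QR)" unfolding lmap_inj_iff[OF f.lmap_axioms]
 proof(intro ballI impI)
  fix q assume q: "q:car QR" "f q = 0[D]"
  obtain x where x: "x:el R s" "q = pj_R x" by(rule R.pi_obtain[OF q(1)])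
  have "(f1 q, f2 q) = e' (f q)" using D(4) q(1) by(simp add: f_def)
  also have "... = (0[?P], 0[QS])" unfolding q(2) by simp
  finally have z: "-[?P] df R s x = 0[?P]" "pj_S (p s x) = 0[QS]" using f1(2) f2(2) x by simp_all
  obtain y where y: "y:el S (s-1)" "p s x = df S (s-1) y" using S.pi_zero[of "p s x"] z(2) x(1) by auto
  let ?c = "te (s-1) (x, -[ob S (s-1)] y)"
  have cc: "?c:el C (s-1)" using x y by simp
  have "df C (s-1) ?c = 0[ob C (s-1+1)]" using z(1) te_d' x y Y.M.r_neg by(simp add: te_zero)
  then obtain c where c: "c:el C (s-1-1)" "?c = df C (s-1-1) c" by(rule exact_atD[OF ex cc])
  obtain r w where "r:el R (s-1-1+1)" and w: "w:el S (s-1-1)" and cw: "c = te (s-1-1) (r, w)" using c(1) by(rule te_surj)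
  hence r: "r:el R (s-1)" by simp
  show "q = 0[QR]" using c(2) te_d'[OF r w] cw te_inj x y r Y.d'.closed[OF w] by simp
 qed
 have surj: "g ` car D = car QC"
 proof(intro subset_antisym image_subsetI subsetI)
  fix z assume "z:car D"
  thus "g z:car QC" using gl by(simp add: lhom_def Pi_iff)
 next
  fix q assume "q:car QC"
  then obtain c where c: "c:el C s" "q = pj_C c" by(rule C.pi_obtain)
  obtain r y where r: "r:car ?P" "y:el S s" "c = te s (r, y)" using c(1) by(rule te_surj)
  have "q = g (e (r, pj_S y))" using g_eq r c by simp
  moreover have "e (r, pj_S y):car D" using r by simp
  ultimately show "q:g ` car D" by simp
 qed
 have mid: "g z = 0[QC] <-> z:f ` car QR" if z: "z:car D" for z
 proof -
  obtain r y where r: "r:car ?P" "y:el S s" "z = e (r, pj_S y)" using D_obtain[OF z] by blast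
  have "g z = 0[QC] <-> (EX c:el C (s-1). te s (r, y) = df C (s-1) c)" unfolding r(3) g_eq[OF r(1,2)] by(rule C.pi_zero) (use r in simp)
  also have "... <-> (EX x:el R s. EX w:el S (s-1). r = -[?P] df R s x & y = p s x +[ob S s] df S (s-1) w)"
  proof
   assume "EX c:el C (s-1). te s (r, y) = df C (s-1) c"
   then obtain c where c: "c:el C (s-1)" "te s (r, y) = df C (s-1) c" by blast
   obtain x w where "x:el R (s-1+1)" and w: "w:el S (s-1)" and cw: "c = te (s-1) (x, w)" using c(1) by(rule te_surj)
   hence x: "x:el R s" by simp
   show "EX x:el R s. EX w:el S (s-1). r = -[?P] df R s x & y = p s x +[ob S s] df S (s-1) w" using c(2) cw te_d'[OF x w] te_inj x w r by auto
  next
   assume "EX x:el R s. EX w:el S (s-1). r = -[?P] df R s x & y = p s x +[ob S s] df S (s-1) w"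
   then obtain x w where x: "x:el R s" and w: "w:el S (s-1)" and ry: "r = -[?P] df R s x" "y = p s x +[ob S s] df S (s-1) w" by blast
   have "te s (r, y) = df C (s-1) (te (s-1) (x, w))" unfolding ry te_d'[OF x w] ..
   moreover have "te (s-1) (x, w):el C (s-1)" using x w by simp
   ultimately show "EX c:el C (s-1). te s (r, y) = df C (s-1) c" by blast
  qed
  also have "... <-> z:f ` car QR"
  proof
   assume "EX x:el R s. EX w:el S (s-1). r = -[?P] df R s x & y = p s x +[ob S s] df S (s-1) w"
   then obtain x w where x: "x:el R s" and w: "w:el S (s-1)" and ry: "r = -[?P] df R s x" "y = p s x +[ob S s] df S (s-1) w" by blast
   have "z = f (pj_R x)" using ry(2) x w r(3) f1(2) f2(2) by(simp add: f_def ry(1))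
   thus "z:f ` car QR" by(rule) (use x in simp)
  next
   assume "z:f ` car QR"
   then obtain q where q: "q:car QR" "z = f q" by blast
   obtain x where x: "x:el R s" "q = pj_R x" by(rule R.pi_obtain[OF q(1)])
   have "e' (e (r, pj_S y)) = e' (e (-[?P] df R s x, pj_S (p s x)))" using q(2) x f1(2) f2(2) r(3) by(simp add: f_def)
   hence e1: "r = -[?P] df R s x" "pj_S y = pj_S (p s x)" using D(4) r x by simp_all
   have "pj_S (y -[ob S s] p s x) = 0[QS]" using e1(2) r(2) x(1) by simp
   then obtain w where w: "w:el S (s-1)" "y -[ob S s] p s x = df S (s-1) w" using S.pi_zero[of "y -[ob S s] p s x"] r(2) x(1) by auto
   have "p s x:el S s" using x by simp
   hence "y = p s x +[ob S s] (y -[ob S s] p s x)" using r(2) by algebra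
   thus "EX x:el R s. EX w:el S (s-1). r = -[?P] df R s x & y = p s x +[ob S s] df S (s-1) w" unfolding w(2) using x(1) w(1) e1(1) by blast
  qed
  finally show ?thesis .
 qed
 have "ses A QR f D g QC" unfolding ses_def using R.Q_Mods D(1) C.Q_Mods fl gl inj surj mid by blast
 moreover have "(%q. e (0[?P], q)):lhom A QS D" by(rule lcomp[OF lhom_inr[OF X.lm] D(2)])
 moreover have "(%z. snd (e' z)):lhom A D QS" by(rule lcomp[OF D(3) lhom_dsum(2)])
 moreover have "ALL q:car QS. snd (e' (e (0[?P], q))) = q" using D(4) by simp
 ultimately show ?thesis by(rule)
qed

end

section \<open>Images of stalk complexes under a derived equivalence\<close>

definition st_map :: "int => 'a fgm => ('a list set => 'a list set) => 'a fgmap" where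
 "st_map s N f = (%n. if n = s then f else (%_. 0[ob (st s N) n]))"

context artin_alg
begin

lemma st_map_chain:
 assumes M: "M:Mods A" and N: "N:Mods A" and f: "f:lhom A M N"
 shows "st_map s N f:cmap A (st s M) (st s N)"
proof(rule cmI)
 interpret M: cx A "st s M" by(rule cxI[OF st_cplx(1)[OF M]])
 interpret N: cx A "st s N" by(rule cxI[OF st_cplx(1)[OF N]])
 fix n show l: "st_map s N f n:lhom A (ob (st s M) n) (ob (st s N) n)" for n
  using f lhom_zero[OF N.lm[of n], of "ob (st s M) n"] by(simp add: st_map_def del: st_simps(2))
 fix x assume "x:el (st s M) n"
 interpret l: lmap A "ob (st s M) (n+1)" "ob (st s N) (n+1)" "st_map s N f (n+1)" by(intro lmapI l M.lm N.lm)
 show "st_map s N f (n+1) (df (st s M) n x) = df (st s N) n (st_map s N f n x)" by simp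
qed

lemma loc_cong:
 assumes X: "X:Cb A" and Y: "Y:Cb A" and h: "hm A X Y f g"
 shows "loc A X Y f = loc A X Y g"
proof -
 note m = hmD[OF h]
 obtain p where p: "p:cmap A (rr X) (rr Y)" "hm A (rr X) Y (ccomp (tt Y) p) (ccomp f (tt X))" "loc A X Y f = cls X Y p"
  by(rule loc_cls_exists[OF X Y m(3)])
 show ?thesis unfolding p(3) by(rule loc_cls[OF X Y m(4) p(1) hm_trans[OF p(2) hm_right[OF h rr_cx[OF X] tt_map[OF X]]], symmetric])
qed

lemma comp_loc:
 assumes X: "X:Cb A" and Y: "Y:Cb A" and Z: "Z:Cb A" and f: "f:cmap A X Y" and g: "g:cmap A Y Z"
 shows "Db_comp A X Y Z (loc A Y Z g) (loc A X Y f) = loc A X Z (ccomp g f)"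
proof -
 obtain p where p: "p:cmap A (rr X) (rr Y)" "hm A (rr X) Y (ccomp (tt Y) p) (ccomp f (tt X))" "loc A X Y f = cls X Y p"
  by(rule loc_cls_exists[OF X Y f])
 obtain q where q: "q:cmap A (rr Y) (rr Z)" "hm A (rr Y) Z (ccomp (tt Z) q) (ccomp g (tt Y))" "loc A Y Z g = cls Y Z q"
  by(rule loc_cls_exists[OF Y Z g])
 show ?thesis using hm_trans[OF hm_right[OF q(2) rr_cx[OF X] p(1), folded ccomp_assoc] hm_left[OF p(2) Cb_cx[OF Z] g]] p(3) q(3) comp_cls[OF X Y Z p(1) q(1)] loc_cls[OF X Z cm_comp[OF f g] cm_comp[OF p(1) q(1)], symmetric] by(simp add: ccomp_assoc)
qed

lemma chain_maps_add:
 assumes "cplx A W" "cplx A Z" "u:cmap A W Z" "v:cmap A W Z"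
 shows "(%n x. u n x +[ob Z n] v n x):cmap A W Z"
proof(rule cmI)
 interpret u: cxmap A W Z u by(intro cxmapI assms)
 interpret v: cxmap A W Z v by(intro cxmapI assms)
 fix n show "(%x. u n x +[ob Z n] v n x):lhom A (ob W n) (ob Z n)" by(intro lhom_add u.Y.lm u.f_lhom v.f_lhom)
 fix x assume "x:el W n"
 thus "u (n+1) (df W n x) +[ob Z (n+1)] v (n+1) (df W n x) = df Z n (u n x +[ob Z n] v n x)" by(simp add: u.comm v.comm)
qed

lemma plus_loc:
 assumes X: "X:Cb A" and Y: "Y:Cb A" and f: "f:cmap A X Y" and g: "g:cmap A X Y"
 shows "Db_plus A X Y (loc A X Y f) (loc A X Y g) = loc A X Y (%n x. f n x +[ob Y n] g n x)"
proof -
 note c = rr_cx[OF X] rr_cx[OF Y] Cb_cx[OF Y] Cb_cx[OF X]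
 obtain p where p: "p:cmap A (rr X) (rr Y)" "hm A (rr X) Y (ccomp (tt Y) p) (ccomp f (tt X))" "loc A X Y f = cls X Y p"
  by(rule loc_cls_exists[OF X Y f])
 obtain q where q: "q:cmap A (rr X) (rr Y)" "hm A (rr X) Y (ccomp (tt Y) q) (ccomp g (tt X))" "loc A X Y g = cls X Y q"
  by(rule loc_cls_exists[OF X Y g])
 let ?s = "%n x. p n x +[ob (rr Y) n] q n x"
 have s: "?s:cmap A (rr X) (rr Y)" by(rule chain_maps_add[OF c(1,2) p(1) q(1)])
 interpret t: cxmap A "rr Y" Y "tt Y" by(intro cxmapI c tt_map Y)
 interpret p: cxmap A "rr X" "rr Y" p by(intro cxmapI c p)
 interpret q: cxmap A "rr X" "rr Y" q by(intro cxmapI c q)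
 note h1 = hmD[OF p(2)] and h2 = hmD[OF q(2)]
 have "hm A (rr X) Y (ccomp (tt Y) ?s) (%n x. ccomp (tt Y) p n x +[ob Y n] ccomp (tt Y) q n x)"
  by(rule hm_eq[OF c(1,3) cm_comp[OF s t.map] chain_maps_add[OF c(1,3) h1(3) h2(3)]]) (simp add: ccomp_def)
 also have "hm A (rr X) Y ... (%n x. ccomp f (tt X) n x +[ob Y n] ccomp g (tt X) n x)"
  by(rule hmI[OF c(1,3) chain_maps_add[OF c(1,3) h1(3) h2(3)] chain_maps_add[OF c(1,3) h1(4) h2(4)] homotopic_add[OF c(1,3) h1(5) h2(5) h1(3,4) h2(3,4)]])
 also (hm_trans) have "(%n x. ccomp f (tt X) n x +[ob Y n] ccomp g (tt X) n x) = ccomp (%n x. f n x +[ob Y n] g n x) (tt X)"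
  by(simp add: ccomp_def comp_def)
 finally show ?thesis unfolding p(3) q(3) plus_cls(2)[OF X Y p(1) q(1)] by(rule loc_cls[OF X Y chain_maps_add[OF c(4,3) f g] s, symmetric])
qed

lemma projective_ext_gen:
 assumes "projective A P" "rgm A:addc A {T}"
 shows "P:ext_gen A T (Suc j)" using add_closure_trans[OF projective_add_closure[OF assms(1)]] assms(2) ext_gen_mono by force

text \<open>The case of \<open>syz_retract\<close> with zero as the second map. It makes statements
  about syzygies independent of the chosen resolution, as soon as the class contains the projective
  modules.\<close>

lemma syz_heq:
 assumes R: "bproj A R" "syz A s R Q pj" and S: "cplx A S" "syz A s S Q' pj'" and h: "heq A R S f g"
  and Q': "Q':ext_gen A T (Suc j)" and reg: "rgm A:addc A {T}"
 shows "Q:ext_gen A T (Suc j)"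
proof -
 note cR = bprojD(1)[OF R(1)]
 note h' = h[unfolded heq_hm[OF cR S(1)]]
 interpret f: cxmap A R S f by(intro cxmapI cR S) (use h' in blast)
 interpret g: cxmap A S R g by(intro cxmapI cR S) (use h' in blast)
 have z: "(%n x. 0[ob R n]):cmap A S R" by(rule cmI) (simp_all add: lhom_zero f.X.lm)
 have "hm A R R (%n x. g n (f n x) +[ob R n] 0[ob R n]) (ccomp g f)"
 proof(rule hm_eq[OF cR cR _ cm_comp[OF f.map g.map]])
  have "(%n x. ccomp g f n x +[ob R n] 0[ob R n]):cmap A R R"
   by(rule chain_maps_add[OF cR cR cm_comp[OF f.map g.map]]) (rule cmI, simp_all add: lhom_zero f.X.lm)
  thus "(%n x. g n (f n x) +[ob R n] 0[ob R n]):cmap A R R" by(simp add: ccomp_def)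
 qed(simp add: ccomp_def)
 hence "hm A R R (%n x. g n (f n x) +[ob R n] 0[ob R n]) cid" using h' hm_trans by blast
 from hmD(5)[OF this] show ?thesis by(rule syz_retract[OF cR R(2) S S f.map g.map f.map z _ Q' Q' projective_ext_gen[OF bprojD(2)[OF R(1)] reg]])
qed

end

text \<open>\<open>F\<close> moves bounds on cohomology by amounts between \<open>a\<close> and
  \<open>b\<close>, and \<open>G\<close> undoes this. With this formulation the inverse equivalence
  is again an instance, for the window from \<open>-b\<close> to \<open>-a\<close>.\<close>

locale tilt = A: artin_alg k A ph + B: artin_alg k B ps + cat_equiv k "Db A ph" "Db B ps" F G alp bet
 for k :: "'k ring" and A :: "'a ring" and ph and B :: "'b ring" and ps and F :: "('a fgcpx, 'a roof set, 'b fgcpx, 'b roof set) cfunctor"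
  and G :: "('b fgcpx, 'b roof set, 'a fgcpx, 'a roof set) cfunctor" and alp bet +
 fixes a b :: int
 assumes ab: "a <= b" and F_dge: "!!X t. X:Cb A ==> dge t X ==> dge (t+a) (fob F X)" and F_dle: "!!X t. X:Cb A ==> dle t X ==> dle (t+b) (fob F X)"
  and G_dge: "!!Z t. Z:Cb B ==> dge t Z ==> dge (t-b) (fob G Z)" and G_cone: "!!K Q u M. B.cone_obj K Q u M ==>
   EX p C te t. p:cmap A (A.rr (fob G K)) (A.rr (fob G Q)) & cone A (A.rr (fob G K)) (A.rr (fob G Q)) p C te & A.res C t (fob G M)"
begin

lemma G_Cb: "Z:Cb B ==> fob G Z:Cb A" and F_Cb: "X:Cb A ==> fob F X:Cb B"
 using fob_G fob_F by simp_all

lemma G_dis: "Z:Cb B ==> Z':Cb B ==> B.dis Z Z' ==> A.dis (fob G Z) (fob G Z')"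
 using functor_iso[OF G] unfolding A.dis_def B.dis_def by simp blast

text \<open>Modules of \<open>B\<close> are placed in degree \<open>a\<close>, so that their images
  under \<open>G\<close> have cohomology in degrees at least \<open>a - b\<close> only. The syzygy
  is taken exactly at this lower end: there triangles of images still give short exact sequences,
  and for an \<open>A\<close>-module in degree 0 it is the syzygy of order
  \<open>b - a\<close>.\<close>

definition gsyz :: "'a fgm => nat => 'b fgm => bool" where
 "gsyz T j N <-> (ALL Q pj. syz A (a-b) (A.rr (fob G (st a N))) Q pj --> Q:ext_gen A T (Suc j))"

context
 fixes T
 assumes reg: "rgm A:addc A {T}"
begin

text \<open>Additivity of \<open>G\<close> enters here. The equation
  \<open>p1 i1 + p2 i2 = 1\<close> is carried to the derived category of \<open>A\<close>, read off
  on resolutions as a homotopy, and handed to \<open>syz_retract\<close>.\<close>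

lemma gsyz_retract2:
 assumes N: "N:Mods B" "N1:Mods B" "N2:Mods B" and m: "i1:lhom B N N1" "p1:lhom B N1 N" "i2:lhom B N N2" "p2:lhom B N2 N"
  and id: "!!x. x:car N ==> p1 (i1 x) +[N] p2 (i2 x) = x" and g: "gsyz T j N1" "gsyz T j N2"
 shows "gsyz T j N"
proof -
 let ?S = "st a"
 note c = B.st_cplx[OF N(1), of a] B.st_cplx[OF N(2), of a] B.st_cplx[OF N(3), of a]
 note ob = G_Cb[OF c(2)] G_Cb[OF c(4)] G_Cb[OF c(6)]
 note sm = B.st_map_chain[OF N(1,2) m(1), of a] B.st_map_chain[OF N(2,1) m(2), of a] B.st_map_chain[OF N(1,3) m(3), of a] B.st_map_chain[OF N(3,1) m(4), of a]
 let ?i1 = "loc B (?S N) (?S N1) (st_map a N1 i1)" and ?p1 = "loc B (?S N1) (?S N) (st_map a N p1)"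
  and ?i2 = "loc B (?S N) (?S N2) (st_map a N2 i2)" and ?p2 = "loc B (?S N2) (?S N) (st_map a N p2)"
 have la: "loc B V W g:arr (Db_lin B ps) V W" if "V:Cb B" "W:Cb B" "g:cmap B V W" for V W g
  using B.loc_cls_exists[OF that] B.arr_cls[OF that(1,2)] by metis
 note ar = la[OF c(2,4) sm(1)] la[OF c(4,2) sm(2)] la[OF c(2,6) sm(3)] la[OF c(6,2) sm(4)]
 note cm = cm_comp[OF sm(1,2)] cm_comp[OF sm(3,4)]
 have zN: "x = 0[ob (?S N) n]" if "n ~= a" "x:el (?S N) n" for n x using that by simp
 have "Db_plus B (?S N) (?S N) (Db_comp B (?S N) (?S N1) (?S N) ?p1 ?i1) (Db_comp B (?S N) (?S N2) (?S N) ?p2 ?i2) =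
  loc B (?S N) (?S N) (%n x. ccomp (st_map a N p1) (st_map a N1 i1) n x +[ob (?S N) n] ccomp (st_map a N p2) (st_map a N2 i2) n x)"
  unfolding B.comp_loc[OF c(2,4,2) sm(1,2)] B.comp_loc[OF c(2,6,2) sm(3,4)] by(rule B.plus_loc[OF c(2,2) cm])
 also have "... = loc B (?S N) (?S N) cid"
 proof(rule B.loc_cong[OF c(2,2) hm_eq[OF c(1,1) B.chain_maps_add[OF c(1,1) cm] cm_id]])
  fix n x assume x: "x:el (?S N) n"
  show "ccomp (st_map a N p1) (st_map a N1 i1) n x +[ob (?S N) n] ccomp (st_map a N p2) (st_map a N2 i2) n x = cid n x"
  proof(cases "n = a")
   case True
   thus ?thesis using id x by(simp add: ccomp_def st_map_def cid_def)
  next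
   case False
   have hc: "ccomp (st_map a N p1) (st_map a N1 i1) n x +[ob (?S N) n] ccomp (st_map a N p2) (st_map a N2 i2) n x:el (?S N) n"
   proof -
    interpret S: cxmap B "?S N" "?S N" "%n x. ccomp (st_map a N p1) (st_map a N1 i1) n x +[ob (?S N) n] ccomp (st_map a N p2) (st_map a N2 i2) n x"
     by(intro cxmapI c(1) B.chain_maps_add[OF c(1,1) cm])
    show ?thesis by(rule S.f.closed[OF x])
   qed
   show ?thesis unfolding cid_def by(rule trans[OF zN[OF False hc] zN[OF False x, symmetric]])
  qed
 qed
 finally have e: "Db_plus B (?S N) (?S N) (Db_comp B (?S N) (?S N1) (?S N) ?p1 ?i1) (Db_comp B (?S N) (?S N2) (?S N) ?p2 ?i2) = loc B (?S N) (?S N) cid" .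
 let ?G = "%N. fob G (st a N)"
 have lin: "far G X X (loc B X X cid) = loc A (fob G X) (fob G X) cid" if "X:Cb B" for X using G that by(simp add: lin_functor_def)
 have arrG: "far G X Y u:arr (Db_lin A ph) (fob G X) (fob G Y)" if "X:Cb B" "Y:Cb B" "u:arr (Db_lin B ps) X Y" for X Y u
  using G that by(simp add: lin_functor_def)
 have plusG: "far G X Y (Db_plus B X Y u v) = Db_plus A (fob G X) (fob G Y) (far G X Y u) (far G X Y v)"
  if "X:Cb B" "Y:Cb B" "u:arr (Db_lin B ps) X Y" "v:arr (Db_lin B ps) X Y" for X Y u v using G that by(simp add: lin_functor_def)
 have compG: "far G X Z (Db_comp B X Y Z v u) = Db_comp A (fob G X) (fob G Y) (fob G Z) (far G Y Z v) (far G X Y u)"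
  if "X:Cb B" "Y:Cb B" "Z:Cb B" "u:arr (Db_lin B ps) X Y" "v:arr (Db_lin B ps) Y Z" for X Y Z u v using G that by(simp add: lin_functor_def)
 have compB: "Db_comp B X Y Z v u:arr (Db_lin B ps) X Z"
  if "X:Cb B" "Y:Cb B" "Z:Cb B" "u:arr (Db_lin B ps) X Y" "v:arr (Db_lin B ps) Y Z" for X Y Z u v
  using categoryD(4)[OF B.category_Db, of X Y Z u v] that by simp
 have e2: "Db_plus A (?G N) (?G N) (Db_comp A (?G N) (?G N1) (?G N) (far G (?S N1) (?S N) ?p1) (far G (?S N) (?S N1) ?i1))
   (Db_comp A (?G N) (?G N2) (?G N) (far G (?S N2) (?S N) ?p2) (far G (?S N) (?S N2) ?i2)) = loc A (?G N) (?G N) cid"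
  using arg_cong[OF e, of "far G (?S N) (?S N)"]
  unfolding lin[OF c(2)] plusG[OF c(2,2) compB[OF c(2,4,2) ar(1,2)] compB[OF c(2,6,2) ar(3,4)]] compG[OF c(2,4,2) ar(1,2)] compG[OF c(2,6,2) ar(3,4)] .
 obtain f1 where f1: "f1:cmap A (A.rr (?G N)) (A.rr (?G N1))" "far G (?S N) (?S N1) ?i1 = A.cls (?G N) (?G N1) f1"
  using arrG[OF c(2,4) ar(1)] unfolding A.arr_cls[OF ob(1,2)] by(elim bexE)
 obtain g1 where g1: "g1:cmap A (A.rr (?G N1)) (A.rr (?G N))" "far G (?S N1) (?S N) ?p1 = A.cls (?G N1) (?G N) g1"
  using arrG[OF c(4,2) ar(2)] unfolding A.arr_cls[OF ob(2,1)] by(elim bexE)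
 obtain f2 where f2: "f2:cmap A (A.rr (?G N)) (A.rr (?G N2))" "far G (?S N) (?S N2) ?i2 = A.cls (?G N) (?G N2) f2"
  using arrG[OF c(2,6) ar(3)] unfolding A.arr_cls[OF ob(1,3)] by(elim bexE)
 obtain g2 where g2: "g2:cmap A (A.rr (?G N2)) (A.rr (?G N))" "far G (?S N2) (?S N) ?p2 = A.cls (?G N2) (?G N) g2"
  using arrG[OF c(6,2) ar(4)] unfolding A.arr_cls[OF ob(3,1)] by(elim bexE)
 note gf = cm_comp[OF f1(1) g1(1)] cm_comp[OF f2(1) g2(1)]
 note R = A.res_rs(1)[OF ob(1)] and cR = A.rr_cx[OF ob(1)]
 have "hm A (A.rr (?G N)) (A.rr (?G N)) (%n x. ccomp g1 f1 n x +[ob (A.rr (?G N)) n] ccomp g2 f2 n x) cid" using e2 f1(2) f2(2) g1(2) g2(2) A.comp_cls[OF ob(1,2,1) f1(1) g1(1)] A.comp_cls[OF ob(1,3,1) f2(1) g2(1)] A.plus_cls(2)[OF ob(1,1) gf] A.ident_cls[OF ob(1)] A.cls_eq[OF ob(1,1) A.chain_maps_add[OF cR cR gf] cm_id] by simp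
 from hmD(5)[OF this] have h: "htp A (A.rr (?G N)) (A.rr (?G N)) (%n x. g1 n (f1 n x) +[ob (A.rr (?G N)) n] g2 n (f2 n x)) cid"
  by(simp add: ccomp_def)
 obtain Q1 pj_1 where Q1: "syz A (a-b) (A.rr (?G N1)) Q1 pj_1" by(rule syz_exists[OF A.rr_cx[OF ob(2)]])
 obtain Q2 pj_2 where Q2: "syz A (a-b) (A.rr (?G N2)) Q2 pj_2" by(rule syz_exists[OF A.rr_cx[OF ob(3)]])
 show ?thesis using g Q1 Q2 gsyz_def A.syz_retract[OF cR _ A.rr_cx[OF ob(2)] Q1 A.rr_cx[OF ob(3)] Q2 f1(1) g1(1) f2(1) g2(1) h _ _ A.projective_ext_gen[OF bprojD(2)[OF R] reg]] by blast
qed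

text \<open>Frees \<open>gsyz\<close> from the chosen resolution and from the particular object in
  its isomorphism class.\<close>

lemma gsyz_res:
 assumes N: "N:Mods B" and r: "A.res R t X" "X:Cb A" "A.dis X (fob G (st a N))" and Q: "syz A (a-b) R Q pj" and g: "gsyz T j N"
 shows "Q:ext_gen A T (Suc j)"
proof -
 note G = G_Cb[OF B.st_cplx(2)[OF N], of a]
 obtain t' where t': "A.res R t' (fob G (st a N))" by(rule A.dis_res[OF r(2) G r(3) r(1)])
 obtain e e' where e: "heq A R (A.rr (fob G (st a N))) e e'" using A.res_unique[OF A.Cb_cx[OF G] t' A.res_self[OF G]] by metis
 obtain Q' pj' where Q': "syz A (a-b) (A.rr (fob G (st a N))) Q' pj'" by(rule syz_exists[OF A.rr_cx[OF G]])
 show ?thesis by(rule A.syz_heq[OF A.resD(1)[OF r(1)] Q A.rr_cx[OF G] Q' e _ reg]) (rule g[unfolded gsyz_def, rule_format, OF Q'])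
qed

text \<open>The short exact sequence becomes a triangle whose third vertex is the stalk complex of
  \<open>V\<close>; \<open>G\<close> carries it to a triangle over \<open>A\<close>, and
  \<open>syz_triangle\<close> turns that into a short exact sequence of syzygies.\<close>

lemma gsyz_extension:
 assumes s: "ses B U f N g V" and g: "gsyz T 0 U" "gsyz T j V"
 shows "gsyz T (Suc j) N"
proof -
 note N = sesD(1-3)[OF s]
 note s' = sesD[OF s]
 interpret f: lmap B U N f by(rule s')
 note c = B.st_cplx[OF N(1), of a] B.st_cplx[OF N(2), of a] B.st_cplx[OF N(3), of a]
 note fm = B.st_map_chain[OF N(1,2) s'(4), of a] and gm = B.st_map_chain[OF N(2,3) s'(5), of a]
 obtain C te where C: "C:Cb B" "cone B (st a U) (st a N) (st_map a N f) C te" "B.cone_obj (st a U) (st a N) (loc B (st a U) (st a N) (st_map a N f)) C"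
  by(rule B.cone_obj_exists[OF c(2,4) fm])
 have "EX gam. qis B C (st a V) gam"
 proof(rule cone_ses[OF C(2) c(5) gm])
  fix n x assume x: "x:el (st a U) n" "st_map a N f n x = 0[ob (st a N) n]"
  show "x = 0[ob (st a U) n]"
  proof(cases "n = a")
   case True
   thus ?thesis using s'(6) x lmap_inj_iff[OF f.lmap_axioms] by(simp add: st_map_def)
  qed(use x in simp)
 next
  fix n y assume y: "y:el (st a N) n"
  show "st_map a V g n y = 0[ob (st a V) n] <-> (EX x:el (st a U) n. y = st_map a N f n x)" using s'(8)[of y] y by(auto simp: st_map_def)
 next
  fix n z assume z: "z:el (st a V) n"
  show "EX y:el (st a N) n. z = st_map a V g n y"
  proof(cases "n = a")
   case True
   thus ?thesis using z s'(7) by(auto simp: st_map_def)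
  next
   case False
   thus ?thesis using z by(simp add: st_map_def)
  qed
 qed blast
 then obtain gam where "qis B C (st a V) gam" ..
 hence d: "A.dis (fob G C) (fob G (st a V))" by(intro G_dis C(1) c(6) B.dis_qis)
 note GC = G_Cb[OF C(1)] and GU = G_Cb[OF c(2)] and GN = G_Cb[OF c(4)] and GV = G_Cb[OF c(6)]
 obtain p D te' t where D: "p:cmap A (A.rr (fob G (st a U))) (A.rr (fob G (st a N)))"
  "cone A (A.rr (fob G (st a U))) (A.rr (fob G (st a N))) p D te'" "A.res D t (fob G C)" using G_cone[OF C(3)] by blast
 have "dge a (st a V)" unfolding dge_def by(intro allI impI exact_at_zero[OF c(5)]) (simp add: B.zero_mod_zero)
 \<comment> \<open>The bound on the cohomology of \<open>G\<close> applied to a stalk in degree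
   \<open>a\<close> is just strong enough for \<open>syz_triangle\<close> in degree
   \<open>a - b\<close>.\<close>
 hence ex: "exact_at D (a-b-1)" using G_dge[OF c(6)] A.dis_exact_at[OF GC GV d] qis_exact_at[OF A.resD(3)[OF D(3)] A.Cb_cx[OF GC] A.resD(2)[OF D(3)]] by(simp add: dge_def)
 show ?thesis unfolding gsyz_def
 proof(intro allI impI)
  fix Q pj assume Q: "syz A (a-b) (A.rr (fob G (st a N))) Q pj"
  obtain QU pj_U where QU: "syz A (a-b) (A.rr (fob G (st a U))) QU pj_U" by(rule syz_exists[OF A.rr_cx[OF GU]])
  obtain QD pj_D where QD: "syz A (a-b) D QD pj_D" by(rule syz_exists[OF A.resD(3)[OF D(3)]])
  have QDE: "QD:ext_gen A T (Suc j)" by(rule gsyz_res[OF N(3) D(3) GC d QD g(2)])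
  have QUE: "QU:ext_gen A T 1" using g(1)[unfolded gsyz_def, rule_format, OF QU] by simp
  obtain E e e' f g where E: "ses A QU f E g QD" "e:lhom A Q E" "e':lhom A E Q" "ALL x:car Q. e' (e x) = x"
   by(rule A.syz_triangle[OF D(2) ex QU Q QD])
  note s = sesD[OF E(1)]
  have "E:ext_gen A T (Suc (Suc j))" using short_exact_iff_ses[OF s(1-3)] E(1) A.ext_gen_extension[OF _ s(2) QUE QDE] by blast
  thus "Q:ext_gen A T (Suc (Suc j))" by(rule A.ext_gen_retract[OF _ _ E(2,3)]) (use Q E(4) in "simp_all add: syz_def")
 qed
qed

lemma gsyz_mono: "gsyz T i N ==> i <= j ==> gsyz T j N"
 unfolding gsyz_def using A.ext_gen_mono[of _ T "Suc i" "Suc j"] by auto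

lemma gsyz_ext_gen:
 assumes Y: "Y:Mods B" "gsyz T 0 Y"
 shows "N:ext_gen B Y (Suc j) ==> gsyz T j N"
proof(rule B.ext_gen_induct[where E = "gsyz T", OF Y(1) gsyz_mono[OF Y(2)]])
 fix n N N1 N2 i1 p1 i2 p2
 assume a: "gsyz T n N1" "gsyz T n N2" "N:Mods B" "N1:Mods B" "N2:Mods B" "i1:lhom B N N1" "p1:lhom B N1 N"
  "i2:lhom B N N2" "p2:lhom B N2 N" "!!x. x:car N ==> p1 (i1 x) +[N] p2 (i2 x) = x"
 show "gsyz T n N" by(rule gsyz_retract2[OF a(3-10,1,2)])
qed(use gsyz_extension in simp_all)

end

end

section \<open>Recovering modules from their syzygies\<close>

context artin_alg
begin

text \<open>The differential induces a map from the syzygy to the next term; exactness in degree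
  \<open>s\<close> says that it is injective.\<close>

lemma syz_step:
 assumes R: "bproj A R" and Q: "syz A s R Q pj" and Q': "syz A (s+1) R Q' pj'" and ex: "exact_at R s"
 obtains d where "ses A Q d (ob R (s+1)) pj' Q'"
proof -
 note cR = bprojD(1)[OF R]
 interpret Q: syzygy A R s Q pj by(rule syzygyI[OF cR Q])
 interpret Q': syzygy A R "s+1" Q' pj' by(rule syzygyI[OF cR Q'])
 obtain d where d: "d:lhom A Q (ob R (s+1))" "ALL x:el R s. d (pj x) = df R s x" by(rule Q.pi_factor[OF Q.lm Q.d_lhom]) simp
 interpret d: lmap A Q "ob R (s+1)" d by(intro lmapI d Q.lm Q.Q.lmA)
 have inj: "inj_on d (car Q)" unfolding lmap_inj_iff[OF d.lmap_axioms]
 proof(intro ballI impI)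
  fix q assume q: "q:car Q" "d q = 0[ob R (s+1)]"
  obtain x where x: "x:el R s" "q = pj x" by(rule Q.pi_obtain[OF q(1)])
  obtain y where "y:el R (s-1)" "x = df R (s-1) y" using d(2) q(2) x exact_atD[OF ex x(1)] by blast
  thus "q = 0[Q]" using x(2) by simp
 qed
 have "pj' x = 0[Q'] <-> x:d ` car Q" if x: "x:el R (s+1)" for x
 proof -
  have "pj' x = 0[Q'] <-> (EX y:el R s. x = df R s y)" using Q'.pi_zero[OF x] by simp
  also have "... <-> x:d ` pj ` el R s" using d(2) by auto
  finally show ?thesis unfolding Q.pi_surj .
 qed
 hence "ses A Q d (ob R (s+1)) pj' Q'" unfolding ses_def using Q.Q_Mods Q.ob_Mods Q'.Q_Mods d(1) Q'.pi_lhom inj Q'.pi_surj by blast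
 thus ?thesis by(rule)
qed

text \<open>The module resolved by \<open>R\<close> is recovered from its \<open>n\<close>-th syzygy by \<open>n\<close> cosyzygy steps, each of
  which costs one extension.\<close>

lemma syz_climb:
 assumes W: "W:Mods A" and h: "!!X R t Q pj. [|X:Mods A; res R t (st 0 X); ALL n>0. zmod (ob R n); syz A (- int n) R Q pj|] ==> Q:ext_gen A W (Suc m)"
 shows "EX W':Mods A. ALL X:Mods A. X:ext_gen A W' (Suc (m+n))" using assms
proof(induction n arbitrary: W m)
 case 0
 show ?case
 proof(intro bexI[OF _ 0(1)] ballI)
  fix X assume X: "X:Mods A"
  note S = st_cplx[OF X, of 0]
  obtain R t where R: "bproj A R" "ALL n>0. zmod (ob R n)" "qis A R (st 0 X) t" using exact_at_zero[OF S(1)] zero_mod_zero resolution_exists[OF S(1), of 0] by auto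
  note cR = bprojD(1)[OF R(1)]
  obtain Q pj where Q: "syz A 0 R Q pj" by(rule syz_exists[OF cR])
  have QE: "Q:ext_gen A W (Suc m)" by(rule 0(2)[OF X _]) (use R Q in "simp_all add: res_def")
  interpret Q: syzygy A R 0 Q pj by(rule syzygyI[OF cR Q])
  interpret t: cxmap A R "st 0 X" t by(intro cxmapI cR S qis_map[OF R(3)])
  interpret X: left_module A X by(rule ModsD(1)[OF X])
  have t0: "t 0:lhom A (ob R 0) X" using t.f_lhom[of 0] by simp
  \<comment> \<open>The syzygy in degree 0 is \<open>X\<close> itself: the augmentation identifies
    the cokernel of the last differential with the cohomology of the stalk complex, since
    \<open>R\<close> is zero above degree 0.\<close>
  obtain g where g: "g:lhom A Q X" "ALL x:el R 0. g (pj x) = t 0 x"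
  proof(rule Q.pi_factor[OF X.lmA t0])
   fix y assume "y:el R (0-1)"
   thus "t 0 (df R (0-1) y) = 0[X]" using t.comm'[of y 0] by simp
  qed
  interpret g: lmap A Q X g by(intro lmapI g Q.Q.lmA X.lmA)
  have z1: "df R 0 x = 0[ob R (0+1)]" if "x:el R 0" for x by(rule zmodD[OF _ Q.d.closed[OF that]]) (use R(2) in simp)
  have inj: "inj_on g (car Q)" unfolding lmap_inj_iff[OF g.lmap_axioms]
  proof(intro ballI impI)
   fix q assume q: "q:car Q" "g q = 0[X]"
   obtain x where x: "x:el R 0" "q = pj x" by(rule Q.pi_obtain[OF q(1)])
   have "t 0 x = df (st 0 X) (0-1) 0[ob (st 0 X) (0-1)]" using g(2) x q(2) by simp
   then obtain y where "y:el R (0-1)" "x = df R (0-1) y" by(rule qis_inj[OF R(3) x(1) z1[OF x(1)], rotated]) simp_all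
   thus "q = 0[Q]" using x(2) Q.pi_d by simp
  qed
  have surj: "x:g ` car Q" if x: "x:car X" for x
  proof -
   have xs: "x:el (st 0 X) 0" "df (st 0 X) 0 x = 0[ob (st 0 X) (0+1)]" using x by simp_all
   obtain w y where w: "w:el R 0" "x = t 0 w +[ob (st 0 X) 0] df (st 0 X) (0-1) y" by(rule qis_surj[OF R(3) xs])
   have "x = g (pj w)" using t.f.closed[OF w(1)] w g(2) by simp
   thus ?thesis by(rule) (use w in simp)
  qed
  have gi: "g:liso A Q X" using surj g(1) inj by(auto simp: liso_def bij_betw_def)
  obtain g' where "g':liso A X Q" by(rule liso_inv[OF gi Q.Q.lmA])
  thus "X:ext_gen A W (Suc (m+0))" using ext_gen_iso[OF QE X] by simp
 qed
next
 case (Suc n)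
 obtain W' where W': "W':Mods A" "ALL n U P V f g. projective A P & ses A U f P g V & U:ext_gen A W (Suc n) -->
  V:ext_gen A W' (Suc (Suc n))" by(rule cosyzygy_step[OF Suc.prems(1)])
 have "Q':ext_gen A W' (Suc (Suc m))"
  if X: "X:Mods A" and r: "res R t (st 0 X)" "ALL n>0. zmod (ob R n)" and Q': "syz A (- int n) R Q' pj'" for X R t Q' pj'
 proof -
  note cR = resD(3)[OF r(1)]
  note S = st_cplx[OF X, of 0]
  obtain Q pj where Q: "syz A (- int (Suc n)) R Q pj" by(rule syz_exists[OF cR])
  have ex: "exact_at R (- int (Suc n))" using exact_at_zero[OF S(1)] qis_exact_at[OF cR S(1) resD(2)[OF r(1)]] by(simp add: zero_mod_zero)
  have e: "- int (Suc n)+1 = - int n" by simp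
  obtain d where d: "ses A Q d (ob R (- int n)) pj' Q'" using syz_step[OF resD(1)[OF r(1)] Q _ ex, unfolded e, OF Q'] .
  show ?thesis using Suc.prems(2)[OF X r Q] W'(2) bprojD(2)[OF resD(1)[OF r(1)]] d by blast
 qed
 from Suc.IH[OF W'(1) this] show ?case by simp
qed

end

context tilt
begin

text \<open>The subcomplex \<open>K\<close> of terms above degree \<open>a\<close> consists of
  projective modules, and the quotient of \<open>V\<close> by it is the lowest term of
  \<open>V\<close> as a stalk complex. The resulting triangle separates the one term that may fail
  to be projective.\<close>

lemma stupid_truncation:
 assumes V: "V:Cb B" and z: "ALL n<a. zmod (ob V n)" and P: "ALL n>a. projective B (ob V n)"
 obtains K f C te where "K:Kb_proj B" "ALL n<=a. zmod (ob K n)" "f:cmap B K V"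
  "B.cone_obj K V (loc B K V f) C" "B.dis C (st a (ob V a))" "C:Cb B"
proof -
 interpret V: cx B V by(rule cxI[OF B.Cb_cx[OF V]])
 let ?M = "ob V a"
 define K where "K = \<lparr>ob = (%n. if n <= a then zero_module else ob V n), df = (%n x. if n <= a then 0[if n+1 <= a then zero_module else ob V (n+1)] else df V n x)\<rparr>"
 have Kob: "ob K n = (if n <= a then zero_module else ob V n)" for n by(simp add: K_def)
 have Kdf: "df K n = (if n <= a then (%x. 0[ob K (n+1)]) else df V n)" for n by(auto simp: K_def)
 have KM: "ob K n:Mods B" for n by(simp add: Kob B.zero_Mods V.ob_Mods)
 note Kl = ModsD(1)[OF KM]
 have Kd: "df K n:lhom B (ob K n) (ob K (n+1))" for n
 proof(cases "n <= a")
  case True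
  thus ?thesis using lhom_zero[OF Kl[of "n+1"], of "ob K n"] by(simp add: Kdf)
 next
  case False
  thus ?thesis using V.d_lhom by(simp add: Kob Kdf)
 qed
 interpret Kd: lmap B "ob K n" "ob K (n+1)" "df K n" for n by(intro lmapI Kl Kd)
 have cK: "cplx B K" unfolding cplx_def using B.ring_A KM Kd by(simp add: add.assoc Kob Kdf)
 obtain N where N: "ALL n. \<bar>n\<bar> > N --> zmod (ob V n)" by(rule B.Cb_bounds[OF V])
 hence KC: "K:Cb B" by(metis Cb_iff[OF B.ring_A] cK Kob B.zero_mod_zero)
 define f where "f n = (if n <= a then (%x. 0[ob V n]) else (%x. x))" for n :: int
 have f: "f:cmap B K V"
 proof(rule cmI)
  fix n show "f n:lhom B (ob K n) (ob V n)" by(simp add: f_def lhom_zero V.lm Kob lhom_id)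
  fix x assume x: "x:el K n"
  show "f (n+1) (df K n x) = df V n (f n x)" by(simp add: f_def Kdf Kob)
 qed
 define g where "g n = (if n = a then (%x. x) else (%_. 0[ob (st a ?M) n]))" for n
 note S = B.st_cplx[OF V.ob_Mods, of a a]
 interpret S: cx B "st a ?M" by(rule cxI[OF S(1)])
 have gl: "g n:lhom B (ob V n) (ob (st a ?M) n)" for n
  using lhom_id[of B ?M] lhom_zero[OF S.lm[of n], of "ob V n"] by(simp add: g_def del: st_simps(2))
 interpret gl: lmap B "ob V n" "ob (st a ?M) n" "g n" for n by(intro lmapI gl V.lm S.lm)
 have g: "g:cmap B V (st a ?M)"
 proof(rule cmI[OF gl])
  fix n x assume x: "x:el V n"
  show "g (n+1) (df V n x) = df (st a ?M) n (g n x)" using z zmodD[OF _ x] by(simp add: g_def)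
 qed
 obtain C te where C: "C:Cb B" "cone B K V f C te" "B.cone_obj K V (loc B K V f) C" by(rule B.cone_obj_exists[OF KC V f])
 have "EX gam. qis B C (st a ?M) gam"
 proof(rule cone_ses[OF C(2) S(1) g])
  fix n x assume x: "x:el K n" "f n x = 0[ob V n]"
  thus "x = 0[ob K n]" by(cases "n <= a") (simp_all add: f_def Kob)
 next
  fix n y assume y: "y:el V n"
  consider "n < a" | "n = a" | "n > a" by linarith
  thus "g n y = 0[ob (st a ?M) n] <-> (EX x:el K n. y = f n x)" using z zmodD[OF _ y] y by(simp add: g_def f_def Kob)
 next
  fix n w assume w: "w:el (st a ?M) n"
  show "EX y:el V n. w = g n y" using w by(auto simp: g_def)
 qed blast
 then obtain gam where "qis B C (st a ?M) gam" ..
 hence "B.dis C (st a ?M)" by(rule B.dis_qis[OF C(1) S(2)])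
 moreover have "K:Kb_proj B" using P KC by(simp add: Kob projective_zero B.zero_Mods B.zero_mod_zero Kb_proj_def)
 moreover have "ALL n<=a. zmod (ob K n)" by(simp add: Kob B.zero_mod_zero)
 ultimately show ?thesis using f C by(intro that)
qed

text \<open>F(X) is represented by a truncation \<open>V\<close> at \<open>a\<close> with projective
  terms above \<open>a\<close>. In the triangle from \<open>K\<close> to \<open>V\<close> to the
  stalk of the lowest term, the image of \<open>K\<close> under \<open>G\<close> has no syzygy in
  degree \<open>a - b\<close>. Hence the syzygy of \<open>X\<close>, up to projective modules, is a
  summand of that of a stalk complex, which \<open>gsyz\<close> controls.\<close>

lemma stalk_syz:
 assumes reg: "rgm A:addc A {T}" and g: "!!N. N:Mods B ==> gsyz T m N" and X: "X:Mods A" and r: "A.res R t (st 0 X)" and Q: "syz A (a-b) R Q pj"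
 shows "Q:ext_gen A T (Suc m)"
proof -
 note S = A.st_cplx[OF X, of 0]
 let ?FX = "fob F (st 0 X)"
 note FX = F_Cb[OF S(2)]
 note RF = B.res_rs[OF FX] and cRF = B.rr_cx[OF FX]
 obtain V rh where V: "trunc B a (B.rr ?FX) V rh" by(rule trunc_at[OF cRF])
 have VC: "V:Cb B" by(rule B.Cb_trunc[OF RF(1) V])
 have "exact_at (B.rr ?FX) n" if "n < a" for n using exact_at_zero[OF S(1)] F_dge[OF S(2), of 0] that qis_exact_at[OF cRF B.Cb_cx[OF FX] RF(2)] by(simp add: A.zero_mod_zero dge_def)
 hence dV: "B.dis ?FX V" using trunc_qis[OF V] RF B.dis_common[OF FX VC B.res_self[OF FX]] by(simp add: B.res_def)
 have Vz: "ALL n<a. zmod (ob V n)" using V by(simp add: trunc_def)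
 have VP: "ALL n>a. projective B (ob V n)" using bprojD(2)[OF RF(1)] by(simp add: trunc_above[OF V])
 obtain K f C te where K: "K:Kb_proj B" "ALL n<=a. zmod (ob K n)" "f:cmap B K V"
  "B.cone_obj K V (loc B K V f) C" "B.dis C (st a (ob V a))" "C:Cb B" by(rule stupid_truncation[OF VC Vz VP])
 note KK = B.Kb_proj_res[OF K(1)]
 have VM: "ob V a:Mods B" by(rule cx.ob_Mods[OF cxI[OF B.Cb_cx[OF VC]]])
 note GK = G_Cb[OF KK(2)] and GV = G_Cb[OF VC] and GC = G_Cb[OF K(6)]
 have "dge (a+1) K" unfolding dge_def using K(2) by(intro allI impI exact_at_zero[OF B.Cb_cx[OF KK(2)]]) simp
 hence dGK: "dge (a-b+1) (fob G K)" using G_dge[OF KK(2), of "a+1"] by(simp add: algebra_simps)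
 \<comment> \<open>By adjunction the morphisms go from \<open>K\<close> to the image under
   \<open>F\<close> of a module in degree \<open>a - b\<close>. That image has no cohomology above
   \<open>a\<close>, while \<open>K\<close> is a complex of projectives living above
   \<open>a\<close>.\<close>
 have hzGK: "hz (Db A ph) (fob G K) (st (a-b) N)" if N: "N:Mods A" for N
 proof -
  note SN = A.st_cplx[OF N, of "a-b"]
  have "dle (a-b) (st (a-b) N)" unfolding dle_def by(intro allI impI exact_at_zero[OF SN(1)]) (simp add: A.zero_mod_zero)
  hence "dle a (fob F (st (a-b) N))" using F_dle[OF SN(2), of "a-b"] by simp
  hence "hz (Db B ps) K (fob F (st (a-b) N))" by(intro B.hz_null[OF KK(2) F_Cb[OF SN(2)] KK(1)]) (use K(2) in "auto simp: dle_def not_le[symmetric]")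
  thus ?thesis using cat_equiv.hz_adj[OF cat_equiv_sym[OF cat_equiv_axioms], of K "st (a-b) N"] KK(2) SN(2) by simp
 qed
 obtain V' where V': "V':Kb_proj A" "A.dis (fob G K) V'" "ALL n<=a-b. zmod (ob V' n)" by(rule A.perfect_criterion[OF GK dGK hzGK])
 note VV = A.Kb_proj_res[OF V'(1)]
 obtain v where v: "A.res V' v (fob G K)" by(rule A.dis_res[OF VV(2) GK A.dis_sym[OF V'(2)] VV(1)])
 obtain e e' where e: "heq A V' (A.rr (fob G K)) e e'" using A.res_unique[OF A.Cb_cx[OF GK] v A.res_self[OF GK]] by metis
 obtain p D te' s where D: "p:cmap A (A.rr (fob G K)) (A.rr (fob G V))"
  "cone A (A.rr (fob G K)) (A.rr (fob G V)) p D te'" "A.res D s (fob G C)" using G_cone[OF K(4)] by blast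
 note cV' = A.Cb_cx[OF VV(2)] and cGK = A.rr_cx[OF GK] and cGV = A.rr_cx[OF GV]
 have em: "e:cmap A V' (A.rr (fob G K))" using e by(simp add: heq_def)
 note pe = cm_comp[OF em D(1)]
 \<comment> \<open>The map is precomposed with \<open>e\<close> so that the cone starts from
   \<open>V'\<close>, the representative of the image of \<open>K\<close> that is zero in degrees up
   to \<open>a - b\<close>.\<close>
 obtain D' te'' where D': "cone A V' (A.rr (fob G V)) (ccomp p e) D' te''" by(rule cone_exists[OF cV' cGV pe])
 obtain c where c: "qis A D' D c" by(rule cone_map_qis[OF D' D(2) heq_qis[OF cV' cGK e] qis_id[OF cGV]]) (simp_all add: homotopic_refl[OF cV' cGV pe])
 have bD': "bproj A D'" by(rule cone_bproj[OF D' VV(3) A.res_rs(1)[OF GV]])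
 note cD' = bprojD(1)[OF bD']
 have rD': "A.res D' (ccomp s c) (fob G C)"
  unfolding A.res_def using bD' qis_comp[OF cD' A.resD(3)[OF D(3)] A.Cb_cx[OF GC] c A.resD(2)[OF D(3)]] by blast
 note SM = B.st_cplx[OF VM, of a]
 have dGC: "A.dis (fob G C) (fob G (st a (ob V a)))" by(rule G_dis[OF K(6) SM(2) K(5)])
 have "dge a (st a (ob V a))" unfolding dge_def by(intro allI impI exact_at_zero[OF SM(1)]) (simp add: B.zero_mod_zero)
 hence ex: "exact_at D' (a-b-1)" using G_dge[OF SM(2)] A.dis_exact_at[OF GC G_Cb[OF SM(2)] dGC] qis_exact_at[OF cD' A.Cb_cx[OF GC] A.resD(2)[OF rD']] by(simp add: dge_def)
 obtain Q0 pj_0 where Q0: "syz A (a-b) V' Q0 pj_0" by(rule syz_exists[OF cV'])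
 obtain QV pj_V where QV: "syz A (a-b) (A.rr (fob G V)) QV pj_V" by(rule syz_exists[OF cGV])
 obtain QD pj_D where QD: "syz A (a-b) D' QD pj_D" by(rule syz_exists[OF cD'])
 have QDE: "QD:ext_gen A T (Suc m)" by(rule gsyz_res[OF reg VM rD' GC dGC QD g[OF VM]])
 obtain E i i' d h where E: "ses A Q0 d E h QD" "i:lhom A QV E" "i':lhom A E QV" "ALL x:car QV. i' (i x) = x"
  by(rule A.syz_triangle[OF D' ex Q0 QV QD])
 note s = sesD[OF E(1)]
 interpret h: lmap A E QD h by(rule s)
 interpret d: lmap A Q0 E d by(rule s)
 \<comment> \<open>The kernel of \<open>h\<close> is the image of \<open>Q0\<close>, a quotient of
   the zero module in degree \<open>a - b\<close> of \<open>V'\<close>. So \<open>E\<close> is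
   isomorphic to the syzygy \<open>QD\<close>.\<close>
 have "inj_on h (car E)" unfolding lmap_inj_iff[OF h.lmap_axioms]
 proof(intro ballI impI)
  fix x assume x: "x:car E" "h x = 0[QD]"
  then obtain q where q: "q:car Q0" "x = d q" using s(8)[OF x(1)] by blast
  obtain y where y: "y:el V' (a-b)" "q = pj_0 y" by(rule syzygy.pi_obtain[OF syzygyI[OF cV' Q0] q(1)])
  interpret Q0: syzygy A V' "a-b" Q0 pj_0 by(rule syzygyI[OF cV' Q0])
  show "x = 0[E]" using zmodD[OF _ y(1)] V'(3) q(2) y(2) by simp
 qed
 hence "E:ext_gen A T (Suc m)" using s(5,7) A.ext_gen_iso[OF QDE s(2)] by(simp add: liso_def bij_betw_def)
 hence QVE: "QV:ext_gen A T (Suc m)" by(rule A.ext_gen_retract[OF _ _ E(2,3)]) (use QV E(4) in "simp_all add: syz_def")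
 have "A.dis (st 0 X) (fob G ?FX)" using GF[of "st 0 X"] S(2) A.dis_sym unfolding A.dis_def by simp
 moreover have "A.dis (fob G ?FX) (fob G V)" by(rule G_dis[OF FX VC dV])
 ultimately have "A.dis (st 0 X) (fob G V)" by(rule A.dis_trans[OF S(2) G_Cb[OF FX] GV])
 then obtain t' where t': "A.res R t' (fob G V)" using A.dis_res[OF S(2) GV _ r] by metis
 obtain u u' where u: "heq A R (A.rr (fob G V)) u u'" using A.res_unique[OF A.Cb_cx[OF GV] t' A.res_self[OF GV]] by metis
 show ?thesis by(rule A.syz_heq[OF A.resD(1)[OF r] Q cGV QV u QVE reg])
qed

theorem ext_dim_transfer:
 assumes Y: "Y:Mods B" "Mods B = ext_gen B Y (m+1)"
 shows "EX W:Mods A. Mods A = ext_gen A W (m+nat (b-a)+1)"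
proof -
 note GY = G_Cb[OF B.st_cplx(2)[OF Y(1)], of a]
 obtain QY pj_Y where QY: "syz A (a-b) (A.rr (fob G (st a Y))) QY pj_Y" by(rule syz_exists[OF A.rr_cx[OF GY]])
 \<comment> \<open>\<open>T\<close> generates the syzygy attached to \<open>Y\<close> and contains
   the regular module, by which syzygies for different resolutions may differ.\<close>
 let ?S = "%i::nat. if i = 0 then QY else rgm A"
 obtain T where T: "T:Mods A" "ALL i<2. ?S i:addc A {T}" by(metis QY A.dominating_module[of 2 ?S] regular_module_Mods(1)[OF A.ring_A] syz_def)
 have reg: "rgm A:addc A {T}" and QYT: "QY:addc A {T}" using T(2)[rule_format, of 1] T(2)[rule_format, of 0] by simp_all
 have "gsyz T 0 Y" unfolding gsyz_def
 proof(intro allI impI)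
  fix Q pj assume Q: "syz A (a-b) (A.rr (fob G (st a Y))) Q pj"
  have h: "heq A (A.rr (fob G (st a Y))) (A.rr (fob G (st a Y))) cid cid" using A.rr_cx[OF GY] by(simp add: heq_hm cm_id hm_refl)
  show "Q:ext_gen A T (Suc 0)" by(rule A.syz_heq[OF A.res_rs(1)[OF GY] Q A.rr_cx[OF GY] QY h _ reg]) (use QYT in simp)
 qed
 hence g: "gsyz T m N" if "N:Mods B" for N using gsyz_ext_gen[OF reg Y(1), of N m] that Y(2) by simp
 have e: "- int (nat (b-a)) = a-b" using ab by simp
 have "EX W:Mods A. ALL X:Mods A. X:ext_gen A W (Suc (m+nat (b-a)))"
 proof(rule A.syz_climb[OF T(1), of "nat (b-a)" m, unfolded e])
  fix X R t Q pj assume "X:Mods A" "A.res R t (st 0 X)" "syz A (a-b) R Q pj"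
  thus "Q:ext_gen A T (Suc m)" by(intro stalk_syz[OF reg, of m X R t Q pj] g)
 qed
 then obtain W where W: "W:Mods A" "ALL X:Mods A. X:ext_gen A W (Suc (m+nat (b-a)))" by blast
 thus ?thesis using A.ext_gen_Mods[of _ W ] by auto
qed

end

lemma iso_arr_comp:
 assumes C: "category C" and o: "X:objs C" "Y:objs C" "Z:objs C" and i: "a:iso_arr C X Y" "a':iso_arr C Y Z"
 shows "cpa C X Y Z a' a:iso_arr C X Z"
proof -
 obtain b where b: "a:arr C X Y" "b:arr C Y X" "cpa C X Y X b a = ident C X" "cpa C Y X Y a b = ident C Y" using i(1) by(rule iso_arrE)
 obtain b' where b': "a':arr C Y Z" "b':arr C Z Y" "cpa C Y Z Y b' a' = ident C Y" "cpa C Z Y Z a' b' = ident C Z" using i(2) by(rule iso_arrE)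
 note cl = categoryD(4)[OF C] and as = categoryD(5)[OF C] and idl = categoryD(3)[OF C]
 have "cpa C X Z X (cpa C Z Y X b b') (cpa C X Y Z a' a) = ident C X"
  using as[OF o(1,3,2,1) cl[OF o b(1) b'(1)] b'(2) b(2)] as[OF o(1,2,3,2) b(1) b'(1,2)] b'(3) b(3) idl[OF o(1,2) b(1)] by simp
 moreover have "cpa C Z X Z (cpa C X Y Z a' a) (cpa C Z Y X b b') = ident C Z"
  using as[OF o(3,1,2,3) cl[OF o(3,2,1) b'(2) b(2)] b(1) b'(1)] as[OF o(3,2,1,2) b'(2) b(2,1)] b(4) b'(4) idl[OF o(3,2) b'(2)] by simp
 ultimately show ?thesis unfolding iso_arr_def using cl[OF o b(1) b'(1)] cl[OF o(3,2,1) b'(2) b(2)] by blast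
qed

section \<open>Shifts and cones under an equivalence, and perfection of the image of the regular
  module\<close>

context artin_alg
begin

lemma dis_shift:
 assumes X: "X:Cb A" and Y: "Y:Cb A" and d: "dis X Y"
 shows "dis (shc X) (shc Y)"
proof -
 obtain s where s: "res (rr X) s Y" by(rule dis_res[OF X Y d res_self[OF X]])
 have "res (shc (rr X)) (shift_map t) (shc Z)" if "res (rr X) t Z" "Z:Cb A" for t Z
  using bproj_shift[OF resD(1)[OF that(1)]] qis_shift[OF resD(3)[OF that(1)] Cb_cx[OF that(2)] resD(2)[OF that(1)]] by(simp add: res_def)
 from this[OF res_self[OF X] X] this[OF s Y] show ?thesis by(rule dis_common[OF Cb_shift(1)[OF X] Cb_shift(1)[OF Y]])
qed

lemma dis_unshift: "X:Cb A ==> dis (shc (unshift X)) X"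
 by(rule dis_qis[OF Cb_shift(1)[OF Cb_shift(2)] _ shift_unshift_qis[OF Cb_cx]])

text \<open>Writes a morphism as the fraction of two chain maps whose denominator becomes an
  isomorphism. Cones of arbitrary morphisms are thereby reduced to cones of chain maps.\<close>

lemma roof_loc:
 assumes X: "X:Cb A" and Y: "Y:Cb A" and p: "p:cmap A (rr X) (rr Y)" and r: "(W, s, f):cls X Y p"
 obtains si si' q where "si:cmap A (rr W) (rr X)" "loc A W X s = cls W X si" "heq A (rr W) (rr X) si si'"
  "q:cmap A (rr W) (rr Y)" "loc A W Y f = cls W Y q" "hm A (rr W) (rr Y) q (ccomp p si)"
proof -
 note cX = Cb_cx[OF X] and cY = Cb_cx[OF Y]
 from r obtain w where ro: "(W, s, f):roofs A X Y" and w: "w:cmap A (rr X) W"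
  "hm A (rr X) X (ccomp s w) (tt X)" "hm A (rr X) Y (ccomp f w) (ccomp (tt Y) p)" unfolding cls_def by blast
 note ro = roofsD[OF ro X]
 note W = ro(1) and cW = ro(4)
 obtain si where si: "si:cmap A (rr W) (rr X)" "hm A (rr W) X (ccomp (tt X) si) (ccomp s (tt W))" "loc A W X s = cls W X si"
  by(rule loc_cls_exists[OF W X qis_map[OF ro(2)]])
 obtain q where q: "q:cmap A (rr W) (rr Y)" "hm A (rr W) Y (ccomp (tt Y) q) (ccomp f (tt W))" "loc A W Y f = cls W Y q"
  by(rule loc_cls_exists[OF W Y ro(3)])
 obtain si' where si': "heq A (rr W) (rr X) si si'" using hm_qis[OF qis_comp[OF rr_cx[OF W] cW cX res_rs(2)[OF W] ro(2)] hm_sym[OF si(2)]] qis_cancel_left[OF rr_cx[OF W] rr_cx[OF X] cX si(1) res_rs(2)[OF X]] qis_heq[OF res_rs(1)[OF W] res_rs(1)[OF X]] by blast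
 have "hm A (rr W) W (ccomp w si) (tt W)" using hm_trans[OF hm_right[OF w(2) rr_cx[OF W] si(1)] si(2)] hm_cancel[OF res_rs(1)[OF W] cW ro(2) cm_comp[OF si(1) w(1)] tt_map[OF W]] by(simp add: ccomp_assoc)
 from hm_left[OF this cY ro(3)] have 1: "hm A (rr W) Y (ccomp f (ccomp w si)) (ccomp f (tt W))" .
 show ?thesis using hm_right[OF w(3) rr_cx[OF W] si(1)] hm_trans[OF q(2)] hm_trans[OF hm_sym[OF 1]] hm_cancel[OF res_rs(1)[OF W] rr_cx[OF Y] res_rs(2)[OF Y] q(1) cm_comp[OF si(1) p]] that[OF si(1,3) si' q(1,3)] by(simp add: ccomp_assoc)
qed

text \<open>Vanishing of Hom(X, N[-s]) is inherited by summands and by extensions. If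
  \<open>Y\<close> generates all modules by finitely many extensions, the single module
  \<open>Y\<close> tests it for all \<open>N\<close>.\<close>

lemma hz_ext_gen:
 assumes X: "X:Cb A" and h: "hz (Db A ph) X (st s Y)" and Y: "Y:Mods A"
 shows "N:ext_gen A Y (Suc j) ==> hz (Db A ph) X (st s N)"
proof -
 let ?R = "rr X"
 interpret R: cx A ?R by(rule cxI[OF rr_cx[OF X]])
 define E where "E N <-> (ALL f:lhom A (ob ?R s) N. (ALL y:el ?R (s-1). f (df ?R (s-1) y) = 0[N]) -->
  (EX h:lhom A (ob ?R (s+1)) N. ALL x:el ?R s. f x = h (df ?R s x)))" for N :: "'a fgm"
 have hE: "hz (Db A ph) X (st s N) <-> E N" if "N:Mods A" for N unfolding E_def by(rule hz_st_iff[OF X that res_self[OF X]])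
 have ret: "E N" if E12: "E N1" "E N2" and N: "N:Mods A" "N1:Mods A" "N2:Mods A" and
  m: "i1:lhom A N N1" "p1:lhom A N1 N" "i2:lhom A N N2" "p2:lhom A N2 N"
  and id: "!!x. x:car N ==> p1 (i1 x) +[N] p2 (i2 x) = x" for N N1 N2 i1 p1 i2 p2 unfolding E_def
 proof(intro ballI impI)
  fix f assume f: "f:lhom A (ob ?R s) N" "ALL y:el ?R (s-1). f (df ?R (s-1) y) = 0[N]"
  note l = ModsD(1)[OF N(1)] ModsD(1)[OF N(2)] ModsD(1)[OF N(3)]
  interpret i1: lmap A N N1 i1 by(intro lmapI l m)
  interpret i2: lmap A N N2 i2 by(intro lmapI l m)
  interpret f: lmap A "ob ?R s" N f by(intro lmapI l R.lm f)
  obtain h1 where h1: "h1:lhom A (ob ?R (s+1)) N1" "ALL x:el ?R s. i1 (f x) = h1 (df ?R s x)"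
   using E12(1)[unfolded E_def, rule_format, OF lcomp[OF f(1) m(1)]] f(2) by auto
  obtain h2 where h2: "h2:lhom A (ob ?R (s+1)) N2" "ALL x:el ?R s. i2 (f x) = h2 (df ?R s x)"
   using E12(2)[unfolded E_def, rule_format, OF lcomp[OF f(1) m(3)]] f(2) by auto
  show "EX h:lhom A (ob ?R (s+1)) N. ALL x:el ?R s. f x = h (df ?R s x)"
  proof(intro bexI[of _ "%x. p1 (h1 x) +[N] p2 (h2 x)"] ballI)
   show "(%x. p1 (h1 x) +[N] p2 (h2 x)):lhom A (ob ?R (s+1)) N" by(intro lhom_add l lcomp[OF h1(1) m(2)] lcomp[OF h2(1) m(4)])
   fix x assume x: "x:el ?R s"
   show "f x = p1 (h1 (df ?R s x)) +[N] p2 (h2 (df ?R s x))" using id[OF f.closed[OF x]] h1(2)[rule_format, OF x] h2(2)[rule_format, OF x] by simp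
  qed
 qed
 have ext: "E N" if EUV: "E U" "E V" and s: "ses A U u N v V" for U u N v V unfolding E_def
 proof(intro ballI impI)
  fix f assume f: "f:lhom A (ob ?R s) N" "ALL y:el ?R (s-1). f (df ?R (s-1) y) = 0[N]"
  note ss = sesD[OF s]
  note l = ModsD(1)[OF ss(1)] ModsD(1)[OF ss(2)] ModsD(1)[OF ss(3)]
  interpret v: lmap A N V v by(rule ss)
  interpret f: lmap A "ob ?R s" N f by(intro lmapI l R.lm f)
  obtain h1 where h1: "h1:lhom A (ob ?R (s+1)) V" "ALL x:el ?R s. v (f x) = h1 (df ?R s x)"
   using EUV(2)[unfolded E_def, rule_format, OF lcomp[OF f(1) ss(5)]] f(2) by auto
  interpret h1: lmap A "ob ?R (s+1)" V h1 by(intro lmapI h1 R.lm l)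
  \<comment> \<open>Projectivity of the term in degree \<open>s+1\<close> lifts the solution for
    \<open>V\<close> to \<open>N\<close>. What is then left of \<open>f\<close> takes values in
    \<open>U\<close> and still kills coboundaries, so the solution for \<open>U\<close> completes
    it.\<close>
  obtain h2 where h2: "h2:lhom A (ob ?R (s+1)) N" "ALL x:el ?R (s+1). v (h2 x) = h1 x"
   by(rule projective_lift[OF bprojD(2)[OF res_rs(1)[OF X]] l(2,3) ModsD(2)[OF ss(2)] ss(5) h1(1)]) (use ss(7) in auto)
  interpret h2: lmap A "ob ?R (s+1)" N h2 by(intro lmapI h2 R.lm l)
  define g where "g x = f x -[N] h2 (df ?R s x)" for x
  have gl: "g:lhom A (ob ?R s) N" unfolding g_def[abs_def] by(intro lhom_minus l f lcomp[OF R.d_lhom h2(1)])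
  have "EX k:lhom A (ob ?R s) U. ALL x:el ?R s. u (k x) = g x"
  proof -
   have "g x:u ` car U" if "x:el ?R s" for x
   proof -
    have "v (g x) = 0[V]" unfolding g_def using that h1(2) h2(2) by simp
    moreover have "g x:car N" unfolding g_def using that by simp
    ultimately show ?thesis using ss(8) by simp
   qed
   then obtain k where "k:lhom A (ob ?R s) U" "ALL x:el ?R s. u (k x) = g x"
    by(rule projective_lift[OF bprojD(2)[OF res_rs(1)[OF X]] l(1,2) ModsD(2)[OF ss(1)] ss(4) gl])
   thus ?thesis by blast
  qed
  then obtain k where k: "k:lhom A (ob ?R s) U" "ALL x:el ?R s. u (k x) = g x" by blast
  interpret k: lmap A "ob ?R s" U k by(intro lmapI k R.lm l)
  have "k (df ?R (s-1) y) = 0[U]" if y: "y:el ?R (s-1)" for y using k f(2) y ss(6) lmap_inj_iff[OF ss(9)] by(simp add: g_def)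
  then obtain h3 where h3: "h3:lhom A (ob ?R (s+1)) U" "ALL x:el ?R s. k x = h3 (df ?R s x)"
   using EUV(1)[unfolded E_def, rule_format, OF k(1)] by blast
  show "EX h:lhom A (ob ?R (s+1)) N. ALL x:el ?R s. f x = h (df ?R s x)"
  proof(intro bexI[of _ "%x. u (h3 x) +[N] h2 x"] ballI)
   show "(%x. u (h3 x) +[N] h2 x):lhom A (ob ?R (s+1)) N" by(intro lhom_add l lcomp[OF h3(1) ss(4)] h2(1))
   fix x assume x: "x:el ?R s"
   have c: "f x:car N" "h2 (df ?R s x):car N" using x by simp_all
   have "u (h3 (df ?R s x)) = f x -[N] h2 (df ?R s x)" using k(2) h3(2) x by(simp add: g_def)
   thus "f x = u (h3 (df ?R s x)) +[N] h2 (df ?R s x)" using c by simp algebra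
  qed
 qed
 have EY: "E Y" using h hE[OF Y] by simp
 have "N:ext_gen A Y (Suc j) ==> E N" for N
 proof(rule ext_gen_induct[where E = "%_. E", OF Y EY])
  fix N N1 N2 i1 p1 i2 p2
  assume a: "E N1" "E N2" "N:Mods A" "N1:Mods A" "N2:Mods A" "i1:lhom A N N1" "p1:lhom A N1 N"
   "i2:lhom A N N2" "p2:lhom A N2 N" "!!x. x:car N ==> p1 (i1 x) +[N] p2 (i2 x) = x"
  show "E N" by(rule ret[OF a])
 next
  fix U X V f g assume a: "ses A U f X g V" "E U" "E V"
  show "E X" by(rule ext[OF a(2,3,1)])
 qed
 thus "N:ext_gen A Y (Suc j) ==> hz (Db A ph) X (st s N)" using hE ext_gen_Mods by blast
qed

end

text \<open>What is kept of a triangle equivalence \<open>F\<close>: compatibility with the shift on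
  objects and preservation of cones. \<open>G\<close> enters only as a linear quasi-inverse; the
  corresponding properties of \<open>G\<close> are derived.\<close>

locale deq = A: artin_alg k A ph + B: artin_alg k B ps + cat_equiv k "Db A ph" "Db B ps" F G alp bet
 for k :: "'k ring" and A :: "'a ring" and ph and B :: "'b ring" and ps and F :: "('a fgcpx, 'a roof set, 'b fgcpx, 'b roof set) cfunctor"
  and G :: "('b fgcpx, 'b roof set, 'a fgcpx, 'a roof set) cfunctor" and alp bet +
 assumes F_shift: "!!X. X:Cb A ==> B.dis (fob F (shc X)) (shc (fob F X))"
  and F_cone: "!!X Y u Z. A.cone_obj X Y u Z ==> B.cone_obj (fob F X) (fob F Y) (far F X Y u) (fob F Z)" and nonzero: "1[A] ~= 0[A]"
begin

lemma G_Cb: "Z:Cb B ==> fob G Z:Cb A" and F_Cb: "X:Cb A ==> fob F X:Cb B"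
 using fob_G fob_F by simp_all

lemma G_dis: "Z:Cb B ==> Z':Cb B ==> B.dis Z Z' ==> A.dis (fob G Z) (fob G Z')"
 using functor_iso[OF G] unfolding A.dis_def B.dis_def by simp blast

lemma GF_dis: "X:Cb A ==> A.dis (fob G (fob F X)) X" and FG_dis: "Z:Cb B ==> B.dis (fob F (fob G Z)) Z"
 using GF FG unfolding A.dis_def B.dis_def by simp_all

lemma G_shift: assumes Z: "Z:Cb B" shows "A.dis (fob G (shc Z)) (shc (fob G Z))"
proof -
 note GZ = G_Cb[OF Z]
 note s = A.Cb_shift(1)[OF GZ] B.Cb_shift(1)[OF Z]
 show ?thesis using B.dis_trans[OF F_Cb[OF s(1)] B.Cb_shift(1)[OF F_Cb[OF GZ]] s(2) F_shift[OF GZ] B.dis_shift[OF F_Cb[OF GZ] Z FG_dis[OF Z]]] G_dis[OF F_Cb[OF s(1)] s(2)] A.dis_trans[OF s(1) G_Cb[OF F_Cb[OF s(1)]] G_Cb[OF s(2)] A.dis_sym[OF GF_dis[OF s(1)]]] A.dis_sym by simp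
qed

lemma exact_G_shift: assumes Z: "Z:Cb B" shows "exact_at (fob G (shc Z)) i <-> exact_at (fob G Z) (i+1)"
 using A.dis_exact_at[OF G_Cb[OF B.Cb_shift(1)[OF Z]] A.Cb_shift(1)[OF G_Cb[OF Z]] G_shift[OF Z], of]
  exact_at_shift[OF A.Cb_cx[OF G_Cb[OF Z]], of] by simp

text \<open>Moves cohomology of \<open>fob G Z\<close> from degree \<open>i\<close> to degree 0,
  where \<open>hz_FA\<close> expresses it by morphisms out of F(A). Shifting and unshifting cover
  both signs of \<open>i\<close>.\<close>

lemma exact_G_any:
 "Z:Cb B ==> EX Z':Cb B. (ALL n. exact_at Z' n <-> exact_at Z (n+i)) & (exact_at (fob G Z) i <-> exact_at (fob G Z') 0)"
proof(induction i arbitrary: Z rule: int_induct[where k = 0])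
 case base
 thus ?case by auto
next
 case (step1 i)
 obtain Z' where Z': "Z':Cb B" "ALL n. exact_at Z' n <-> exact_at (shc Z) (n+i)"
  "exact_at (fob G (shc Z)) i <-> exact_at (fob G Z') 0" using step1(2)[OF B.Cb_shift(1)[OF step1(3)]] by blast
 show ?case using Z' exact_at_shift[OF B.Cb_cx[OF step1(3)]] exact_G_shift[OF step1(3), of i] by(intro bexI[OF _ Z'(1)]) (simp add: add.assoc)
next
 case (step2 i)
 note U = B.Cb_shift(2)[OF step2(3)]
 note sU = B.Cb_shift(1)[OF U] and d = B.dis_unshift[OF step2(3)]
 obtain Z' where Z': "Z':Cb B" "ALL n. exact_at Z' n <-> exact_at (unshift Z) (n+i)"
  "exact_at (fob G (unshift Z)) i <-> exact_at (fob G Z') 0" using step2(2)[OF U] by blast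
 have 1: "exact_at (unshift Z) (n+i) <-> exact_at Z (n+(i-1))" for n
  using exact_at_shift[OF B.Cb_cx[OF U], of "n+(i-1)"] B.dis_exact_at[OF sU step2(3) d, of "n+(i-1)"] by simp
 have 2: "exact_at (fob G Z) (i-1) <-> exact_at (fob G (unshift Z)) i"
  using exact_G_shift[OF U, of "i-1"] A.dis_exact_at[OF G_Cb[OF sU] G_Cb[OF step2(3)] G_dis[OF sU step2(3) d], of "i-1"] by simp
 show ?case using Z' 1 2 by(intro bexI[OF _ Z'(1)]) simp
qed

lemma exact_G_st: assumes Y: "Y:Mods B" shows "exact_at (fob G (st s Y)) i <-> exact_at (fob G (st 0 Y)) (i-s)"
proof(induction s arbitrary: i rule: int_induct[where k = 0])
 case (step1 s)
 show ?case using exact_G_shift[OF B.st_cplx(2)[OF Y], of "s+1" "i-1"] step1(2)[of "i-1"] by(simp add: B.shift_st[OF Y] algebra_simps)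
next
 case (step2 s)
 show ?case using exact_G_shift[OF B.st_cplx(2)[OF Y], of s i] step2(2)[of "i+1"] by(simp add: B.shift_st[OF Y] algebra_simps)
qed simp

text \<open>The image of \<open>u\<close> under \<open>G\<close> is written as a fraction, and
  \<open>C\<close> is the cone of its numerator \<open>f\<close>. \<open>F\<close> preserves this
  cone, and through \<open>bet\<close> the image of \<open>f\<close> is isomorphic to
  \<open>u\<close>; so \<open>fob F C\<close> is isomorphic to \<open>M\<close>, and
  \<open>C\<close> to \<open>fob G M\<close>.\<close>

lemma G_cone:
 assumes u: "B.cone_obj K Q u M"
 shows "EX p C te t. p:cmap A (A.rr (fob G K)) (A.rr (fob G Q)) & cone A (A.rr (fob G K)) (A.rr (fob G Q)) p C te & A.res C t (fob G M)"
proof -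
 from u have o: "K:Cb B" "Q:Cb B" "M:Cb B" and ua: "u:arr (Db_lin B ps) K Q" using B.cone_obj_objs by blast+
 note g = G_Cb[OF o(1)] G_Cb[OF o(2)] G_Cb[OF o(3)]
 have ga: "far G K Q u:arr (Db_lin A ph) (fob G K) (fob G Q)" using G o ua by(simp add: lin_functor_def)
 obtain p where p: "p:cmap A (A.rr (fob G K)) (A.rr (fob G Q))" "far G K Q u = A.cls (fob G K) (fob G Q) p"
  using ga unfolding A.arr_cls[OF g(1,2)] by(elim bexE)
 obtain W s f f' where r: "(W, s, f):A.cls (fob G K) (fob G Q) p" "(W, s, f'):A.cls (fob G K) (fob G Q) p" by(rule A.cls_common[OF g(1,2) p(1,1)])
 have "(W, s, f):roofs A (fob G K) (fob G Q)" using r(1) A.cls_roofs by blast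
 note ro = A.roofsD[OF this g(1)]
 note W = ro(1) and f = ro(3) and s = qis_map[OF ro(2)]
 obtain si si' q where si: "si:cmap A (A.rr W) (A.rr (fob G K))" "loc A W (fob G K) s = A.cls W (fob G K) si" "heq A (A.rr W) (A.rr (fob G K)) si si'"
  and q: "q:cmap A (A.rr W) (A.rr (fob G Q))" "loc A W (fob G Q) f = A.cls W (fob G Q) q" "hm A (A.rr W) (A.rr (fob G Q)) q (ccomp p si)"
  by(rule A.roof_loc[OF g(1,2) p(1) r(1)])
 obtain C te where C: "C:Cb A" "A.cone_obj W (fob G Q) (loc A W (fob G Q) f) C" by(rule A.cone_obj_exists[OF W g(2) f])
 let ?ls = "loc A W (fob G K) s" and ?lf = "loc A W (fob G Q) f" and ?u = "far G K Q u"
 have ls: "?ls:arr (Db_lin A ph) W (fob G K)" unfolding si(2) A.arr_cls[OF W g(1)] using si(1) by blast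
 have lsi: "?ls:iso_arr (Db A ph) W (fob G K)" unfolding si(2) A.iso_cls[OF W g(1) si(1)] using si(3) by blast
 have lf: "?lf = Db_comp A W (fob G K) (fob G Q) ?u ?ls"
  unfolding q(2) p(2) si(2) A.comp_cls[OF W g(1,2) si(1) p(1)] by(rule A.cls_cong[OF W g(2) q(3)])
 note FW = F_Cb[OF W] and FK = F_Cb[OF g(1)] and FQ = F_Cb[OF g(2)] and FC = F_Cb[OF C(1)]
 let ?FW = "fob F W" and ?FK = "fob F (fob G K)" and ?FQ = "fob F (fob G Q)"
 have bet_K: "bet K:iso_arr (Db B ps) ?FK K" and bet_Q: "bet Q:iso_arr (Db B ps) ?FQ Q"
  using bet o by(simp_all add: nat_iso_def fcomp_def fidentity_def)
 have Fls: "far F W (fob G K) ?ls:iso_arr (Db B ps) ?FW ?FK" by(rule functor_iso[OF F _ _ lsi]) (simp_all add: W g)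
 have Flsa: "far F W (fob G K) ?ls:arr (Db_lin B ps) ?FW ?FK" using Fls by(simp add: iso_arr_def)
 have Fua: "far F (fob G K) (fob G Q) ?u:arr (Db_lin B ps) ?FK ?FQ" using F g ga by(simp add: lin_functor_def)
 have bet_a: "bet K:arr (Db_lin B ps) ?FK K" "bet Q:arr (Db_lin B ps) ?FQ Q" using bet_K bet_Q by(simp_all add: iso_arr_def)
 let ?a = "Db_comp B ?FW ?FK K (bet K) (far F W (fob G K) ?ls)"
 have ai: "?a:iso_arr (Db B ps) ?FW K" using iso_arr_comp[OF B.category_Db _ _ _ Fls bet_K] FW FK o by simp
 note as = categoryD(5)[OF B.category_Db, unfolded Db_simps]
 \<comment> \<open>The square consists of the image under \<open>F\<close> of the fraction and the
   naturality of \<open>bet\<close> at \<open>u\<close>; the denominator becomes part of the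
   isomorphism \<open>?a\<close>.\<close>
 have sq: "Db_comp B ?FW ?FQ Q (bet Q) (far F W (fob G Q) ?lf) = Db_comp B ?FW K Q u ?a" using lf F W g ls ga bet o ua as[OF FW FK FQ o(2) Flsa Fua bet_a(2)] as[OF FW FK o(1,2) Flsa bet_a(1) ua] by(simp add: lin_functor_def nat_iso_def fcomp_def fidentity_def)
 have dC: "A.dis C (fob G M)" using B.cone_obj_unique[OF F_cone[OF C(2)] u ai bet_Q sq] G_dis[OF FC o(3)] A.dis_trans[OF C(1) G_Cb[OF FC] g(3) A.dis_sym[OF GF_dis[OF C(1)]]] by simp
 note cW = A.rr_cx[OF W] and cK = A.rr_cx[OF g(1)] and cQ = A.rr_cx[OF g(2)]
 obtain C1 te_1 where C1: "cone A (A.rr W) (A.rr (fob G Q)) q C1 te_1" by(rule cone_exists[OF cW cQ q(1)])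
 obtain t1 where t1: "A.res C1 t1 C" by(rule A.cone_obj_res[OF C(2)[unfolded q(2)] q(1) C1])
 obtain D te_2 where D: "cone A (A.rr (fob G K)) (A.rr (fob G Q)) p D te_2" by(rule cone_exists[OF cK cQ p(1)])
 \<comment> \<open>\<open>C1\<close> is the cone on the lift \<open>q\<close> of the numerator and
   \<open>D\<close> the cone on the lift \<open>p\<close> of the whole morphism. They are compared
   by means of the invertible denominator \<open>si\<close>.\<close>
 obtain c where c: "qis A C1 D c" by(rule cone_map_qis[OF C1 D heq_qis[OF cW cK si(3)] qis_id[OF cQ]]) (use hmD(5)[OF q(3)] in simp)
 have bD: "bproj A D" by(rule cone_bproj[OF D A.res_rs(1)[OF g(1)] A.res_rs(1)[OF g(2)]])
 obtain c' where c': "heq A C1 D c c'" by(rule qis_heq[OF A.resD(1)[OF t1] bD c])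
 obtain t where "A.res D t (fob G M)" using heq_qis[OF bprojD(1)[OF bD] A.resD(3)[OF t1] heq_sym[OF c']] A.res_def bD qis_comp[OF bprojD(1)[OF bD] A.resD(3)[OF t1] A.Cb_cx[OF C(1)] _ A.resD(2)[OF t1]] A.dis_res[OF C(1) g(3) dC] by blast
 thus ?thesis using p(1) D by blast
qed

abbreviation "FA \<equiv> fob F (st 0 (rgm A))"

lemma reg_Cb: "st 0 (rgm A):Cb A"
 by(rule A.Kb_proj_res(2)[OF A.st_regular])

lemma hz_FA: assumes Z: "Z:Cb B" shows "hz (Db B ps) FA Z <-> exact_at (fob G Z) 0"
 using hz_adj[of "st 0 (rgm A)" Z] A.hz_st_regular[OF G_Cb[OF Z], of 0] reg_Cb Z by simp

text \<open>\<open>perfect_criterion\<close> requires one degree that works for all modules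
  \<open>N\<close>. For the single module \<open>Y\<close> it exists because the image of
  \<open>Y\<close> under \<open>G\<close> is bounded, and since every module is an iterated
  extension from \<open>Y\<close>, the same degree serves for all.\<close>

lemma FA_perfect: obtains V where "V:Kb_proj B" "B.dis FA V"
proof -
 note FA = F_Cb[OF reg_Cb]
 obtain Y N0 where Y: "Y:Mods B" "Mods B = ext_gen B Y (Suc N0)" using B.ext_dim_finite by blast
 obtain N1 where N1: "ALL n. \<bar>n\<bar> > N1 --> zmod (ob FA n)" by(rule B.Cb_bounds[OF FA])
 note GY = G_Cb[OF B.st_cplx(2)[OF Y(1), of 0]]
 obtain N2 where N2: "ALL n. \<bar>n\<bar> > N2 --> zmod (ob (fob G (st 0 Y)) n)" by(rule A.Cb_bounds[OF GY])
 \<comment> \<open>This degree is chosen so that F(A) is zero up to \<open>s\<close>, and so that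
   the image of \<open>Y\<close> under \<open>G\<close> is zero in degree \<open>-s\<close>.\<close>
 define s where "s = - \<bar>N1\<bar>-\<bar>N2\<bar>-1"
 have "dge (s+1) FA" unfolding dge_def using exact_at_zero[OF B.Cb_cx[OF FA]] N1[rule_format] by(simp add: s_def)
 moreover have "hz (Db B ps) FA (st s N)" if N: "N:Mods B" for N
 using exact_at_zero[OF A.Cb_cx[OF GY]] N2[rule_format] hz_FA[OF B.st_cplx(2)[OF Y(1)]] exact_G_st[OF Y(1), of s 0] B.hz_ext_gen[OF FA _ Y(1)] N Y(2) by(simp add: s_def)
 ultimately show ?thesis using B.perfect_criterion[OF FA] that by metis
qed

context
 fixes T a b
 assumes T: "T:Kb_proj B" "B.dis FA T" and supp: "ALL n. ~ zmod (ob T n) --> a <= n & n <= b"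
begin

text \<open>H^i of \<open>fob G Z\<close> is Hom(F(A), Z[i]). It vanishes once \<open>Z\<close> is
  exact in the degrees occupied by the complex of projectives \<open>T\<close> after a shift by
  \<open>i\<close>.\<close>

lemma exact_G:
 assumes Z: "Z:Cb B" and ex: "!!n. a+i <= n ==> n <= b+i ==> exact_at Z n"
 shows "exact_at (fob G Z) i"
proof -
 note TT = B.Kb_proj_res[OF T(1)]
 obtain Z' where Z': "Z':Cb B" "ALL n. exact_at Z' n <-> exact_at Z (n+i)" "exact_at (fob G Z) i <-> exact_at (fob G Z') 0"
  using exact_G_any[OF Z] by blast
 show ?thesis using B.hz_null[OF TT(2) Z'(1) TT(1)] supp Z'(2) ex hz_iso_left[OF B.category_Db, of T FA Z'] B.dis_sym[OF T(2)] TT(2) F_Cb[OF reg_Cb] Z'(1) B.dis_def hz_FA[OF Z'(1)] Z'(3) by simp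
qed

lemma G_dge: "Z:Cb B ==> dge t Z ==> dge (t-b) (fob G Z)"
 unfolding dge_def[of "t-b"] by(intro allI impI exact_G) (simp_all add: dge_def)

lemma G_dle: "Z:Cb B ==> dle t Z ==> dle (t-a) (fob G Z)"
 unfolding dle_def[of "t-a"] by(intro allI impI exact_G) (simp_all add: dle_def)

text \<open>The bounds for \<open>F\<close> follow from those for \<open>G\<close>: orthogonality of
  \<open>fob F X\<close> to the test objects is orthogonality of \<open>X\<close> to their images
  under \<open>G\<close>.\<close>

lemma F_dle: assumes X: "X:Cb A" "dle t X" shows "dle (t+b) (fob F X)"
 unfolding B.dle_iff[OF F_Cb[OF X(1)]]
proof(intro ballI impI)
 fix Z assume Z: "Z:Cb B" "dge (t+b+1) Z"
 thus "hz (Db B ps) (fob F X) Z" using G_dge[OF Z] A.hz_dle_dge[OF X G_Cb[OF Z(1)]] hz_adj[of X Z] X by simp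
qed

lemma F_dge: assumes X: "X:Cb A" "dge t X" shows "dge (t+a) (fob F X)"
 unfolding B.dge_iff[OF F_Cb[OF X(1)]]
proof(intro ballI impI)
 fix Z assume Z: "Z:Cb B" "dle (t+a-1) Z"
 hence "dle (t-1) (fob G Z)" using G_dle[OF Z] by simp
 hence "hz (Db A ph) (fob G Z) X" using A.hz_dle_dge[OF G_Cb[OF Z(1)], of "t-1" X] X by simp
 thus "hz (Db B ps) Z (fob F X)" using cat_equiv.hz_adj[OF cat_equiv_sym[OF cat_equiv_axioms], of Z X] X Z by simp
qed

lemma tilt_F: "a <= b ==> tilt k A ph B ps F G alp bet a b"
 by(intro tilt.intro tilt_axioms.intro A.artin_alg_axioms B.artin_alg_axioms cat_equiv_axioms F_dge F_dle G_dge G_cone)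

text \<open>Seen from the other side the window from \<open>a\<close> to \<open>b\<close> is
  reflected at 0. Its width, on which the estimate depends, is unchanged, so the second inequality
  comes from the same theorem.\<close>

lemma tilt_G: "a <= b ==> tilt k B ps A ph G F bet alp (- b) (- a)"
proof(intro tilt.intro tilt_axioms.intro A.artin_alg_axioms B.artin_alg_axioms cat_equiv_sym[OF cat_equiv_axioms])
 fix K Q u M assume "A.cone_obj K Q u M"
 from B.cone_obj_cone[OF F_cone[OF this]] obtain p C te t where "p:cmap B (B.rr (fob F K)) (B.rr (fob F Q))"
  "cone B (B.rr (fob F K)) (B.rr (fob F Q)) p C te" "B.res C t (fob F M)" by metis
 thus "EX p C te t. p:cmap B (B.rr (fob F K)) (B.rr (fob F Q)) & cone B (B.rr (fob F K)) (B.rr (fob F Q)) p C te & B.res C t (fob F M)" by blast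
qed(use G_dge G_dle F_dge in simp_all)

end

text \<open>If \<open>T\<close> were zero, F(A) would vanish and \<open>A\<close> with it, against
  \<open>nonzero\<close>. A nonzero term is what provides the least and the greatest degree measured
  by \<open>radical_length\<close>.\<close>

lemma FA_nonzero:
 assumes T: "T:Kb_proj B" "B.dis FA T"
 shows "EX n. ~ zmod (ob T n)"
proof(rule ccontr)
 assume z: "\<nexists>n. ~ zmod (ob T n)"
 note TT = B.Kb_proj_res[OF T(1)] and FA = F_Cb[OF reg_Cb]
 have ex: "exact_at (st 0 (rgm A)) 0" using B.hz_null[OF TT(2) FA TT(1)] z hz_iso_left[OF B.category_Db, of T FA FA] B.dis_sym[OF T(2)] TT(2) FA B.dis_def hz_FA[OF FA] A.dis_exact_at[OF G_Cb[OF FA] reg_Cb GF_dis[OF reg_Cb]] by simp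
 have "x = 0[rgm A]" if x: "x:car (rgm A)" for x using x exact_atD[OF ex] by simp
 moreover obtain ep where e: "ep:liso A (rgm A) (lreg A)" by(rule regular_liso[OF A.ring_A])
 interpret R: ring A by(rule A.ring_A)
 have "1[A]:ep ` car (rgm A)" "0[A]:ep ` car (rgm A)" using e by(simp_all add: liso_def bij_betw_def)
 ultimately show False using nonzero by(metis imageE)
qed

theorem ext_dim_bound:
 "\<bar>ereal_of_enat (ext_dim A)-ereal_of_enat (ext_dim B)\<bar> <= ereal (real_of_int (perfect_length B ps FA-1))"
proof -
 note FA = F_Cb[OF reg_Cb]
 obtain V where V: "V:Kb_proj B" "B.dis FA V" by(rule FA_perfect)
 obtain T f g where T: "T:Kb_proj B" "radical_cpx B T" "heq B V T f g" using B.radical_representative[OF V(1)] by metis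
 note VV = B.Kb_proj_res[OF V(1)] and TT = B.Kb_proj_res[OF T(1)]
 have dT: "B.dis FA T" using B.dis_qis[OF VV(2) TT(2) heq_qis[OF B.Cb_cx[OF VV(2)] B.Cb_cx[OF TT(2)] T(3)]] B.dis_trans[OF FA VV(2) TT(2) V(2)] by simp
 obtain i where "~ zmod (ob T i)" using FA_nonzero[OF T(1) dT] by blast
 then obtain a b where ab: "a <= b" "ALL n. ~ zmod (ob T n) --> a <= n & n <= b" "radical_length T = b-a+1"
  by(rule B.radical_length_support[OF TT(2)])
 interpret tF: tilt k A ph B ps F G alp bet a b by(rule tilt_F[OF T(1) dT ab(2,1)])
 interpret tG: tilt k B ps A ph G F bet alp "- b" "- a" by(rule tilt_G[OF T(1) dT ab(2,1)])
 define d where "d = nat (b-a)"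
 define SA where "SA = {n. EX T:Mods A. Mods A = ext_gen A T (n+1)}"
 define SB where "SB = {n. EX T:Mods B. Mods B = ext_gen B T (n+1)}"
 have AB: "n+d:SA" if "n:SB" for n using that tF.ext_dim_transfer unfolding SA_def SB_def d_def by blast
 have BA: "n+d:SB" if "n:SA" for n using that tG.ext_dim_transfer SA_def SB_def by(auto simp: d_def)
 \<comment> \<open>Both sets of admissible indices are nonempty, so the infima are attained and both
   dimensions are natural numbers; their difference is then computed in the reals.\<close>
 have least: "(INF n\<in>S. enat n) = enat (LEAST n. n:S)" if "S ~= {}" for S :: "nat set"
 proof(rule antisym)
  show "(INF n\<in>S. enat n) <= enat (LEAST n. n:S)" by(metis that LeastI_ex all_not_in_conv INF_lower)
  show "enat (LEAST n. n:S) <= (INF n\<in>S. enat n)" by(rule INF_greatest) (simp add: Least_le)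
 qed
 obtain U N where "U:Mods A" "Mods A = ext_gen A U (Suc N)" using A.ext_dim_finite by blast
 hence ne: "SA ~= {}" "SB ~= {}" using SA_def BA by auto
 define x where "x = (LEAST n. n:SA)"
 define y where "y = (LEAST n. n:SB)"
 have x: "x:SA" and y: "y:SB" unfolding x_def y_def using ne by(metis LeastI_ex all_not_in_conv)+
 have "x <= y+d" using Least_le[of "%n. n:SA", OF AB[OF y]] by(simp add: x_def)
 moreover have "y <= x+d" using Least_le[of "%n. n:SB", OF BA[OF x]] by(simp add: y_def)
 ultimately have "\<bar>real x-real y\<bar> <= real d" by linarith
 moreover have "real d = real_of_int (perfect_length B ps FA-1)" using B.perfect_length_radical[OF FA T(1,2) dT] ab(1) by(simp add: d_def ab(3))
 moreover have "ext_dim A = enat x" "ext_dim B = enat y"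
  unfolding ext_dim_def SA_def[symmetric] SB_def[symmetric] using least ne by(simp_all add: x_def y_def)
 ultimately show ?thesis by simp
qed

end

text \<open>The condition that 1 and 0 differ in \<open>A\<close> excludes the zero algebra, for
  which F(A) is isomorphic to zero and the supremum and infimum in \<open>radical_length\<close> are
  taken over the empty set.\<close>

theorem theorem1p1:
  fixes k :: "'k ring" and A :: "'a ring" and B :: "'b ring"
    and \<phi> :: "'k \<Rightarrow> 'a" and \<psi> :: "'k \<Rightarrow> 'b"
    and F :: "('a fgcpx, 'a roof set, 'b fgcpx, 'b roof set) cfunctor"
  assumes "comm_artin_ring k"
    and "artin_algebra k A \<phi>" and "artin_algebra k B \<psi>"
    and "\<one>\<^bsub>A\<^esub> \<noteq> \<zero>\<^bsub>A\<^esub>"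
    and "derived_equivalence k A \<phi> B \<psi> F"
  shows "\<bar>ereal_of_enat (ext_dim A) - ereal_of_enat (ext_dim B)\<bar>
           \<le> ereal (real_of_int (perfect_length B \<psi> (fob F (stalk (regular_module A))) - 1))"
proof -
 interpret A: artin_alg k A \<phi> by(rule artin_alg.intro) (fact)+
 interpret B: artin_alg k B \<psi> by(rule artin_alg.intro) (fact)+
 have tri: "triangle_functor k (Db A \<phi>) (Db B \<psi>) F" and eq: "equivalence_functor k (Db A \<phi>) (Db B \<psi>) F"
  using assms(5) by(simp_all add: derived_equivalence_def triangle_equivalence_def)
 obtain G \<alpha> \<beta> where G: "lin_functor k (Db B \<psi>) (Db A \<phi>) G"
  "nat_iso (Db A \<phi>) (Db A \<phi>) (fcomp G F) fidentity \<alpha>" "nat_iso (Db B \<psi>) (Db B \<psi>) (fcomp F G) fidentity \<beta>"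
  using eq unfolding equivalence_functor_def by blast
 obtain \<eta> where \<eta>: "nat_iso (Db A \<phi>) (Db B \<psi>) (fcomp F (shift_functor (Db A \<phi>))) (fcomp (shift_functor (Db B \<psi>)) F) \<eta>"
  and tr: "!!X Y Z u v w. (X, Y, Z, u, v, w):triangles (Db A \<phi>) ==>
      (fob F X, fob F Y, fob F Z, far F X Y u, far F Y Z v,
      cpa (Db B \<psi>) (fob F Z) (fob F (shift_ob (Db A \<phi>) X)) (shift_ob (Db B \<psi>) (fob F X))
       (\<eta> X) (far F Z (shift_ob (Db A \<phi>) X) w)):triangles (Db B \<psi>)" using tri unfolding triangle_functor_def by blast
 interpret deq k A \<phi> B \<psi> F G \<alpha> \<beta>
 proof(intro deq.intro deq_axioms.intro A.artin_alg_axioms B.artin_alg_axioms cat_equiv.intro A.category_Db B.category_Db G assms(4))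
  show "lin_functor k (Db A \<phi>) (Db B \<psi>) F" using eq by(simp add: equivalence_functor_def)
  fix X assume "X:Cb A"
  thus "B.dis (fob F (shc X)) (shc (fob F X))" using \<eta> B.dis_def by(auto simp: nat_iso_def fcomp_def shift_functor_def)
 next
  fix X Y u Z assume "A.cone_obj X Y u Z"
  thus "B.cone_obj (fob F X) (fob F Y) (far F X Y u) (fob F Z)" unfolding A.cone_obj_def B.cone_obj_def using tr by blast
 qed
 show ?thesis unfolding stalk_st by(rule ext_dim_bound)
qed

end
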